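(* Let $\beta\in(1,2)$ and let $\eta$ be a Lévy process satisfying Assumption (A) (see context), with slowly varying function $f$ and characteristic exponent $\psi$. Let $\phi:\mathbb R\to\mathbb R$ be in $L^1(\mathbb R)$ with $\int_{\mathbb R}\phi(y)\,dy\ne0$. Let $F_T=T^{1-1/\beta}f(T^{1/\beta})^{-1}$ and $x\in\mathbb R$. Then, as $T\to\infty$, $$\left(\frac1{F_T}\int_0^{Tf(T^{1/\beta})^{-1}t}\phi(\eta_s-T^{1/\beta}x)\,ds\right)_{t\ge0}\Longrightarrow\left(L_t(x)\int_{\mathbb R}\phi(y)\,dy\right)_{t\ge0}$$ in the sense of convergence of finite-dimensional distributions. If, moreover, there exists $\kappa\in(0,1)$ with $\int_1^\infty\psi(w)^{-\kappa}dw<\infty$, then the convergence holds weakly in $\mathcal C[0,\infty)$.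
   Context: Assumption (A), for $\beta\in(1,2)$: $\eta$ is a Lévy process with characteristic triple $(0,0,\nu)$ and characteristic exponent $\psi$ (so $\mathbb E e^{i\theta\eta_t}=e^{-t\psi(\theta)}$), whose Lévy measure is $\nu(dx)=c(\beta)^{-1}g(x)\,dx$, where $g(x)=f(x)|x|^{-1-\beta}\ge0$ is symmetric and $f$ is symmetric and slowly varying at infinity (so $g$ is regularly varying at infinity with exponent $-1-\beta$), $c(\beta)=\int_{\mathbb R}(1-e^{iu}+iu\mathbf 1_{\{|u|\le1\}})|u|^{-1-\beta}du$, and $\int_1^\infty\psi(z)^{-1}dz<\infty$. $(L_t(x))_{t\ge0,x\in\mathbb R}$ is a jointly continuous version of the local time (with respect to Lebesgue measure) of a symmetric $\beta$-stable Lévy process $\xi$ with $\mathbb E e^{i\theta\xi_t}=e^{-t|\theta|^\beta}$, $\xi_0=0$. $\mathcal C[0,\infty)$ carries the topology of uniform convergence on compacts. *)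

theory Defs
  imports "HOL-Probability.Probability"
begin

section \<open>Convergence in law in topological spaces\<close>

definition borel_of :: "'c topology \<Rightarrow> 'c measure" where
  "borel_of X = sigma (topspace X) {U. openin X U}"

text \<open>The variables may be ill-behaved on a null set (a path integral of an unbounded function
  need not converge there), so the laws are those of random elements that agree with them
  almost surely; they do not depend on the choice of these.\<close>

definition conv_in_law ::
  "'c topology \<Rightarrow> 'a measure \<Rightarrow> (real \<Rightarrow> 'a \<Rightarrow> 'c) \<Rightarrow> 'b measure \<Rightarrow> ('b \<Rightarrow> 'c) \<Rightarrow> bool" where
  "conv_in_law X M Y N Z \<longleftrightarrow>
    (\<exists>Y' Z'.
      (\<forall>\<^sub>F T in at_top. Y' T \<in> M \<rightarrow>\<^sub>M borel_of X \<and> (AE \<omega> in M. Y' T \<omega> = Y T \<omega>)) \<and>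
      Z' \<in> N \<rightarrow>\<^sub>M borel_of X \<and> (AE \<omega> in N. Z' \<omega> = Z \<omega>) \<and>
      (\<forall>h. continuous_map X euclideanreal h \<and> bounded (h ` topspace X) \<longrightarrow>
        ((\<lambda>T. \<integral>\<omega>. h (Y' T \<omega>) \<partial>M) \<longlongrightarrow> (\<integral>\<omega>. h (Z' \<omega>) \<partial>N)) at_top))"

definition fdd_conv ::
  "'a measure \<Rightarrow> (real \<Rightarrow> real \<Rightarrow> 'a \<Rightarrow> real) \<Rightarrow> 'b measure \<Rightarrow> (real \<Rightarrow> 'b \<Rightarrow> real) \<Rightarrow> bool" where
  "fdd_conv M Y N Z \<longleftrightarrow>
    (\<forall>J. finite J \<and> J \<subseteq> {0..} \<longrightarrow>
      conv_in_law (product_topology (\<lambda>_. euclideanreal) J)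
        M (\<lambda>T \<omega>. \<lambda>t\<in>J. Y T t \<omega>) N (\<lambda>\<omega>. \<lambda>t\<in>J. Z t \<omega>))"

text \<open>The space \<open>C[0,\<infinity>)\<close>, with the topology of uniform convergence on compact sets.\<close>

definition C_halfline :: "(real \<Rightarrow> real) set" where
  "C_halfline = {w \<in> extensional {0..}. continuous_on {0..} w}"

definition C_halfline_open :: "(real \<Rightarrow> real) set \<Rightarrow> bool" where
  "C_halfline_open U \<longleftrightarrow> U \<subseteq> C_halfline \<and>
    (\<forall>w\<in>U. \<exists>K\<ge>0. \<exists>e>0. \<forall>v\<in>C_halfline. (\<forall>t\<in>{0..K}. \<bar>v t - w t\<bar> < e) \<longrightarrow> v \<in> U)"

lemma istopology_C_halfline_open: "istopology C_halfline_open"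
  unfolding istopology_def
proof (intro conjI allI impI)
  fix S T assume S: "C_halfline_open S" and T: "C_halfline_open T"
  show "C_halfline_open (S \<inter> T)"
    unfolding C_halfline_open_def
  proof (intro conjI ballI)
    show "S \<inter> T \<subseteq> C_halfline"
      using S by (auto simp: C_halfline_open_def)
  next
    fix w assume w: "w \<in> S \<inter> T"
    obtain K e where 1: "K \<ge> 0" "e > 0"
      "\<And>v. v \<in> C_halfline \<Longrightarrow> (\<forall>t\<in>{0..K}. \<bar>v t - w t\<bar> < e) \<Longrightarrow> v \<in> S"
      using S w unfolding C_halfline_open_def by blast
    obtain K' e' where 3: "K' \<ge> 0" "e' > 0"
      "\<And>v. v \<in> C_halfline \<Longrightarrow> (\<forall>t\<in>{0..K'}. \<bar>v t - w t\<bar> < e') \<Longrightarrow> v \<in> T"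
      using T w unfolding C_halfline_open_def by blast
    show "\<exists>K\<ge>0. \<exists>e>0. \<forall>v\<in>C_halfline. (\<forall>t\<in>{0..K}. \<bar>v t - w t\<bar> < e) \<longrightarrow> v \<in> S \<inter> T"
    proof (rule exI[of _ "max K K'"], intro conjI, goal_cases)
      case 2
      show ?case
      proof (rule exI[of _ "min e e'"], intro conjI ballI impI)
        fix v assume v: "v \<in> C_halfline" "\<forall>t\<in>{0..max K K'}. \<bar>v t - w t\<bar> < min e e'"
        have "v \<in> S" by (rule 1(3)[OF v(1)]) (use v(2) in auto)
        moreover have "v \<in> T" by (rule 3(3)[OF v(1)]) (use v(2) in auto)
        ultimately show "v \<in> S \<inter> T" ..
      qed (use 1 3 in auto)
    qed (use 1 in auto)
  qed
next
  fix \<K> assume "\<forall>S\<in>\<K>. C_halfline_open S"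
  then show "C_halfline_open (\<Union>\<K>)"
    unfolding C_halfline_open_def by (meson Union_iff Union_least)
qed

definition C_halfline_topology :: "(real \<Rightarrow> real) topology" where
  "C_halfline_topology = topology C_halfline_open"

lemma openin_C_halfline_topology: "openin C_halfline_topology U \<longleftrightarrow> C_halfline_open U"
  by (simp add: C_halfline_topology_def istopology_C_halfline_open)

lemma topspace_C_halfline_topology: "topspace C_halfline_topology = C_halfline"
proof -
  have "C_halfline_open C_halfline"
    unfolding C_halfline_open_def by (auto intro: exI[of _ 0] exI[of _ 1])
  then show ?thesis
    unfolding topspace_def openin_C_halfline_topology by (auto simp: C_halfline_open_def)
qed

definition weak_conv_C ::
  "'a measure \<Rightarrow> (real \<Rightarrow> real \<Rightarrow> 'a \<Rightarrow> real) \<Rightarrow> 'b measure \<Rightarrow> (real \<Rightarrow> 'b \<Rightarrow> real) \<Rightarrow> bool" where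
  "weak_conv_C M Y N Z \<longleftrightarrow>
    conv_in_law C_halfline_topology M (\<lambda>T \<omega>. \<lambda>t\<in>{0..}. Y T t \<omega>) N (\<lambda>\<omega>. \<lambda>t\<in>{0..}. Z t \<omega>)"


section \<open>Levy processes\<close>

definition cadlag :: "(real \<Rightarrow> real) \<Rightarrow> bool" where
  "cadlag w \<longleftrightarrow> (\<forall>t\<ge>0. continuous (at_right t) w) \<and> (\<forall>t>0. \<exists>l. (w \<longlongrightarrow> l) (at_left t))"

definition levy_process :: "'a measure \<Rightarrow> (real \<Rightarrow> 'a \<Rightarrow> real) \<Rightarrow> bool" where
  "levy_process M X \<longleftrightarrow>
    prob_space M \<and>
    (\<forall>t\<ge>0. X t \<in> borel_measurable M) \<and>
    (AE \<omega> in M. X 0 \<omega> = 0) \<and>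
    (\<forall>n (\<tau> :: nat \<Rightarrow> real). 0 \<le> \<tau> 0 \<and> (\<forall>i<n. \<tau> i \<le> \<tau> (Suc i)) \<longrightarrow>
      prob_space.indep_vars M (\<lambda>_. borel) (\<lambda>i \<omega>. X (\<tau> (Suc i)) \<omega> - X (\<tau> i) \<omega>) {..<n}) \<and>
    (\<forall>s\<ge>0. \<forall>h\<ge>0. distr M borel (\<lambda>\<omega>. X (s + h) \<omega> - X s \<omega>) = distr M borel (X h)) \<and>
    (AE \<omega> in M. cadlag (\<lambda>t. X t \<omega>))"

definition levy_measure :: "real measure \<Rightarrow> bool" where
  "levy_measure \<nu> \<longleftrightarrow> sets \<nu> = sets borel \<and> emeasure \<nu> {0} = 0 \<and>
    (\<integral>\<^sup>+ x. ennreal (min 1 (x\<^sup>2)) \<partial>\<nu>) < \<infinity>"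

definition levy_exponent :: "real \<Rightarrow> real \<Rightarrow> real measure \<Rightarrow> real \<Rightarrow> complex" where
  "levy_exponent a q \<nu> \<theta> =
    - \<i> * complex_of_real (a * \<theta>) + complex_of_real (q * \<theta>\<^sup>2 / 2) +
    (CLINT x|\<nu>. 1 - iexp (\<theta> * x) + \<i> * complex_of_real (\<theta> * x) * indicator {-1..1} x)"

definition has_characteristic_triple ::
  "'a measure \<Rightarrow> (real \<Rightarrow> 'a \<Rightarrow> real) \<Rightarrow> real \<Rightarrow> real \<Rightarrow> real measure \<Rightarrow> bool" where
  "has_characteristic_triple M X a q \<nu> \<longleftrightarrow> q \<ge> 0 \<and> levy_measure \<nu> \<and>
    (\<forall>t\<ge>0. \<forall>\<theta>. char (distr M borel (X t)) \<theta> =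
      exp (- (complex_of_real t * levy_exponent a q \<nu> \<theta>)))"

definition stable_process :: "real \<Rightarrow> 'a measure \<Rightarrow> (real \<Rightarrow> 'a \<Rightarrow> real) \<Rightarrow> bool" where
  "stable_process \<beta> M \<xi> \<longleftrightarrow> levy_process M \<xi> \<and>
    (\<forall>t\<ge>0. \<forall>\<theta>. char (distr M borel (\<xi> t)) \<theta> = complex_of_real (exp (- (t * \<bar>\<theta>\<bar> powr \<beta>))))"

text \<open>The occupation measure of \<open>[0,t]\<close> has density \<open>L t\<close> with respect to Lebesgue measure.\<close>

definition local_time :: "'a measure \<Rightarrow> (real \<Rightarrow> 'a \<Rightarrow> real) \<Rightarrow> (real \<Rightarrow> real \<Rightarrow> 'a \<Rightarrow> real) \<Rightarrow> bool" where
  "local_time M \<xi> L \<longleftrightarrow>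
    (\<forall>t\<ge>0. \<forall>x. L t x \<in> borel_measurable M) \<and>
    (\<forall>t\<ge>0. AE \<omega> in M. (\<forall>x. L t x \<omega> \<ge> 0) \<and>
      distr (restrict_space lborel {0..t}) borel (\<lambda>s. \<xi> s \<omega>) =
      density lborel (\<lambda>x. ennreal (L t x \<omega>)))"

definition jointly_continuous_local_time ::
  "'a measure \<Rightarrow> (real \<Rightarrow> 'a \<Rightarrow> real) \<Rightarrow> (real \<Rightarrow> real \<Rightarrow> 'a \<Rightarrow> real) \<Rightarrow> bool" where
  "jointly_continuous_local_time M \<xi> L \<longleftrightarrow> local_time M \<xi> L \<and>
    (AE \<omega> in M. continuous_on ({0..} \<times> UNIV) (\<lambda>(t, x). L t x \<omega>))"


section \<open>The assumption on the driving process\<close>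

definition slowly_varying :: "(real \<Rightarrow> real) \<Rightarrow> bool" where
  "slowly_varying f \<longleftrightarrow> f \<in> borel_measurable borel \<and> (\<forall>\<^sub>F x in at_top. f x > 0) \<and>
    (\<forall>r>0. ((\<lambda>x. f (r * x) / f x) \<longlongrightarrow> 1) at_top)"

text \<open>By symmetry the integral defining \<open>c(\<beta>)\<close> and the exponent \<open>\<psi>\<close> below are real and nonnegative;
  \<open>Re\<close> only adjusts the type.\<close>

definition c_stable :: "real \<Rightarrow> real" where
  "c_stable \<beta> =
    Re (CLINT u|lborel. (1 - iexp u + \<i> * complex_of_real u * indicator {-1..1} u) *
      complex_of_real (\<bar>u\<bar> powr (- 1 - \<beta>)))"

definition assumption_A ::
  "real \<Rightarrow> 'a measure \<Rightarrow> (real \<Rightarrow> 'a \<Rightarrow> real) \<Rightarrow> (real \<Rightarrow> real) \<Rightarrow> (real \<Rightarrow> complex) \<Rightarrow> bool" where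
  "assumption_A \<beta> M \<eta> f \<psi> \<longleftrightarrow>
    (let g = (\<lambda>x. f x * \<bar>x\<bar> powr (- 1 - \<beta>));
         \<nu> = density lborel (\<lambda>x. ennreal (g x / c_stable \<beta>))
     in levy_process M \<eta> \<and>
        has_characteristic_triple M \<eta> 0 0 \<nu> \<and>
        \<psi> = levy_exponent 0 0 \<nu> \<and>
        (\<forall>x. g x \<ge> 0) \<and>
        (\<forall>x. f (- x) = f x) \<and>
        slowly_varying f \<and>
        (\<integral>\<^sup>+ z\<in>{1..}. inverse (ennreal (Re (\<psi> z))) \<partial>lborel) < \<infinity>)"

definition norming :: "real \<Rightarrow> (real \<Rightarrow> real) \<Rightarrow> real \<Rightarrow> real" where
  "norming \<beta> f T = T powr (1 - 1 / \<beta>) / f (T powr (1 / \<beta>))"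

definition scaled_functional ::
  "real \<Rightarrow> (real \<Rightarrow> real) \<Rightarrow> (real \<Rightarrow> real) \<Rightarrow> (real \<Rightarrow> 'a \<Rightarrow> real) \<Rightarrow> real \<Rightarrow>
    real \<Rightarrow> real \<Rightarrow> 'a \<Rightarrow> real" where
  "scaled_functional \<beta> f \<phi> \<eta> x T t \<omega> =
    1 / norming \<beta> f T *
    (LINT s:{0..T / f (T powr (1 / \<beta>)) * t}|lborel. \<phi> (\<eta> s \<omega> - T powr (1 / \<beta>) * x))"

end

(*
  With R = T^(1/beta), the process X^R_t = eta(R^beta t / f(R)) / R is a Levy process whose exponent
  converges to |theta|^beta (dominated convergence with Potter's bounds), and the functional is the
  occupation integral of the kernel y |-> R phi(R y), which concentrates at 0. As 1/psi is integrable
  at infinity, uniformly in R after scaling, X^R_t has a bounded density, and the occupation integral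
  of a kernel with integral 0 that is concentrated near 0 has a small second moment. Hence, up to a
  small L^1 error for all large R, the functional may be replaced by the integral of phi times the
  occupation integral of a fixed tent kernel. For bounded Lipschitz kernels the occupation integrals
  converge because the increments do (discretise time, and couple the increments by Skorohod's
  theorem); for the stable process, shrinking the tents recovers the local time.

  In C[0,oo) tightness comes from monotonicity: the increments of the functional are dominated by
  those of the functional of |phi|, which is nondecreasing in t and converges to a process with
  continuous paths.
*)
theory Submission
  imports Defs "HOL-Real_Asymp.Real_Asymp"
begin

text \<open>The kernels R phi(R y) are in general neither continuous nor bounded uniformly in R, so
  weak convergence cannot be applied to them directly; they are first traded for a fixed Lipschitz
  tent. The trade is made in L^2, where the vanishing integral of the difference of the two kernels
  becomes a cancellation in the transition densities. This needs bounds uniform in R. At low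
  frequencies regular variation bounds the scaled exponent below by a power greater than 1. At high
  frequencies only the integrability of 1/psi is known; undoing the scaling turns that part into
  R^(1 - beta) f(R) times a fixed finite integral, and this vanishes because beta > 1.

  All limits are taken in one order. The accuracy parameter (tent width, time mesh, interpolation
  mesh) is fixed by looking at the limit process, where continuity of the local time or right
  continuity of the path is available. Then R tends to infinity with the parameter fixed: each error
  is bounded by an integral whose limit in R is the corresponding error of the limit process, or by
  a quantity that is small for all large R.\<close>

section \<open>Slowly varying functions\<close>

text \<open>If uniformity failed along \<open>(x n, u n)\<close>, the sets of good shifts seen from \<open>x n\<close> and from
  \<open>x n + u n\<close> would both have almost full measure in \<open>{0..2}\<close>, hence would meet.\<close>

lemma slowly_increasing_uniform:
  fixes h :: "real \<Rightarrow> real"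
  assumes [measurable]: "h \<in> borel_measurable borel"
    and lim: "\<And>u. ((\<lambda>x. h (x + u) - h x) \<longlongrightarrow> 0) at_top" and e: "\<epsilon> > 0"
  shows "\<exists>X. \<forall>x\<ge>X. \<forall>u\<in>{0..1}. \<bar>h (x + u) - h x\<bar> < \<epsilon>"
proof (rule ccontr)
  assume "\<not> ?thesis"
  then have "\<forall>n::nat. \<exists>x u. x \<ge> real n \<and> u \<in> {0..1} \<and> \<bar>h (x + u) - h x\<bar> \<ge> \<epsilon>"
    by (meson not_less)
  then obtain x u where xu: "\<And>n. x n \<ge> real n" "\<And>n. u n \<in> {0..1}" 
    "\<And>n. \<bar>h (x n + u n) - h (x n)\<bar> \<ge> \<epsilon>"
    by metis
  have x: "filterlim x at_top sequentially"
    by (rule filterlim_at_top_mono[OF filterlim_real_sequentially]) (use xu in auto)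
  have xu': "filterlim (\<lambda>n. x n + u n) at_top sequentially"
    by (rule filterlim_at_top_mono[OF x]) (use xu(2) in auto)
  define V where "V y n = {l\<in>{0..2}. \<forall>m\<ge>n. \<bar>h (y m + l) - h (y m)\<bar> < \<epsilon> / 2}" for y :: "nat \<Rightarrow> real" and n
  have V_meas [measurable]: "V y n \<in> sets borel" for y n
    unfolding V_def by measurable
  \<comment> \<open>The bound 3/2 is half the length of \<open>{0..3}\<close>, which contains both
    \<open>V x n\<close> and the translate \<open>W\<close> of the other set: two subsets of measure
    above one half of the total must meet.\<close>
  have V_lim: "\<forall>\<^sub>F n in sequentially. emeasure lborel (V y n) > ennreal (3/2)" 
    if y: "filterlim y at_top sequentially" for y
  proof -
    have "(\<Union>n. V y n) = {0..2}"
    proof -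
      have "\<exists>n. l \<in> V y n" if "l \<in> {0..2}" for l
      proof -
        have "((\<lambda>m. h (y m + l) - h (y m)) \<longlongrightarrow> 0) sequentially"
          using filterlim_compose[OF lim y] .
        then have "\<forall>\<^sub>F m in sequentially. \<bar>h (y m + l) - h (y m)\<bar> < \<epsilon> / 2"
          using e by (auto dest!: tendstoD[of _ _ _ "\<epsilon>/2"] simp: dist_real_def)
        then show ?thesis
          using that unfolding V_def eventually_sequentially by auto
      qed
      then show ?thesis by (auto simp: V_def)
    qed
    moreover have "(\<lambda>n. emeasure lborel (V y n)) \<longlonglongrightarrow> emeasure lborel (\<Union>n. V y n)"
      by (rule Lim_emeasure_incseq) (auto simp: incseq_def V_def intro: V_meas[unfolded V_def])
    ultimately have "(\<lambda>n. emeasure lborel (V y n)) \<longlonglongrightarrow> 2"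
      by (simp add: ennreal_numeral)
    moreover have "ennreal (3/2) < 2"
      using ennreal_less_iff[of "3/2" 2] by simp
    ultimately show ?thesis by (rule order_tendstoD)
  qed
  obtain n where n: "emeasure lborel (V x n) > ennreal (3/2)" "emeasure lborel (V (\<lambda>n. x n + u n) n) > ennreal (3/2)"
    using eventually_happens'[OF _ eventually_conj[OF V_lim[OF x] V_lim[OF xu']]] by auto
  define W where "W = {l. l - u n \<in> V (\<lambda>n. x n + u n) n}"
  have W_meas [measurable]: "W \<in> sets borel" unfolding W_def by measurable
  have "emeasure lborel W = emeasure (distr lborel borel ((+) (u n))) W"
    by (simp add: lborel_distr_plus)
  also have "\<dots> = emeasure lborel (V (\<lambda>n. x n + u n) n)"
    by (subst emeasure_distr) (auto intro!: arg_cong[where f="emeasure lborel"] simp: W_def)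
  finally have W: "emeasure lborel W > ennreal (3/2)" using n by simp
  have "V x n \<inter> W \<noteq> {}"
  proof
    assume d: "V x n \<inter> W = {}"
    have "3 = ennreal (3/2) + ennreal (3/2)"
      by (subst ennreal_plus[symmetric]) auto
    also have "\<dots> < emeasure lborel (V x n) + emeasure lborel W"
      using n(1) W by (rule add_strict_mono)
    also have "\<dots> = emeasure lborel (V x n \<union> W)"
      using d by (subst plus_emeasure) auto
    also have "\<dots> \<le> emeasure lborel {0..3::real}"
    proof (rule emeasure_mono)
      show "V x n \<union> W \<subseteq> {0..3}"
        using xu(2)[of n] by (auto simp: V_def W_def)
    qed auto
    finally show False by simp
  qed
  then obtain l where l: "l \<in> V x n" "l \<in> W" by auto
  have "\<bar>h (x n + l) - h (x n)\<bar> < \<epsilon> / 2" using l(1) by (auto simp: V_def)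
  moreover have "\<bar>h (x n + u n + (l - u n)) - h (x n + u n)\<bar> < \<epsilon> / 2" 
    using l(2) unfolding W_def V_def by blast
  then have "\<bar>h (x n + l) - h (x n + u n)\<bar> < \<epsilon> / 2" by simp
  ultimately show False using xu(3)[of n] by linarith
qed

text \<open>In the variable \<open>ln x\<close> slow variation becomes additive, and the factors in
  \<open>{1..2}\<close> become shifts in \<open>{0..1}\<close>, because
  \<open>ln l \<le> l - 1\<close>. The tolerance is written as \<open>2 powr \<delta>\<close> so
  that repeated doubling yields exact powers.\<close>

lemma slowly_varying_uniform:
  assumes f: "slowly_varying f" and d: "\<delta> > 0"
  shows "\<exists>X>0. \<forall>x\<ge>X. f x > 0 \<and> (\<forall>l\<in>{1..2}. f (l * x) \<le> 2 powr \<delta> * f x \<and> f x \<le> 2 powr \<delta> * f (l * x))"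
proof -
  have fm [measurable]: "f \<in> borel_measurable borel" and pos: "\<forall>\<^sub>F x in at_top. f x > 0"
    and rat: "\<And>r. r > 0 \<Longrightarrow> ((\<lambda>x. f (r * x) / f x) \<longlongrightarrow> 1) at_top"
    using f by (auto simp: slowly_varying_def)
  obtain X1 where X1: "\<And>x. x \<ge> X1 \<Longrightarrow> f x > 0"
    using pos by (auto simp: eventually_at_top_linorder)
  define h where "h x = ln (f (exp x))" for x
  have "((\<lambda>x. h (x + u) - h x) \<longlongrightarrow> 0) at_top" for u
  proof -
    have "((\<lambda>x. ln (f (exp u * exp x) / f (exp x))) \<longlongrightarrow> ln 1) at_top"
      by (intro tendsto_ln filterlim_compose[OF rat exp_at_top]) auto
    moreover have "\<forall>\<^sub>F x in at_top. ln (f (exp u * exp x) / f (exp x)) = h (x + u) - h x"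
    proof -
      have "\<forall>\<^sub>F x in at_top. exp u * exp x \<ge> X1 \<and> exp x \<ge> (X1::real)"
        by (intro eventually_conj; real_asymp)
      then show ?thesis
      proof eventually_elim
        case (elim x)
        then show ?case using X1[of "exp x"] X1[of "exp u * exp x"]
          by (simp add: h_def ln_div exp_add mult.commute)
      qed
    qed
    ultimately show ?thesis by (simp add: tendsto_cong)
  qed
  moreover have "h \<in> borel_measurable borel" unfolding h_def by measurable
  ultimately obtain Y where Y: "\<And>x u. x \<ge> Y \<Longrightarrow> u \<in> {0..1} \<Longrightarrow> \<bar>h (x + u) - h x\<bar> < \<delta> * ln 2"
    using slowly_increasing_uniform[of h "\<delta> * ln 2"] d by (metis ln_gt_zero mult_pos_pos one_less_numeral_iff semiring_norm(76))
  define X where "X = max (max 1 X1) (exp Y)"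
  show ?thesis
  proof (intro exI[of _ X] conjI allI impI ballI)
    show "X > 0" by (simp add: X_def less_max_iff_disj)
    fix x assume x: "x \<ge> X"
    then have x0: "x > 0" "x \<ge> X1" "x \<ge> exp Y" by (auto simp: X_def)
    then show fx: "f x > 0" using X1 by auto
    fix l :: real assume l: "l \<in> {1..2}"
    have "x \<le> x * l" using l x0 mult_left_mono[of 1 l x] by auto
    then have "l * x \<ge> X1" using x0 by (metis dual_order.trans mult.commute mult_1_right)
    then have fl: "f (l * x) > 0" by (rule X1)
    have "ln x \<ge> Y" using x0 by (simp add: ln_ge_iff)
    moreover have "ln l \<in> {0..1}"
    proof -
      have "ln l \<le> l - 1" using l by (intro ln_le_minus_one) auto
      then show ?thesis using l by auto
    qed
    ultimately have "\<bar>h (ln x + ln l) - h (ln x)\<bar> < \<delta> * ln 2" by (rule Y)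
    then have a: "\<bar>ln (f (l * x)) - ln (f x)\<bar> < \<delta> * ln 2"
      using l x0 by (simp add: h_def exp_add mult.commute)
    have p: "2 powr \<delta> = exp (\<delta> * ln 2)" by (simp add: powr_def)
    have "ln (f (l * x)) \<le> ln (f x) + \<delta> * ln 2" using a by auto
    then show "f (l * x) \<le> 2 powr \<delta> * f x"
      using fl fx unfolding p by (metis exp_add exp_le_cancel_iff exp_ln mult.commute)
    have "ln (f x) \<le> ln (f (l * x)) + \<delta> * ln 2" using a by auto
    then show "f x \<le> 2 powr \<delta> * f (l * x)"
      using fl fx unfolding p by (metis exp_add exp_le_cancel_iff exp_ln mult.commute)
  qed
qed

text \<open>Potter's bounds. A ratio between \<open>2 ^ n\<close> and \<open>2 ^ Suc n\<close> is
  crossed in n doublings and one last factor from \<open>{1..2}\<close>. Each costs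
  \<open>2 powr \<delta>\<close>; the doublings amount to at most the power
  \<open>(y / x) powr \<delta>\<close>, and the last factor is the constant in front.\<close>

lemma slowly_varying_Potter:
  assumes f: "slowly_varying f" and d: "\<delta> > 0"
  obtains X where "X > 0" "\<And>x. x \<ge> X \<Longrightarrow> f x > 0" 
    "\<And>x y. x \<ge> X \<Longrightarrow> y \<ge> x \<Longrightarrow> f y \<le> 2 powr \<delta> * (y / x) powr \<delta> * f x"
    "\<And>x y. x \<ge> X \<Longrightarrow> y \<ge> x \<Longrightarrow> f x \<le> 2 powr \<delta> * (y / x) powr \<delta> * f y"
proof -
  obtain X where X: "X > 0" "\<And>x. x \<ge> X \<Longrightarrow> f x > 0"
    "\<And>x l. x \<ge> X \<Longrightarrow> l \<in> {1..2} \<Longrightarrow> f (l * x) \<le> 2 powr \<delta> * f x"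
    "\<And>x l. x \<ge> X \<Longrightarrow> l \<in> {1..2} \<Longrightarrow> f x \<le> 2 powr \<delta> * f (l * x)"
    using slowly_varying_uniform[OF f d] by auto
  have step: "f (l * x) \<le> 2 powr (\<delta> * (n + 1)) * f x \<and> f x \<le> 2 powr (\<delta> * (n + 1)) * f (l * x)"
    if "x \<ge> X" "l \<ge> 2 ^ n" "l \<le> 2 ^ Suc n" for x l and n :: nat
    using that
  proof (induction n arbitrary: l)
    case 0
    then show ?case using X(3,4)[of x l] by auto
  next
    case (Suc n)
    have x: "x > 0" using Suc X by auto
    have l2: "l / 2 \<ge> 1" using Suc.prems(2) one_le_power[of "2::real" n] unfolding power_Suc by linarith
    have "1 * x \<le> (l / 2) * x" using l2 x by (intro mult_right_mono) auto
    then have xl: "(l/2) * x \<ge> X" using Suc by auto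
    have IH: "f (l / 2 * x) \<le> 2 powr (\<delta> * (n + 1)) * f x" "f x \<le> 2 powr (\<delta> * (n + 1)) * f (l / 2 * x)"
      using Suc.IH[of "l/2"] Suc.prems by auto
    have eq: "2 powr (\<delta> * (real (Suc n) + 1)) = 2 powr \<delta> * 2 powr (\<delta> * (n + 1))"
      by (simp add: powr_add[symmetric] algebra_simps)
    have s: "f (2 * (l / 2 * x)) \<le> 2 powr \<delta> * f (l / 2 * x)" "f (l / 2 * x) \<le> 2 powr \<delta> * f (2 * (l / 2 * x))"
      using X(3,4)[OF xl, of 2] by auto
    have "f (l * x) \<le> 2 powr \<delta> * f (l / 2 * x)" using s by simp
    also have "\<dots> \<le> 2 powr \<delta> * (2 powr (\<delta> * (n + 1)) * f x)"
      by (intro mult_left_mono IH) auto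
    finally have 1: "f (l * x) \<le> 2 powr (\<delta> * (real (Suc n) + 1)) * f x" unfolding eq by simp
    have "f x \<le> 2 powr (\<delta> * (n + 1)) * f (l / 2 * x)" by (rule IH)
    also have "\<dots> \<le> 2 powr (\<delta> * (n + 1)) * (2 powr \<delta> * f (l * x))"
      using s by (intro mult_left_mono) auto
    also have "\<dots> = 2 powr (\<delta> * (real (Suc n) + 1)) * f (l * x)" unfolding eq by (simp only: mult_ac)
    finally show ?case using 1 by simp
  qed
  have main: "f y \<le> 2 powr \<delta> * (y / x) powr \<delta> * f x \<and> f x \<le> 2 powr \<delta> * (y / x) powr \<delta> * f y"
    if xy: "x \<ge> X" "y \<ge> x" for x y
  proof -
    have x: "x > 0" using xy X by auto
    define l where "l = y / x"
    have l1: "l \<ge> 1" using xy x by (simp add: l_def)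
    define n where "n = nat \<lfloor>log 2 l\<rfloor>"
    have lg: "log 2 l \<ge> 0" using l1 by simp
    have "real n \<le> log 2 l" "log 2 l \<le> real (Suc n)"
      using lg unfolding n_def by linarith+
    then have n: "2 ^ n \<le> l" "l \<le> 2 ^ Suc n"
      using l1 by (simp_all add: le_log_iff log_le_iff powr_realpow[symmetric] del: of_nat_Suc power_Suc)
    have "2 powr (\<delta> * (n + 1)) = 2 powr \<delta> * (2 ^ n) powr \<delta>"
      by (simp add: powr_realpow[symmetric] powr_powr powr_add[symmetric] algebra_simps)
    also have "\<dots> \<le> 2 powr \<delta> * l powr \<delta>"
      using n d by (intro mult_left_mono powr_mono2) auto
    finally have le: "2 powr (\<delta> * (n + 1)) \<le> 2 powr \<delta> * l powr \<delta>" .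
    have y: "y = l * x" using x by (simp add: l_def)
    have pos: "f x > 0" "f y > 0" using X xy by auto
    have "f y \<le> 2 powr (\<delta> * (n + 1)) * f x" "f x \<le> 2 powr (\<delta> * (n + 1)) * f y"
      using step[OF xy(1) n] y by auto
    then show ?thesis
      using mult_right_mono[OF le, of "f x"] mult_right_mono[OF le, of "f y"] pos unfolding l_def by linarith
  qed
  show ?thesis using that[OF X(1,2)] main by blast
qed

text \<open>Potter's bound with half the exponent, taken from the fixed point \<open>X\<close>,
  leaves a decaying power. The quotient form disposes of the small jumps in the scaling limit, the
  product form of the high frequencies in the tail of the inverse exponent.\<close>

lemma slowly_varying_powr_tendsto_0:
  assumes f: "slowly_varying f" and a: "a > 0"
  shows "((\<lambda>x. x powr (-a) * f x) \<longlongrightarrow> 0) at_top" "((\<lambda>x. x powr (-a) / f x) \<longlongrightarrow> 0) at_top"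
proof -
  obtain X where X: "X > 0" "\<And>x. x \<ge> X \<Longrightarrow> f x > 0" 
    "\<And>x y. x \<ge> X \<Longrightarrow> y \<ge> x \<Longrightarrow> f y \<le> 2 powr (a/2) * (y / x) powr (a/2) * f x"
    "\<And>x y. x \<ge> X \<Longrightarrow> y \<ge> x \<Longrightarrow> f x \<le> 2 powr (a/2) * (y / x) powr (a/2) * f y"
    using slowly_varying_Potter[OF f, of "a/2"] a by auto
  let ?C = "2 powr (a/2) * (1 / X) powr (a/2)"
  have z: "((\<lambda>x. ?C * c * x powr (-a/2)) \<longlongrightarrow> 0) at_top" for c :: real
    by (rule tendsto_mult_right_zero) (use a in real_asymp)
  have e: "\<forall>\<^sub>F x in at_top. x \<ge> X" by (rule eventually_ge_at_top)
  have pw: "x powr (-a) * (x / X) powr (a/2) = (1 / X) powr (a/2) * x powr (-a/2)" if "x \<ge> X" for x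
  proof -
    have "x > 0" using that X by auto
    then have "x powr (-a) * x powr (a/2) = x powr (-a/2)"
      by (simp add: powr_add[symmetric])
    then show ?thesis using X \<open>x > 0\<close> by (simp add: powr_divide)
  qed
  show "((\<lambda>x. x powr (-a) * f x) \<longlongrightarrow> 0) at_top"
  proof (rule tendsto_sandwich[OF _ _ tendsto_const z[of "f X"]])
    show "\<forall>\<^sub>F x in at_top. 0 \<le> x powr (-a) * f x"
      using e by eventually_elim (use X in \<open>auto simp: less_imp_le\<close>)
    show "\<forall>\<^sub>F x in at_top. x powr (-a) * f x \<le> ?C * f X * x powr (-a/2)"
      using e
    proof eventually_elim
      case (elim x)
      have "x powr (-a) * f x \<le> x powr (-a) * (2 powr (a/2) * (x / X) powr (a/2) * f X)"
        using X elim by (intro mult_left_mono) auto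
      also have "\<dots> = 2 powr (a/2) * f X * (x powr (-a) * (x / X) powr (a/2))"
        by (simp only: mult_ac)
      also have "\<dots> = ?C * f X * x powr (-a/2)" unfolding pw[OF elim] by (simp only: mult_ac)
      finally show ?case .
    qed
  qed
  show "((\<lambda>x. x powr (-a) / f x) \<longlongrightarrow> 0) at_top"
  proof (rule tendsto_sandwich[OF _ _ tendsto_const z[of "1 / f X"]])
    show "\<forall>\<^sub>F x in at_top. 0 \<le> x powr (-a) / f x"
      using e by eventually_elim (use X in \<open>auto simp: less_imp_le\<close>)
    show "\<forall>\<^sub>F x in at_top. x powr (-a) / f x \<le> ?C * (1 / f X) * x powr (-a/2)"
      using e
    proof eventually_elim
      case (elim x)
      have p: "f x > 0" "f X > 0" using X elim by auto
      have "f X \<le> 2 powr (a/2) * (x / X) powr (a/2) * f x" using X elim by auto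
      then have "1 / f x \<le> 2 powr (a/2) * (x / X) powr (a/2) * (1 / f X)"
        using p by (simp add: field_simps)
      then have "x powr (-a) * (1 / f x) \<le> x powr (-a) * (2 powr (a/2) * (x / X) powr (a/2) * (1 / f X))"
        by (intro mult_left_mono) auto
      also have "\<dots> = 2 powr (a/2) * (1 / f X) * (x powr (-a) * (x / X) powr (a/2))"
        by (simp only: mult_ac)
      also have "\<dots> = ?C * (1 / f X) * x powr (-a/2)" unfolding pw[OF elim] by (simp only: mult_ac)
      finally show ?case by simp
    qed
  qed
qed

section \<open>Characteristic exponents with symmetric Levy density\<close>

text \<open>The integrand behaves like \<open>u powr (1 - a)\<close> near 0 and like
  \<open>u powr (- 1 - a)\<close> at infinity, integrable for a < 2 and a > 0 respectively. Besides
  the stable Levy measure itself it serves, with a slightly above and slightly below \<beta>, as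
  dominating function.\<close>

lemma integrable_min_square_powr:
  assumes a: "0 < a" "a < 2"
  shows "integrable lborel (\<lambda>u::real. min 1 (u\<^sup>2) * \<bar>u\<bar> powr (- 1 - a))"
proof -
  define h :: "real \<Rightarrow> real" where "h u = min 1 (u\<^sup>2) * \<bar>u\<bar> powr (- 1 - a)" for u
  have hm [measurable]: "h \<in> borel_measurable borel" unfolding h_def by measurable
  have 1: "integrable lborel (\<lambda>x. indicator {0..1} x * x powr (1 - a))"
  proof -
    have "(\<lambda>x. x powr (1 - a)) absolutely_integrable_on {0..1}"
      by (intro nonnegative_absolutely_integrable_1 integrable_on_powr_from_0) (use a in auto)
    then show ?thesis
      by (simp add: set_integrable_def integrable_completion)
  qed
  have 2: "integrable lborel (\<lambda>x. indicator {1..} x * x powr (- 1 - a))"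
  proof -
    have "(\<lambda>x. x powr (- 1 - a)) integrable_on {1..}"
      using has_integral_powr_to_inf[of "- 1 - a" 1] a by (auto simp: integrable_on_def)
    then have "(\<lambda>x. x powr (- 1 - a)) absolutely_integrable_on {1..}"
      by (intro nonnegative_absolutely_integrable_1) auto
    then show ?thesis
      by (simp add: set_integrable_def integrable_completion)
  qed
  have 3: "integrable lborel (\<lambda>x. indicator {0<..} x * h x)"
  proof (rule Bochner_Integration.integrable_bound[OF Bochner_Integration.integrable_add[OF 1 2]])
    show "AE x in lborel. norm (indicator {0<..} x * h x)
      \<le> norm (indicator {0..1} x * x powr (1 - a) + indicator {1..} x * x powr (- 1 - a))"
    proof (intro AE_I2)
      fix x :: real
      have "h x \<le> x powr (1 - a)" if "0 < x"
      proof -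
        have "h x \<le> x\<^sup>2 * x powr (- 1 - a)" unfolding h_def using that by (intro mult_mono) auto
        also have "\<dots> = x powr 2 * x powr (- 1 - a)" using that by simp
        also have "\<dots> = x powr (1 - a)" unfolding powr_add[symmetric] by simp
        finally show ?thesis .
      qed
      moreover have "h x \<le> x powr (- 1 - a)" if "0 < x"
      proof -
        have "h x \<le> 1 * x powr (- 1 - a)" unfolding h_def using that by (intro mult_mono) auto
        then show ?thesis by simp
      qed
      moreover have "h x \<ge> 0" by (simp add: h_def)
      ultimately show "norm (indicator {0<..} x * h x)
        \<le> norm (indicator {0..1} x * x powr (1 - a) + indicator {1..} x * x powr (- 1 - a))"
        by (cases "x > 0"; cases "x \<le> 1") (auto simp: indicator_def add_increasing)
    qed
  qed auto
  have 4: "integrable lborel (\<lambda>x. indicator {0<..} (- x) * h (- x))"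
    using lborel_integrable_real_affine[OF 3, of "-1" 0] by simp
  have "integrable lborel (\<lambda>x. indicator {0<..} x * h x + indicator {0<..} (- x) * h (- x))"
    using 3 4 by (rule Bochner_Integration.integrable_add)
  also have "(\<lambda>x. indicator {0<..} x * h x + indicator {0<..} (- x) * h (- x)) = h"
    by (auto simp: fun_eq_iff h_def indicator_def)
  finally show ?thesis unfolding h_def .
qed

lemma one_minus_cos_le: "1 - cos (x::real) \<le> x\<^sup>2 / 2"
proof -
  have "2 * (sin (x/2))\<^sup>2 \<le> 2 * (x/2)\<^sup>2"
    using abs_le_square_iff[THEN iffD1, OF abs_sin_x_le_abs_x[of "x/2"]] by simp
  moreover have "cos x = 1 - 2 * (sin (x/2))\<^sup>2"
    using cos_double_sin[of "x/2"] by simp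
  ultimately show ?thesis by (simp add: power2_eq_square)
qed

lemma one_minus_cos_le_min: "1 - cos (\<theta> * x :: real) \<le> (2 + \<theta>\<^sup>2) * min 1 (x\<^sup>2)"
proof (cases "x\<^sup>2 \<le> 1")
  case True
  have "1 - cos (\<theta> * x) \<le> \<theta>\<^sup>2 * x\<^sup>2 / 2" using one_minus_cos_le[of "\<theta> * x"] by (simp add: power_mult_distrib)
  also have "\<dots> \<le> (2 + \<theta>\<^sup>2) * x\<^sup>2" by (simp add: algebra_simps)
  finally show ?thesis using True by simp
next
  case False
  have "1 - cos (\<theta> * x) \<le> 2" using cos_ge_minus_one[of "\<theta> * x"] by linarith
  then show ?thesis using False by (simp add: add_increasing2)
qed

text \<open>Inside the unit interval this is the second-order Taylor remainder of the exponential;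
  outside it the compensator is absent and the modulus is at most 2.\<close>

lemma levy_integrand_bound:
  "cmod (1 - iexp (\<theta> * x) + \<i> * complex_of_real (\<theta> * x) * indicator {-1..1} x) \<le> (2 + \<theta>\<^sup>2) * min 1 (x\<^sup>2)"
proof (cases "x \<in> {-1..1}")
  case True
  then have "x\<^sup>2 \<le> 1" by (auto simp: abs_square_le_1 abs_le_iff)
  have "cmod (1 - iexp (\<theta> * x) + \<i> * complex_of_real (\<theta> * x)) = cmod (iexp (\<theta> * x) - (1 + \<i> * complex_of_real (\<theta> * x)))"
    by (subst norm_minus_commute) (simp add: algebra_simps)
  also have "\<dots> \<le> \<bar>\<theta> * x\<bar>^2 / 2"
    using iexp_approx1[of "\<theta> * x" 1] by (simp add: numeral_2_eq_2)
  also have "\<dots> \<le> (2 + \<theta>\<^sup>2) * x\<^sup>2"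
    by (simp add: power_mult_distrib algebra_simps)
  finally show ?thesis using True \<open>x\<^sup>2 \<le> 1\<close> by simp
next
  case False
  then have "x\<^sup>2 \<ge> 1" by (auto simp: abs_square_le_1 not_le less_imp_le abs_if split: if_splits intro: order.trans[OF _ one_le_power])
     (smt (verit) one_le_power power2_minus)
  have "cmod (1 - iexp (\<theta> * x)) \<le> 1 + 1"
    by (rule order.trans[OF norm_triangle_ineq4]) simp
  then show ?thesis using False \<open>x\<^sup>2 \<ge> 1\<close> by (simp add: add_increasing2)
qed

text \<open>The imaginary part, sine and compensator together, is odd, so reflection annihilates it;
  only \<open>1 - cos\<close> survives. From here on the exponent can be treated as a real
  function.\<close>

lemma levy_integral_even:
  fixes w :: "real \<Rightarrow> real"
  assumes [measurable]: "w \<in> borel_measurable borel" and nn: "\<And>x. w x \<ge> 0"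
    and even: "\<And>x. w (- x) = w x"
    and int: "integrable lborel (\<lambda>x. min 1 (x\<^sup>2) * w x)"
  shows "(CLINT x|lborel. (1 - iexp (\<theta> * x) + \<i> * complex_of_real (\<theta> * x) * indicator {-1..1} x) * complex_of_real (w x))
     = complex_of_real (LINT x|lborel. (1 - cos (\<theta> * x)) * w x)"
proof -
  let ?F = "\<lambda>x. (1 - iexp (\<theta> * x) + \<i> * complex_of_real (\<theta> * x) * indicator {-1..1} x) * complex_of_real (w x)"
  have iF: "integrable lborel ?F"
  proof (rule Bochner_Integration.integrable_bound[OF integrable_mult_right[OF int, of "2 + \<theta>\<^sup>2"]])
    show "AE x in lborel. cmod (?F x) \<le> norm ((2 + \<theta>\<^sup>2) * (min 1 (x\<^sup>2) * w x))"
    proof (intro AE_I2)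
      fix x
      have "cmod (?F x) \<le> ((2 + \<theta>\<^sup>2) * min 1 (x\<^sup>2)) * w x"
        unfolding norm_mult using levy_integrand_bound[of \<theta> x] nn[of x] by (intro mult_mono) auto
      then show "cmod (?F x) \<le> norm ((2 + \<theta>\<^sup>2) * (min 1 (x\<^sup>2) * w x))"
        by (simp add: mult.assoc)
    qed
  qed auto
  have re: "Re (?F x) = (1 - cos (\<theta> * x)) * w x" for x
    by (simp add: indicator_def Re_exp)
  have im: "Im (?F x) = (- sin (\<theta> * x) + \<theta> * x * indicator {-1..1} x) * w x" for x
    by (simp add: indicator_def Im_exp)
  have "Im (integral\<^sup>L lborel ?F) = (LINT x|lborel. Im (?F x))"
    using iF by (rule integral_Im[symmetric])
  also have "\<dots> = 0"
  proof -
    have "(LINT x|lborel. Im (?F x)) = (LINT x|lborel. Im (?F (0 + (-1) * x)))"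
      using lborel_integral_real_affine[of "-1" "\<lambda>x. Im (?F x)" 0] by simp
    also have "\<dots> = (LINT x|lborel. - Im (?F x))"
      unfolding im by (intro Bochner_Integration.integral_cong) (auto simp: even indicator_def algebra_simps)
    finally show ?thesis by simp
  qed
  finally have "Im (integral\<^sup>L lborel ?F) = 0" .
  moreover have "Re (integral\<^sup>L lborel ?F) = (LINT x|lborel. (1 - cos (\<theta> * x)) * w x)"
    unfolding re[symmetric] using iF by (rule integral_Re[symmetric])
  ultimately show ?thesis by (simp add: complex_eq_iff)
qed

lemma levy_exponent_even:
  fixes w :: "real \<Rightarrow> real"
  assumes [measurable]: "w \<in> borel_measurable borel" and nn: "\<And>x. w x \<ge> 0"
    and even: "\<And>x. w (- x) = w x"
    and int: "integrable lborel (\<lambda>x. min 1 (x\<^sup>2) * w x)"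
  shows "levy_exponent 0 0 (density lborel (\<lambda>x. ennreal (w x))) \<theta> =
    complex_of_real (LINT x|lborel. (1 - cos (\<theta> * x)) * w x)"
proof -
  have "levy_exponent 0 0 (density lborel (\<lambda>x. ennreal (w x))) \<theta> = 
    (CLINT x|lborel. w x *\<^sub>R (1 - iexp (\<theta> * x) + \<i> * complex_of_real (\<theta> * x) * indicator {-1..1} x))"
    unfolding levy_exponent_def by (subst integral_density) (use nn in auto)
  also have "\<dots> = complex_of_real (LINT x|lborel. (1 - cos (\<theta> * x)) * w x)"
    by (subst levy_integral_even[symmetric]) (use assms in \<open>auto simp: scaleR_conv_of_real mult.commute\<close>)
  finally show ?thesis .
qed

lemma c_stable_eq:
  assumes "1 < \<beta>" "\<beta> < 2"
  shows "c_stable \<beta> = (LINT u|lborel. (1 - cos u) * \<bar>u\<bar> powr (- 1 - \<beta>))"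
  using levy_integral_even[of "\<lambda>u. \<bar>u\<bar> powr (- 1 - \<beta>)" 1] integrable_min_square_powr[of \<beta>] assms
  by (simp add: c_stable_def)

lemma integrable_one_minus_cos:
  fixes w :: "real \<Rightarrow> real"
  assumes [measurable]: "w \<in> borel_measurable borel" and nn: "\<And>x. w x \<ge> 0"
    and int: "integrable lborel (\<lambda>x. min 1 (x\<^sup>2) * w x)"
  shows "integrable lborel (\<lambda>x. (1 - cos (\<theta> * x)) * w x)"
proof (rule Bochner_Integration.integrable_bound[OF integrable_mult_right[OF int, of "2 + \<theta>\<^sup>2"]])
  show "AE x in lborel. norm ((1 - cos (\<theta> * x)) * w x) \<le> norm ((2 + \<theta>\<^sup>2) * (min 1 (x\<^sup>2) * w x))"
  proof (intro AE_I2)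
    fix x
    have "(1 - cos (\<theta> * x)) * w x \<le> ((2 + \<theta>\<^sup>2) * min 1 (x\<^sup>2)) * w x"
      using one_minus_cos_le_min[of \<theta> x] nn[of x] by (intro mult_right_mono) auto
    then show "norm ((1 - cos (\<theta> * x)) * w x) \<le> norm ((2 + \<theta>\<^sup>2) * (min 1 (x\<^sup>2) * w x))"
      using nn[of x] cos_le_one[of "\<theta> * x"] by (simp add: mult.assoc)
  qed
qed auto

text \<open>The integrand is nonnegative and strictly positive on \<open>{1..2}\<close>, which is
  not a null set.\<close>

lemma c_stable_pos:
  assumes b: "1 < \<beta>" "\<beta> < 2"
  shows "c_stable \<beta> > 0"
proof -
  let ?h = "\<lambda>u::real. (1 - cos u) * \<bar>u\<bar> powr (- 1 - \<beta>)"
  have i: "integrable lborel ?h"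
    using integrable_one_minus_cos[of "\<lambda>u. \<bar>u\<bar> powr (- 1 - \<beta>)" 1] integrable_min_square_powr[of \<beta>] b by simp
  have nn: "?h u \<ge> 0" for u by simp
  have "(LINT u|lborel. ?h u) \<noteq> 0"
  proof
    assume "(LINT u|lborel. ?h u) = 0"
    then have "AE u in lborel. ?h u = 0"
      using i nn by (subst (asm) integral_nonneg_eq_0_iff_AE) auto
    moreover have "?h u \<noteq> 0" if "u \<in> {1..2}" for u
    proof -
      have "cos u < cos 0" using that pi_gt3 by (intro cos_monotone_0_pi) auto
      then show ?thesis using that by simp
    qed
    ultimately have "AE u in lborel. u \<notin> {1..2::real}" by (auto elim: eventually_mono)
    then have "emeasure lborel {1..2::real} = 0"
      by (subst (asm) AE_iff_measurable[of "{1..2}"]) auto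
    then show False by simp
  qed
  then show ?thesis unfolding c_stable_eq[OF b]
    using integral_nonneg_AE[of ?h lborel] nn by (smt (verit) AE_I2 integral_nonneg)
qed

text \<open>The substitution u -> \<theta> u shows homogeneity of degree \<beta>. This identifies
  the limit of the scaled exponents and explains the normalisation by
  \<open>c_stable\<close>.\<close>

lemma stable_exponent_integral:
  assumes b: "1 < \<beta>" "\<beta> < 2"
  shows "(LINT u|lborel. (1 - cos (\<theta> * u)) * \<bar>u\<bar> powr (- 1 - \<beta>)) = c_stable \<beta> * \<bar>\<theta>\<bar> powr \<beta>"
proof (cases "\<theta> = 0")
  case False
  have "c_stable \<beta> = \<bar>\<theta>\<bar> * (LINT u|lborel. (1 - cos (\<theta> * u)) * \<bar>\<theta> * u\<bar> powr (- 1 - \<beta>))"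
    unfolding c_stable_eq[OF b]
    using lborel_integral_real_affine[of \<theta> "\<lambda>u. (1 - cos u) * \<bar>u\<bar> powr (- 1 - \<beta>)" 0] False by simp
  also have "(LINT u|lborel. (1 - cos (\<theta> * u)) * \<bar>\<theta> * u\<bar> powr (- 1 - \<beta>)) = 
    (LINT u|lborel. \<bar>\<theta>\<bar> powr (- 1 - \<beta>) * ((1 - cos (\<theta> * u)) * \<bar>u\<bar> powr (- 1 - \<beta>)))"
    by (intro Bochner_Integration.integral_cong) (auto simp: abs_mult powr_mult)
  also have "\<dots> = \<bar>\<theta>\<bar> powr (- 1 - \<beta>) * (LINT u|lborel. (1 - cos (\<theta> * u)) * \<bar>u\<bar> powr (- 1 - \<beta>))"
    by simp
  finally have "\<bar>\<theta>\<bar> powr \<beta> * c_stable \<beta> = (\<bar>\<theta>\<bar> powr \<beta> * \<bar>\<theta>\<bar> powr 1 * \<bar>\<theta>\<bar> powr (- 1 - \<beta>)) * (LINT u|lborel. (1 - cos (\<theta> * u)) * \<bar>u\<bar> powr (- 1 - \<beta>))"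
    by simp
  also have "\<bar>\<theta>\<bar> powr \<beta> * \<bar>\<theta>\<bar> powr 1 * \<bar>\<theta>\<bar> powr (- 1 - \<beta>) = 1"
    unfolding powr_add[symmetric] using False by simp
  finally show ?thesis by (simp add: mult.commute)
qed auto

section \<open>The characteristic exponent: scaling limit, lower bound, integrability of its
  inverse\<close>

definition tail_density :: "real \<Rightarrow> (real \<Rightarrow> real) \<Rightarrow> real \<Rightarrow> real" where
  "tail_density \<beta> f x = f x * \<bar>x\<bar> powr (- 1 - \<beta>)"

text \<open>The exponent \<psi> of the driving process as a real function; for \<open>f = 1\<close>
  the division by \<open>c_stable\<close> would make it exactly
  \<open>\<bar>z\<bar> powr \<beta>\<close>.\<close>

definition tail_exponent :: "real \<Rightarrow> (real \<Rightarrow> real) \<Rightarrow> real \<Rightarrow> real" where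
  "tail_exponent \<beta> f z = (LINT x|lborel. (1 - cos (z * x)) * tail_density \<beta> f x) / c_stable \<beta>"

locale regular_exponent =
  fixes \<beta> :: real and f :: "real \<Rightarrow> real"
  assumes beta: "1 < \<beta>" "\<beta> < 2"
    and sv: "slowly_varying f"
    and tail_nonneg: "\<And>x. tail_density \<beta> f x \<ge> 0"
    and even: "\<And>x. f (- x) = f x"
    and tail_int: "integrable lborel (\<lambda>x. min 1 (x\<^sup>2) * tail_density \<beta> f x)"
    and inverse_int: "(\<integral>\<^sup>+ z\<in>{1..}. inverse (ennreal (tail_exponent \<beta> f z)) \<partial>lborel) < \<infinity>"
begin

abbreviation "g \<equiv> tail_density \<beta> f"
abbreviation "\<Psi> \<equiv> tail_exponent \<beta> f"

lemma f_meas [measurable]: "f \<in> borel_measurable borel"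
  using sv by (simp add: slowly_varying_def)

lemma g_meas [measurable]: "g \<in> borel_measurable borel"
  unfolding tail_density_def[abs_def] by measurable

lemma f_nonneg: "x \<noteq> 0 \<Longrightarrow> f x \<ge> 0"
  using tail_nonneg[of x] by (auto simp: tail_density_def zero_le_mult_iff)

lemma f_abs: "f \<bar>x\<bar> = f x"
  using even[of x] by (auto simp: abs_if)

lemma int_cos: "integrable lborel (\<lambda>x. (1 - cos (z * x)) * g x)"
  using integrable_one_minus_cos[of g z] tail_nonneg tail_int by simp

lemma Psi_meas [measurable]: "\<Psi> \<in> borel_measurable borel"
  unfolding tail_exponent_def[abs_def] by measurable

lemma Psi_nonneg: "\<Psi> z \<ge> 0"
  unfolding tail_exponent_def using c_stable_pos[OF beta] tail_nonneg
  by (intro divide_nonneg_pos integral_nonneg_AE AE_I2 mult_nonneg_nonneg) auto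

lemma Psi_even: "\<Psi> (- z) = \<Psi> z"
  unfolding tail_exponent_def by simp

text \<open>The substitution x = R u produces the stable integral with the extra factor
  \<open>f (R * u) / f R\<close>, which tends to 1. Potter's bounds dominate this factor only while
  \<open>\<bar>R * u\<bar>\<close> exceeds \<open>X\<close>, so the jumps of size at most
  \<open>X\<close> are split off. For these, \<open>1 - cos\<close> is at most the square of the
  angle over 2, and the contribution is of order \<open>R powr (\<beta> - 2) / f R\<close>.\<close>

lemma tail_exponent_scaling:
  "((\<lambda>R. R powr \<beta> / f R * \<Psi> (\<theta> / R)) \<longlongrightarrow> \<bar>\<theta>\<bar> powr \<beta>) at_top"
proof -
  \<comment> \<open>Chosen so that \<open>\<beta> + \<delta>\<close> stays below 2 and
    \<open>\<beta> - \<delta>\<close> above 0: Potter's factor is a power \<open>\<delta>\<close>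
    for \<open>\<bar>u\<bar> \<ge> 1\<close> and \<open>- \<delta>\<close> for
    \<open>\<bar>u\<bar> < 1\<close>, and both resulting dominating functions must be
    integrable.\<close>
  define \<delta> where "\<delta> = (2 - \<beta>) / 2"
  have d: "\<delta> > 0" "\<beta> + \<delta> < 2" "\<beta> - \<delta> > 0" using beta by (auto simp: \<delta>_def field_simps)
  obtain X where X: "X > 0" "\<And>x. x \<ge> X \<Longrightarrow> f x > 0" 
    "\<And>x y. x \<ge> X \<Longrightarrow> y \<ge> x \<Longrightarrow> f y \<le> 2 powr \<delta> * (y / x) powr \<delta> * f x"
    "\<And>x y. x \<ge> X \<Longrightarrow> y \<ge> x \<Longrightarrow> f x \<le> 2 powr \<delta> * (y / x) powr \<delta> * f y"
    using slowly_varying_Potter[OF sv d(1)] by metis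
  define c where "c = c_stable \<beta>"
  have c: "c > 0" unfolding c_def by (rule c_stable_pos[OF beta])
  define s where "s R u = (1 - cos (\<theta> * u)) * \<bar>u\<bar> powr (- 1 - \<beta>) * (if \<bar>R * u\<bar> > X then f (R * u) / f R else 0)" for R u
  define p where "p R = R powr \<beta> / f R * (LINT x|lborel. indicator {-X..X} x * ((1 - cos (\<theta> / R * x)) * g x))" for R
  define w where "w u = (2 + \<theta>\<^sup>2) * 2 powr \<delta> * (min 1 (u\<^sup>2) * \<bar>u\<bar> powr (- 1 - (\<beta> - \<delta>)) + min 1 (u\<^sup>2) * \<bar>u\<bar> powr (- 1 - (\<beta> + \<delta>)))" for u
  have large: "((\<lambda>R. LINT u|lborel. s R u) \<longlongrightarrow> (LINT u|lborel. (1 - cos (\<theta> * u)) * \<bar>u\<bar> powr (- 1 - \<beta>))) at_top"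
  proof (rule integral_dominated_convergence_at_top[where w=w])
    show "integrable lborel w" unfolding w_def
      using d beta by (intro integrable_mult_right Bochner_Integration.integrable_add integrable_min_square_powr) auto
    show "s R \<in> borel_measurable lborel" for R unfolding s_def by measurable
    show "AE u in lborel. ((\<lambda>R. s R u) \<longlongrightarrow> (1 - cos (\<theta> * u)) * \<bar>u\<bar> powr (- 1 - \<beta>)) at_top"
    proof (intro AE_I2)
      fix u
      show "((\<lambda>R. s R u) \<longlongrightarrow> (1 - cos (\<theta> * u)) * \<bar>u\<bar> powr (- 1 - \<beta>)) at_top"
      proof (cases "u = 0")
        case False
        have "((\<lambda>R. (1 - cos (\<theta> * u)) * \<bar>u\<bar> powr (- 1 - \<beta>) * (f (\<bar>u\<bar> * R) / f R)) \<longlongrightarrow> (1 - cos (\<theta> * u)) * \<bar>u\<bar> powr (- 1 - \<beta>) * 1) at_top"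
          using sv False by (intro tendsto_intros) (auto simp: slowly_varying_def)
        moreover have "\<forall>\<^sub>F R in at_top. (1 - cos (\<theta> * u)) * \<bar>u\<bar> powr (- 1 - \<beta>) * (f (\<bar>u\<bar> * R) / f R) = s R u"
          using eventually_gt_at_top[of "X / \<bar>u\<bar>"] eventually_gt_at_top[of 0]
        proof eventually_elim
          case (elim R)
          have "\<bar>R * u\<bar> > X" using elim False by (simp add: field_simps abs_mult)
          moreover have "f (\<bar>u\<bar> * R) = f (R * u)" using f_abs[of "R * u"] elim by (simp add: abs_mult mult.commute)
          ultimately show ?case by (simp add: s_def)
        qed
        ultimately show ?thesis by (simp add: tendsto_cong)
      qed (simp add: s_def)
    qed
    show "\<forall>\<^sub>F R in at_top. AE u in lborel. norm (s R u) \<le> w u"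
      using eventually_ge_at_top[of X]
    proof eventually_elim
      case (elim R)
      have R: "R > 0" "f R > 0" using elim X by auto
      show ?case
      proof (intro AE_I2)
        fix u
        have rat: "f (R * u) / f R \<le> 2 powr \<delta> * (\<bar>u\<bar> powr \<delta> + \<bar>u\<bar> powr (- \<delta>))" if "\<bar>R * u\<bar> > X"
        proof (cases "\<bar>u\<bar> \<ge> 1")
          case True
          have "f (R * u) = f (R * \<bar>u\<bar>)" using f_abs[of "R * u"] R by (simp add: abs_mult)
          also have "\<dots> \<le> 2 powr \<delta> * (R * \<bar>u\<bar> / R) powr \<delta> * f R"
            using elim True R by (intro X(3)) auto
          also have "R * \<bar>u\<bar> / R = \<bar>u\<bar>" using R by simp
          finally have "f (R * u) / f R \<le> 2 powr \<delta> * \<bar>u\<bar> powr \<delta>" using R by (simp add: field_simps)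
          also have "\<dots> \<le> 2 powr \<delta> * (\<bar>u\<bar> powr \<delta> + \<bar>u\<bar> powr (- \<delta>))" by (intro mult_left_mono) auto
          finally show ?thesis .
        next
          case False
          have u0: "u \<noteq> 0" using that X(1) by auto
          have "f (R * u) = f (R * \<bar>u\<bar>)" using f_abs[of "R * u"] R by (simp add: abs_mult)
          also have "\<dots> \<le> 2 powr \<delta> * (R / (R * \<bar>u\<bar>)) powr \<delta> * f R"
            using that False R by (intro X(4)) (auto simp: abs_mult mult_le_cancel_left2)
          also have "R / (R * \<bar>u\<bar>) = 1 / \<bar>u\<bar>" using R by simp
          also have "(1 / \<bar>u\<bar>) powr \<delta> = \<bar>u\<bar> powr (- \<delta>)" using u0 by (simp add: powr_minus_divide powr_divide)
          finally have "f (R * u) / f R \<le> 2 powr \<delta> * \<bar>u\<bar> powr (- \<delta>)" using R by (simp add: field_simps)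
          also have "\<dots> \<le> 2 powr \<delta> * (\<bar>u\<bar> powr \<delta> + \<bar>u\<bar> powr (- \<delta>))" by (intro mult_left_mono) auto
          finally show ?thesis .
        qed
        have fnn: "f (R * u) / f R \<ge> 0" if "\<bar>R * u\<bar> > X" using f_nonneg[of "R * u"] that X(1) R by (cases "u = 0") auto
        have "norm (s R u) = (1 - cos (\<theta> * u)) * \<bar>u\<bar> powr (- 1 - \<beta>) * (if \<bar>R * u\<bar> > X then f (R * u) / f R else 0)"
          unfolding s_def using fnn by (auto simp: abs_mult)
        also have "\<dots> \<le> (1 - cos (\<theta> * u)) * \<bar>u\<bar> powr (- 1 - \<beta>) * (2 powr \<delta> * (\<bar>u\<bar> powr \<delta> + \<bar>u\<bar> powr (- \<delta>)))"
          using rat by (intro mult_left_mono) auto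
        also have "\<dots> \<le> ((2 + \<theta>\<^sup>2) * min 1 (u\<^sup>2)) * \<bar>u\<bar> powr (- 1 - \<beta>) * (2 powr \<delta> * (\<bar>u\<bar> powr \<delta> + \<bar>u\<bar> powr (- \<delta>)))"
          by (intro mult_right_mono one_minus_cos_le_min) auto
        also have "\<dots> = (2 + \<theta>\<^sup>2) * 2 powr \<delta> * (min 1 (u\<^sup>2) * (\<bar>u\<bar> powr (- 1 - \<beta>) * \<bar>u\<bar> powr \<delta>) + min 1 (u\<^sup>2) * (\<bar>u\<bar> powr (- 1 - \<beta>) * \<bar>u\<bar> powr (- \<delta>)))"
          by (simp add: algebra_simps)
        also have "\<dots> = w u" unfolding w_def powr_add[symmetric] by (simp add: algebra_simps)
        finally show "norm (s R u) \<le> w u" .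
      qed
    qed
  qed auto
  have small: "(p \<longlongrightarrow> 0) at_top"
  proof -
    define I where "I = max 1 (X\<^sup>2) * (LINT x|lborel. min 1 (x\<^sup>2) * g x)"
    have "((\<lambda>R. \<theta>\<^sup>2 / 2 * I * (R powr (-(2 - \<beta>)) / f R)) \<longlongrightarrow> 0) at_top"
      by (intro tendsto_mult_right_zero slowly_varying_powr_tendsto_0[OF sv]) (use beta in auto)
    moreover have "\<forall>\<^sub>F R in at_top. norm (p R) \<le> \<theta>\<^sup>2 / 2 * I * (R powr (-(2 - \<beta>)) / f R)"
      using eventually_ge_at_top[of X]
    proof eventually_elim
      case (elim R)
      have R: "R > 0" "f R > 0" using elim X by auto
      let ?J = "LINT x|lborel. indicator {-X..X} x * ((1 - cos (\<theta> / R * x)) * g x)"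
      have J0: "?J \<ge> 0" using tail_nonneg by (intro integral_nonneg_AE AE_I2) auto
      have "?J \<le> (LINT x|lborel. (\<theta>\<^sup>2 / R\<^sup>2 / 2 * max 1 (X\<^sup>2)) * (min 1 (x\<^sup>2) * g x))"
      proof (rule integral_mono)
        show "integrable lborel (\<lambda>x. indicator {-X..X} x * ((1 - cos (\<theta> / R * x)) * g x))"
          using integrable_mult_indicator[OF _ int_cos[of "\<theta> / R"], of "{-X..X}"] by simp
        fix x
        have b: "(1 - cos (\<theta> / R * x)) \<le> \<theta>\<^sup>2 / R\<^sup>2 / 2 * x\<^sup>2"
          using one_minus_cos_le[of "\<theta> / R * x"] by (simp add: power_mult_distrib power_divide)
        have x2: "x\<^sup>2 \<le> max 1 (X\<^sup>2) * min 1 (x\<^sup>2)" if "x \<in> {-X..X}"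
        proof -
          have "x\<^sup>2 \<le> X\<^sup>2" using that X(1) by (auto simp: abs_le_square_iff[symmetric])
          then show ?thesis by (auto simp: min_def max_def mult_le_cancel_right1)
        qed
        have nn: "g x \<ge> 0" by (rule tail_nonneg)
        show "indicator {-X..X} x * ((1 - cos (\<theta> / R * x)) * g x) \<le> (\<theta>\<^sup>2 / R\<^sup>2 / 2 * max 1 (X\<^sup>2)) * (min 1 (x\<^sup>2) * g x)"
        proof (cases "x \<in> {-X..X}")
          case True
          have "(1 - cos (\<theta> / R * x)) * g x \<le> (\<theta>\<^sup>2 / R\<^sup>2 / 2 * x\<^sup>2) * g x" using b nn by (rule mult_right_mono)
          also have "\<dots> \<le> (\<theta>\<^sup>2 / R\<^sup>2 / 2 * (max 1 (X\<^sup>2) * min 1 (x\<^sup>2))) * g x"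
            using nn by (intro mult_right_mono mult_left_mono x2[OF True]) auto
          finally show ?thesis using True by (simp add: mult.assoc)
        qed (use nn in \<open>auto intro!: mult_nonneg_nonneg\<close>)
      qed (intro integrable_mult_right tail_int)
      also have "\<dots> = \<theta>\<^sup>2 / R\<^sup>2 / 2 * I" by (simp add: I_def)
      finally have "p R \<le> R powr \<beta> / f R * (\<theta>\<^sup>2 / R\<^sup>2 / 2 * I)"
        unfolding p_def using R by (intro mult_left_mono) auto
      also have "\<dots> = \<theta>\<^sup>2 / 2 * I * (R powr \<beta> / R powr 2 / f R)" using R by (simp add: mult_ac)
      also have "R powr \<beta> / R powr 2 = R powr (-(2 - \<beta>))" unfolding powr_diff[symmetric] by simp
      finally show ?case using J0 R unfolding p_def by simp
    qed
    ultimately show ?thesis by (rule Lim_null_comparison[rotated])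
  qed
  have split: "\<forall>\<^sub>F R in at_top. R powr \<beta> / f R * \<Psi> (\<theta> / R) = (p R + (LINT u|lborel. s R u)) / c"
    using eventually_ge_at_top[of X]
  proof eventually_elim
    case (elim R)
    have R: "R > 0" "f R > 0" using elim X by auto
    let ?k = "\<lambda>x. (1 - cos (\<theta> / R * x)) * g x"
    let ?B = "{x. \<bar>x\<bar> > X}"
    have iB: "integrable lborel (\<lambda>x. indicator ?B x * ?k x)"
      using integrable_mult_indicator[OF _ int_cos[of "\<theta> / R"], of ?B] by simp
    have iA: "integrable lborel (\<lambda>x. indicator {-X..X} x * ?k x)"
      using integrable_mult_indicator[OF _ int_cos[of "\<theta> / R"], of "{-X..X}"] by simp
    have "(LINT x|lborel. ?k x) = (LINT x|lborel. indicator {-X..X} x * ?k x + indicator ?B x * ?k x)"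
      by (intro Bochner_Integration.integral_cong) (auto simp: indicator_def)
    also have "\<dots> = (LINT x|lborel. indicator {-X..X} x * ?k x) + (LINT x|lborel. indicator ?B x * ?k x)"
      using iA iB by (rule Bochner_Integration.integral_add)
    finally have 1: "R powr \<beta> / f R * (LINT x|lborel. ?k x) = p R + R powr \<beta> / f R * (LINT x|lborel. indicator ?B x * ?k x)"
      by (simp add: p_def distrib_left)
    have "(LINT x|lborel. indicator ?B x * ?k x) = R * (LINT u|lborel. indicator ?B (R * u) * ?k (R * u))"
      using lborel_integral_real_affine[of R "\<lambda>x. indicator ?B x * ?k x" 0] R by simp
    then have "R powr \<beta> / f R * (LINT x|lborel. indicator ?B x * ?k x) = 
        (LINT u|lborel. R powr \<beta> / f R * R * (indicator ?B (R * u) * ?k (R * u)))"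
      by simp
    also have "\<dots> = (LINT u|lborel. s R u)"
    proof (intro Bochner_Integration.integral_cong refl)
      fix u
      have "R powr \<beta> * R powr 1 * R powr (- 1 - \<beta>) = 1" unfolding powr_add[symmetric] using R by simp
      then have e: "R powr \<beta> * R * R powr (- 1 - \<beta>) = 1" using R by simp
      have "R powr \<beta> / f R * R * (indicator ?B (R * u) * ?k (R * u)) =
        (R powr \<beta> * R * R powr (- 1 - \<beta>)) * (indicator ?B (R * u) * ((1 - cos (\<theta> * u)) * (f (R * u) / f R * \<bar>u\<bar> powr (- 1 - \<beta>))))"
        using R by (simp add: tail_density_def abs_mult powr_mult)
      also have "\<dots> = s R u"
        unfolding e by (simp add: s_def indicator_def)
      finally show "R powr \<beta> / f R * R * (indicator ?B (R * u) * ?k (R * u)) = s R u" .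
    qed
    finally show ?case using 1 by (simp add: tail_exponent_def c_def add_divide_distrib)
  qed
  have "((\<lambda>R. (p R + (LINT u|lborel. s R u)) / c) \<longlongrightarrow> (0 + c * \<bar>\<theta>\<bar> powr \<beta>) / c) at_top"
    using c by (intro tendsto_intros small large[unfolded stable_exponent_integral[OF beta] c_def[symmetric]]) auto
  then show ?thesis using c split by (simp add: tendsto_cong)
qed

text \<open>It is enough to integrate over \<open>{1/z..2/z}\<close>. There the angle lies in
  \<open>{1..2}\<close>, so \<open>1 - cos\<close> is at least \<open>1 - cos 1\<close>, and
  Potter's bound with exponent 1 gives \<open>f (1 / z) \<le> 4 * f x\<close>: a factor 2 from its
  constant and a factor 2 from the ratio. The frequency must be small, since slow variation says
  nothing about \<open>f\<close> at bounded arguments.\<close>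

lemma tail_exponent_lower:
  obtains C X where "C > 0" "X > 0" "\<And>z. 0 < z \<Longrightarrow> z \<le> 1 / X \<Longrightarrow> C * z powr \<beta> * f (1 / z) \<le> \<Psi> z"
proof -
  obtain X where X: "X > 0" "\<And>x. x \<ge> X \<Longrightarrow> f x > 0" 
    "\<And>x y. x \<ge> X \<Longrightarrow> y \<ge> x \<Longrightarrow> f x \<le> 2 powr 1 * (y / x) powr 1 * f y"
    using slowly_varying_Potter[OF sv, of 1] by (metis zero_less_one)
  define c where "c = c_stable \<beta>"
  have c: "c > 0" unfolding c_def by (rule c_stable_pos[OF beta])
  define C where "C = (1 - cos 1) / 4 * 2 powr (- 1 - \<beta>) / c"
  have cos1: "cos (1::real) < 1" 
    using cos_monotone_0_pi[of 0 1] pi_gt3 by simp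
  have "C > 0" using cos1 c by (simp add: C_def)
  moreover have "C * z powr \<beta> * f (1 / z) \<le> \<Psi> z" if z: "0 < z" "z \<le> 1 / X" for z
  proof -
    define K where "K = (1 - cos 1) / 4 * f (1 / z) * (2 / z) powr (- 1 - \<beta>)"
    have zX: "1 / z \<ge> X" using z X(1) by (simp add: field_simps)
    then have fz: "f (1 / z) > 0" by (rule X(2))
    have "(LINT x|lborel. indicator {1/z..2/z} x * K) \<le> (LINT x|lborel. (1 - cos (z * x)) * g x)"
    proof (rule integral_mono)
      show "integrable lborel (\<lambda>x. indicator {1/z..2/z} x * K)"
        by (intro integrable_mult_left integrable_real_indicator emeasure_compact_finite compact_Icc) auto
      fix x
      show "indicator {1/z..2/z} x * K \<le> (1 - cos (z * x)) * g x"
      proof (cases "x \<in> {1/z..2/z}")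
        case True
        have x0: "x > 0" using True z by (auto intro: less_le_trans[of _ "1/z"])
        have zx: "z * x \<ge> 1" "z * x \<le> 2" using True z by (auto simp: field_simps)
        then have cx: "cos (z * x) \<le> cos 1"
          using pi_gt3 by (intro cos_monotone_0_pi_le) auto
        have "f (1 / z) \<le> 2 powr 1 * (x / (1/z)) powr 1 * f x"
          using True zX by (intro X(3)) auto
        also have "\<dots> = 2 * (z * x) * f x" using x0 z by (simp add: mult.commute)
        also have "\<dots> \<le> 2 * 2 * f x" using zx f_nonneg[of x] x0 by (intro mult_right_mono mult_left_mono) auto
        finally have fx: "f (1/z) / 4 \<le> f x" by simp
        have px: "(2 / z) powr (- 1 - \<beta>) \<le> \<bar>x\<bar> powr (- 1 - \<beta>)"
          using True x0 beta by (intro powr_mono2') auto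
        have "K = (1 - cos 1) * ((f (1/z) / 4) * (2 / z) powr (- 1 - \<beta>))" by (simp add: K_def)
        also have "\<dots> \<le> (1 - cos (z * x)) * (f x * \<bar>x\<bar> powr (- 1 - \<beta>))"
          using cx fx px fz cos1 by (intro mult_mono) auto
        finally show ?thesis using True by (simp add: tail_density_def)
      qed (use tail_nonneg in auto)
    qed (rule int_cos)
    moreover have "(LINT x|lborel. indicator {1/z..2/z} x * K) = K / z"
      using z by (simp add: divide_right_mono field_simps)
    moreover have "K / z = C * c * z powr \<beta> * f (1 / z)"
    proof -
      have "(2 / z) powr (- 1 - \<beta>) / z = 2 powr (- 1 - \<beta>) * z powr \<beta>"
      proof -
        have "(2 / z) powr (- 1 - \<beta>) = 2 powr (- 1 - \<beta>) / z powr (- 1 - \<beta>)" using z by (simp add: powr_divide)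
        also have "z powr (- 1 - \<beta>) = 1 / (z * z powr \<beta>)" 
          using z by (simp add: powr_minus_divide powr_add powr_diff field_simps)
        finally show ?thesis using z by simp
      qed
      then have a: "K / z = (1 - cos 1) / 4 * f (1 / z) * (2 powr (- 1 - \<beta>) * z powr \<beta>)"
        unfolding K_def by (metis times_divide_eq_right)
      have b: "C * c = (1 - cos 1) / 4 * 2 powr (- 1 - \<beta>)" using c by (simp add: C_def)
      show ?thesis unfolding a b by simp
    qed
    ultimately show ?thesis using c unfolding tail_exponent_def c_def[symmetric] by (simp add: field_simps)
  qed
  ultimately show ?thesis using that X(1) by blast
qed

lemma Psi_double: "\<Psi> (2 * z) \<le> 4 * \<Psi> z"
proof -
  have "(LINT x|lborel. (1 - cos (2 * z * x)) * g x) \<le> (LINT x|lborel. 4 * ((1 - cos (z * x)) * g x))"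
  proof (rule integral_mono[OF int_cos integrable_mult_right[OF int_cos]])
    fix x
    have "1 - cos (2 * (z * x)) = 2 * (1 + cos (z * x)) * (1 - cos (z * x))"
      unfolding cos_double_cos by (simp add: algebra_simps power2_eq_square)
    also have "\<dots> \<le> 4 * (1 - cos (z * x))" 
      using cos_le_one[of "z * x"] by (intro mult_right_mono) auto
    finally have "1 - cos (2 * (z * x)) \<le> 4 * (1 - cos (z * x))" .
    from mult_right_mono[OF this tail_nonneg[of x]]
    show "(1 - cos (2 * z * x)) * g x \<le> 4 * ((1 - cos (z * x)) * g x)" by (simp only: mult.assoc)
  qed
  then show ?thesis unfolding tail_exponent_def
    using c_stable_pos[OF beta] by (simp add: divide_right_mono)
qed

text \<open>The doubling bound carries integrability from \<open>{1..}\<close> down to any \<open>{a..}\<close>.\<close>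

lemma inverse_Psi_finite:
  assumes "a > 0"
  shows "(\<integral>\<^sup>+ z\<in>{a..}. inverse (ennreal (\<Psi> z)) \<partial>lborel) < \<infinity>"
proof -
  have *: "(\<integral>\<^sup>+ z\<in>{1/2^k..}. inverse (ennreal (\<Psi> z)) \<partial>lborel) < \<infinity>" for k :: nat
  proof (induction k)
    case 0 then show ?case using inverse_int by simp
  next
    case (Suc k)
    have "(\<integral>\<^sup>+ z\<in>{1/2^Suc k..}. inverse (ennreal (\<Psi> z)) \<partial>lborel) \<le>
      (\<integral>\<^sup>+ z. 4 * (inverse (ennreal (\<Psi> (0 + 2 * z))) * indicator {1/2^k..} (0 + 2 * z)) \<partial>lborel)"
    proof (rule nn_integral_mono)
      fix z :: real
      have "inverse (ennreal (\<Psi> z)) \<le> 4 * inverse (ennreal (\<Psi> (2 * z)))"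
      proof (cases "\<Psi> (2 * z) = 0")
        case False
        then have p: "\<Psi> (2 * z) > 0" using Psi_nonneg[of "2*z"] by simp
        then have "\<Psi> z > 0" using Psi_double[of z] by linarith
        then show ?thesis using p Psi_double[of z]
          by (simp add: inverse_ennreal ennreal_numeral[symmetric] ennreal_mult[symmetric] field_simps del: ennreal_numeral)
      qed (simp add: ennreal_mult_top)
      then show "inverse (ennreal (\<Psi> z)) * indicator {1/2^Suc k..} z \<le> 4 * (inverse (ennreal (\<Psi> (0 + 2 * z))) * indicator {1/2^k..} (0 + 2 * z))"
        by (auto simp: indicator_def field_simps)
    qed
    also have "\<dots> = 2 * (\<bar>2\<bar> * (\<integral>\<^sup>+ z. (inverse (ennreal (\<Psi> (0 + 2 * z))) * indicator {1/2^k..} (0 + 2 * z)) \<partial>lborel))"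
      by (subst nn_integral_cmult) (auto simp: mult.assoc[symmetric])
    also have "(\<bar>2\<bar> * (\<integral>\<^sup>+ z. (inverse (ennreal (\<Psi> (0 + 2 * z))) * indicator {1/2^k..} (0 + 2 * z)) \<partial>lborel)) = 
       (\<integral>\<^sup>+ z\<in>{1/2^k..}. inverse (ennreal (\<Psi> z)) \<partial>lborel)"
      using nn_integral_real_affine[of "\<lambda>z. inverse (ennreal (\<Psi> z)) * indicator {1/2^k..} z" 2 0] by simp
    also have "2 * \<dots> < \<infinity>" using Suc by (simp add: ennreal_mult_less_top)
    finally show ?case .
  qed
  obtain k :: nat where "1 / 2 ^ k < a"
    using real_arch_pow_inv[OF assms, of "1/2"] by (auto simp: power_one_over)
  then have "(\<integral>\<^sup>+ z\<in>{a..}. inverse (ennreal (\<Psi> z)) \<partial>lborel) \<le> (\<integral>\<^sup>+ z\<in>{1/2^k..}. inverse (ennreal (\<Psi> z)) \<partial>lborel)"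
    by (intro nn_integral_mono) (auto simp: indicator_def)
  then show ?thesis using * by (rule le_less_trans)
qed


text \<open>The frequencies are split at \<open>R / X\<close>. Below it,
  \<open>tail_exponent_lower\<close> and Potter's bound give the lower bound
  \<open>C' * \<theta> powr e\<close> with e > 1, whose inverse has a small tail beyond
  \<open>K\<close> for all R at once. Above it, undoing the scaling leaves
  \<open>R powr (- (\<beta> - 1)) * f R\<close> times the finite integral of the inverse exponent
  over \<open>{1/X..}\<close>, and this tends to 0.\<close>

lemma inverse_tail_exponent_uniform:
  assumes "\<epsilon> > 0"
  obtains K where "K > 0" 
    "\<forall>\<^sub>F R in at_top. (\<integral>\<^sup>+ \<theta>. inverse (ennreal (R powr \<beta> / f R * \<Psi> (\<theta> / R))) * indicator {\<theta>. \<bar>\<theta>\<bar> > K} \<theta> \<partial>lborel) \<le> ennreal \<epsilon>"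
proof -
  \<comment> \<open>The loss in Potter's bound is half of \<open>\<beta> - 1\<close>, so that the
    remaining power \<open>e\<close> still exceeds 1 and its inverse is integrable at
    infinity.\<close>
  define \<delta> where "\<delta> = (\<beta> - 1) / 2"
  have d: "\<delta> > 0" using beta by (simp add: \<delta>_def)
  define e where "e = \<beta> - \<delta>"
  have e: "e > 1" using beta by (simp add: e_def \<delta>_def field_simps)
  obtain X1 where X1: "X1 > 0" "\<And>x. x \<ge> X1 \<Longrightarrow> f x > 0" 
    "\<And>x y. x \<ge> X1 \<Longrightarrow> y \<ge> x \<Longrightarrow> f y \<le> 2 powr \<delta> * (y / x) powr \<delta> * f x"
    using slowly_varying_Potter[OF sv d(1)] by metis
  obtain C X2 where X2: "C > 0" "X2 > 0" "\<And>z. 0 < z \<Longrightarrow> z \<le> 1 / X2 \<Longrightarrow> C * z powr \<beta> * f (1 / z) \<le> \<Psi> z"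
    using tail_exponent_lower by metis
  define X where "X = max X1 X2"
  have X: "X > 0" "X \<ge> X1" "X \<ge> X2" using X1(1) by (auto simp: X_def)
  have XX: "1 / X \<le> 1 / X2" using X X2 by (simp add: frac_le)
  define C' where "C' = C * 2 powr (- \<delta>)"
  have C': "C' > 0" using X2(1) by (simp add: C'_def)
  define \<psi> where "\<psi> R \<theta> = R powr \<beta> / f R * \<Psi> (\<theta> / R)" for R \<theta>
  have psim [measurable]: "\<psi> R \<in> borel_measurable borel" for R unfolding \<psi>_def by measurable
  have low: "C' * \<theta> powr e \<le> \<psi> R \<theta>" if R: "R \<ge> X" and t: "1 \<le> \<theta>" "\<theta> \<le> R / X" for R \<theta>
  proof -
    have R0: "R > 0" using R X by simp
    have fR: "f R > 0" using X1(2)[of R] R X by simp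
    have "X * \<theta> \<le> R" using t X by (simp add: pos_le_divide_eq mult.commute)
    then have "X \<le> R / \<theta>" using t by (simp add: pos_le_divide_eq)
    then have xt: "R / \<theta> \<ge> X1" using X by simp
    have "f R \<le> 2 powr \<delta> * (R / (R / \<theta>)) powr \<delta> * f (R / \<theta>)"
      using t R0 by (intro X1(3) xt) (auto simp: field_simps)
    also have "R / (R / \<theta>) = \<theta>" using R0 by simp
    finally have "1 \<le> 2 powr \<delta> * \<theta> powr \<delta> * (f (R / \<theta>) / f R)" using fR by (simp add: field_simps)
    then have "(2 powr (- \<delta>) * \<theta> powr (- \<delta>)) * 1 \<le> (2 powr (- \<delta>) * \<theta> powr (- \<delta>)) * (2 powr \<delta> * \<theta> powr \<delta> * (f (R / \<theta>) / f R))"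
      by (intro mult_left_mono) auto
    also have "\<dots> = f (R / \<theta>) / f R" using t by (simp add: powr_minus field_simps)
    finally have rat: "2 powr (- \<delta>) * \<theta> powr (- \<delta>) \<le> f (R / \<theta>) / f R" by simp
    have "C' * \<theta> powr e = C * \<theta> powr \<beta> * (2 powr (- \<delta>) * \<theta> powr (- \<delta>))"
      unfolding C'_def e_def by (simp add: powr_diff powr_minus field_simps)
    also have "\<dots> \<le> C * \<theta> powr \<beta> * (f (R / \<theta>) / f R)"
      using X2(1) by (intro mult_left_mono rat) auto
    also have "\<dots> = R powr \<beta> / f R * (C * (\<theta> / R) powr \<beta> * f (1 / (\<theta> / R)))"
      using R0 t by (simp add: powr_divide)
    also have "\<dots> \<le> R powr \<beta> / f R * \<Psi> (\<theta> / R)"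
    proof (intro mult_left_mono X2(3))
      show "\<theta> / R \<le> 1 / X2"
      proof -
        have "\<theta> / R \<le> 1 / X" using t R0 X by (simp add: field_simps)
        then show ?thesis using XX by linarith
      qed
    qed (use R0 t fR in auto)
    finally show ?thesis unfolding \<psi>_def .
  qed
  define I where "I = enn2real (\<integral>\<^sup>+ z\<in>{1/X..}. inverse (ennreal (\<Psi> z)) \<partial>lborel)"
  have I: "(\<integral>\<^sup>+ z\<in>{1/X..}. inverse (ennreal (\<Psi> z)) \<partial>lborel) = ennreal I"
    unfolding I_def using inverse_Psi_finite[of "1/X"] X(1) by simp
  have I0: "I \<ge> 0" by (simp add: I_def)
  have "((\<lambda>K. K powr (1 - e) / ((e - 1) * C')) \<longlongrightarrow> 0) at_top"
    using e by (intro tendsto_divide_zero tendsto_neg_powr filterlim_ident) auto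
  \<comment> \<open>Budget: by symmetry each half-line receives half of \<epsilon>, shared equally
    by the frequencies below and above \<open>R / X\<close>. \<open>K \<ge> 1\<close> puts every
    frequency beyond \<open>K\<close> into the range of \<open>low\<close>.\<close>
  then have "\<forall>\<^sub>F K in at_top. K powr (1 - e) / ((e - 1) * C') < \<epsilon> / 4 \<and> K \<ge> 1"
    using assms by (intro eventually_conj order_tendstoD(2)[where y=0] eventually_ge_at_top) auto
  then obtain K where K: "K powr (1 - e) / ((e - 1) * C') < \<epsilon> / 4" "K \<ge> 1"
    by (auto simp: eventually_at_top_linorder)
  have powint: "(\<integral>\<^sup>+\<theta>. ennreal (\<theta> powr (- e) / C') * indicator {K..} \<theta> \<partial>lborel) = ennreal (K powr (1 - e) / ((e - 1) * C'))"
  proof -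
    have "(\<integral>\<^sup>+\<theta>. ennreal (\<theta> powr (- e) / C') * indicator {K..} \<theta> \<partial>lborel) = ennreal (0 - (- (K powr (1 - e) / ((e - 1) * C'))))"
    proof (rule nn_integral_FTC_atLeast)
      fix x assume x: "x \<ge> K"
      have "((\<lambda>x. - (x powr (1 - e) / ((e - 1) * C'))) has_real_derivative - ((1 - e) * x powr (1 - e - 1) / ((e - 1) * C'))) (at x)"
        using x K(2) DERIV_minus[OF DERIV_cdivide[OF has_real_derivative_powr[of x "1 - e"]]] by simp
      also have "- ((1 - e) * x powr (1 - e - 1) / ((e - 1) * C')) = x powr (- e) / C'"
        using e C' by (simp add: field_simps)
      finally show "((\<lambda>x. - (x powr (1 - e) / ((e - 1) * C'))) has_real_derivative x powr (- e) / C') (at x)" .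
      show "0 \<le> x powr (- e) / C'" using C' by simp
    next
      show "((\<lambda>x. - (x powr (1 - e) / ((e - 1) * C'))) \<longlongrightarrow> 0) at_top"
        using e tendsto_minus[OF tendsto_divide_zero[OF tendsto_neg_powr[OF _ filterlim_ident, of "1 - e"]]] by simp
    qed auto
    then show ?thesis by simp
  qed
  have "((\<lambda>R. I * (R powr (- (\<beta> - 1)) * f R)) \<longlongrightarrow> 0) at_top"
    using beta by (intro tendsto_mult_right_zero slowly_varying_powr_tendsto_0[OF sv]) auto
  then have ev: "\<forall>\<^sub>F R in at_top. I * (R powr (- (\<beta> - 1)) * f R) < \<epsilon> / 4"
    using assms by (intro order_tendstoD(2)[where y=0]) auto
  have "\<forall>\<^sub>F R in at_top. (\<integral>\<^sup>+ \<theta>. inverse (ennreal (\<psi> R \<theta>)) * indicator {\<theta>. \<bar>\<theta>\<bar> > K} \<theta> \<partial>lborel) \<le> ennreal \<epsilon>"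
    using ev eventually_ge_at_top[of X]
  proof eventually_elim
    case (elim R)
    have R: "R > 0" "f R > 0" using elim X X1(2)[of R] by auto
    let ?h = "\<lambda>\<theta>. inverse (ennreal (\<psi> R \<theta>)) * indicator {K<..} \<theta>"
    have far: "(\<integral>\<^sup>+ \<theta>. inverse (ennreal (\<psi> R \<theta>)) * indicator {R / X..} \<theta> \<partial>lborel) \<le> ennreal (\<epsilon> / 4)"
    proof -
      have "(\<integral>\<^sup>+ \<theta>. inverse (ennreal (\<psi> R \<theta>)) * indicator {R / X..} \<theta> \<partial>lborel) = 
        ennreal \<bar>R\<bar> * (\<integral>\<^sup>+ z. inverse (ennreal (\<psi> R (0 + R * z))) * indicator {R / X..} (0 + R * z) \<partial>lborel)"
        using R by (intro nn_integral_real_affine) auto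
      also have "(\<integral>\<^sup>+ z. inverse (ennreal (\<psi> R (0 + R * z))) * indicator {R / X..} (0 + R * z) \<partial>lborel) = 
        (\<integral>\<^sup>+ z. ennreal (f R / R powr \<beta>) * (inverse (ennreal (\<Psi> z)) * indicator {1/X..} z) \<partial>lborel)"
      proof (intro nn_integral_cong)
        fix z
        have "inverse (ennreal (\<psi> R (0 + R * z))) = inverse (ennreal (R powr \<beta> / f R) * ennreal (\<Psi> z))"
          using R Psi_nonneg ennreal_mult[of "R powr \<beta> / f R" "\<Psi> z"] by (simp add: \<psi>_def)
        also have "\<dots> = inverse (ennreal (R powr \<beta> / f R)) * inverse (ennreal (\<Psi> z))"
          using R by (intro ennreal_inverse_mult) auto
        also have "inverse (ennreal (R powr \<beta> / f R)) = ennreal (f R / R powr \<beta>)"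
          using R by (simp add: inverse_ennreal)
        finally show "inverse (ennreal (\<psi> R (0 + R * z))) * indicator {R / X..} (0 + R * z) = 
           ennreal (f R / R powr \<beta>) * (inverse (ennreal (\<Psi> z)) * indicator {1/X..} z)"
          using R X(1) by (simp add: indicator_def field_simps)
      qed
      also have "\<dots> = ennreal (f R / R powr \<beta>) * ennreal I"
        by (subst nn_integral_cmult) (auto simp: I)
      also have "ennreal \<bar>R\<bar> * \<dots> = ennreal (R * (f R / R powr \<beta> * I))"
        using R I0 ennreal_mult[of R "f R / R powr \<beta> * I"] ennreal_mult[of "f R / R powr \<beta>" I] by simp
      also have "R * (f R / R powr \<beta> * I) = I * (R powr (- (\<beta> - 1)) * f R)"
        using R by (simp add: powr_diff powr_minus field_simps)
      also have "ennreal \<dots> \<le> ennreal (\<epsilon> / 4)" using elim by (intro ennreal_leI) simp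
      finally show ?thesis .
    qed
    have "(\<integral>\<^sup>+ \<theta>. ?h \<theta> \<partial>lborel) \<le> (\<integral>\<^sup>+ \<theta>. ennreal (\<theta> powr (- e) / C') * indicator {K..} \<theta> + inverse (ennreal (\<psi> R \<theta>)) * indicator {R / X..} \<theta> \<partial>lborel)"
    proof (rule nn_integral_mono)
      fix \<theta> :: real
      show "?h \<theta> \<le> ennreal (\<theta> powr (- e) / C') * indicator {K..} \<theta> + inverse (ennreal (\<psi> R \<theta>)) * indicator {R / X..} \<theta>"
      proof (cases "K < \<theta> \<and> \<theta> < R / X")
        case True
        then have l: "C' * \<theta> powr e \<le> \<psi> R \<theta>" using K elim by (intro low) auto
        have p: "C' * \<theta> powr e > 0" using C' K(2) True by auto
        have "inverse (ennreal (\<psi> R \<theta>)) = ennreal (1 / \<psi> R \<theta>)" using l p by (simp add: inverse_ennreal inverse_eq_divide)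
        also have "\<dots> \<le> ennreal (1 / (C' * \<theta> powr e))" using l p by (intro ennreal_leI divide_left_mono) auto
        also have "1 / (C' * \<theta> powr e) = \<theta> powr (- e) / C'" by (simp add: powr_minus field_simps)
        finally show ?thesis using True by (simp add: indicator_def)
      qed (auto simp: indicator_def)
    qed
    also have "\<dots> = (\<integral>\<^sup>+ \<theta>. ennreal (\<theta> powr (- e) / C') * indicator {K..} \<theta> \<partial>lborel) + (\<integral>\<^sup>+ \<theta>. inverse (ennreal (\<psi> R \<theta>)) * indicator {R / X..} \<theta> \<partial>lborel)"
      by (intro nn_integral_add) auto
    also have "\<dots> \<le> ennreal (\<epsilon> / 4) + ennreal (\<epsilon> / 4)"
      unfolding powint using K(1) by (intro add_mono far ennreal_leI) auto
    also have "\<dots> = ennreal (\<epsilon> / 2)" using assms by (simp add: ennreal_plus[symmetric] del: ennreal_plus)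
    finally have half: "(\<integral>\<^sup>+ \<theta>. ?h \<theta> \<partial>lborel) \<le> ennreal (\<epsilon> / 2)" .
    have half': "(\<integral>\<^sup>+ \<theta>. ?h (0 + (-1) * \<theta>) \<partial>lborel) = (\<integral>\<^sup>+ \<theta>. ?h \<theta> \<partial>lborel)"
      using nn_integral_real_affine[of ?h "-1" 0] by simp
    have "(\<integral>\<^sup>+ \<theta>. inverse (ennreal (\<psi> R \<theta>)) * indicator {\<theta>. \<bar>\<theta>\<bar> > K} \<theta> \<partial>lborel) = (\<integral>\<^sup>+ \<theta>. ?h \<theta> + ?h (0 + (-1) * \<theta>) \<partial>lborel)"
      using K(2) by (intro nn_integral_cong) (auto simp: indicator_def \<psi>_def Psi_even)
    also have "\<dots> = (\<integral>\<^sup>+ \<theta>. ?h \<theta> \<partial>lborel) + (\<integral>\<^sup>+ \<theta>. ?h (0 + (-1) * \<theta>) \<partial>lborel)"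
      by (intro nn_integral_add) auto
    also have "\<dots> \<le> ennreal (\<epsilon> / 2) + ennreal (\<epsilon> / 2)" unfolding half' by (intro add_mono half)
    also have "\<dots> = ennreal \<epsilon>" using assms by (simp add: ennreal_plus[symmetric] del: ennreal_plus)
    finally show ?case .
  qed
  then show ?thesis using that[of K] K(2) unfolding \<psi>_def by auto
qed

end

section \<open>Densities from integrable characteristic functions\<close>

definition inverse_fourier :: "(real \<Rightarrow> real) \<Rightarrow> real \<Rightarrow> real" where
  "inverse_fourier c x = (LINT t|lborel. cos (t * x) * c t) / (2 * pi)"

lemma abs_sin_diff_le: "\<bar>sin x - sin y\<bar> \<le> \<bar>x - y :: real\<bar>"
proof -
  have "\<bar>sin x - sin y\<bar> = 2 * \<bar>sin ((x - y) / 2)\<bar> * \<bar>cos ((x + y) / 2)\<bar>"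
    by (simp add: sin_diff_sin abs_mult)
  also have "\<dots> \<le> 2 * \<bar>(x - y) / 2\<bar> * 1"
    by (intro mult_mono mult_left_mono abs_sin_x_le_abs_x) auto
  finally show ?thesis by simp
qed

lemma integrable_sin_kernel:
  fixes c :: "real \<Rightarrow> real"
  assumes c: "integrable lborel c"
  shows "integrable lborel (\<lambda>t. sin (t * x) / t * c t)"
proof (rule Bochner_Integration.integrable_bound[OF integrable_mult_right[OF integrable_norm[OF c], of "\<bar>x\<bar>"]])
  show "AE t in lborel. norm (sin (t * x) / t * c t) \<le> norm (\<bar>x\<bar> * norm (c t))"
  proof (intro AE_I2)
    fix t
    have "\<bar>sin (t * x) / t\<bar> \<le> \<bar>x\<bar>"
      using abs_sin_x_le_abs_x[of "t * x"] by (cases "t = 0") (auto simp: abs_mult field_simps)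
    then show "norm (sin (t * x) / t * c t) \<le> norm (\<bar>x\<bar> * norm (c t))"
      unfolding real_norm_def abs_mult[of _ "c t"] abs_mult[of "\<bar>x\<bar>"] by (intro mult_mono) auto
  qed
qed (use c in auto)

text \<open>Differentiation under the integral: the difference quotients of
  \<open>sin (t * x) / t\<close> are bounded by 1, so \<open>c\<close> itself dominates. At t = 0
  the quotient has the value 0 instead of its limit x, which concerns a null set only.\<close>

lemma DERIV_integral_sin:
  assumes c: "integrable lborel c"
  shows "((\<lambda>x. LINT t|lborel. sin (t * x) / t * c t) has_real_derivative (LINT t|lborel. cos (t * x) * c t)) (at x)"
proof -
  have cm [measurable]: "c \<in> borel_measurable borel" using c by auto
  note i = integrable_sin_kernel[OF c]
  show ?thesis unfolding DERIV_def tendsto_at_iff_sequentially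
  proof (intro allI impI)
    fix h :: "nat \<Rightarrow> real" assume h: "\<forall>i. h i \<in> UNIV - {0}" "h \<longlonglongrightarrow> 0"
    have "((\<lambda>n. LINT t|lborel. (sin (t * (x + h n)) / t - sin (t * x) / t) / h n * c t) \<longlonglongrightarrow> (LINT t|lborel. cos (t * x) * c t))"
    proof (rule integral_dominated_convergence[where w="\<lambda>t. norm (c t)"])
      show "integrable lborel (\<lambda>t. norm (c t))" using c by simp
      show "AE t in lborel. (\<lambda>n. (sin (t * (x + h n)) / t - sin (t * x) / t) / h n * c t) \<longlonglongrightarrow> cos (t * x) * c t"
        using AE_lborel_singleton[of 0]
      proof eventually_elim
        case (elim t)
        have "((\<lambda>y. sin (t * y) / t) has_real_derivative cos (t * x)) (at x)"
          using elim by (auto intro!: derivative_eq_intros)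
        then have "((\<lambda>h. (sin (t * (x + h)) / t - sin (t * x) / t) / h) \<longlongrightarrow> cos (t * x)) (at 0)"
          by (simp add: DERIV_def)
        then have "(\<lambda>n. (sin (t * (x + h n)) / t - sin (t * x) / t) / h n) \<longlonglongrightarrow> cos (t * x)"
          using h unfolding tendsto_at_iff_sequentially comp_def by blast
        then show ?case by (intro tendsto_intros)
      qed
      show "AE t in lborel. norm ((sin (t * (x + h n)) / t - sin (t * x) / t) / h n * c t) \<le> norm (c t)" for n
      proof (intro AE_I2)
        fix t
        have hn: "h n \<noteq> 0" using h by auto
        have "\<bar>(sin (t * (x + h n)) / t - sin (t * x) / t) / h n\<bar> \<le> 1"
        proof (cases "t = 0")
          case False
          have "\<bar>sin (t * (x + h n)) - sin (t * x)\<bar> \<le> \<bar>t\<bar> * \<bar>h n\<bar>"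
            using abs_sin_diff_le[of "t * (x + h n)" "t * x"] by (simp add: algebra_simps abs_mult)
          then show ?thesis using False hn by (simp add: diff_divide_distrib[symmetric] abs_mult divide_le_eq)
        qed simp
        then show "norm ((sin (t * (x + h n)) / t - sin (t * x) / t) / h n * c t) \<le> norm (c t)"
          unfolding real_norm_def abs_mult[of _ "c t"] by (intro mult_left_le_one_le) auto
      qed
    qed auto
    moreover have "(LINT t|lborel. (sin (t * (x + h n)) / t - sin (t * x) / t) / h n * c t) = 
      ((LINT t|lborel. sin (t * (x + h n)) / t * c t) - (LINT t|lborel. sin (t * x) / t * c t)) / h n" for n
    proof -
      have "(LINT t|lborel. (sin (t * (x + h n)) / t - sin (t * x) / t) / h n * c t) = 
        (LINT t|lborel. (sin (t * (x + h n)) / t * c t - sin (t * x) / t * c t) / h n)"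
        by (intro Bochner_Integration.integral_cong) (auto simp: field_simps)
      also have "\<dots> = ((LINT t|lborel. sin (t * (x + h n)) / t * c t) - (LINT t|lborel. sin (t * x) / t * c t)) / h n"
        by (simp only: integral_divide_zero Bochner_Integration.integral_diff[OF i i])
      finally show ?thesis .
    qed
    ultimately show "((\<lambda>h. ((LINT t|lborel. sin (t * (x + h)) / t * c t) - (LINT t|lborel. sin (t * x) / t * c t)) / h) \<circ> h)
      \<longlonglongrightarrow> (LINT t|lborel. cos (t * x) * c t)" by (simp only: comp_def)
  qed
qed

text \<open>Levy's inversion formula. As the kernel is bounded by b - a and \<open>c\<close> is
  integrable, the truncated integrals converge to the full one; since \<open>c\<close> is real,
  taking real parts leaves the sines.\<close>

lemma (in real_distribution) measure_Ioc_integrable_char: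
  assumes ch: "\<And>t. char M t = complex_of_real (c t)" and c: "integrable lborel c"
    and ab: "a \<le> b" and at: "measure M {a} = 0" "measure M {b} = 0"
  shows "measure M {a<..b} = ((LINT t|lborel. sin (t * b) / t * c t) - (LINT t|lborel. sin (t * a) / t * c t)) / (2 * pi)"
proof -
  have cm [measurable]: "c \<in> borel_measurable borel" using c by auto
  define F where "F t = (iexp (-(t * a)) - iexp (-(t * b))) / (\<i> * t) * complex_of_real (c t)" for t :: real
  have Fm [measurable]: "F \<in> borel_measurable borel" unfolding F_def by measurable
  have Fb: "cmod (F t) \<le> norm ((b - a) * norm (c t))" for t
  proof (cases "t = 0")
    case False
    have "cmod ((iexp (t * (-a)) - iexp (t * (-b))) / (\<i> * t)) \<le> (-a) - (-b)"
      by (rule Levy_Inversion_aux2) (use ab False in auto)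
    then have "cmod ((iexp (-(t * a)) - iexp (-(t * b))) / (\<i> * t)) \<le> b - a" by simp
    then show ?thesis unfolding F_def norm_mult using ab by (intro mult_mono) auto
  qed (simp add: F_def)
  have iw: "integrable lborel (\<lambda>t. (b - a) * norm (c t))" using c by simp
  have iF: "integrable lborel F"
    by (rule Bochner_Integration.integrable_bound[OF iw]) (use Fb in auto)
  have "(\<lambda>n::nat. LINT t|lborel. indicator {-real n<..<real n} t *\<^sub>R F t) \<longlonglongrightarrow> (LINT t|lborel. F t)"
  proof (rule integral_dominated_convergence[OF _ _ iw])
    show "AE t in lborel. (\<lambda>n. indicator {-real n<..<real n} t *\<^sub>R F t) \<longlonglongrightarrow> F t"
    proof (intro AE_I2 tendsto_eventually)
      fix t :: real
      have "\<forall>\<^sub>F n in sequentially. real n > \<bar>t\<bar>" by real_asymp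
      then show "\<forall>\<^sub>F n in sequentially. indicator {-real n<..<real n} t *\<^sub>R F t = F t"
        by eventually_elim (auto simp: indicator_def)
    qed
    show "AE t in lborel. norm (indicator {-real n<..<real n} t *\<^sub>R F t) \<le> (b - a) * norm (c t)" for n
      using Fb ab by (auto simp: indicator_def)
  qed auto
  then have lim: "(\<lambda>n::nat. 1 / (2 * pi) * (CLBINT t=-real n..real n. F t)) \<longlonglongrightarrow> 1 / (2 * pi) * (LINT t|lborel. F t)"
    by (intro tendsto_intros) (simp add: interval_lebesgue_integral_def set_lebesgue_integral_def)
  moreover have "(\<lambda>n::nat. 1 / (2 * pi) * (CLBINT t=-real n..real n. F t)) \<longlonglongrightarrow> measure M {a<..b}"
    using Levy_Inversion[OF ab at] unfolding ch F_def by simp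
  ultimately have "complex_of_real (measure M {a<..b}) = 1 / (2 * pi) * (LINT t|lborel. F t)"
    by (rule LIMSEQ_unique[rotated])
  then have "measure M {a<..b} = Re (1 / (2 * pi) * (LINT t|lborel. F t))" by (metis Re_complex_of_real)
  also have "\<dots> = (LINT t|lborel. Re (F t)) / (2 * pi)"
    using iF by (subst integral_Re) (auto simp: Re_divide_of_real[of _ "2*pi", simplified])
  also have "(LINT t|lborel. Re (F t)) = (LINT t|lborel. sin (t * b) / t * c t - sin (t * a) / t * c t)"
  proof (intro Bochner_Integration.integral_cong refl)
    fix t
    show "Re (F t) = sin (t * b) / t * c t - sin (t * a) / t * c t"
      by (cases "t = 0") (simp_all add: F_def Re_divide Re_exp Im_exp power2_eq_square field_simps)
  qed
  also have "\<dots> = (LINT t|lborel. sin (t * b) / t * c t) - (LINT t|lborel. sin (t * a) / t * c t)"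
    by (intro Bochner_Integration.integral_diff integrable_sin_kernel c)
  finally show ?thesis .
qed

text \<open>By inversion the distribution function equals a primitive \<open>P\<close> of
  \<open>inverse_fourier c\<close> up to a constant, first at points without mass and then
  everywhere: the atoms are countable, so every point is approached from the right by such points.
  Monotonicity of the distribution function makes its derivative nonnegative.\<close>

lemma (in real_distribution) density_integrable_char:
  assumes ch: "\<And>t. char M t = complex_of_real (c t)" and c: "integrable lborel c"
  shows "inverse_fourier c x \<ge> 0" "M = density lborel (\<lambda>x. ennreal (inverse_fourier c x))"
proof -
  have cm [measurable]: "c \<in> borel_measurable borel" using c by auto
  define P where "P x = (LINT t|lborel. sin (t * x) / t * c t) / (2 * pi)" for x
  have dP: "(P has_real_derivative inverse_fourier c x) (at x)" for x
    unfolding P_def inverse_fourier_def by (intro DERIV_cdivide DERIV_integral_sin c)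
  have contP: "isCont P x" for x using dP by (rule DERIV_isCont)
  have eqC: "cdf M b - cdf M a = P b - P a" if "a < b" "measure M {a} = 0" "measure M {b} = 0" for a b
    using measure_Ioc_integrable_char[OF ch c, of a b] that unfolding cdf_diff_eq[OF that(1)] P_def
    by (simp add: diff_divide_distrib)
  obtain a0 where a0: "measure M {a0} = 0"
    using open_minus_countable[OF countable_support, of "{0<..<1}"] by auto
  define k where "k = cdf M a0 - P a0"
  have eqk: "cdf M b = P b + k" if "measure M {b} = 0" for b
    using eqC[of a0 b] eqC[of b a0] a0 that unfolding k_def by (cases "a0 < b"; cases "b < a0") auto
  have eq: "cdf M x = P x + k" for x
  proof -
    have "\<exists>b. x < b \<and> b < x + 1 / Suc n \<and> measure M {b} = 0" for n
      using open_minus_countable[OF countable_support, of "{x<..<x + 1 / Suc n}"] by auto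
    then obtain b where b: "\<And>n. x < b n" "\<And>n. b n < x + 1 / Suc n" "\<And>n. measure M {b n} = 0" by metis
    have bl: "b \<longlonglongrightarrow> x"
    proof (rule tendsto_sandwich[of "\<lambda>_. x" b _ "\<lambda>n. x + 1 / Suc n"])
      show "(\<lambda>n. x + 1 / real (Suc n)) \<longlonglongrightarrow> x" by real_asymp
    qed (use b in \<open>auto intro!: always_eventually less_imp_le\<close>)
    then have "filterlim b (at_right x) sequentially"
      unfolding filterlim_at using b(1) by (auto intro!: always_eventually simp: less_imp_neq[symmetric])
    then have "(\<lambda>n. cdf M (b n)) \<longlonglongrightarrow> cdf M x"
      using cdf_is_right_cont[of x] unfolding continuous_within by (rule filterlim_compose[rotated])
    moreover have "(\<lambda>n. P (b n) + k) \<longlonglongrightarrow> P x + k"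
      using contP bl by (intro tendsto_intros isCont_tendsto_compose[of x P]) 
    ultimately show ?thesis using b(3) eqk by (simp add: LIMSEQ_unique)
  qed
  have dF: "(cdf M has_real_derivative inverse_fourier c x) (at x)" for x
  proof -
    have "((\<lambda>x. P x + k) has_real_derivative inverse_fourier c x) (at x)"
      using DERIV_add[OF dP DERIV_const] by simp
    then show ?thesis using eq by (subst ext[of "cdf M", OF eq])
  qed
  show nn: "inverse_fourier c x \<ge> 0" for x
  proof (rule ccontr)
    assume "\<not> inverse_fourier c x \<ge> 0"
    then obtain d where d: "d > 0" "\<And>h. h > 0 \<Longrightarrow> h < d \<Longrightarrow> cdf M x > cdf M (x + h)"
      using DERIV_neg_dec_right[OF dF[of x]] by auto
    have "cdf M x > cdf M (x + d / 2)" using d by auto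
    moreover have "cdf M x \<le> cdf M (x + d / 2)" using d by (intro cdf_nondecreasing) auto
    ultimately show False by simp
  qed
  have pm: "inverse_fourier c \<in> borel_measurable borel" unfolding inverse_fourier_def[abs_def] by measurable
  show "M = density lborel (\<lambda>x. ennreal (inverse_fourier c x))"
  proof (rule measure_eqI_lessThan)
    fix x
    have "emeasure M {x<..} = ennreal (1 - cdf M x)"
    proof -
      have "measure M {x<..} = 1 - measure M {..x}"
        using prob_compl[of "{..x}"] by (simp add: Compl_eq_Diff_UNIV[symmetric])
      then show ?thesis by (simp add: emeasure_eq_measure cdf_def)
    qed
    also have "\<dots> = (\<integral>\<^sup>+y. ennreal (inverse_fourier c y) * indicator {x..} y \<partial>lborel)"
      using nn dF pm cdf_lim_at_top_prob by (intro nn_integral_FTC_atLeast[symmetric]) auto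
    also have "\<dots> = (\<integral>\<^sup>+y. ennreal (inverse_fourier c y) * indicator {x<..} y \<partial>lborel)"
      by (intro nn_integral_cong_AE) (use AE_lborel_singleton[of x] in \<open>auto simp: indicator_def elim!: eventually_mono\<close>)
    also have "\<dots> = emeasure (density lborel (\<lambda>x. ennreal (inverse_fourier c x))) {x<..}"
      using pm by (subst emeasure_density) auto
    finally show "emeasure M {x<..} = emeasure (density lborel (\<lambda>x. ennreal (inverse_fourier c x))) {x<..}" .
    show "emeasure M {x<..} < \<infinity>" using emeasure_finite[of "{x<..}"] by (simp add: less_top[symmetric])
  qed auto
qed

section \<open>Regular versions of Levy processes\<close>

text \<open>Independence of finitely many variables says that their joint law is the product of the
  marginal laws, and laws do not see null sets.\<close>

lemma (in prob_space) indep_vars_cong_AE: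
  assumes fin: "finite I" and ind: "indep_vars (\<lambda>_. borel) Y I"
    and eq: "\<And>i. i \<in> I \<Longrightarrow> AE \<omega> in M. Y i \<omega> = (Z i \<omega> :: real)"
    and Z: "\<And>i. i \<in> I \<Longrightarrow> Z i \<in> borel_measurable M"
  shows "indep_vars (\<lambda>_. borel) Z I"
proof (cases "I = {}")
  case False
  have Y: "\<And>i. i \<in> I \<Longrightarrow> Y i \<in> borel_measurable M" using ind by (auto simp: indep_vars_def2)
  have "distr M (PiM I (\<lambda>_. borel)) (\<lambda>x. \<lambda>i\<in>I. Z i x) = distr M (PiM I (\<lambda>_. borel)) (\<lambda>x. \<lambda>i\<in>I. Y i x)"
  proof (rule distr_cong_AE)
    have "AE \<omega> in M. \<forall>i\<in>I. Y i \<omega> = Z i \<omega>" using fin eq by (simp add: AE_finite_all)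
    then show "AE \<omega> in M. (\<lambda>i\<in>I. Z i \<omega>) = (\<lambda>i\<in>I. Y i \<omega>)" by eventually_elim auto
  qed (use Y Z in \<open>auto intro!: measurable_restrict\<close>)
  also have "\<dots> = PiM I (\<lambda>i. distr M borel (Y i))"
    using indep_vars_iff_distr_eq_PiM'[of I Y "\<lambda>_. borel"] ind False Y by auto
  also have "\<dots> = PiM I (\<lambda>i. distr M borel (Z i))"
    by (intro PiM_cong refl distr_cong_AE) (use eq Y Z in auto)
  finally show ?thesis
    using indep_vars_iff_distr_eq_PiM'[of I Z "\<lambda>_. borel"] False Z by auto
qed (auto simp: indep_vars_def2 indep_sets_def)

text \<open>Sampling at grid points to the right of t gives jointly measurable processes, because
  each involves only countably many times; right continuity makes them converge.\<close>

lemma borel_measurable_right_continuous_process: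
  fixes X :: "real \<Rightarrow> 'a \<Rightarrow> real"
  assumes X [measurable]: "\<And>t. X t \<in> borel_measurable M"
    and rc: "\<And>\<omega> t. \<omega> \<in> space M \<Longrightarrow> continuous (at_right t) (\<lambda>s. X s \<omega>)"
  shows "(\<lambda>(t, \<omega>). X t \<omega>) \<in> borel_measurable (borel \<Otimes>\<^sub>M M)"
proof (rule borel_measurable_LIMSEQ_real)
  \<comment> \<open>The added 1 makes the sampling time strictly larger than t, so the convergence
    is along \<open>at_right t\<close>.\<close>
  let ?s = "\<lambda>(n::nat) (t::real). (real_of_int \<lfloor>real (Suc n) * t\<rfloor> + 1) / real (Suc n)"
  show "(\<lambda>p. (\<lambda>(t, \<omega>). X (?s n t) \<omega>) p) \<in> borel_measurable (borel \<Otimes>\<^sub>M M)" for n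
  proof -
    have "(\<lambda>p. (\<lambda>i p. X ((of_int i + 1) / real (Suc n)) (snd p)) \<lfloor>real (Suc n) * fst p\<rfloor> p) \<in> borel_measurable (borel \<Otimes>\<^sub>M M)"
      by (rule measurable_compose_countable) measurable
    then show ?thesis by (simp add: case_prod_beta)
  qed
  fix p :: "real \<times> 'a" assume "p \<in> space (borel \<Otimes>\<^sub>M M)"
  then obtain t \<omega> where p: "p = (t, \<omega>)" "\<omega> \<in> space M" by (auto simp: space_pair_measure)
  have gt: "?s n t > t" "?s n t \<le> t + 1 / real (Suc n)" for n
  proof -
    have "real (Suc n) * t < real_of_int \<lfloor>real (Suc n) * t\<rfloor> + 1" by linarith
    then show "?s n t > t" by (simp add: field_simps del: of_nat_Suc)
    have "real_of_int \<lfloor>real (Suc n) * t\<rfloor> + 1 \<le> real (Suc n) * t + 1" by linarith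
    then show "?s n t \<le> t + 1 / real (Suc n)" by (simp add: field_simps del: of_nat_Suc)
  qed
  have "(\<lambda>n. ?s n t) \<longlonglongrightarrow> t"
  proof (rule tendsto_sandwich[of "\<lambda>_. t" _ _ "\<lambda>n. t + 1 / real (Suc n)"])
    show "(\<lambda>n. t + 1 / real (Suc n)) \<longlonglongrightarrow> t" by real_asymp
  qed (use gt in \<open>auto intro!: always_eventually less_imp_le simp del: of_nat_Suc\<close>)
  then have "filterlim (\<lambda>n. ?s n t) (at_right t) sequentially"
    unfolding filterlim_at using gt(1) by (auto intro!: always_eventually simp: less_imp_neq[symmetric] simp del: of_nat_Suc)
  then show "(\<lambda>n. (\<lambda>(t, \<omega>). X (?s n t) \<omega>) p) \<longlonglongrightarrow> (\<lambda>(t, \<omega>). X t \<omega>) p"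
    using rc[OF p(2), of t] unfolding p continuous_within prod.case by (rule filterlim_compose[rotated])
qed

lemma levy_process_cong_AE:
  assumes lp: "levy_process M X" and [measurable]: "\<And>t. X' t \<in> borel_measurable M"
    and eq: "AE \<omega> in M. \<forall>t\<ge>0. X' t \<omega> = X t \<omega>"
  shows "levy_process M X'"
proof -
  interpret prob_space M using lp by (simp add: levy_process_def)
  have Xm: "t \<ge> 0 \<Longrightarrow> X t \<in> borel_measurable M" for t using lp by (simp add: levy_process_def)
  have eqt: "AE \<omega> in M. X' t \<omega> = X t \<omega>" if "t \<ge> 0" for t
    using eq by eventually_elim (use that in auto)
  show ?thesis unfolding levy_process_def
  proof (intro conjI allI impI)
    show "prob_space M" by unfold_locales
    show "X' t \<in> borel_measurable M" for t by simp
    have "AE \<omega> in M. X 0 \<omega> = 0" using lp by (simp add: levy_process_def)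
    then show "AE \<omega> in M. X' 0 \<omega> = 0" using eqt[of 0] by auto
    have "AE \<omega> in M. cadlag (\<lambda>t. X t \<omega>)" using lp by (simp add: levy_process_def)
    then show "AE \<omega> in M. cadlag (\<lambda>t. X' t \<omega>)"
      using eq
    proof eventually_elim
      case (elim \<omega>)
      have "continuous (at_right t) (\<lambda>t. X' t \<omega>)" if "t \<ge> 0" for t
      proof -
        have "((\<lambda>t. X t \<omega>) \<longlongrightarrow> X t \<omega>) (at_right t)" using elim that by (auto simp: cadlag_def continuous_within)
        moreover have ev: "\<forall>\<^sub>F s in at_right t. X' s \<omega> = X s \<omega>"
          using eventually_at_right_less[of t] by eventually_elim (use elim that in auto)
        ultimately have "((\<lambda>t. X' t \<omega>) \<longlongrightarrow> X t \<omega>) (at_right t)" using tendsto_cong[OF ev] by simp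
        then show ?thesis using elim that by (simp add: continuous_within)
      qed
      moreover have "\<exists>l. ((\<lambda>t. X' t \<omega>) \<longlongrightarrow> l) (at_left t)" if t: "t > 0" for t
      proof -
        obtain l where "((\<lambda>t. X t \<omega>) \<longlongrightarrow> l) (at_left t)" using elim t by (auto simp: cadlag_def)
        moreover have ev: "\<forall>\<^sub>F s in at_left t. X' s \<omega> = X s \<omega>"
          using eventually_at_left_real[OF t] by eventually_elim (use elim in auto)
        ultimately have "((\<lambda>t. X' t \<omega>) \<longlongrightarrow> l) (at_left t)" using tendsto_cong[OF ev] by simp
        then show ?thesis by blast
      qed
      ultimately show ?case by (auto simp: cadlag_def)
    qed
  next
    fix n and \<tau> :: "nat \<Rightarrow> real" assume t: "0 \<le> \<tau> 0 \<and> (\<forall>i<n. \<tau> i \<le> \<tau> (Suc i))"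
    have pos: "\<tau> i \<ge> 0" if "i \<le> n" for i
      using that
    proof (induction i)
      case (Suc i)
      then have "0 \<le> \<tau> i" "\<tau> i \<le> \<tau> (Suc i)" using t by auto
      then show ?case by linarith
    qed (use t in auto)
    show "indep_vars (\<lambda>_. borel) (\<lambda>i \<omega>. X' (\<tau> (Suc i)) \<omega> - X' (\<tau> i) \<omega>) {..<n}"
    proof (rule indep_vars_cong_AE)
      show "indep_vars (\<lambda>_. borel) (\<lambda>i \<omega>. X (\<tau> (Suc i)) \<omega> - X (\<tau> i) \<omega>) {..<n}"
        using lp t unfolding levy_process_def by blast
      show "AE \<omega> in M. X (\<tau> (Suc i)) \<omega> - X (\<tau> i) \<omega> = X' (\<tau> (Suc i)) \<omega> - X' (\<tau> i) \<omega>" if "i \<in> {..<n}" for i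
        using eqt[OF pos[of i]] eqt[OF pos[of "Suc i"]] that by auto
    qed auto
  next
    fix s h :: real assume sh: "0 \<le> s" "0 \<le> h"
    have "distr M borel (\<lambda>\<omega>. X' (s + h) \<omega> - X' s \<omega>) = distr M borel (\<lambda>\<omega>. X (s + h) \<omega> - X s \<omega>)"
      using eqt[of s] eqt[of "s + h"] sh Xm by (intro distr_cong_AE) auto
    also have "\<dots> = distr M borel (X h)" using lp sh by (simp add: levy_process_def)
    also have "\<dots> = distr M borel (X' h)" using eqt[of h] sh Xm by (intro distr_cong_AE) auto
    finally show "distr M borel (\<lambda>\<omega>. X' (s + h) \<omega> - X' s \<omega>) = distr M borel (X' h)" .
  qed
qed

lemma levy_process_scale:
  assumes lp: "levy_process M X" and a: "a > 0"
  shows "levy_process M (\<lambda>t \<omega>. X (a * t) \<omega> / R)"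
proof -
  interpret prob_space M using lp by (simp add: levy_process_def)
  have Xm: "t \<ge> 0 \<Longrightarrow> X t \<in> borel_measurable M" for t using lp by (simp add: levy_process_def)
  show ?thesis unfolding levy_process_def
  proof (intro conjI allI impI)
    show "prob_space M" by unfold_locales
    show "(\<lambda>\<omega>. X (a * t) \<omega> / R) \<in> borel_measurable M" if "t \<ge> 0" for t using Xm[of "a * t"] a that by simp
    have "AE \<omega> in M. X 0 \<omega> = 0" using lp by (simp add: levy_process_def)
    then show "AE \<omega> in M. X (a * 0) \<omega> / R = 0" by eventually_elim auto
    have "AE \<omega> in M. cadlag (\<lambda>t. X t \<omega>)" using lp by (simp add: levy_process_def)
    then show "AE \<omega> in M. cadlag (\<lambda>t. X (a * t) \<omega> / R)"
    proof eventually_elim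
      case (elim \<omega>)
      have "((\<lambda>t. X (a * t) \<omega>) \<longlongrightarrow> X (a * t) \<omega>) (at_right t)" if "t \<ge> 0" for t
      proof -
        have "((\<lambda>t. X t \<omega>) \<longlongrightarrow> X (a * t) \<omega>) (at_right (a * t))"
          using elim that a by (auto simp: cadlag_def continuous_within)
        moreover have "filterlim ((*) a) (at_right (a * t)) (at_right t)"
          unfolding filterlim_at using a by (auto intro!: tendsto_intros eventually_at_right_less[THEN eventually_mono] )
        ultimately show ?thesis by (rule filterlim_compose)
      qed
      moreover have "\<exists>l. ((\<lambda>t. X (a * t) \<omega> / R) \<longlongrightarrow> l) (at_left t)" if t: "t > 0" for t
      proof -
        obtain l where "((\<lambda>t. X t \<omega>) \<longlongrightarrow> l) (at_left (a * t))"
          using elim[unfolded cadlag_def] mult_pos_pos[OF a t] by blast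
        moreover have "filterlim ((*) a) (at_left (a * t)) (at_left t)"
          unfolding filterlim_at using a by (auto intro!: tendsto_intros simp: eventually_at_filter)
        ultimately have "((\<lambda>t. X (a * t) \<omega>) \<longlongrightarrow> l) (at_left t)" by (rule filterlim_compose)
        then have "((\<lambda>t. X (a * t) \<omega> / R) \<longlongrightarrow> l / R) (at_left t)" unfolding divide_inverse by (intro tendsto_intros)
        then show ?thesis by blast
      qed
      ultimately show ?case by (auto simp: cadlag_def continuous_within divide_inverse intro!: tendsto_intros)
    qed
  next
    fix n and \<tau> :: "nat \<Rightarrow> real" assume t: "0 \<le> \<tau> 0 \<and> (\<forall>i<n. \<tau> i \<le> \<tau> (Suc i))"
    have "indep_vars (\<lambda>_. borel) (\<lambda>i \<omega>. X (a * \<tau> (Suc i)) \<omega> - X (a * \<tau> i) \<omega>) {..<n}"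
    proof -
      have "\<forall>n (\<tau> :: nat \<Rightarrow> real). 0 \<le> \<tau> 0 \<and> (\<forall>i<n. \<tau> i \<le> \<tau> (Suc i)) \<longrightarrow>
        indep_vars (\<lambda>_. borel) (\<lambda>i \<omega>. X (\<tau> (Suc i)) \<omega> - X (\<tau> i) \<omega>) {..<n}"
        using lp by (simp add: levy_process_def)
      from this[rule_format, of "\<lambda>i. a * \<tau> i" n] show ?thesis using t a by auto
    qed
    then have "indep_vars (\<lambda>_. borel) (\<lambda>i \<omega>. (\<lambda>y. y / R) (X (a * \<tau> (Suc i)) \<omega> - X (a * \<tau> i) \<omega>)) {..<n}"
      by (rule indep_vars_compose2) auto
    then show "indep_vars (\<lambda>_. borel) (\<lambda>i \<omega>. X (a * \<tau> (Suc i)) \<omega> / R - X (a * \<tau> i) \<omega> / R) {..<n}"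
      by (simp add: diff_divide_distrib)
  next
    fix s h :: real assume sh: "0 \<le> s" "0 \<le> h"
    have [measurable]: "X (a * s + a * h) \<in> borel_measurable M" "X (a * s) \<in> borel_measurable M" "X (a * h) \<in> borel_measurable M"
      using sh a by (auto intro!: Xm)
    have "distr M borel (\<lambda>\<omega>. X (a * (s + h)) \<omega> / R - X (a * s) \<omega> / R) = 
       distr (distr M borel (\<lambda>\<omega>. X (a * s + a * h) \<omega> - X (a * s) \<omega>)) borel (\<lambda>y. y / R)"
      by (subst distr_distr) (auto simp: comp_def diff_divide_distrib distrib_left)
    also have "distr M borel (\<lambda>\<omega>. X (a * s + a * h) \<omega> - X (a * s) \<omega>) = distr M borel (X (a * h))"
      using lp sh a by (simp add: levy_process_def)
    also have "distr (distr M borel (X (a * h))) borel (\<lambda>y. y / R) = distr M borel (\<lambda>\<omega>. X (a * h) \<omega> / R)"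
      by (subst distr_distr) (auto simp: comp_def)
    finally show "distr M borel (\<lambda>\<omega>. X (a * (s + h)) \<omega> / R - X (a * s) \<omega> / R) = distr M borel (\<lambda>\<omega>. X (a * h) \<omega> / R)" .
  qed
qed

text \<open>Joint measurability in time and chance is what Fubini's theorem requires;
  \<open>levy_process\<close> speaks of measurability at fixed nonnegative times and of regular
  paths off a null set.\<close>

locale levy_path =
  fixes M :: "'a measure" and X :: "real \<Rightarrow> 'a \<Rightarrow> real"
  assumes lp: "levy_process M X"
    and joint: "(\<lambda>(t, \<omega>). X t \<omega>) \<in> borel_measurable (borel \<Otimes>\<^sub>M M)"

sublocale levy_path \<subseteq> prob_space M
  using lp by (simp add: levy_process_def)

text \<open>Setting the process to 0 at negative times, and at all times on a measurable null set
  containing the irregular paths, makes every path right-continuous on the whole line. Path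
  integrals over nonnegative times change only on that null set.\<close>

lemma levy_process_regularize:
  assumes lp: "levy_process M X"
  obtains X' where "levy_path M X'" "AE \<omega> in M. \<forall>t\<ge>0. X' t \<omega> = X t \<omega>"
proof -
  interpret prob_space M using lp by (simp add: levy_process_def)
  have Xm: "t \<ge> 0 \<Longrightarrow> X t \<in> borel_measurable M" for t using lp by (simp add: levy_process_def)
  have "AE \<omega> in M. cadlag (\<lambda>t. X t \<omega>)" using lp by (simp add: levy_process_def)
  then obtain B where B: "{\<omega> \<in> space M. \<not> cadlag (\<lambda>t. X t \<omega>)} \<subseteq> B" "emeasure M B = 0" "B \<in> sets M"
    by (rule AE_E)
  define X' where "X' t \<omega> = (if t \<ge> 0 \<and> \<omega> \<notin> B then X t \<omega> else 0)" for t \<omega>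
  have m: "X' t \<in> borel_measurable M" for t
  proof (cases "t \<ge> 0")
    case True
    have [measurable]: "X t \<in> borel_measurable M" "B \<in> sets M" using Xm True B by auto
    show ?thesis unfolding X'_def[abs_def] using True by simp
  qed (simp add: X'_def[abs_def])
  have eq: "AE \<omega> in M. \<forall>t\<ge>0. X' t \<omega> = X t \<omega>"
    using AE_not_in[of B M] B by (auto simp: X'_def null_sets_def elim!: eventually_mono)
  have rc: "continuous (at_right t) (\<lambda>s. X' s \<omega>)" if "\<omega> \<in> space M" for \<omega> t
  proof (cases "t \<ge> 0 \<and> \<omega> \<notin> B")
    case True
    then have "cadlag (\<lambda>t. X t \<omega>)" using B(1) that by auto
    then have "((\<lambda>t. X t \<omega>) \<longlongrightarrow> X t \<omega>) (at_right t)" using True by (auto simp: cadlag_def continuous_within)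
    moreover have ev: "\<forall>\<^sub>F s in at_right t. X' s \<omega> = X s \<omega>"
      using eventually_at_right_less[of t] by eventually_elim (use True in \<open>auto simp: X'_def\<close>)
    ultimately have "((\<lambda>t. X' t \<omega>) \<longlongrightarrow> X t \<omega>) (at_right t)" using tendsto_cong[OF ev] by simp
    then show ?thesis using True by (simp add: continuous_within X'_def)
  next
    case False
    have "\<forall>\<^sub>F s in at_right t. X' s \<omega> = 0"
    proof (cases "\<omega> \<in> B")
      case False
      then have "t < 0" using \<open>\<not> (t \<ge> 0 \<and> \<omega> \<notin> B)\<close> by auto
      from eventually_at_right_real[OF this] show ?thesis by eventually_elim (auto simp: X'_def)
    qed (simp add: X'_def)
    then have "((\<lambda>t. X' t \<omega>) \<longlongrightarrow> 0) (at_right t)" by (rule tendsto_eventually)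
    then show ?thesis using False by (auto simp: continuous_within X'_def)
  qed
  have "levy_path M X'"
    by (intro levy_path.intro levy_process_cong_AE[OF lp m eq] borel_measurable_right_continuous_process m rc)
  then show ?thesis using that eq by blast
qed

context levy_path begin

lemma X_joint [measurable (raw)]:
  assumes "T \<in> borel_measurable K" "W \<in> measurable K M"
  shows "(\<lambda>z. X (T z) (W z)) \<in> borel_measurable K"
  using measurable_compose[OF measurable_Pair[OF assms] joint] by simp

lemma X_meas [measurable]: "X t \<in> borel_measurable M"
  by (rule X_joint) auto

lemma X_0: "AE \<omega> in M. X 0 \<omega> = 0"
  using lp by (simp add: levy_process_def)

lemma stationary: "s \<ge> 0 \<Longrightarrow> h \<ge> 0 \<Longrightarrow> distr M borel (\<lambda>\<omega>. X (s + h) \<omega> - X s \<omega>) = distr M borel (X h)"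
  using lp by (simp add: levy_process_def)

lemma indep_increments:
  assumes "0 \<le> \<tau> 0" "\<And>i. i < n \<Longrightarrow> \<tau> i \<le> \<tau> (Suc i)"
  shows "indep_vars (\<lambda>_. borel) (\<lambda>i \<omega>. X (\<tau> (Suc i)) \<omega> - X (\<tau> i) \<omega>) {..<n}"
  using lp assms unfolding levy_process_def by blast

lemma real_distribution_X: "real_distribution (distr M borel (X t))"
  by (intro real_distribution.intro prob_space_distr real_distribution_axioms.intro) auto

lemma distr_increments_PiM:
  assumes n: "n > 0" and h: "h \<ge> 0"
  shows "distr M (PiM {..<n} (\<lambda>_. borel)) (\<lambda>\<omega>. \<lambda>i\<in>{..<n}. X (real (Suc i) * h) \<omega> - X (real i * h) \<omega>)
    = PiM {..<n} (\<lambda>_. distr M borel (X h))"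
proof -
  have "indep_vars (\<lambda>_. borel) (\<lambda>i \<omega>. X (real (Suc i) * h) \<omega> - X (real i * h) \<omega>) {..<n}"
    by (rule indep_increments) (use h in \<open>auto intro!: mult_right_mono\<close>)
  then have "distr M (PiM {..<n} (\<lambda>_. borel)) (\<lambda>\<omega>. \<lambda>i\<in>{..<n}. X (real (Suc i) * h) \<omega> - X (real i * h) \<omega>)
    = PiM {..<n} (\<lambda>i. distr M borel (\<lambda>\<omega>. X (real (Suc i) * h) \<omega> - X (real i * h) \<omega>))"
    using n by (subst (asm) indep_vars_iff_distr_eq_PiM') auto
  also have "(\<lambda>i. distr M borel (\<lambda>\<omega>. X (real (Suc i) * h) \<omega> - X (real i * h) \<omega>)) = (\<lambda>_. distr M borel (X h))"
    using stationary[of "real i * h" h for i] h by (auto simp: fun_eq_iff distrib_right add.commute)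
  finally show ?thesis .
qed

text \<open>The increments over the times 0, r, s are independent; as X starts at 0, the first of
  them is X r itself almost surely.\<close>

lemma distr_pair:
  assumes rs: "0 \<le> r" "r \<le> s"
  shows "distr M (borel \<Otimes>\<^sub>M borel) (\<lambda>\<omega>. (X r \<omega>, X s \<omega> - X r \<omega>)) =
    distr M borel (X r) \<Otimes>\<^sub>M distr M borel (X (s - r))"
proof -
  define \<tau> where "\<tau> i = (if i = 0 then 0 else if i = 1 then r else s)" for i :: nat
  have "indep_vars (\<lambda>_. borel) (\<lambda>i \<omega>. X (\<tau> (Suc i)) \<omega> - X (\<tau> i) \<omega>) {..<2}"
    by (rule indep_increments) (use rs in \<open>auto simp: \<tau>_def\<close>)
  then have "indep_var (PiM {0} (\<lambda>_. borel)) (\<lambda>\<omega>. restrict (\<lambda>i. X (\<tau> (Suc i)) \<omega> - X (\<tau> i) \<omega>) {0})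
      (PiM {1} (\<lambda>_. borel)) (\<lambda>\<omega>. restrict (\<lambda>i. X (\<tau> (Suc i)) \<omega> - X (\<tau> i) \<omega>) {1})"
    by (rule indep_var_restrict) auto
  from indep_var_compose[OF this, of "\<lambda>v. v 0" borel "\<lambda>v. v 1" borel]
  have "indep_var borel (\<lambda>\<omega>. X (\<tau> (Suc 0)) \<omega> - X (\<tau> 0) \<omega>) borel (\<lambda>\<omega>. X (\<tau> (Suc 1)) \<omega> - X (\<tau> 1) \<omega>)"
    by (simp add: comp_def)
  then have "distr M borel (\<lambda>\<omega>. X r \<omega> - X 0 \<omega>) \<Otimes>\<^sub>M distr M borel (\<lambda>\<omega>. X s \<omega> - X r \<omega>) = 
    distr M (borel \<Otimes>\<^sub>M borel) (\<lambda>\<omega>. (X r \<omega> - X 0 \<omega>, X s \<omega> - X r \<omega>))"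
    unfolding indep_var_distribution_eq by (simp add: \<tau>_def)
  also have "\<dots> = distr M (borel \<Otimes>\<^sub>M borel) (\<lambda>\<omega>. (X r \<omega>, X s \<omega> - X r \<omega>))"
    by (rule distr_cong_AE) (use X_0 in \<open>auto elim!: eventually_mono\<close>)
  also have "distr M borel (\<lambda>\<omega>. X r \<omega> - X 0 \<omega>) = distr M borel (X r)"
    using stationary[of 0 r] rs by simp
  also have "distr M borel (\<lambda>\<omega>. X s \<omega> - X r \<omega>) = distr M borel (X (s - r))"
    using stationary[of r "s - r"] rs by simp
  finally show ?thesis by simp
qed

lemma scale: "a > 0 \<Longrightarrow> levy_path M (\<lambda>t \<omega>. X (a * t) \<omega> / R)"
  by (intro levy_path.intro levy_process_scale[OF lp]) auto

end

section \<open>Second moments of occupation functionals\<close>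

text \<open>The moment bounds are proved for one process with a real exponent and will be applied to
  every rescaled process. They must therefore display their dependence on \<psi>, which enters
  through integrals of \<open>inverse (ennreal (\<psi> \<theta>))\<close> over high
  frequencies.\<close>

locale levy_path_char = levy_path M X for M :: "'a measure" and X +
  fixes \<psi> :: "real \<Rightarrow> real"
  assumes psi_meas [measurable]: "\<psi> \<in> borel_measurable borel"
    and psi_nonneg: "\<And>\<theta>. \<psi> \<theta> \<ge> 0"
    and char_X: "\<And>t \<theta>. t \<ge> 0 \<Longrightarrow> char (distr M borel (X t)) \<theta> = complex_of_real (exp (- (t * \<psi> \<theta>)))"
    and inverse_psi: "(\<integral>\<^sup>+\<theta>. inverse (ennreal (\<psi> \<theta>)) * indicator {\<theta>. \<bar>\<theta>\<bar> > 1} \<theta> \<partial>lborel) < \<infinity>"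
begin

text \<open>\<open>P t\<close> bounds the density \<open>p t\<close> of \<open>X t\<close>, and \<open>W t (y - z)\<close> bounds \<open>\<bar>p t y - p t z\<bar>\<close>. The function
  \<open>kk t\<close> bounds the integral of \<open>e r\<close> over \<open>r \<in> {0..t}\<close>; integrated against \<open>1\<close> and \<open>min 2 \<bar>\<theta> * y\<bar>\<close> it gives the
  bounds \<open>G t\<close> and \<open>Om t y\<close> below for the time integrals of \<open>P\<close> and \<open>W\<close>.\<close>

definition "e t \<theta> = exp (- (t * \<psi> \<theta>))"
definition "P t = (LINT \<theta>|lborel. e t \<theta>)"
definition "W t y = (LINT \<theta>|lborel. min 2 \<bar>\<theta> * y\<bar> * e t \<theta>)"
definition "p t = inverse_fourier (e t)"
definition "kk t \<theta> = min (ennreal t) (inverse (ennreal (\<psi> \<theta>)))"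

lemma e_meas [measurable]: "(\<lambda>z. e (fst z) (snd z)) \<in> borel_measurable (borel \<Otimes>\<^sub>M borel)" "e t \<in> borel_measurable borel"
  "(\<lambda>t. e t \<theta>) \<in> borel_measurable borel"
  unfolding e_def[abs_def] by measurable

lemma e_pos: "e t \<theta> > 0" by (simp add: e_def)

lemma kk_meas [measurable]: "kk t \<in> borel_measurable borel"
  unfolding kk_def[abs_def] by measurable

text \<open>From \<open>y \<le> exp y\<close> with y = t \<psi>(\<theta>). Where \<psi> vanishes,
  the right-hand side is infinite.\<close>

lemma e_le_inverse: "t > 0 \<Longrightarrow> ennreal (e t \<theta>) \<le> inverse (ennreal t) * inverse (ennreal (\<psi> \<theta>))"
proof (cases "\<psi> \<theta> = 0")
  case False
  assume t: "t > 0"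
  have ps: "\<psi> \<theta> > 0" using False psi_nonneg[of \<theta>] by simp
  have a: "t * \<psi> \<theta> > 0" using t ps by simp
  have "t * \<psi> \<theta> \<le> exp (t * \<psi> \<theta>)" using exp_ge_add_one_self[of "t * \<psi> \<theta>"] by linarith
  then have "e t \<theta> \<le> inverse (t * \<psi> \<theta>)" unfolding e_def exp_minus using a by (intro le_imp_inverse_le) auto
  also have "\<dots> = inverse t * inverse (\<psi> \<theta>)" by simp
  finally have "ennreal (e t \<theta>) \<le> ennreal (inverse t * inverse (\<psi> \<theta>))" by (rule ennreal_leI)
  then show ?thesis using t ps by (simp add: ennreal_mult inverse_ennreal)
qed (auto simp: ennreal_mult_top inverse_ennreal)

lemma e_int:
  assumes t: "t > 0"
  shows "integrable lborel (e t)"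
proof (rule integrableI_bounded)
  have "(\<integral>\<^sup>+\<theta>. ennreal (norm (e t \<theta>)) \<partial>lborel) \<le>
    (\<integral>\<^sup>+\<theta>. indicator {-1..1} \<theta> + inverse (ennreal t) * (inverse (ennreal (\<psi> \<theta>)) * indicator {\<theta>. \<bar>\<theta>\<bar> > 1} \<theta>) \<partial>lborel)"
  proof (rule nn_integral_mono)
    fix \<theta>
    have "ennreal (e t \<theta>) \<le> 1" using t psi_nonneg[of \<theta>] by (simp add: e_def)
    then show "ennreal (norm (e t \<theta>)) \<le> indicator {-1..1} \<theta> + inverse (ennreal t) * (inverse (ennreal (\<psi> \<theta>)) * indicator {\<theta>. \<bar>\<theta>\<bar> > 1} \<theta>)"
      using e_le_inverse[OF t, of \<theta>] e_pos[of t \<theta>] by (auto simp: indicator_def)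
  qed
  also have "\<dots> = (\<integral>\<^sup>+\<theta>. indicator {-1..1::real} \<theta> \<partial>lborel) + inverse (ennreal t) * (\<integral>\<^sup>+\<theta>. inverse (ennreal (\<psi> \<theta>)) * indicator {\<theta>. \<bar>\<theta>\<bar> > 1} \<theta> \<partial>lborel)"
    by (subst nn_integral_add) (auto simp: nn_integral_cmult)
  also have "\<dots> < \<infinity>"
    using inverse_psi t by (simp add: ennreal_mult_less_top inverse_ennreal)
  finally show "(\<integral>\<^sup>+\<theta>. ennreal (norm (e t \<theta>)) \<partial>lborel) < \<infinity>" .
qed simp

lemma p_meas [measurable]: "p t \<in> borel_measurable borel"
  unfolding p_def inverse_fourier_def[abs_def] by measurable

lemma distr_X_density:
  assumes "t > 0"
  shows "distr M borel (X t) = density lborel (\<lambda>y. ennreal (p t y))" "p t y \<ge> 0"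
proof -
  interpret D: real_distribution "distr M borel (X t)" by (rule real_distribution_X)
  have "char (distr M borel (X t)) \<theta> = complex_of_real (e t \<theta>)" for \<theta>
    using char_X[of t \<theta>] assms by (simp add: e_def)
  then show "distr M borel (X t) = density lborel (\<lambda>y. ennreal (p t y))" "p t y \<ge> 0"
    using D.density_integrable_char[of "e t"] e_int[OF assms] unfolding p_def by auto
qed

lemma two_pi: "(1::real) \<le> 2 * pi" using pi_gt3 by simp

lemma P_nonneg: "P t \<ge> 0" unfolding P_def by (intro integral_nonneg_AE AE_I2) (simp add: e_pos less_imp_le)

lemma int_min_e: "t > 0 \<Longrightarrow> integrable lborel (\<lambda>\<theta>. min 2 \<bar>\<theta> * y\<bar> * e t \<theta>)"
  by (rule Bochner_Integration.integrable_bound[where f="\<lambda>\<theta>. 2 * e t \<theta>"])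
    (auto simp: abs_mult e_pos less_imp_le intro!: mult_right_mono e_int)

lemma W_nonneg: "W t y \<ge> 0" unfolding W_def by (intro integral_nonneg_AE AE_I2) (simp add: e_pos less_imp_le)

lemma W_uminus: "W t (- y) = W t y" by (simp add: W_def)

text \<open>Truncating an absolute value at 2 keeps it subadditive. This separates the two spatial
  arguments of the covariance bound, so that each can be integrated against its own copy of the
  kernel.\<close>

lemma W_add: "t > 0 \<Longrightarrow> W t (y + z) \<le> W t y + W t z"
proof -
  assume t: "t > 0"
  have "W t (y + z) \<le> (LINT \<theta>|lborel. min 2 \<bar>\<theta> * y\<bar> * e t \<theta> + min 2 \<bar>\<theta> * z\<bar> * e t \<theta>)"
    unfolding W_def
  proof (intro integral_mono int_min_e Bochner_Integration.integrable_add t)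
    fix \<theta>
    have "min 2 \<bar>\<theta> * (y + z)\<bar> \<le> min 2 \<bar>\<theta> * y\<bar> + min 2 \<bar>\<theta> * z\<bar>" by (simp add: distrib_left)
    from mult_right_mono[OF this, of "e t \<theta>"] e_pos[of t \<theta>]
    show "min 2 \<bar>\<theta> * (y + z)\<bar> * e t \<theta> \<le> min 2 \<bar>\<theta> * y\<bar> * e t \<theta> + min 2 \<bar>\<theta> * z\<bar> * e t \<theta>"
      by (simp add: distrib_right)
  qed
  also have "\<dots> = W t y + W t z" unfolding W_def by (intro Bochner_Integration.integral_add int_min_e t)
  finally show ?thesis .
qed

lemma abs_cos_diff_le: "\<bar>cos x - cos y\<bar> \<le> \<bar>x - y :: real\<bar>"
  using abs_sin_diff_le[of "pi/2 - x" "pi/2 - y"] by (simp add: sin_cos_eq[symmetric] cos_sin_eq)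

lemma p_le: "t > 0 \<Longrightarrow> p t y \<le> P t" and p_diff: "t > 0 \<Longrightarrow> \<bar>p t y - p t z\<bar> \<le> W t (y - z)"
proof -
  assume t: "t > 0"
  have ic: "integrable lborel (\<lambda>\<theta>. cos (\<theta> * y) * e t \<theta>)" for y
    by (rule Bochner_Integration.integrable_bound[OF e_int[OF t]]) (auto simp: abs_mult e_pos less_imp_le intro!: mult_left_le_one_le)
  have "(LINT \<theta>|lborel. cos (\<theta> * y) * e t \<theta>) \<le> P t" unfolding P_def
    by (intro integral_mono ic e_int t) (use e_pos in \<open>auto intro!: mult_left_le_one_le simp: less_imp_le\<close>)
  then have "p t y \<le> P t / (2 * pi)" unfolding p_def inverse_fourier_def by (intro divide_right_mono) auto
  also have "\<dots> \<le> P t" using two_pi P_nonneg[of t] by (simp add: divide_le_eq mult_left_mono[of 1 "2 * pi" "P t", simplified])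
  finally show "p t y \<le> P t" .
  have "p t y - p t z = (LINT \<theta>|lborel. (cos (\<theta> * y) - cos (\<theta> * z)) * e t \<theta>) / (2 * pi)"
    unfolding p_def inverse_fourier_def diff_divide_distrib[symmetric] 
    by (subst Bochner_Integration.integral_diff[OF ic ic, symmetric]) (simp add: left_diff_distrib)
  moreover have "\<bar>LINT \<theta>|lborel. (cos (\<theta> * y) - cos (\<theta> * z)) * e t \<theta>\<bar> \<le> W t (y - z)"
    unfolding W_def
  proof (rule order.trans[OF integral_abs_bound integral_mono])
    show "integrable lborel (\<lambda>\<theta>. \<bar>(cos (\<theta> * y) - cos (\<theta> * z)) * e t \<theta>\<bar>)"
      using Bochner_Integration.integrable_diff[OF ic ic, of y z] by (intro integrable_abs) (simp add: left_diff_distrib)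
    fix \<theta>
    have "\<bar>cos (\<theta> * y) - cos (\<theta> * z)\<bar> \<le> min 2 \<bar>\<theta> * (y - z)\<bar>"
      using abs_cos_diff_le[of "\<theta> * y" "\<theta> * z"] cos_le_one[of "\<theta> * y"] cos_le_one[of "\<theta> * z"]
        cos_ge_minus_one[of "\<theta> * y"] cos_ge_minus_one[of "\<theta> * z"]
      unfolding right_diff_distrib by linarith
    then show "\<bar>(cos (\<theta> * y) - cos (\<theta> * z)) * e t \<theta>\<bar> \<le> min 2 \<bar>\<theta> * (y - z)\<bar> * e t \<theta>"
      using e_pos[of t \<theta>] by (simp add: abs_mult mult_right_mono)
  qed (rule int_min_e[OF t])
  ultimately have "\<bar>p t y - p t z\<bar> \<le> W t (y - z) / (2 * pi)" by (simp add: divide_right_mono)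
  also have "\<dots> \<le> W t (y - z)" using two_pi W_nonneg[of t "y - z"] by (simp add: divide_le_eq mult_left_mono[of 1 "2 * pi" "W t (y - z)", simplified])
  finally show "\<bar>p t y - p t z\<bar> \<le> W t (y - z)" .
qed

lemma nn_integral_translate:
  fixes h :: "real \<Rightarrow> ennreal"
  assumes [measurable]: "h \<in> borel_measurable borel"
  shows "(\<integral>\<^sup>+y. h (y + x) \<partial>lborel) = (\<integral>\<^sup>+y. h y \<partial>lborel)"
  using nn_integral_real_affine[of h 1 x] by (simp add: add.commute)

lemma nn_distr_bound:
  fixes h :: "real \<Rightarrow> ennreal"
  assumes t: "t > 0" and [measurable]: "h \<in> borel_measurable borel"
  shows "(\<integral>\<^sup>+y. h (y + x) \<partial>distr M borel (X t)) \<le> ennreal (P t) * (\<integral>\<^sup>+y. h y \<partial>lborel)"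
proof -
  have "(\<integral>\<^sup>+y. h (y + x) \<partial>distr M borel (X t)) = (\<integral>\<^sup>+y. ennreal (p t y) * h (y + x) \<partial>lborel)"
    unfolding distr_X_density(1)[OF t] by (subst nn_integral_density) auto
  also have "\<dots> \<le> (\<integral>\<^sup>+y. ennreal (P t) * h (y + x) \<partial>lborel)"
    by (intro nn_integral_mono mult_right_mono ennreal_leI p_le t) auto
  also have "\<dots> = ennreal (P t) * (\<integral>\<^sup>+y. h y \<partial>lborel)"
    by (simp add: nn_integral_cmult nn_integral_translate)
  finally show ?thesis .
qed

lemma nn_expectation_bound:
  fixes h :: "real \<Rightarrow> ennreal"
  assumes t: "t > 0" and [measurable]: "h \<in> borel_measurable borel"
  shows "(\<integral>\<^sup>+\<omega>. h (X t \<omega> - x) \<partial>M) \<le> ennreal (P t) * (\<integral>\<^sup>+y. h y \<partial>lborel)"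
  using nn_distr_bound[OF t assms(2), of "-x"] by (simp add: nn_integral_distr)

text \<open>X r and the increment up to s are independent with densities bounded by
  \<open>P r\<close> and \<open>P (s - r)\<close>. No cancellation enters; the bound supplies the
  absolute integrability for the Fubini argument of the second moment.\<close>

lemma nn_expectation_pair:
  fixes h :: "real \<Rightarrow> ennreal"
  assumes rs: "0 < r" "r < s" and [measurable]: "h \<in> borel_measurable borel"
  shows "(\<integral>\<^sup>+\<omega>. h (X r \<omega> - x) * h (X s \<omega> - x) \<partial>M) \<le> (\<integral>\<^sup>+y. h y \<partial>lborel)\<^sup>2 * (ennreal (P r) * ennreal (P (s - r)))"
proof -
  interpret D: prob_space "distr M borel (X (s - r))" by (rule prob_space_distr) simp
  let ?N = "\<integral>\<^sup>+y. h y \<partial>lborel"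
  have "(\<integral>\<^sup>+\<omega>. h (X r \<omega> - x) * h (X s \<omega> - x) \<partial>M) = 
    (\<integral>\<^sup>+q. h (fst q - x) * h (fst q + snd q - x) \<partial>distr M (borel \<Otimes>\<^sub>M borel) (\<lambda>\<omega>. (X r \<omega>, X s \<omega> - X r \<omega>)))"
    by (subst nn_integral_distr) auto
  also have "\<dots> = (\<integral>\<^sup>+q. h (fst q - x) * h (fst q + snd q - x) \<partial>(distr M borel (X r) \<Otimes>\<^sub>M distr M borel (X (s - r))))"
    using rs by (subst distr_pair) auto
  also have "\<dots> = (\<integral>\<^sup>+y. \<integral>\<^sup>+z. h (y - x) * h (y + z - x) \<partial>distr M borel (X (s - r)) \<partial>distr M borel (X r))"
    by (subst D.nn_integral_fst[symmetric]) auto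
  also have "\<dots> \<le> (\<integral>\<^sup>+y. h (y + - x) * (ennreal (P (s - r)) * ?N) \<partial>distr M borel (X r))"
  proof (rule nn_integral_mono)
    fix y
    have "(\<integral>\<^sup>+z. h (y - x) * h (y + z - x) \<partial>distr M borel (X (s - r))) = h (y - x) * (\<integral>\<^sup>+z. h (z + (y - x)) \<partial>distr M borel (X (s - r)))"
      by (subst nn_integral_cmult[symmetric]) (auto simp: algebra_simps)
    also have "\<dots> \<le> h (y - x) * (ennreal (P (s - r)) * ?N)"
      using rs by (intro mult_left_mono nn_distr_bound) auto
    finally show "(\<integral>\<^sup>+z. h (y - x) * h (y + z - x) \<partial>distr M borel (X (s - r))) \<le> h (y + - x) * (ennreal (P (s - r)) * ?N)" by simp
  qed
  also have "\<dots> = (\<integral>\<^sup>+y. h (y + - x) \<partial>distr M borel (X r)) * (ennreal (P (s - r)) * ?N)"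
    by (intro nn_integral_multc) auto
  also have "\<dots> \<le> (ennreal (P r) * ?N) * (ennreal (P (s - r)) * ?N)"
    using rs by (intro mult_right_mono nn_distr_bound) auto
  finally show ?thesis by (simp add: power2_eq_square mult_ac)
qed

text \<open>The continuity bound for the density at time u, averaged with the weight
  \<open>\<bar>k\<bar>\<close>; it is small when \<open>k\<close> has most of its mass near
  0.\<close>

definition "A k u = (\<integral>\<^sup>+y. ennreal \<bar>k y\<bar> * ennreal (W u y) \<partial>lborel)"

lemma W_meas [measurable]: "W u \<in> borel_measurable borel"
  unfolding W_def[abs_def] by measurable

text \<open>As \<open>k\<close> has integral \<open>0\<close>, the transition density \<open>p (s - r) (w - y)\<close> may be replaced by
  \<open>p (s - r) (w - y) - p (s - r) 0\<close>, which is small for \<open>w\<close> and \<open>y\<close> near \<open>0\<close>.\<close>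

lemma expectation_pair_bound:
  assumes rs: "0 < r" "r < s" and k: "integrable lborel k" "(LINT y|lborel. k y) = 0"
  shows "ennreal \<bar>expectation (\<lambda>\<omega>. k (X r \<omega> - x) * k (X s \<omega> - x))\<bar> \<le> 
    2 * (\<integral>\<^sup>+y. ennreal \<bar>k y\<bar> \<partial>lborel) * (ennreal (P r) * A k (s - r))"
proof -
  have km [measurable]: "k \<in> borel_measurable borel" using k by auto
  let ?N = "\<integral>\<^sup>+y. ennreal \<bar>k y\<bar> \<partial>lborel"
  have Nfin: "?N < \<infinity>" using k(1) by (simp add: integrable_iff_bounded)
  define u where "u = s - r"
  have u: "u > 0" using rs by (simp add: u_def)
  interpret D: prob_space "distr M borel (X u)" by (rule prob_space_distr) simp
  interpret R: prob_space "distr M borel (X r)" by (rule prob_space_distr) simp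
  interpret DR: pair_sigma_finite "distr M borel (X r)" "distr M borel (X u)" ..
  let ?D = "distr M borel (X r) \<Otimes>\<^sub>M distr M borel (X u)"
  have dp: "distr M (borel \<Otimes>\<^sub>M borel) (\<lambda>\<omega>. (X r \<omega>, X s \<omega> - X r \<omega>)) = ?D"
    using rs unfolding u_def by (intro distr_pair) auto
  \<comment> \<open>\<open>H y\<close> is the conditional expectation of the second factor, given
    that the process is at y at time r.\<close>
  define H where "H y = (LINT z|distr M borel (X u). k (y + z - x))" for y
  have Hb: "ennreal \<bar>H y\<bar> \<le> A k u + ?N * ennreal (W u (y - x))" for y
  proof -
    have ikp: "integrable lborel (\<lambda>w. k w * c w)" if "c \<in> borel_measurable borel" "\<And>w. \<bar>c w\<bar> \<le> B" for c B
    proof (rule Bochner_Integration.integrable_bound[OF integrable_mult_right[OF integrable_abs[OF k(1)], of B]])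
      show "AE w in lborel. norm (k w * c w) \<le> norm (B * \<bar>k w\<bar>)"
        using that(2) by (auto simp: abs_mult mult.commute[of B] intro!: mult_left_mono order.trans[OF that(2)])
    qed (use that in auto)
    have "H y = (LINT z|lborel. p u z * k (y + z - x))"
      unfolding H_def distr_X_density(1)[OF u] using distr_X_density(2)[OF u] by (subst integral_density) auto
    also have "\<dots> = (LINT w|lborel. k w * p u (w - (y - x)))"
      using lborel_integral_real_affine[of 1 "\<lambda>z. k z * p u (z - (y - x))" "y - x"] by (simp add: algebra_simps)
    also have "\<dots> = (LINT w|lborel. k w * (p u (w - (y - x)) - p u 0))"
    proof -
      have "integrable lborel (\<lambda>w. k w * p u (w - (y - x)))"
        using p_le[OF u] distr_X_density(2)[OF u] by (intro ikp[of _ "P u"]) auto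
      then show ?thesis using k by (simp add: right_diff_distrib)
    qed
    finally have "ennreal \<bar>H y\<bar> \<le> (\<integral>\<^sup>+w. ennreal \<bar>k w * (p u (w - (y - x)) - p u 0)\<bar> \<partial>lborel)"
      using integral_norm_bound_ennreal[OF ikp[of "\<lambda>w. p u (w - (y - x)) - p u 0" "2 * P u"]] p_le[OF u] distr_X_density(2)[OF u]
      by (auto simp: abs_le_iff intro: add_increasing2 add_mono) (smt (verit) p_le u distr_X_density(2))
    also have "\<dots> \<le> (\<integral>\<^sup>+w. ennreal \<bar>k w\<bar> * ennreal (W u w) + ennreal \<bar>k w\<bar> * ennreal (W u (y - x)) \<partial>lborel)"
    proof (rule nn_integral_mono)
      fix w
      have "\<bar>p u (w - (y - x)) - p u 0\<bar> \<le> W u (w - (y - x))" using p_diff[OF u, of "w - (y - x)" 0] by simp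
      also have "\<dots> \<le> W u w + W u (y - x)" using W_add[OF u, of w "-(y - x)"] by (simp only: add_uminus_conv_diff W_uminus)
      finally have "\<bar>k w * (p u (w - (y - x)) - p u 0)\<bar> \<le> \<bar>k w\<bar> * (W u w + W u (y - x))"
        by (simp add: abs_mult mult_left_mono)
      then have "ennreal \<bar>k w * (p u (w - (y - x)) - p u 0)\<bar> \<le> ennreal (\<bar>k w\<bar> * (W u w + W u (y - x)))" by (rule ennreal_leI)
      also have "\<dots> = ennreal \<bar>k w\<bar> * ennreal (W u w) + ennreal \<bar>k w\<bar> * ennreal (W u (y - x))"
        using W_nonneg by (simp add: ennreal_mult distrib_left)
      finally show "ennreal \<bar>k w * (p u (w - (y - x)) - p u 0)\<bar> \<le> ennreal \<bar>k w\<bar> * ennreal (W u w) + ennreal \<bar>k w\<bar> * ennreal (W u (y - x))" .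
    qed
    also have "\<dots> = A k u + ?N * ennreal (W u (y - x))"
      unfolding A_def by (subst nn_integral_add) (auto simp: nn_integral_multc)
    finally show ?thesis .
  qed
  have Hm [measurable]: "H \<in> borel_measurable borel" unfolding H_def by measurable
  have "(\<integral>\<^sup>+\<omega>. ennreal \<bar>k (X r \<omega> - x)\<bar> * ennreal \<bar>k (X s \<omega> - x)\<bar> \<partial>M) < \<infinity>"
    by (rule le_less_trans[OF nn_expectation_pair[OF rs]]) (use Nfin in \<open>auto simp: ennreal_mult_less_top power2_eq_square\<close>)
  then have intM: "integrable M (\<lambda>\<omega>. k (X r \<omega> - x) * k (X s \<omega> - x))"
    by (intro integrableI_bounded) (auto simp: abs_mult ennreal_mult)
  have intD: "integrable ?D (\<lambda>(y, z). k (y - x) * k (y + z - x))"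
    unfolding dp[symmetric] using intM by (subst integrable_distr_eq) (auto simp: algebra_simps)
  have "expectation (\<lambda>\<omega>. k (X r \<omega> - x) * k (X s \<omega> - x)) = (LINT q|?D. (\<lambda>(y, z). k (y - x) * k (y + z - x)) q)"
    unfolding dp[symmetric] by (subst integral_distr) auto
  also have "\<dots> = (LINT y|distr M borel (X r). LINT z|distr M borel (X u). k (y - x) * k (y + z - x))"
    using DR.integral_fst[OF intD] by simp
  also have "\<dots> = (LINT y|distr M borel (X r). k (y - x) * H y)" unfolding H_def by simp
  finally have "ennreal \<bar>expectation (\<lambda>\<omega>. k (X r \<omega> - x) * k (X s \<omega> - x))\<bar> = ennreal (norm (LINT y|distr M borel (X r). k (y - x) * H y))" by simp
  also have "\<dots> \<le> (\<integral>\<^sup>+y. ennreal (norm (k (y - x) * H y)) \<partial>distr M borel (X r))"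
  proof (rule integral_norm_bound_ennreal)
    show "integrable (distr M borel (X r)) (\<lambda>y. k (y - x) * H y)"
      using DR.integrable_fst[OF intD] unfolding H_def by simp
  qed
  also have "\<dots> \<le> (\<integral>\<^sup>+y. (\<lambda>y. ennreal \<bar>k y\<bar> * (A k u + ?N * ennreal (W u y))) (y + - x) \<partial>distr M borel (X r))"
  proof (rule nn_integral_mono)
    fix y
    show "ennreal (norm (k (y - x) * H y)) \<le> (\<lambda>y. ennreal \<bar>k y\<bar> * (A k u + ?N * ennreal (W u y))) (y + - x)"
      using Hb[of y] by (simp add: abs_mult ennreal_mult mult_left_mono)
  qed
  also have "\<dots> \<le> ennreal (P r) * (\<integral>\<^sup>+y. ennreal \<bar>k y\<bar> * (A k u + ?N * ennreal (W u y)) \<partial>lborel)"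
    using rs by (intro nn_distr_bound) auto
  also have "(\<integral>\<^sup>+y. ennreal \<bar>k y\<bar> * (A k u + ?N * ennreal (W u y)) \<partial>lborel) = ?N * A k u + ?N * A k u"
  proof -
    have "(\<integral>\<^sup>+y. ennreal \<bar>k y\<bar> * (A k u + ?N * ennreal (W u y)) \<partial>lborel) = 
      (\<integral>\<^sup>+y. ennreal \<bar>k y\<bar> * A k u + ?N * (ennreal \<bar>k y\<bar> * ennreal (W u y)) \<partial>lborel)"
      by (intro nn_integral_cong) (simp add: distrib_left mult_ac)
    also have "\<dots> = ?N * A k u + ?N * A k u"
      unfolding A_def by (subst nn_integral_add) (auto simp: nn_integral_multc nn_integral_cmult)
    finally show ?thesis .
  qed
  finally show ?thesis unfolding u_def by (simp add: mult_2 distrib_left distrib_right mult_ac)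
qed

end

lemma nn_integral_convolution:
  fixes a b :: "real \<Rightarrow> ennreal"
  assumes [measurable]: "a \<in> borel_measurable borel" "b \<in> borel_measurable borel"
  shows "(\<integral>\<^sup>+q. a (fst q) * b (snd q - fst q) \<partial>(lborel \<Otimes>\<^sub>M lborel)) = (\<integral>\<^sup>+r. a r \<partial>lborel) * (\<integral>\<^sup>+r. b r \<partial>lborel)"
proof -
  have "(\<integral>\<^sup>+q. a (fst q) * b (snd q - fst q) \<partial>(lborel \<Otimes>\<^sub>M lborel)) = (\<integral>\<^sup>+r. \<integral>\<^sup>+s. a r * b (s - r) \<partial>lborel \<partial>lborel)"
    by (subst lborel.nn_integral_fst[symmetric]) auto
  also have "\<dots> = (\<integral>\<^sup>+r. a r * (\<integral>\<^sup>+s. b (s + - r) \<partial>lborel) \<partial>lborel)"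
    by (subst nn_integral_cmult[symmetric]) auto
  also have "\<dots> = (\<integral>\<^sup>+r. a r * (\<integral>\<^sup>+s. b s \<partial>lborel) \<partial>lborel)"
    using nn_integral_real_affine[of b 1 "- r" for r] by (simp add: add.commute)
  finally show ?thesis by (simp add: nn_integral_multc)
qed

text \<open>The diagonal is a null set and symmetry makes the two open triangles equal, so a bound
  for r < s suffices, at the price of a factor 2. As the bound depends on r and on the gap s - r,
  the double integral factorises.\<close>

lemma nn_integral_square_bound:
  fixes a b :: "real \<Rightarrow> ennreal" and \<Phi> :: "real \<times> real \<Rightarrow> ennreal"
  assumes [measurable]: "a \<in> borel_measurable borel" "b \<in> borel_measurable borel" "\<Phi> \<in> borel_measurable (borel \<Otimes>\<^sub>M borel)"
    and sym: "\<And>r s. \<Phi> (r, s) = \<Phi> (s, r)"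
    and le: "\<And>r s. r < s \<Longrightarrow> \<Phi> (r, s) \<le> C * (a r * b (s - r))"
  shows "(\<integral>\<^sup>+q. \<Phi> q \<partial>(lborel \<Otimes>\<^sub>M lborel)) \<le> 2 * C * ((\<integral>\<^sup>+r. a r \<partial>lborel) * (\<integral>\<^sup>+r. b r \<partial>lborel))"
proof -
  let ?I = "(\<integral>\<^sup>+r. a r \<partial>lborel) * (\<integral>\<^sup>+r. b r \<partial>lborel)"
  let ?h = "\<lambda>q. a (fst q) * b (snd q - fst q)"
  have diag: "AE q in lborel \<Otimes>\<^sub>M (lborel :: real measure). fst q \<noteq> (snd q :: real)"
  proof (rule lborel_pair.AE_pair_measure)
    show "{q \<in> space (lborel \<Otimes>\<^sub>M lborel). fst q \<noteq> (snd q :: real)} \<in> sets (lborel \<Otimes>\<^sub>M lborel)"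
      by measurable
    show "AE x in lborel. AE y in lborel. fst (x, y) \<noteq> (snd (x, y) :: real)"
    proof (rule AE_I2)
      fix x :: real
      show "AE y in lborel. fst (x, y) \<noteq> (snd (x, y) :: real)"
        using AE_lborel_singleton[of x] by eventually_elim auto
    qed
  qed
  have "(\<integral>\<^sup>+q. \<Phi> q \<partial>(lborel \<Otimes>\<^sub>M lborel)) \<le> (\<integral>\<^sup>+q. C * ?h q + C * ?h (snd q, fst q) \<partial>(lborel \<Otimes>\<^sub>M lborel))"
  proof (rule nn_integral_mono_AE, use diag in eventually_elim)
    case (elim q)
    obtain r s where q: "q = (r, s)" by (cases q)
    show ?case
    proof (cases "r < s")
      case True
      then show ?thesis using le[of r s] unfolding q by (simp add: add_increasing2)
    next
      case False
      then have "s < r" using elim q by auto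
      then show ?thesis using le[of s r] sym[of r s] unfolding q by (simp add: add_increasing)
    qed
  qed
  also have "\<dots> = C * (\<integral>\<^sup>+q. ?h q \<partial>(lborel \<Otimes>\<^sub>M lborel)) + C * (\<integral>\<^sup>+q. ?h (snd q, fst q) \<partial>(lborel \<Otimes>\<^sub>M lborel))"
    by (subst nn_integral_add) (auto simp: nn_integral_cmult)
  also have "(\<integral>\<^sup>+q. ?h (snd q, fst q) \<partial>(lborel \<Otimes>\<^sub>M lborel)) = (\<integral>\<^sup>+q. ?h q \<partial>(lborel \<Otimes>\<^sub>M lborel))"
  proof -
    have "(\<integral>\<^sup>+q. ?h q \<partial>(lborel \<Otimes>\<^sub>M lborel)) = (\<integral>\<^sup>+q. ?h q \<partial>(distr (lborel \<Otimes>\<^sub>M lborel) (lborel \<Otimes>\<^sub>M lborel) (\<lambda>(x, y). (y, x))))"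
      by (subst lborel_pair.distr_pair_swap) simp
    also have "\<dots> = (\<integral>\<^sup>+q. ?h (snd q, fst q) \<partial>(lborel \<Otimes>\<^sub>M lborel))"
      by (subst nn_integral_distr) (auto simp: case_prod_beta)
    finally show ?thesis ..
  qed
  also have "(\<integral>\<^sup>+q. ?h q \<partial>(lborel \<Otimes>\<^sub>M lborel)) = ?I" by (rule nn_integral_convolution) auto
  finally show ?thesis by (simp add: mult_2 distrib_right mult.assoc)
qed

section \<open>Time integrals and the second moment bound\<close>

context levy_path_char begin

text \<open>Time 0 is left out because the law of the process there is a point mass; the density
  bounds hold at positive times only.\<close>

definition "K t x k r \<omega> = indicator {0<..t} r * k (X r \<omega> - x)" for k :: "real \<Rightarrow> real"

lemma K_meas:
  assumes [measurable]: "k \<in> borel_measurable borel"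
  shows "(\<lambda>q. K t x k (fst q) (snd q)) \<in> borel_measurable (lborel \<Otimes>\<^sub>M M)"
  unfolding K_def by measurable

lemma set_integral_K: "(LINT r:{0..t}|lborel. k (X r \<omega> - x)) = (LINT r|lborel. K t x k r \<omega>)"
  "set_integrable lborel {0..t} (\<lambda>r. k (X r \<omega> - x)) \<longleftrightarrow> integrable lborel (\<lambda>r. K t x k r \<omega>)"
  if [measurable]: "k \<in> borel_measurable borel" "\<omega> \<in> space M"
proof -
  have ae: "AE r in lborel. indicator {0..t} r *\<^sub>R k (X r \<omega> - x) = K t x k r \<omega>"
    using AE_lborel_singleton[of 0] by eventually_elim (auto simp: K_def indicator_def)
  have [measurable]: "(\<lambda>r. K t x k r \<omega>) \<in> borel_measurable borel" unfolding K_def by measurable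
  show "(LINT r:{0..t}|lborel. k (X r \<omega> - x)) = (LINT r|lborel. K t x k r \<omega>)"
    unfolding set_lebesgue_integral_def by (intro integral_cong_AE ae) auto
  show "set_integrable lborel {0..t} (\<lambda>r. k (X r \<omega> - x)) \<longleftrightarrow> integrable lborel (\<lambda>r. K t x k r \<omega>)"
    unfolding set_integrable_def by (intro integrable_cong_AE ae) auto
qed

lemma P_meas [measurable]: "P \<in> borel_measurable borel"
  unfolding P_def[abs_def] e_def by measurable

lemma W_joint: "(\<lambda>q. W (fst q) (snd q)) \<in> borel_measurable (borel \<Otimes>\<^sub>M borel)"
  unfolding W_def e_def by measurable

lemma W_joint' [measurable (raw)]:
  "f \<in> borel_measurable L \<Longrightarrow> h \<in> borel_measurable L \<Longrightarrow> (\<lambda>z. W (f z) (h z)) \<in> borel_measurable L"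
  using measurable_compose[OF measurable_Pair[of f L borel h borel] W_joint] by simp

lemma A_meas [measurable]:
  assumes [measurable]: "k \<in> borel_measurable borel"
  shows "A k \<in> borel_measurable borel"
  unfolding A_def[abs_def] by measurable

definition "G t = (\<integral>\<^sup>+\<theta>. kk t \<theta> \<partial>lborel)"
definition "Om t y = (\<integral>\<^sup>+\<theta>. ennreal (min 2 \<bar>\<theta> * y\<bar>) * kk t \<theta> \<partial>lborel)"

lemma e_time_integral:
  assumes t: "t \<ge> 0"
  shows "(\<integral>\<^sup>+r. ennreal (e r \<theta>) * indicator {0<..t} r \<partial>lborel) \<le> kk t \<theta>"
  unfolding kk_def
proof (rule min.boundedI)
  have "(\<integral>\<^sup>+r. ennreal (e r \<theta>) * indicator {0<..t} r \<partial>lborel) \<le> (\<integral>\<^sup>+r. indicator {0<..t} r \<partial>lborel)"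
    using psi_nonneg[of \<theta>] by (intro nn_integral_mono) (auto simp: e_def indicator_def)
  then show "(\<integral>\<^sup>+r. ennreal (e r \<theta>) * indicator {0<..t} r \<partial>lborel) \<le> ennreal t" using t by simp
  show "(\<integral>\<^sup>+r. ennreal (e r \<theta>) * indicator {0<..t} r \<partial>lborel) \<le> inverse (ennreal (\<psi> \<theta>))"
  proof (cases "\<psi> \<theta> = 0")
    case False
    then have ps: "\<psi> \<theta> > 0" using psi_nonneg[of \<theta>] by simp
    have "(\<integral>\<^sup>+r. ennreal (e r \<theta>) * indicator {0<..t} r \<partial>lborel) \<le> (\<integral>\<^sup>+r. ennreal (e r \<theta>) * indicator {0..} r \<partial>lborel)"
      by (intro nn_integral_mono) (auto simp: indicator_def)
    also have "\<dots> = ennreal (0 - (- (exp (- (0 * \<psi> \<theta>)) / \<psi> \<theta>)))"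
    proof (rule nn_integral_FTC_atLeast)
      show "((\<lambda>r. - (exp (- (r * \<psi> \<theta>)) / \<psi> \<theta>)) has_real_derivative e r \<theta>) (at r)" for r
        unfolding e_def using ps by (auto intro!: derivative_eq_intros)
      have "((\<lambda>r. exp (- (r * \<psi> \<theta>))) \<longlongrightarrow> 0) at_top"
        using ps by real_asymp
      from tendsto_minus[OF tendsto_divide_zero[OF this, of "\<psi> \<theta>"]]
      show "((\<lambda>r. - (exp (- (r * \<psi> \<theta>)) / \<psi> \<theta>)) \<longlongrightarrow> 0) at_top"
        by simp
    qed (auto simp: e_pos less_imp_le)
    also have "\<dots> = inverse (ennreal (\<psi> \<theta>))" using ps by (simp add: inverse_ennreal inverse_eq_divide)
    finally show ?thesis .
  qed simp
qed

lemma P_eq: "t > 0 \<Longrightarrow> ennreal (P t) = (\<integral>\<^sup>+\<theta>. ennreal (e t \<theta>) \<partial>lborel)"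
  unfolding P_def by (intro nn_integral_eq_integral[symmetric] e_int AE_I2) (simp_all add: less_imp_le[OF e_pos])

lemma W_eq: "t > 0 \<Longrightarrow> ennreal (W t y) = (\<integral>\<^sup>+\<theta>. ennreal (min 2 \<bar>\<theta> * y\<bar> * e t \<theta>) \<partial>lborel)"
  unfolding W_def by (intro nn_integral_eq_integral[symmetric] int_min_e AE_I2) (simp_all add: less_imp_le[OF e_pos])

lemma P_time_integral:
  assumes t: "t \<ge> 0"
  shows "(\<integral>\<^sup>+r. ennreal (P r) * indicator {0<..t} r \<partial>lborel) \<le> G t"
proof -
  have "(\<integral>\<^sup>+r. ennreal (P r) * indicator {0<..t} r \<partial>lborel) = (\<integral>\<^sup>+r. \<integral>\<^sup>+\<theta>. ennreal (e r \<theta>) * indicator {0<..t} r \<partial>lborel \<partial>lborel)"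
    by (intro nn_integral_cong) (auto simp: nn_integral_multc P_eq indicator_def)
  also have "\<dots> = (\<integral>\<^sup>+\<theta>. \<integral>\<^sup>+r. ennreal (e r \<theta>) * indicator {0<..t} r \<partial>lborel \<partial>lborel)"
    by (rule lborel_pair.Fubini'[symmetric]) (auto simp: e_def)
  also have "\<dots> \<le> G t" unfolding G_def by (intro nn_integral_mono e_time_integral t)
  finally show ?thesis .
qed

lemma W_time_integral:
  assumes t: "t \<ge> 0"
  shows "(\<integral>\<^sup>+r. ennreal (W r y) * indicator {0<..t} r \<partial>lborel) \<le> Om t y"
proof -
  have "(\<integral>\<^sup>+r. ennreal (W r y) * indicator {0<..t} r \<partial>lborel) = 
      (\<integral>\<^sup>+r. \<integral>\<^sup>+\<theta>. ennreal (min 2 \<bar>\<theta> * y\<bar>) * (ennreal (e r \<theta>) * indicator {0<..t} r) \<partial>lborel \<partial>lborel)"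
    by (intro nn_integral_cong) (auto simp: nn_integral_multc W_eq indicator_def ennreal_mult e_pos less_imp_le)
  also have "\<dots> = (\<integral>\<^sup>+\<theta>. \<integral>\<^sup>+r. ennreal (min 2 \<bar>\<theta> * y\<bar>) * (ennreal (e r \<theta>) * indicator {0<..t} r) \<partial>lborel \<partial>lborel)"
    by (rule lborel_pair.Fubini'[symmetric]) (auto simp: e_def)
  also have "\<dots> \<le> Om t y" unfolding Om_def
    by (subst nn_integral_cmult) (auto simp: e_def[abs_def, symmetric] intro!: nn_integral_mono mult_left_mono e_time_integral t)
  finally show ?thesis .
qed

lemma A_time_integral:
  assumes t: "t \<ge> 0" and [measurable]: "k \<in> borel_measurable borel"
  shows "(\<integral>\<^sup>+r. A k r * indicator {0<..t} r \<partial>lborel) \<le> (\<integral>\<^sup>+y. ennreal \<bar>k y\<bar> * Om t y \<partial>lborel)"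
proof -
  have "(\<integral>\<^sup>+r. A k r * indicator {0<..t} r \<partial>lborel) = (\<integral>\<^sup>+r. \<integral>\<^sup>+y. ennreal \<bar>k y\<bar> * (ennreal (W r y) * indicator {0<..t} r) \<partial>lborel \<partial>lborel)"
    unfolding A_def by (intro nn_integral_cong) (auto simp: nn_integral_multc indicator_def)
  also have "\<dots> = (\<integral>\<^sup>+y. \<integral>\<^sup>+r. ennreal \<bar>k y\<bar> * (ennreal (W r y) * indicator {0<..t} r) \<partial>lborel \<partial>lborel)"
    by (rule lborel_pair.Fubini'[symmetric]) (auto simp: W_def e_def)
  also have "\<dots> \<le> (\<integral>\<^sup>+y. ennreal \<bar>k y\<bar> * Om t y \<partial>lborel)"
  proof (rule nn_integral_mono)
    fix y
    have [measurable]: "(\<lambda>r. W r y) \<in> borel_measurable borel" unfolding W_def e_def by measurable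
    show "(\<integral>\<^sup>+r. ennreal \<bar>k y\<bar> * (ennreal (W r y) * indicator {0<..t} r) \<partial>lborel) \<le> ennreal \<bar>k y\<bar> * Om t y"
      by (subst nn_integral_cmult) (auto intro!: mult_left_mono W_time_integral t)
  qed
  finally show ?thesis .
qed

lemma G_finite: "G t < \<infinity>"
proof -
  have "G t \<le> (\<integral>\<^sup>+\<theta>. ennreal t * indicator {-1..1} \<theta> + inverse (ennreal (\<psi> \<theta>)) * indicator {\<theta>. \<bar>\<theta>\<bar> > 1} \<theta> \<partial>lborel)"
    unfolding G_def kk_def by (intro nn_integral_mono) (auto simp: indicator_def min_def)
  also have "\<dots> = ennreal t * (\<integral>\<^sup>+\<theta>. indicator {-1..1::real} \<theta> \<partial>lborel) + (\<integral>\<^sup>+\<theta>. inverse (ennreal (\<psi> \<theta>)) * indicator {\<theta>. \<bar>\<theta>\<bar> > 1} \<theta> \<partial>lborel)"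
    by (subst nn_integral_add) (auto simp: nn_integral_cmult)
  also have "\<dots> < \<infinity>"
    using inverse_psi by (simp add: ennreal_mult_less_top)
  finally show ?thesis .
qed

text \<open>The density of \<open>X r\<close> is at most \<open>P r\<close>, whose time integral is
  at most \<open>G t\<close>. In particular the path integral of an integrable, possibly unbounded
  kernel converges almost surely.\<close>

lemma nn_occupation_bound:
  fixes h :: "real \<Rightarrow> ennreal"
  assumes t: "t \<ge> 0" and [measurable]: "h \<in> borel_measurable borel"
  shows "(\<integral>\<^sup>+\<omega>. (\<integral>\<^sup>+r. indicator {0<..t} r * h (X r \<omega> - x) \<partial>lborel) \<partial>M) \<le> G t * (\<integral>\<^sup>+y. h y \<partial>lborel)"
proof -
  interpret LM: pair_sigma_finite lborel M ..
  have "(\<integral>\<^sup>+\<omega>. (\<integral>\<^sup>+r. indicator {0<..t} r * h (X r \<omega> - x) \<partial>lborel) \<partial>M) = 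
    (\<integral>\<^sup>+r. (\<integral>\<^sup>+\<omega>. indicator {0<..t} r * h (X r \<omega> - x) \<partial>M) \<partial>lborel)"
    by (rule LM.Fubini') measurable
  also have "\<dots> \<le> (\<integral>\<^sup>+r. ennreal (P r) * indicator {0<..t} r * (\<integral>\<^sup>+y. h y \<partial>lborel) \<partial>lborel)"
    by (intro nn_integral_mono) (auto simp: indicator_def nn_expectation_bound)
  also have "\<dots> = (\<integral>\<^sup>+r. ennreal (P r) * indicator {0<..t} r \<partial>lborel) * (\<integral>\<^sup>+y. h y \<partial>lborel)"
    by (rule nn_integral_multc) auto
  also have "\<dots> \<le> G t * (\<integral>\<^sup>+y. h y \<partial>lborel)"
    by (intro mult_right_mono P_time_integral t) auto
  finally show ?thesis .
qed

lemma AE_integrable_K: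
  assumes t: "t \<ge> 0" and k: "integrable lborel k"
  shows "AE \<omega> in M. integrable lborel (\<lambda>r. K t x k r \<omega>)"
proof -
  have km [measurable]: "k \<in> borel_measurable borel" using k by auto
  have "(\<integral>\<^sup>+\<omega>. (\<integral>\<^sup>+r. indicator {0<..t} r * ennreal \<bar>k (X r \<omega> - x)\<bar> \<partial>lborel) \<partial>M) \<le> G t * (\<integral>\<^sup>+y. ennreal \<bar>k y\<bar> \<partial>lborel)"
    by (rule nn_occupation_bound) (use t in auto)
  also have "\<dots> < \<infinity>" using k G_finite by (auto simp: integrable_iff_bounded ennreal_mult_less_top)
  finally have "AE \<omega> in M. (\<integral>\<^sup>+r. indicator {0<..t} r * ennreal \<bar>k (X r \<omega> - x)\<bar> \<partial>lborel) \<noteq> \<infinity>"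
    by (intro nn_integral_noteq_infinite) auto
  then show ?thesis using AE_space
  proof eventually_elim
    case (elim \<omega>)
    have [measurable]: "\<omega> \<in> space M" by fact
    show ?case
    proof (rule integrableI_bounded)
      show "(\<lambda>r. K t x k r \<omega>) \<in> borel_measurable lborel" unfolding K_def by measurable
      have "(\<integral>\<^sup>+r. ennreal (norm (K t x k r \<omega>)) \<partial>lborel) = (\<integral>\<^sup>+r. indicator {0<..t} r * ennreal \<bar>k (X r \<omega> - x)\<bar> \<partial>lborel)"
        by (intro nn_integral_cong) (auto simp: K_def indicator_def)
      then show "(\<integral>\<^sup>+r. ennreal (norm (K t x k r \<omega>)) \<partial>lborel) < \<infinity>" using elim by (simp add: less_top)
    qed
  qed
qed

text \<open>The square of the occupation integral is a double integral over pairs of times, and the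
  expectation is moved inside. \<open>nn_expectation_pair\<close> justifies this exchange, then
  \<open>expectation_pair_bound\<close> brings in the cancellation. The factor 4 is 2 from the two
  triangles times 2 from the covariance bound.\<close>

theorem occupation_L2_bound:
  assumes t: "t \<ge> 0" and k: "integrable lborel k" "(LINT y|lborel. k y) = 0"
  shows "(\<integral>\<^sup>+\<omega>. ennreal ((LINT r:{0..t}|lborel. k (X r \<omega> - x))\<^sup>2) \<partial>M) \<le>
    4 * (\<integral>\<^sup>+y. ennreal \<bar>k y\<bar> \<partial>lborel) * (G t * (\<integral>\<^sup>+y. ennreal \<bar>k y\<bar> * Om t y \<partial>lborel))"
proof -
  have km [measurable]: "k \<in> borel_measurable borel" using k by auto
  let ?N = "\<integral>\<^sup>+y. ennreal \<bar>k y\<bar> \<partial>lborel"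
  have Nfin: "?N < \<infinity>" using k(1) by (simp add: integrable_iff_bounded)
  let ?Q = "lborel \<Otimes>\<^sub>M lborel :: (real \<times> real) measure"
  interpret Q: sigma_finite_measure ?Q unfolding lborel_prod by (rule sigma_finite_lborel)
  interpret QM: pair_sigma_finite ?Q M ..
  define \<kappa> where "\<kappa> = K t x k"
  have kappa_meas [measurable]: "(\<lambda>q. \<kappa> (fst q) (snd q)) \<in> borel_measurable (lborel \<Otimes>\<^sub>M M)"
    unfolding \<kappa>_def by (rule K_meas) simp
  have km2 [measurable (raw)]: "(\<lambda>z. \<kappa> (f z) (g z)) \<in> borel_measurable L" 
    if "f \<in> borel_measurable L" "g \<in> measurable L M" for f g and L :: "'z measure"
    using measurable_compose[OF measurable_Pair[of f L lborel g M] kappa_meas] that by simp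
  \<comment> \<open>The absolute version of the covariance; its finite integral gives integrability
    on the product of the time square and the probability space.\<close>
  define \<Phi> where "\<Phi> q = (\<integral>\<^sup>+\<omega>. ennreal \<bar>\<kappa> (fst q) \<omega> * \<kappa> (snd q) \<omega>\<bar> \<partial>M)" for q
  have "(\<integral>\<^sup>+q. \<Phi> q \<partial>?Q) \<le> 2 * ?N\<^sup>2 * ((\<integral>\<^sup>+r. ennreal (P r) * indicator {0<..t} r \<partial>lborel) * (\<integral>\<^sup>+r. ennreal (P r) * indicator {0<..t} r \<partial>lborel))"
  proof (rule nn_integral_square_bound)
    show "\<Phi> \<in> borel_measurable (borel \<Otimes>\<^sub>M borel)" unfolding \<Phi>_def[abs_def] by measurable
    show "\<Phi> (r, s) = \<Phi> (s, r)" for r s unfolding \<Phi>_def by (simp add: mult.commute)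
    fix r s :: real assume rs: "r < s"
    show "\<Phi> (r, s) \<le> ?N\<^sup>2 * (ennreal (P r) * indicator {0<..t} r * (ennreal (P (s - r)) * indicator {0<..t} (s - r)))"
    proof (cases "0 < r \<and> s \<le> t")
      case True
      have "\<Phi> (r, s) = (\<integral>\<^sup>+\<omega>. ennreal \<bar>k (X r \<omega> - x)\<bar> * ennreal \<bar>k (X s \<omega> - x)\<bar> \<partial>M)"
        unfolding \<Phi>_def \<kappa>_def K_def using True rs by (simp add: abs_mult ennreal_mult)
      also have "\<dots> \<le> ?N\<^sup>2 * (ennreal (P r) * ennreal (P (s - r)))"
        using True rs by (intro nn_expectation_pair) auto
      finally show ?thesis using True rs by simp
    next
      case False
      then have "\<Phi> (r, s) = 0" using rs unfolding \<Phi>_def \<kappa>_def K_def by (auto simp: indicator_def)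
      then show ?thesis by simp
    qed
  qed auto
  also have "\<dots> \<le> 2 * ?N\<^sup>2 * (G t * G t)"
    by (intro mult_left_mono mult_mono P_time_integral t) auto
  also have "\<dots> < \<infinity>" using Nfin G_finite[of t] by (auto simp: ennreal_mult_less_top power2_eq_square)
  finally have Phi_fin: "(\<integral>\<^sup>+q. \<Phi> q \<partial>?Q) < \<infinity>" .
  have int: "integrable (?Q \<Otimes>\<^sub>M M) (\<lambda>(q, \<omega>). \<kappa> (fst q) \<omega> * \<kappa> (snd q) \<omega>)"
  proof (rule integrableI_bounded)
    show "(\<lambda>(q, \<omega>). \<kappa> (fst q) \<omega> * \<kappa> (snd q) \<omega>) \<in> borel_measurable (?Q \<Otimes>\<^sub>M M)" by measurable
    have "(\<integral>\<^sup>+z. ennreal (norm (case z of (q, \<omega>) \<Rightarrow> \<kappa> (fst q) \<omega> * \<kappa> (snd q) \<omega>)) \<partial>(?Q \<Otimes>\<^sub>M M)) = (\<integral>\<^sup>+q. \<Phi> q \<partial>?Q)"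
      unfolding \<Phi>_def by (subst nn_integral_fst[symmetric]) auto
    then show "(\<integral>\<^sup>+z. ennreal (norm (case z of (q, \<omega>) \<Rightarrow> \<kappa> (fst q) \<omega> * \<kappa> (snd q) \<omega>)) \<partial>(?Q \<Otimes>\<^sub>M M)) < \<infinity>"
      using Phi_fin by simp
  qed
  define S where "S \<omega> = (LINT r|lborel. \<kappa> r \<omega>)" for \<omega>
  have Sm [measurable]: "S \<in> borel_measurable M" unfolding S_def by measurable
  have S2: "AE \<omega> in M. (LINT q|?Q. \<kappa> (fst q) \<omega> * \<kappa> (snd q) \<omega>) = (S \<omega>)\<^sup>2"
    using QM.AE_integrable_snd[OF int] AE_integrable_K[OF t k(1), of x]
  proof eventually_elim
    case (elim \<omega>)
    have "(LINT q|?Q. \<kappa> (fst q) \<omega> * \<kappa> (snd q) \<omega>) = (LINT r|lborel. LINT s|lborel. \<kappa> r \<omega> * \<kappa> s \<omega>)"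
      using lborel_pair.integral_fst'[of "\<lambda>q. \<kappa> (fst q) \<omega> * \<kappa> (snd q) \<omega>"] elim by (simp add: case_prod_beta)
    also have "\<dots> = (S \<omega>)\<^sup>2" unfolding S_def by (simp add: power2_eq_square)
    finally show ?case .
  qed
  have intS: "integrable M (\<lambda>\<omega>. (S \<omega>)\<^sup>2)"
    using QM.integrable_snd[OF int] by (rule integrable_cong_AE_imp) (use S2 in \<open>auto simp: eq_commute\<close>)
  have "(\<integral>\<^sup>+\<omega>. ennreal ((LINT r:{0..t}|lborel. k (X r \<omega> - x))\<^sup>2) \<partial>M) = (\<integral>\<^sup>+\<omega>. ennreal ((S \<omega>)\<^sup>2) \<partial>M)"
    by (intro nn_integral_cong) (simp add: S_def \<kappa>_def set_integral_K)
  also have "\<dots> = ennreal (LINT \<omega>|M. (S \<omega>)\<^sup>2)"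
    using intS by (intro nn_integral_eq_integral) auto
  also have "(LINT \<omega>|M. (S \<omega>)\<^sup>2) = (LINT \<omega>|M. LINT q|?Q. \<kappa> (fst q) \<omega> * \<kappa> (snd q) \<omega>)"
    using S2 by (intro integral_cong_AE) (auto simp: eq_commute)
  also have "\<dots> = (LINT q|?Q. LINT \<omega>|M. \<kappa> (fst q) \<omega> * \<kappa> (snd q) \<omega>)"
    using QM.Fubini_integral[OF int] by simp
  also have "ennreal \<dots> \<le> ennreal (norm (LINT q|?Q. LINT \<omega>|M. \<kappa> (fst q) \<omega> * \<kappa> (snd q) \<omega>))"
    by (intro ennreal_leI) simp
  also have "\<dots> \<le> (\<integral>\<^sup>+q. ennreal \<bar>LINT \<omega>|M. \<kappa> (fst q) \<omega> * \<kappa> (snd q) \<omega>\<bar> \<partial>?Q)"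
    using integral_norm_bound_ennreal[OF QM.integrable_fst[OF int]] by (simp add: case_prod_beta)
  also have "\<dots> \<le> 2 * (2 * ?N) * ((\<integral>\<^sup>+r. ennreal (P r) * indicator {0<..t} r \<partial>lborel) * (\<integral>\<^sup>+r. A k r * indicator {0<..t} r \<partial>lborel))"
  proof (rule nn_integral_square_bound)
    show "(\<lambda>q. ennreal \<bar>LINT \<omega>|M. \<kappa> (fst q) \<omega> * \<kappa> (snd q) \<omega>\<bar>) \<in> borel_measurable (borel \<Otimes>\<^sub>M borel)" by measurable
    fix r s :: real
    show "ennreal \<bar>LINT \<omega>|M. \<kappa> (fst (r, s)) \<omega> * \<kappa> (snd (r, s)) \<omega>\<bar> = ennreal \<bar>LINT \<omega>|M. \<kappa> (fst (s, r)) \<omega> * \<kappa> (snd (s, r)) \<omega>\<bar>" 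
      by (simp add: mult.commute)
    assume rs: "r < s"
    show "ennreal \<bar>LINT \<omega>|M. \<kappa> (fst (r, s)) \<omega> * \<kappa> (snd (r, s)) \<omega>\<bar> \<le>
       2 * ?N * (ennreal (P r) * indicator {0<..t} r * (A k (s - r) * indicator {0<..t} (s - r)))"
    proof (cases "0 < r \<and> s \<le> t")
      case True
      have "ennreal \<bar>LINT \<omega>|M. \<kappa> (fst (r, s)) \<omega> * \<kappa> (snd (r, s)) \<omega>\<bar> = ennreal \<bar>expectation (\<lambda>\<omega>. k (X r \<omega> - x) * k (X s \<omega> - x))\<bar>"
        unfolding \<kappa>_def K_def using True rs by simp
      also have "\<dots> \<le> 2 * ?N * (ennreal (P r) * A k (s - r))"
        using True rs by (intro expectation_pair_bound k) auto
      finally show ?thesis using True rs by simp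
    next
      case False
      then have "(LINT \<omega>|M. \<kappa> (fst (r, s)) \<omega> * \<kappa> (snd (r, s)) \<omega>) = 0" using rs unfolding \<kappa>_def K_def by (auto simp: indicator_def)
      then show ?thesis by simp
    qed
  qed auto
  also have "\<dots> \<le> 2 * (2 * ?N) * (G t * (\<integral>\<^sup>+y. ennreal \<bar>k y\<bar> * Om t y \<partial>lborel))"
    by (intro mult_left_mono mult_mono P_time_integral A_time_integral t km) auto
  finally show ?thesis by (simp add: mult.assoc[symmetric])
qed

end

section \<open>Tent kernels and the replacement of the scaled kernel\<close>

definition tent :: "real \<Rightarrow> real \<Rightarrow> real" where
  "tent \<epsilon> y = max 0 (1 - \<bar>y\<bar> / \<epsilon>) / \<epsilon>"

lemma tent_meas [measurable]: "tent \<epsilon> \<in> borel_measurable borel"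
  unfolding tent_def[abs_def] by measurable

lemma tent_nonneg: "\<epsilon> > 0 \<Longrightarrow> tent \<epsilon> y \<ge> 0" by (simp add: tent_def)

lemma tent_le: "\<epsilon> > 0 \<Longrightarrow> tent \<epsilon> y \<le> 1 / \<epsilon>" by (simp add: tent_def divide_right_mono)

lemma tent_support: "\<epsilon> > 0 \<Longrightarrow> \<bar>y\<bar> \<ge> \<epsilon> \<Longrightarrow> tent \<epsilon> y = 0" by (simp add: tent_def)

text \<open>The Lipschitz bound is the reason for tents instead of normalised indicators: it
  controls the time discretisation of their occupation integrals.\<close>

lemma tent_lipschitz: "\<epsilon> > 0 \<Longrightarrow> \<bar>tent \<epsilon> y - tent \<epsilon> z\<bar> \<le> \<bar>y - z\<bar> / \<epsilon>\<^sup>2"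
proof -
  assume e: "\<epsilon> > 0"
  have "\<bar>max 0 (1 - \<bar>y\<bar> / \<epsilon>) - max 0 (1 - \<bar>z\<bar> / \<epsilon>)\<bar> \<le> \<bar>\<bar>y\<bar> / \<epsilon> - \<bar>z\<bar> / \<epsilon>\<bar>" by linarith
  also have "\<dots> = \<bar>\<bar>y\<bar> - \<bar>z\<bar>\<bar> / \<epsilon>" using e by (simp add: diff_divide_distrib[symmetric])
  also have "\<dots> \<le> \<bar>y - z\<bar> / \<epsilon>" using e by (intro divide_right_mono) auto
  finally have "\<bar>max 0 (1 - \<bar>y\<bar> / \<epsilon>) - max 0 (1 - \<bar>z\<bar> / \<epsilon>)\<bar> / \<epsilon> \<le> \<bar>y - z\<bar> / \<epsilon> / \<epsilon>"
    using e by (intro divide_right_mono) auto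
  then show ?thesis using e by (simp add: tent_def diff_divide_distrib[symmetric] power2_eq_square)
qed

lemma tent_integral:
  assumes e: "\<epsilon> > 0"
  shows "integrable lborel (tent \<epsilon>)" "(LINT y|lborel. tent \<epsilon> y) = 1"
proof -
  have F: "(LINT y|lborel. (1 - y) * indicator {0..1} y) = (1 - 1\<^sup>2 / 2) - (0 - 0\<^sup>2 / 2 :: real)"
    by (rule integral_FTC_Icc_real) (auto intro!: derivative_eq_intros continuous_intros)
  have i: "integrable lborel (\<lambda>y::real. (1 - y) * indicator {0..1} y)"
    using borel_integrable_atLeastAtMost[of 0 1 "\<lambda>y. 1 - y :: real"] by (simp add: mult.commute)
  have i': "integrable lborel (\<lambda>y::real. (1 - (- y)) * indicator {0..1} (- y))"
    using lborel_integrable_real_affine[OF i, of "-1" 0] by simp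
  have F': "(LINT y|lborel. (1 - (- y)) * indicator {0..1} (- y :: real)) = 1 / 2"
    using lborel_integral_real_affine[of "-1" "\<lambda>y::real. (1 - y) * indicator {0..1} y" 0] F by simp
  have ae: "AE y in lborel. (1 - y) * indicator {0..1} y + (1 - (- y)) * indicator {0..1} (- y) = tent 1 y"
    using AE_lborel_singleton[of 0] by eventually_elim (auto simp: indicator_def tent_def max_def)
  have i1: "integrable lborel (tent 1)"
    by (rule integrable_cong_AE_imp[OF Bochner_Integration.integrable_add[OF i i'] _ ae]) simp
  have I1: "(LINT y|lborel. tent 1 y) = 1"
  proof -
    have "(LINT y|lborel. tent 1 y) = (LINT y|lborel. (1 - y) * indicator {0..1} y + (1 - (- y)) * indicator {0..1} (- y))"
      using ae by (intro integral_cong_AE) (auto simp: eq_commute)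
    also have "\<dots> = 1" by (subst Bochner_Integration.integral_add[OF i i']) (simp only: F F', simp)
    finally show ?thesis .
  qed
  have s: "tent \<epsilon> = (\<lambda>y. (1 / \<epsilon>) * tent 1 (0 + (1 / \<epsilon>) * y))"
    using e by (auto simp: tent_def fun_eq_iff abs_mult)
  show "integrable lborel (tent \<epsilon>)" unfolding s
    using e lborel_integrable_real_affine[OF i1, of "1/\<epsilon>" 0] by (intro integrable_mult_right) auto
  show "(LINT y|lborel. tent \<epsilon> y) = 1"
    using lborel_integral_real_affine[of "1/\<epsilon>" "tent 1" 0] e I1 unfolding s by simp
qed

lemma tail_integral_tendsto_0:
  assumes "integrable lborel (\<phi> :: real \<Rightarrow> real)" and d: "d > 0"
  shows "((\<lambda>R. LINT y|lborel. indicator {y. \<bar>y\<bar> > R * d} y * \<bar>\<phi> y\<bar>) \<longlongrightarrow> 0) at_top"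
proof -
  have [measurable]: "\<phi> \<in> borel_measurable borel" using assms by auto
  have "((\<lambda>R. LINT y|lborel. indicator {y. \<bar>y\<bar> > R * d} y * \<bar>\<phi> y\<bar>) \<longlongrightarrow> integral\<^sup>L lborel (\<lambda>_::real. 0::real)) at_top"
  proof (rule integral_dominated_convergence_at_top[where w="\<lambda>y. \<bar>\<phi> y\<bar>"
        and s="\<lambda>R y. indicator {y. \<bar>y\<bar> > R * d} y * \<bar>\<phi> y\<bar>" and f="\<lambda>_. 0"])
    show "AE y in lborel. ((\<lambda>R. indicator {y. \<bar>y\<bar> > R * d} y * \<bar>\<phi> y\<bar>) \<longlongrightarrow> 0) at_top"
    proof (intro AE_I2 tendsto_eventually)
      fix y :: real
      show "\<forall>\<^sub>F R in at_top. indicator {y. \<bar>y\<bar> > R * d} y * \<bar>\<phi> y\<bar> = 0"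
        using eventually_ge_at_top[of "\<bar>y\<bar> / d"] by eventually_elim (use d in \<open>auto simp: indicator_def field_simps\<close>)
    qed
  qed (use assms in \<open>auto simp: indicator_def\<close>)
  then show ?thesis by simp
qed

context levy_path_char begin

lemma G_le: "G t \<le> ennreal (2 * L * t) + (\<integral>\<^sup>+\<theta>. inverse (ennreal (\<psi> \<theta>)) * indicator {\<theta>. \<bar>\<theta>\<bar> > L} \<theta> \<partial>lborel)"
  if "L \<ge> 0" "t \<ge> 0"
proof -
  have "G t \<le> (\<integral>\<^sup>+\<theta>. ennreal t * indicator {-L..L} \<theta> + inverse (ennreal (\<psi> \<theta>)) * indicator {\<theta>. \<bar>\<theta>\<bar> > L} \<theta> \<partial>lborel)"
    unfolding G_def kk_def by (intro nn_integral_mono) (auto simp: indicator_def min_def)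
  also have "\<dots> = ennreal t * (\<integral>\<^sup>+\<theta>. indicator {-L..L::real} \<theta> \<partial>lborel) + (\<integral>\<^sup>+\<theta>. inverse (ennreal (\<psi> \<theta>)) * indicator {\<theta>. \<bar>\<theta>\<bar> > L} \<theta> \<partial>lborel)"
    by (subst nn_integral_add) (auto simp: nn_integral_cmult)
  also have "ennreal t * (\<integral>\<^sup>+\<theta>. indicator {-L..L::real} \<theta> \<partial>lborel) = ennreal (2 * L * t)"
    using that by (simp add: ennreal_mult[symmetric] mult_ac)
  finally show ?thesis .
qed

text \<open>Frequencies up to \<open>L\<close> see
  \<open>\<bar>\<theta> * y\<bar> \<le> L * d\<close> and a time integral of at most t; higher ones
  are left to the inverse exponent and the truncation at 2. Hence \<open>L\<close> is chosen first,
  to make the second term small, and \<open>d\<close> afterwards, to make the first one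
  small.\<close>

lemma Om_le: "Om t y \<le> ennreal (2 * L * (L * d * t)) + 2 * (\<integral>\<^sup>+\<theta>. inverse (ennreal (\<psi> \<theta>)) * indicator {\<theta>. \<bar>\<theta>\<bar> > L} \<theta> \<partial>lborel)"
  if L: "L \<ge> 0" "t \<ge> 0" "\<bar>y\<bar> \<le> d"
proof -
  have "Om t y \<le> (\<integral>\<^sup>+\<theta>. ennreal (L * d * t) * indicator {-L..L} \<theta> + 2 * (inverse (ennreal (\<psi> \<theta>)) * indicator {\<theta>. \<bar>\<theta>\<bar> > L} \<theta>) \<partial>lborel)"
    unfolding Om_def
  proof (rule nn_integral_mono)
    fix \<theta>
    show "ennreal (min 2 \<bar>\<theta> * y\<bar>) * kk t \<theta> \<le> ennreal (L * d * t) * indicator {-L..L} \<theta> + 2 * (inverse (ennreal (\<psi> \<theta>)) * indicator {\<theta>. \<bar>\<theta>\<bar> > L} \<theta>)"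
    proof (cases "\<bar>\<theta>\<bar> \<le> L")
      case True
      have "\<bar>\<theta> * y\<bar> \<le> L * d" unfolding abs_mult using True L by (intro mult_mono) auto
      then have "ennreal (min 2 \<bar>\<theta> * y\<bar>) * kk t \<theta> \<le> ennreal (L * d) * ennreal t"
        unfolding kk_def by (intro mult_mono ennreal_leI) auto
      also have "\<dots> = ennreal (L * d * t)" using L by (subst ennreal_mult) auto
      finally show ?thesis using True by (auto simp: indicator_def abs_le_iff)
    next
      case False
      have "ennreal (min 2 \<bar>\<theta> * y\<bar>) * kk t \<theta> \<le> ennreal 2 * inverse (ennreal (\<psi> \<theta>))"
        unfolding kk_def by (intro mult_mono ennreal_leI) auto
      then show ?thesis using False by (auto simp: indicator_def)
    qed
  qed
  also have "\<dots> = ennreal (L * d * t) * (\<integral>\<^sup>+\<theta>. indicator {-L..L::real} \<theta> \<partial>lborel) + 2 * (\<integral>\<^sup>+\<theta>. inverse (ennreal (\<psi> \<theta>)) * indicator {\<theta>. \<bar>\<theta>\<bar> > L} \<theta> \<partial>lborel)"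
    by (subst nn_integral_add) (auto simp: nn_integral_cmult)
  also have "ennreal (L * d * t) * (\<integral>\<^sup>+\<theta>. indicator {-L..L::real} \<theta> \<partial>lborel) = ennreal (2 * L * (L * d * t))"
    using that by (simp add: ennreal_mult[symmetric] mult_ac)
  finally show ?thesis .
qed

text \<open>A crude bound for the small part of the kernel lying far from 0, where there is no gain
  from closeness.\<close>

lemma Om_le_G: "Om t y \<le> 2 * G t"
proof -
  have "Om t y \<le> (\<integral>\<^sup>+\<theta>. 2 * kk t \<theta> \<partial>lborel)" unfolding Om_def
  proof (intro nn_integral_mono mult_right_mono)
    fix \<theta>
    have "ennreal (min 2 \<bar>\<theta> * y\<bar>) \<le> ennreal 2" by (intro ennreal_leI) auto
    then show "ennreal (min 2 \<bar>\<theta> * y\<bar>) \<le> 2" by simp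
  qed auto
  also have "\<dots> = 2 * G t" unfolding G_def by (subst nn_integral_cmult) auto
  finally show ?thesis .
qed

text \<open>In the application the truncation level \<open>L\<close> (for \<open>G\<close>) is fixed once and for all, while \<open>L'\<close>
  (for \<open>Om\<close>) depends on the target accuracy.\<close>

lemma occupation_L2_explicit:
  assumes t: "t \<ge> 0" and k: "integrable lborel k" "(LINT y|lborel. k y) = 0" "(LINT y|lborel. \<bar>k y\<bar>) \<le> n"
    and L: "L \<ge> 0" "(\<integral>\<^sup>+\<theta>. inverse (ennreal (\<psi> \<theta>)) * indicator {\<theta>. \<bar>\<theta>\<bar> > L} \<theta> \<partial>lborel) \<le> ennreal 1"
    and L': "L' \<ge> 0" "(\<integral>\<^sup>+\<theta>. inverse (ennreal (\<psi> \<theta>)) * indicator {\<theta>. \<bar>\<theta>\<bar> > L'} \<theta> \<partial>lborel) \<le> ennreal \<epsilon>'" "\<epsilon>' \<ge> 0"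
    and d: "d \<ge> 0" and tail: "(LINT y|lborel. indicator {y. \<bar>y\<bar> > d} y * \<bar>k y\<bar>) \<le> \<tau>"
  shows "(\<integral>\<^sup>+\<omega>. ennreal ((LINT r:{0..t}|lborel. k (X r \<omega> - x))\<^sup>2) \<partial>M) \<le>
    ennreal (4 * n * ((2 * L * t + 1) * (n * (2 * L' * (L' * d * t) + 2 * \<epsilon>') + 2 * (2 * L * t + 1) * \<tau>)))"
proof -
  have km [measurable]: "k \<in> borel_measurable borel" using k by auto
  have n0: "n \<ge> 0" using k(3) by (rule order.trans[rotated]) (auto intro!: integral_nonneg_AE)
  have tau0: "\<tau> \<ge> 0" using tail by (rule order.trans[rotated]) (auto intro!: integral_nonneg_AE)
  let ?g = "2 * L * t + 1" and ?o = "2 * L' * (L' * d * t) + 2 * \<epsilon>'"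
  have g0: "?g \<ge> 0" using L t by auto
  have o0: "?o \<ge> 0" using L' d t by auto
  have N: "(\<integral>\<^sup>+y. ennreal \<bar>k y\<bar> \<partial>lborel) \<le> ennreal n"
    using k by (subst nn_integral_eq_integral) (auto intro: ennreal_leI)
  have G: "G t \<le> ennreal ?g"
    using order.trans[OF G_le[OF L(1) t] add_left_mono[OF L(2)]] L t by (subst ennreal_plus) auto
  have O: "Om t y \<le> ennreal ?o" if "\<bar>y\<bar> \<le> d" for y
  proof -
    have "Om t y \<le> ennreal (2 * L' * (L' * d * t)) + 2 * ennreal \<epsilon>'"
      by (rule order.trans[OF Om_le[OF L'(1) t that] add_left_mono[OF mult_left_mono[OF L'(2)]]]) auto
    also have "\<dots> = ennreal ?o" using L' d t by (simp add: ennreal_mult)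
    finally show ?thesis .
  qed
  have "(\<integral>\<^sup>+y. ennreal \<bar>k y\<bar> * Om t y \<partial>lborel) \<le>
    (\<integral>\<^sup>+y. ennreal \<bar>k y\<bar> * ennreal ?o + ennreal (indicator {y. \<bar>y\<bar> > d} y * \<bar>k y\<bar>) * ennreal (2 * ?g) \<partial>lborel)"
  proof (rule nn_integral_mono)
    fix y
    show "ennreal \<bar>k y\<bar> * Om t y \<le> ennreal \<bar>k y\<bar> * ennreal ?o + ennreal (indicator {y. \<bar>y\<bar> > d} y * \<bar>k y\<bar>) * ennreal (2 * ?g)"
    proof (cases "\<bar>y\<bar> \<le> d")
      case True
      then show ?thesis using O[OF True] by (simp add: add_increasing2 mult_left_mono)
    next
      case False
      have "Om t y \<le> 2 * ennreal ?g" by (rule order.trans[OF Om_le_G mult_left_mono[OF G]]) auto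
      also have "\<dots> = ennreal (2 * ?g)" using g0 by (subst ennreal_mult) auto
      finally show ?thesis using False by (simp add: add_increasing mult_left_mono)
    qed
  qed
  also have "\<dots> = (\<integral>\<^sup>+y. ennreal \<bar>k y\<bar> \<partial>lborel) * ennreal ?o + (\<integral>\<^sup>+y. ennreal (indicator {y. \<bar>y\<bar> > d} y * \<bar>k y\<bar>) \<partial>lborel) * ennreal (2 * ?g)"
    by (subst nn_integral_add) (auto simp: nn_integral_multc)
  also have "\<dots> \<le> ennreal n * ennreal ?o + ennreal \<tau> * ennreal (2 * ?g)"
  proof (intro add_mono mult_right_mono N)
    have "integrable lborel (\<lambda>y. indicator {y. \<bar>y\<bar> > d} y * \<bar>k y\<bar>)"
      using integrable_mult_indicator[of "{y. \<bar>y\<bar> > d}" lborel "\<lambda>y. \<bar>k y\<bar>"] k by simp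
    then show "(\<integral>\<^sup>+y. ennreal (indicator {y. \<bar>y\<bar> > d} y * \<bar>k y\<bar>) \<partial>lborel) \<le> ennreal \<tau>"
      using tail by (subst nn_integral_eq_integral) (auto intro: ennreal_leI)
  qed auto
  also have "\<dots> = ennreal (n * ?o + \<tau> * (2 * ?g))"
    using n0 o0 tau0 g0 by (simp only: ennreal_mult[symmetric] ennreal_plus[symmetric] mult_nonneg_nonneg zero_le_numeral)
  finally have KO: "(\<integral>\<^sup>+y. ennreal \<bar>k y\<bar> * Om t y \<partial>lborel) \<le> ennreal (n * ?o + \<tau> * (2 * ?g))" .
  have "(\<integral>\<^sup>+\<omega>. ennreal ((LINT r:{0..t}|lborel. k (X r \<omega> - x))\<^sup>2) \<partial>M) \<le>
    4 * (\<integral>\<^sup>+y. ennreal \<bar>k y\<bar> \<partial>lborel) * (G t * (\<integral>\<^sup>+y. ennreal \<bar>k y\<bar> * Om t y \<partial>lborel))"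
    by (rule occupation_L2_bound[OF t k(1,2)])
  also have "\<dots> \<le> 4 * ennreal n * (ennreal ?g * ennreal (n * ?o + \<tau> * (2 * ?g)))"
    by (intro mult_mono N G KO order_refl) auto
  also have "\<dots> = ennreal (4 * n * (?g * (n * ?o + \<tau> * (2 * ?g))))"
    using n0 o0 tau0 g0 by (simp only: ennreal_mult[symmetric] ennreal_numeral[symmetric] mult_nonneg_nonneg zero_le_numeral add_nonneg_nonneg)
  finally show ?thesis by (simp add: mult_ac)
qed

end


text \<open>From the pointwise inequality that \<open>\<bar>S\<bar>\<close> is at most \<delta> plus
  the square of S divided by \<delta>. It passes from L^2 to L^1 at the price of a factor 2.\<close>

lemma nn_integral_abs_le_of_square:
  assumes d: "\<delta> > 0" and [measurable]: "S \<in> borel_measurable M"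
    and S: "(\<integral>\<^sup>+\<omega>. ennreal ((S \<omega>)\<^sup>2) \<partial>M) \<le> ennreal (\<delta>\<^sup>2)" and M: "prob_space M"
  shows "(\<integral>\<^sup>+\<omega>. ennreal \<bar>S \<omega>\<bar> \<partial>M) \<le> ennreal (2 * \<delta>)"
proof -
  interpret prob_space M by fact
  have "(\<integral>\<^sup>+\<omega>. ennreal \<bar>S \<omega>\<bar> \<partial>M) \<le> (\<integral>\<^sup>+\<omega>. ennreal \<delta> + ennreal (1 / \<delta>) * ennreal ((S \<omega>)\<^sup>2) \<partial>M)"
  proof (rule nn_integral_mono)
    fix \<omega>
    have "\<bar>S \<omega>\<bar> * \<delta> \<le> \<delta> * \<delta> + (S \<omega>)\<^sup>2"
    proof (cases "\<bar>S \<omega>\<bar> \<le> \<delta>")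
      case True then show ?thesis using d by (intro add_increasing2 mult_right_mono) auto
    next
      case False
      then have "\<bar>S \<omega>\<bar> * \<delta> \<le> \<bar>S \<omega>\<bar> * \<bar>S \<omega>\<bar>" using d by (intro mult_left_mono) auto
      then show ?thesis using d by (simp add: power2_eq_square add_increasing)
    qed
    then have "\<bar>S \<omega>\<bar> \<le> \<delta> + 1 / \<delta> * (S \<omega>)\<^sup>2" using d by (simp add: field_simps)
    then have "ennreal \<bar>S \<omega>\<bar> \<le> ennreal (\<delta> + 1 / \<delta> * (S \<omega>)\<^sup>2)" by (rule ennreal_leI)
    also have "\<dots> = ennreal \<delta> + ennreal (1 / \<delta>) * ennreal ((S \<omega>)\<^sup>2)"
      using d by (simp only: ennreal_mult[symmetric] ennreal_plus[symmetric] mult_nonneg_nonneg zero_le_power2 less_imp_le divide_nonneg_pos zero_le_one)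
    finally show "ennreal \<bar>S \<omega>\<bar> \<le> ennreal \<delta> + ennreal (1 / \<delta>) * ennreal ((S \<omega>)\<^sup>2)" .
  qed
  also have "\<dots> = ennreal \<delta> + ennreal (1 / \<delta>) * (\<integral>\<^sup>+\<omega>. ennreal ((S \<omega>)\<^sup>2) \<partial>M)"
    by (subst nn_integral_add) (auto simp: nn_integral_cmult emeasure_space_1)
  also have "\<dots> \<le> ennreal \<delta> + ennreal (1 / \<delta>) * ennreal (\<delta>\<^sup>2)"
    by (intro add_left_mono mult_left_mono S) auto
  also have "\<dots> = ennreal (2 * \<delta>)"
    using d by (simp add: ennreal_mult[symmetric] ennreal_plus[symmetric] power2_eq_square del: ennreal_plus)
  finally show ?thesis .
qed

text \<open>The difference of the scaled kernel and the tent multiplied by the integral of \<phi>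
  has integral 0, an L^1 norm bounded independently of R, and for large R almost no mass outside
  \<open>{-d..d}\<close>, since the tent lives there and the scaled kernel concentrates. The second
  moment bound then applies with constants fixed beforehand. It matters that \<open>d\<close> does
  not depend on \<epsilon>: every sufficiently narrow tent may serve, and the narrowness is decided
  later by the local time.\<close>

lemma (in regular_exponent) occupation_approximation:
  fixes X :: "real \<Rightarrow> real \<Rightarrow> 'a \<Rightarrow> real"
  assumes X: "\<forall>\<^sub>F R in at_top. levy_path_char M (X R) (\<lambda>\<theta>. R powr \<beta> / f R * \<Psi> (\<theta> / R))"
    and phi: "integrable lborel \<phi>" and t: "t \<ge> 0" and eta: "\<eta> > 0"
  shows "\<exists>d>0. \<forall>\<epsilon>. 0 < \<epsilon> \<longrightarrow> \<epsilon> \<le> d \<longrightarrow> (\<forall>\<^sub>F R in at_top.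
    (\<integral>\<^sup>+\<omega>. ennreal \<bar>(LINT r:{0..t}|lborel. R * \<phi> (R * (X R r \<omega> - x))) - (LINT y|lborel. \<phi> y) * (LINT r:{0..t}|lborel. tent \<epsilon> (X R r \<omega> - x))\<bar> \<partial>M) \<le> ennreal \<eta>)"
proof -
  have phim [measurable]: "\<phi> \<in> borel_measurable borel" using phi by auto
  define c where "c = (LINT y|lborel. \<phi> y)"
  \<comment> \<open>Each of the two kernels has L^1 norm at most that of \<phi>; the added 1 keeps
    \<open>n\<close> positive when \<phi> vanishes almost everywhere.\<close>
  define n where "n = 2 * (LINT y|lborel. \<bar>\<phi> y\<bar>) + 1"
  have phi0: "(LINT y|lborel. \<bar>\<phi> y\<bar>) \<ge> 0" by (intro integral_nonneg_AE) auto
  have n: "n > 0" using phi0 unfolding n_def by linarith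
  define \<delta> where "\<delta> = \<eta> / 2"
  have del: "\<delta> > 0" using eta by (simp add: \<delta>_def)
  define \<psi> where "\<psi> R \<theta> = R powr \<beta> / f R * \<Psi> (\<theta> / R)" for R \<theta>
  obtain L where L: "L > 0" "\<forall>\<^sub>F R in at_top. (\<integral>\<^sup>+ \<theta>. inverse (ennreal (\<psi> R \<theta>)) * indicator {\<theta>. \<bar>\<theta>\<bar> > L} \<theta> \<partial>lborel) \<le> ennreal 1"
    using inverse_tail_exponent_uniform[of 1] unfolding \<psi>_def by auto
  define g where "g = 2 * L * t + 1"
  have g: "g > 0" using L t by (simp add: g_def add_nonneg_pos)
  \<comment> \<open>\<open>q\<close> is what the innermost bracket of the bound may amount to: one
    quarter goes to the low frequencies through \<open>d\<close>, one quarter to the high ones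
    through \<open>\<epsilon>'\<close>, and one half to the mass far from 0 through
    \<open>\<tau>\<close>.\<close>
  define q where "q = \<delta>\<^sup>2 / (4 * n * g)"
  have q: "q > 0" using del n g by (simp add: q_def)
  define \<epsilon>' where "\<epsilon>' = q / (8 * n)"
  have e': "\<epsilon>' > 0" using q n by (simp add: \<epsilon>'_def)
  obtain L' where L': "L' > 0" "\<forall>\<^sub>F R in at_top. (\<integral>\<^sup>+ \<theta>. inverse (ennreal (\<psi> R \<theta>)) * indicator {\<theta>. \<bar>\<theta>\<bar> > L'} \<theta> \<partial>lborel) \<le> ennreal \<epsilon>'"
    using inverse_tail_exponent_uniform[OF e'] unfolding \<psi>_def by auto
  define d where "d = q / (4 * n * (2 * L' * L' * t + 1))"
  have lt: "2 * L' * L' * t + 1 > 0" using L' t by (simp add: add_nonneg_pos)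
  have d: "d > 0" using q n lt by (simp add: d_def)
  define \<tau> where "\<tau> = q / (4 * g)"
  have tau: "\<tau> > 0" using q g by (simp add: \<tau>_def)
  have final: "4 * n * (g * (n * (2 * L' * (L' * d * t) + 2 * \<epsilon>') + 2 * g * \<tau>)) \<le> \<delta>\<^sup>2"
  proof -
    have "n * (2 * L' * (L' * d * t)) \<le> n * ((2 * L' * L' * t + 1) * d)"
      using n d by (intro mult_left_mono) (auto simp: algebra_simps)
    also have "\<dots> = q / 4" using n lt by (simp add: d_def)
    finally have a: "n * (2 * L' * (L' * d * t)) \<le> q / 4" .
    have b: "n * (2 * \<epsilon>') = q / 4" using n by (simp add: \<epsilon>'_def)
    have c: "2 * g * \<tau> = q / 2" using g by (simp add: \<tau>_def)
    have "n * (2 * L' * (L' * d * t) + 2 * \<epsilon>') + 2 * g * \<tau> \<le> q"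
      unfolding distrib_left b c using a by simp
    then have "4 * n * (g * (n * (2 * L' * (L' * d * t) + 2 * \<epsilon>') + 2 * g * \<tau>)) \<le> 4 * n * (g * q)"
      using n g by (intro mult_left_mono) auto
    also have "\<dots> = \<delta>\<^sup>2" using n g by (simp add: q_def)
    finally show ?thesis .
  qed
  have tl: "\<forall>\<^sub>F R in at_top. (LINT y|lborel. indicator {y. \<bar>y\<bar> > R * d} y * \<bar>\<phi> y\<bar>) < \<tau>"
    using order_tendstoD(2)[OF tail_integral_tendsto_0[OF phi d] tau] .
  show ?thesis
  proof (intro exI[of _ d] conjI allI impI d)
    fix \<epsilon> :: real assume eps: "0 < \<epsilon>" "\<epsilon> \<le> d"
    show "\<forall>\<^sub>F R in at_top. (\<integral>\<^sup>+\<omega>. ennreal \<bar>(LINT r:{0..t}|lborel. R * \<phi> (R * (X R r \<omega> - x))) - (LINT y|lborel. \<phi> y) * (LINT r:{0..t}|lborel. tent \<epsilon> (X R r \<omega> - x))\<bar> \<partial>M) \<le> ennreal \<eta>"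
      using X L(2) L'(2) tl eventually_gt_at_top[of 0]
    proof eventually_elim
      case (elim R)
      have R: "R > 0" by fact
      interpret levy_path_char M "X R" "\<psi> R" using elim(1) unfolding \<psi>_def .
      define a where "a y = R * \<phi> (R * y)" for y
      define b where "b y = c * tent \<epsilon> y" for y
      define k where "k y = a y - b y" for y
      have ia: "integrable lborel a" unfolding a_def
        using lborel_integrable_real_affine[OF phi, of R 0] R by simp
      have ib: "integrable lborel b" unfolding b_def using tent_integral[OF eps(1)] by simp
      have ik: "integrable lborel k" unfolding k_def by (intro Bochner_Integration.integrable_diff ia ib)
      have am [measurable]: "a \<in> borel_measurable borel" "b \<in> borel_measurable borel" "k \<in> borel_measurable borel"
        using ia ib ik by auto
      have La: "(LINT y|lborel. a y) = c"
        using lborel_integral_real_affine[of R \<phi> 0] R unfolding a_def c_def by simp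
      have Lb: "(LINT y|lborel. b y) = c" unfolding b_def using tent_integral[OF eps(1)] by simp
      have k0: "(LINT y|lborel. k y) = 0" unfolding k_def by (subst Bochner_Integration.integral_diff[OF ia ib]) (simp add: La Lb)
      have Laa: "(LINT y|lborel. \<bar>a y\<bar>) = (LINT y|lborel. \<bar>\<phi> y\<bar>)"
        using lborel_integral_real_affine[of R "\<lambda>y. \<bar>\<phi> y\<bar>" 0] R unfolding a_def by (simp add: abs_mult)
      have Lbb: "(LINT y|lborel. \<bar>b y\<bar>) = \<bar>c\<bar>"
        unfolding b_def using tent_integral[OF eps(1)] tent_nonneg[OF eps(1)] by (simp add: abs_mult)
      have cle: "\<bar>c\<bar> \<le> (LINT y|lborel. \<bar>\<phi> y\<bar>)" unfolding c_def by (rule integral_abs_bound)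
      have kn: "(LINT y|lborel. \<bar>k y\<bar>) \<le> n"
      proof -
        have "(LINT y|lborel. \<bar>k y\<bar>) \<le> (LINT y|lborel. \<bar>a y\<bar> + \<bar>b y\<bar>)"
          using ia ib ik by (intro integral_mono Bochner_Integration.integrable_add integrable_abs) (auto simp: k_def)
        also have "\<dots> = (LINT y|lborel. \<bar>a y\<bar>) + (LINT y|lborel. \<bar>b y\<bar>)"
          using ia ib by (intro Bochner_Integration.integral_add integrable_abs)
        finally show ?thesis using cle unfolding Laa Lbb n_def by simp
      qed
      have kt: "(LINT y|lborel. indicator {y. \<bar>y\<bar> > d} y * \<bar>k y\<bar>) \<le> \<tau>"
      proof -
        have "(LINT y|lborel. indicator {y. \<bar>y\<bar> > d} y * \<bar>k y\<bar>) = (LINT y|lborel. indicator {y. \<bar>y\<bar> > d} y * \<bar>a y\<bar>)"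
        proof (intro Bochner_Integration.integral_cong refl)
          fix y
          show "indicator {y. \<bar>y\<bar> > d} y * \<bar>k y\<bar> = indicator {y. \<bar>y\<bar> > d} y * \<bar>a y\<bar>"
            using tent_support[OF eps(1), of y] eps(2) by (auto simp: k_def b_def indicator_def)
        qed
        also have "\<dots> = (LINT y|lborel. indicator {y. \<bar>y\<bar> > R * d} y * \<bar>\<phi> y\<bar>)"
        proof -
          have "(LINT y|lborel. indicator {y. \<bar>y\<bar> > R * d} y * \<bar>\<phi> y\<bar>) = R * (LINT y|lborel. indicator {y. \<bar>y\<bar> > R * d} (R * y) * \<bar>\<phi> (R * y)\<bar>)"
            using lborel_integral_real_affine[of R "\<lambda>y. indicator {y. \<bar>y\<bar> > R * d} y * \<bar>\<phi> y\<bar>" 0] R by simp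
          also have "\<dots> = (LINT y|lborel. R * (indicator {y. \<bar>y\<bar> > R * d} (R * y) * \<bar>\<phi> (R * y)\<bar>))" by simp
          also have "\<dots> = (LINT y|lborel. indicator {y. \<bar>y\<bar> > d} y * \<bar>a y\<bar>)"
            using R by (intro Bochner_Integration.integral_cong refl) (auto simp: indicator_def a_def abs_mult)
          finally show ?thesis ..
        qed
        finally show ?thesis using elim by simp
      qed
      have "(\<integral>\<^sup>+\<omega>. ennreal ((LINT r:{0..t}|lborel. k (X R r \<omega> - x))\<^sup>2) \<partial>M) \<le> 
        ennreal (4 * n * ((2 * L * t + 1) * (n * (2 * L' * (L' * d * t) + 2 * \<epsilon>') + 2 * (2 * L * t + 1) * \<tau>)))"
        using L(1) L'(1) e' d elim by (intro occupation_L2_explicit t ik k0 kn kt) auto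
      also have "\<dots> \<le> ennreal (\<delta>\<^sup>2)" using final unfolding g_def by (rule ennreal_leI)
      finally have "(\<integral>\<^sup>+\<omega>. ennreal \<bar>LINT r:{0..t}|lborel. k (X R r \<omega> - x)\<bar> \<partial>M) \<le> ennreal (2 * \<delta>)"
        by (intro nn_integral_abs_le_of_square del) (auto simp: set_lebesgue_integral_def prob_space_axioms)
      moreover have "(\<integral>\<^sup>+\<omega>. ennreal \<bar>(LINT r:{0..t}|lborel. a (X R r \<omega> - x)) - c * (LINT r:{0..t}|lborel. tent \<epsilon> (X R r \<omega> - x))\<bar> \<partial>M) = 
        (\<integral>\<^sup>+\<omega>. ennreal \<bar>LINT r:{0..t}|lborel. k (X R r \<omega> - x)\<bar> \<partial>M)"
      proof (rule nn_integral_cong_AE)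
        show "AE \<omega> in M. ennreal \<bar>(LINT r:{0..t}|lborel. a (X R r \<omega> - x)) - c * (LINT r:{0..t}|lborel. tent \<epsilon> (X R r \<omega> - x))\<bar> = 
          ennreal \<bar>LINT r:{0..t}|lborel. k (X R r \<omega> - x)\<bar>"
          using AE_integrable_K[OF t ia, of x] AE_integrable_K[OF t ib, of x] AE_space
        proof eventually_elim
          case (elim \<omega>)
          have i: "set_integrable lborel {0..t} (\<lambda>r. a (X R r \<omega> - x))" "set_integrable lborel {0..t} (\<lambda>r. b (X R r \<omega> - x))"
            using elim by (simp_all add: set_integral_K)
          have "(LINT r:{0..t}|lborel. k (X R r \<omega> - x)) = (LINT r:{0..t}|lborel. a (X R r \<omega> - x)) - (LINT r:{0..t}|lborel. b (X R r \<omega> - x))"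
            unfolding k_def by (rule set_integral_diff[OF i])
          then show ?case by (simp add: b_def)
        qed
      qed
      ultimately show ?case by (simp add: a_def c_def \<delta>_def)
    qed
  qed
qed

section \<open>Convergence of occupation functionals of bounded kernels\<close>

text \<open>The test functions: Lipschitz functions of finitely many coordinates, taken as functions
  of the whole path. Thus no product space is needed for each finite set of times, and interpolated
  paths can be inserted directly.\<close>

definition lip_on :: "real set \<Rightarrow> real \<Rightarrow> ((real \<Rightarrow> real) \<Rightarrow> real) \<Rightarrow> bool" where
  "lip_on J C g \<longleftrightarrow> finite J \<and> C \<ge> 0 \<and> (\<forall>v w. \<bar>g v - g w\<bar> \<le> C * (\<Sum>j\<in>J. \<bar>v j - w j\<bar>))"

lemma lip_onD: "lip_on J C g \<Longrightarrow> \<bar>g v - g w\<bar> \<le> C * (\<Sum>j\<in>J. \<bar>v j - w j\<bar>)"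
  by (simp add: lip_on_def)

lemma lip_on_cong:
  assumes "lip_on J C g" "\<And>j. j \<in> J \<Longrightarrow> v j = w j"
  shows "g v = g w"
proof -
  have "(\<Sum>j\<in>J. \<bar>v j - w j\<bar>) = 0" using assms(2) by simp
  then show ?thesis using lip_onD[OF assms(1), of v w] by simp
qed

lemma lip_on_tendsto:
  assumes g: "lip_on J C g" and lim: "\<And>j. j \<in> J \<Longrightarrow> ((\<lambda>i. v i j) \<longlongrightarrow> w j) F"
  shows "((\<lambda>i. g (v i)) \<longlongrightarrow> g w) F"
proof -
  have "((\<lambda>i. C * (\<Sum>j\<in>J. \<bar>v i j - w j\<bar>)) \<longlongrightarrow> C * (\<Sum>j\<in>J. \<bar>w j - w j\<bar>)) F"
    by (intro tendsto_mult_left tendsto_sum tendsto_rabs tendsto_diff tendsto_const lim)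
  then have z: "((\<lambda>i. C * (\<Sum>j\<in>J. \<bar>v i j - w j\<bar>)) \<longlongrightarrow> 0) F" by simp
  have "((\<lambda>i. g (v i) - g w) \<longlongrightarrow> 0) F"
  proof (rule Lim_null_comparison[OF _ z])
    show "\<forall>\<^sub>F i in F. norm (g (v i) - g w) \<le> C * (\<Sum>j\<in>J. \<bar>v i j - w j\<bar>)"
      unfolding real_norm_def by (intro always_eventually allI lip_onD[OF g])
  qed
  then show ?thesis by (rule LIM_zero_cancel)
qed

text \<open>The finitely many times are renumbered by natural numbers. On the countable product the
  Lipschitz function is continuous, hence Borel, and a sequence of random variables is a Borel map
  into that product.\<close>

lemma lip_on_measurable:
  assumes g: "lip_on J C g" and W: "\<And>t. t \<in> J \<Longrightarrow> W t \<in> borel_measurable M"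
  shows "(\<lambda>\<omega>. g (\<lambda>t. W t \<omega>)) \<in> borel_measurable M"
proof -
  have J: "finite J" using g by (simp add: lip_on_def)
  obtain a :: "nat \<Rightarrow> real" and n where a: "J = a ` {i. i < n}" "inj_on a {i. i < n}"
    using finite_imp_nat_seg_image_inj_on[OF J] by blast
  define e where "e = inv_into {i. i < n} a"
  have e: "a (e t) = t" "e t < n" if "t \<in> J" for t
    using that f_inv_into_f[of t a "{i. i < n}"] inv_into_into[of t a "{i. i < n}"] unfolding a(1) e_def by auto
  define h where "h u = g (\<lambda>t. u (e t))" for u :: "nat \<Rightarrow> real"
  have "continuous_on UNIV h"
    unfolding continuous_on_def h_def
  proof (intro ballI lip_on_tendsto[OF g])
    fix u :: "nat \<Rightarrow> real" and j :: real
    have "continuous_on UNIV (\<lambda>u :: nat \<Rightarrow> real. u (e j))" by (rule continuous_on_product_coordinates)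
    then show "((\<lambda>u. u (e j)) \<longlongrightarrow> u (e j)) (at u within UNIV)" by (simp add: continuous_on_def)
  qed
  then have hm [measurable]: "h \<in> borel_measurable borel" by (rule borel_measurable_continuous_onI)
  have "(\<lambda>\<omega>. if i < n then W (a i) \<omega> else 0) \<in> borel_measurable M" for i
    using W[of "a i"] a(1) by (cases "i < n") auto
  then have "(\<lambda>\<omega> i. if i < n then W (a i) \<omega> else 0) \<in> measurable M borel"
    by (intro measurable_coordinatewise_then_product)
  then have "(\<lambda>\<omega>. h (\<lambda>i. if i < n then W (a i) \<omega> else 0)) \<in> borel_measurable M"
    by measurable
  also have "(\<lambda>\<omega>. h (\<lambda>i. if i < n then W (a i) \<omega> else 0)) = (\<lambda>\<omega>. g (\<lambda>t. W t \<omega>))"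
    unfolding h_def by (intro ext lip_on_cong[OF g]) (use e in auto)
  finally show ?thesis .
qed

text \<open>The scheme behind every exchange of limits below; the approximation \<open>b\<close> and
  its limit may depend on \<epsilon>.\<close>

lemma tendsto_approximation:
  fixes a :: "'i \<Rightarrow> real"
  assumes "\<And>\<epsilon>. \<epsilon> > 0 \<Longrightarrow> \<exists>b l'. (\<forall>\<^sub>F i in F. \<bar>a i - b i\<bar> \<le> \<epsilon>) \<and> (b \<longlongrightarrow> l') F \<and> \<bar>l' - l\<bar> \<le> \<epsilon>"
  shows "(a \<longlongrightarrow> l) F"
proof (rule tendstoI)
  fix e :: real assume e: "e > 0"
  obtain b l' where b: "\<forall>\<^sub>F i in F. \<bar>a i - b i\<bar> \<le> e / 4" "(b \<longlongrightarrow> l') F" "\<bar>l' - l\<bar> \<le> e / 4"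
    using assms[of "e / 4"] e by auto
  have "\<forall>\<^sub>F i in F. dist (b i) l' < e / 4" using b(2) e by (intro tendstoD) auto
  with b(1) show "\<forall>\<^sub>F i in F. dist (a i) l < e"
  proof eventually_elim
    case (elim i)
    then show ?case using b(3) e unfolding dist_real_def by linarith
  qed
qed

text \<open>Convergence is assumed for the law at each single time only; independence and
  stationarity of the increments lift it to finite grids.\<close>

locale levy_limit =
  fixes M :: "'a measure" and X :: "real \<Rightarrow> real \<Rightarrow> 'a \<Rightarrow> real" and N :: "'b measure" and \<xi> :: "real \<Rightarrow> 'b \<Rightarrow> real"
  assumes X_path: "\<And>R. levy_path M (X R)" and xi_path: "levy_path N \<xi>"
    and char_lim: "\<And>h \<theta>. h \<ge> 0 \<Longrightarrow> ((\<lambda>R. char (distr M borel (X R h)) \<theta>) \<longlongrightarrow> char (distr N borel (\<xi> h)) \<theta>) at_top"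

sublocale levy_limit \<subseteq> X: levy_path M "X R" for R by (rule X_path)
sublocale levy_limit \<subseteq> xi: levy_path N \<xi> by (rule xi_path)

context levy_limit begin

lemma weak_conv_marginal:
  assumes h: "h \<ge> 0" and R: "filterlim R at_top sequentially"
  shows "weak_conv_m (\<lambda>n. distr M borel (X (R n) h)) (distr N borel (\<xi> h))"
  using filterlim_compose[OF char_lim[OF h] R]
  by (intro levy_continuity X.real_distribution_X xi.real_distribution_X)

lemma marginal_convergence:
  assumes h: "h \<ge> 0" and u: "continuous_on UNIV u" "\<And>y. \<bar>u y\<bar> \<le> (B::real)"
  shows "((\<lambda>R. LINT \<omega>|M. u (X R h \<omega>)) \<longlongrightarrow> (LINT \<omega>|N. u (\<xi> h \<omega>))) at_top"
proof (rule tendsto_at_topI_sequentially)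
  fix R :: "nat \<Rightarrow> real" assume R: "filterlim R at_top sequentially"
  have um [measurable]: "u \<in> borel_measurable borel" using u(1) by (rule borel_measurable_continuous_onI)
  have "(\<lambda>n. integral\<^sup>L (distr M borel (X (R n) h)) u) \<longlonglongrightarrow> integral\<^sup>L (distr N borel (\<xi> h)) u"
    using u continuous_on_eq_continuous_at[of UNIV u]
    by (intro weak_conv_imp_integral_bdd_continuous_conv[where B=B] weak_conv_marginal h R X.real_distribution_X xi.real_distribution_X) auto
  then show "(\<lambda>n. LINT \<omega>|M. u (X (R n) h \<omega>)) \<longlonglongrightarrow> (LINT \<omega>|N. u (\<xi> h \<omega>))"
    by (simp add: integral_distr)
qed

text \<open>The increments over a regular grid are independent with the law of the process at time
  h. Skorohod's theorem couples these one-dimensional laws on a space \<Omega>; on the m-fold power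
  of \<Omega> the coordinates give independent increments that converge at every point, and
  dominated convergence finishes. This is why sequential continuity in each coordinate is the right
  condition on \<Phi>.\<close>

lemma increments_convergence:
  fixes \<Phi> :: "(nat \<Rightarrow> real) \<Rightarrow> real"
  assumes m: "m > 0" and h: "h \<ge> 0" and [measurable]: "\<Phi> \<in> borel_measurable (PiM {..<m} (\<lambda>_. borel))"
    and bd: "\<And>v. \<bar>\<Phi> v\<bar> \<le> B"
    and cont: "\<And>v w. (\<And>i. i < m \<Longrightarrow> (\<lambda>n. v n i) \<longlonglongrightarrow> w i) \<Longrightarrow> (\<lambda>n::nat. \<Phi> (v n)) \<longlonglongrightarrow> \<Phi> w"
  shows "((\<lambda>R. LINT \<omega>|M. \<Phi> (\<lambda>i\<in>{..<m}. X R (real (Suc i) * h) \<omega> - X R (real i * h) \<omega>)) \<longlongrightarrow> 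
    (LINT \<omega>|N. \<Phi> (\<lambda>i\<in>{..<m}. \<xi> (real (Suc i) * h) \<omega> - \<xi> (real i * h) \<omega>))) at_top"
proof (rule tendsto_at_topI_sequentially)
  fix R :: "nat \<Rightarrow> real" assume R: "filterlim R at_top sequentially"
  define \<mu> where "\<mu> n = distr M borel (X (R n) h)" for n
  define \<nu> where "\<nu> = distr N borel (\<xi> h)"
  have rd: "real_distribution (\<mu> n)" "real_distribution \<nu>" for n
    unfolding \<mu>_def \<nu>_def by (rule X.real_distribution_X xi.real_distribution_X)+
  have "weak_conv_m \<mu> \<nu>" unfolding \<mu>_def \<nu>_def by (rule weak_conv_marginal[OF h R])
  from Skorohod[OF rd this] obtain \<Omega> :: "real measure" and Y and Y' :: "real \<Rightarrow> real" where 
    O: "prob_space \<Omega>" "\<And>n. Y n \<in> measurable \<Omega> borel" "\<And>n. distr \<Omega> borel (Y n) = \<mu> n"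
      "Y' \<in> measurable \<Omega> lborel" "distr \<Omega> borel Y' = \<nu>" "\<And>w. w \<in> space \<Omega> \<Longrightarrow> (\<lambda>n. Y n w) \<longlonglongrightarrow> Y' w"
    by blast
  note [measurable] = O(2) 
  have Y'm [measurable]: "Y' \<in> measurable \<Omega> borel" using O(4) by simp
  let ?P = "PiM {..<m} (\<lambda>_. \<Omega>)" and ?B = "PiM {..<m} (\<lambda>_. borel :: real measure)"
  interpret O: prob_space \<Omega> by fact
  interpret P: product_prob_space "\<lambda>_. \<Omega>" "{..<m}" ..
  have PY: "PiM {..<m} (\<lambda>_. distr \<Omega> borel Z) = distr ?P ?B (compose {..<m} Z)" if [measurable]: "Z \<in> measurable \<Omega> borel" for Z
  proof -
    have "prob_space (distr \<Omega> borel Z)" by (rule O.prob_space_distr) simp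
    then have "PiM {..<m} (\<lambda>_. distr \<Omega> borel Z) = PiM {..<m} (\<lambda>_. distr \<Omega> (distr \<Omega> borel Z) Z)"
      by (intro PiM_cong refl distr_cong) auto
    also have "\<dots> = distr ?P (PiM {..<m} (\<lambda>_. distr \<Omega> borel Z)) (compose {..<m} Z)"
      by (rule distr_PiM_finite_prob_space'[symmetric]) (auto intro: O O.prob_space_distr)
    also have "\<dots> = distr ?P ?B (compose {..<m} Z)"
      by (intro distr_cong sets_PiM_cong) auto
    finally show ?thesis .
  qed
  have comp_meas: "compose {..<m} Z \<in> measurable ?P ?B" if [measurable]: "Z \<in> measurable \<Omega> borel" for Z
    unfolding compose_def by measurable
  have EX: "(LINT \<omega>|M. \<Phi> (\<lambda>i\<in>{..<m}. X (R n) (real (Suc i) * h) \<omega> - X (R n) (real i * h) \<omega>)) = (LINT w|?P. \<Phi> (compose {..<m} (Y n) w))" for n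
  proof -
    have "(LINT \<omega>|M. \<Phi> (\<lambda>i\<in>{..<m}. X (R n) (real (Suc i) * h) \<omega> - X (R n) (real i * h) \<omega>)) = 
      integral\<^sup>L (distr M ?B (\<lambda>\<omega>. \<lambda>i\<in>{..<m}. X (R n) (real (Suc i) * h) \<omega> - X (R n) (real i * h) \<omega>)) \<Phi>"
      by (intro integral_distr[symmetric] measurable_restrict borel_measurable_diff X.X_meas) auto
    also have "\<dots> = integral\<^sup>L (distr ?P ?B (compose {..<m} (Y n))) \<Phi>"
      by (simp only: X.distr_increments_PiM[OF m h] \<mu>_def[symmetric] O(3)[symmetric] PY O(2))
    also have "\<dots> = (LINT w|?P. \<Phi> (compose {..<m} (Y n) w))" by (intro integral_distr comp_meas) auto
    finally show ?thesis .
  qed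
  have Exi: "(LINT \<omega>|N. \<Phi> (\<lambda>i\<in>{..<m}. \<xi> (real (Suc i) * h) \<omega> - \<xi> (real i * h) \<omega>)) = (LINT w|?P. \<Phi> (compose {..<m} Y' w))"
  proof -
    have "(LINT \<omega>|N. \<Phi> (\<lambda>i\<in>{..<m}. \<xi> (real (Suc i) * h) \<omega> - \<xi> (real i * h) \<omega>)) = 
      integral\<^sup>L (distr N ?B (\<lambda>\<omega>. \<lambda>i\<in>{..<m}. \<xi> (real (Suc i) * h) \<omega> - \<xi> (real i * h) \<omega>)) \<Phi>"
      by (intro integral_distr[symmetric] measurable_restrict borel_measurable_diff xi.X_meas) auto
    also have "\<dots> = integral\<^sup>L (distr ?P ?B (compose {..<m} Y')) \<Phi>"
      by (simp only: xi.distr_increments_PiM[OF m h] \<nu>_def[symmetric] O(5)[symmetric] PY Y'm)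
    also have "\<dots> = (LINT w|?P. \<Phi> (compose {..<m} Y' w))" by (intro integral_distr comp_meas) auto
    finally show ?thesis .
  qed
  show "(\<lambda>n. LINT \<omega>|M. \<Phi> (\<lambda>i\<in>{..<m}. X (R n) (real (Suc i) * h) \<omega> - X (R n) (real i * h) \<omega>)) \<longlonglongrightarrow>
    (LINT \<omega>|N. \<Phi> (\<lambda>i\<in>{..<m}. \<xi> (real (Suc i) * h) \<omega> - \<xi> (real i * h) \<omega>))"
    unfolding EX Exi
  proof (rule integral_dominated_convergence[where w="\<lambda>_. B"])
    show "(\<lambda>w. \<Phi> (compose {..<m} Y' w)) \<in> borel_measurable ?P"
      by (rule measurable_compose[OF comp_meas[OF Y'm]]) simp
    show "(\<lambda>w. \<Phi> (compose {..<m} (Y n) w)) \<in> borel_measurable ?P" for n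
      by (rule measurable_compose[OF comp_meas[OF O(2)]]) simp
    show "AE w in ?P. (\<lambda>n. \<Phi> (compose {..<m} (Y n) w)) \<longlonglongrightarrow> \<Phi> (compose {..<m} Y' w)"
    proof (rule AE_I2)
      fix w assume w: "w \<in> space ?P"
      then have "w i \<in> space \<Omega>" if "i < m" for i using that by (auto simp: space_PiM PiE_iff)
      then show "(\<lambda>n. \<Phi> (compose {..<m} (Y n) w)) \<longlonglongrightarrow> \<Phi> (compose {..<m} Y' w)"
        using O(6) by (intro cont) (auto simp: compose_def)
    qed
  qed (use bd in auto)
qed

end

section \<open>Discretisation of time\<close>

definition occ :: "(real \<Rightarrow> real) \<Rightarrow> real \<Rightarrow> (real \<Rightarrow> 'a \<Rightarrow> real) \<Rightarrow> real \<Rightarrow> 'a \<Rightarrow> real" where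
  "occ q x X t \<omega> = (LINT r:{0..t}|lborel. q (X r \<omega> - x))"

text \<open>The last multiple of 1/n not exceeding r, for nonnegative r. The natural number in front
  of the step is the number of increments that add up to the process at this time.\<close>

definition grid :: "nat \<Rightarrow> real \<Rightarrow> real" where
  "grid n r = real (nat \<lfloor>r * real n\<rfloor>) * (1 / real n)"

lemma grid_meas [measurable]: "grid n \<in> borel_measurable borel"
  unfolding grid_def[abs_def] by measurable

lemma grid_bounds:
  assumes "n > 0" "r \<ge> 0"
  shows "0 \<le> grid n r" "grid n r \<le> r" "r - grid n r \<le> 1 / real n"
proof -
  have "real (nat \<lfloor>r * real n\<rfloor>) = real_of_int \<lfloor>r * real n\<rfloor>" using assms by simp
  then have g: "grid n r = real_of_int \<lfloor>r * real n\<rfloor> / real n" by (simp add: grid_def)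
  have "real_of_int \<lfloor>r * real n\<rfloor> \<le> r * real n" "r * real n \<le> real_of_int \<lfloor>r * real n\<rfloor> + 1" by linarith+
  then have "real_of_int \<lfloor>r * real n\<rfloor> / real n \<le> r" "r \<le> (real_of_int \<lfloor>r * real n\<rfloor> + 1) / real n"
    using assms by (simp_all add: pos_divide_le_eq pos_le_divide_eq)
  then show "grid n r \<le> r" "r - grid n r \<le> 1 / real n" unfolding g add_divide_distrib by linarith+
  show "0 \<le> grid n r" unfolding grid_def using assms by simp
qed

lemma bounded_set_integrable:
  assumes [measurable]: "w \<in> borel_measurable borel" and "\<And>r. r \<in> {a..b} \<Longrightarrow> \<bar>w r\<bar> \<le> (B::real)"
  shows "set_integrable lborel {a..b::real} w"
  unfolding set_integrable_def
proof (rule Bochner_Integration.integrable_bound[where f="\<lambda>r. B * indicator {a..b} r"])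
  show "integrable lborel (\<lambda>r. B * indicator {a..b} r)"
    by (intro integrable_mult_right integrable_real_indicator emeasure_compact_finite compact_Icc) auto
  show "AE r in lborel. norm (indicator {a..b} r *\<^sub>R w r) \<le> norm (B * indicator {a..b} r)"
  proof (rule AE_I2)
    fix r show "norm (indicator {a..b} r *\<^sub>R w r) \<le> norm (B * indicator {a..b} r)"
      using assms(2)[of r] by (cases "r \<in> {a..b}") auto
  qed
qed auto

locale lipschitz_kernel =
  fixes q :: "real \<Rightarrow> real" and Q \<Lambda> :: real
  assumes q_meas [measurable]: "q \<in> borel_measurable borel"
    and q_bound: "\<And>y. \<bar>q y\<bar> \<le> Q" and q_lip: "\<And>y z. \<bar>q y - q z\<bar> \<le> \<Lambda> * \<bar>y - z\<bar>"
    and Lam: "\<Lambda> \<ge> 0"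
begin

text \<open>A modulus for the increments of q. It is bounded and continuous, so its expectations
  converge along with the marginal laws.\<close>

definition u :: "real \<Rightarrow> real" where "u y = min (2 * Q) (\<Lambda> * \<bar>y\<bar>)"

lemma Q_nonneg: "Q \<ge> 0" using q_bound[of 0] by linarith

lemma u_bounds: "0 \<le> u y" "u y \<le> 2 * Q" "\<bar>u y\<bar> \<le> 2 * Q"
  using Q_nonneg Lam by (auto simp: u_def)

lemma u_meas [measurable]: "u \<in> borel_measurable borel" unfolding u_def[abs_def] by measurable

lemma u_cont: "continuous_on UNIV u" unfolding u_def by (intro continuous_intros)

lemma q_diff: "\<bar>q y - q z\<bar> \<le> u (y - z)"
  using q_bound[of y] q_bound[of z] q_lip[of y z] unfolding u_def by auto

end

locale levy_path_kernel = levy_path M X + lipschitz_kernel q Q \<Lambda> 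
  for M :: "'a measure" and X and q Q \<Lambda>
begin

text \<open>Bounds the expected error of freezing the process at grid times. By stationarity the
  increment since the last grid time has the law of the process at the elapsed time, so the error
  depends on one-dimensional laws only and can be followed to the limit in R.\<close>

definition err :: "nat \<Rightarrow> real \<Rightarrow> real" where
  "err n t = (LINT r:{0..t}|lborel. (LINT \<omega>|M. u (X (r - grid n r) \<omega>)))"

lemma occ_meas [measurable]: "occ q x X t \<in> borel_measurable M" "occ q x (\<lambda>r. X (grid n r)) t \<in> borel_measurable M"
  unfolding occ_def[abs_def] set_lebesgue_integral_def by measurable

lemma occ_integrable: "\<omega> \<in> space M \<Longrightarrow> set_integrable lborel {0..t} (\<lambda>r. q (X r \<omega> - x))"
  "\<omega> \<in> space M \<Longrightarrow> set_integrable lborel {0..t} (\<lambda>r. q (X (grid n r) \<omega> - x))"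
  by (rule bounded_set_integrable[where B=Q]; use q_bound in \<open>auto\<close>)+

lemma discretisation_error:
  assumes n: "n > 0" and t: "t \<ge> 0"
  shows "integrable M (\<lambda>\<omega>. \<bar>occ q x X t \<omega> - occ q x (\<lambda>r. X (grid n r)) t \<omega>\<bar>)"
    "(LINT \<omega>|M. \<bar>occ q x X t \<omega> - occ q x (\<lambda>r. X (grid n r)) t \<omega>\<bar>) \<le> err n t"
proof -
  interpret LM: pair_sigma_finite lborel M ..
  let ?D = "\<lambda>\<omega>. \<bar>occ q x X t \<omega> - occ q x (\<lambda>r. X (grid n r)) t \<omega>\<bar>"
  let ?w = "\<lambda>r. (LINT \<omega>|M. u (X (r - grid n r) \<omega>))"
  have w_bd: "0 \<le> ?w r" "?w r \<le> 2 * Q" for r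
  proof -
    show "0 \<le> ?w r" using u_bounds by (intro integral_nonneg_AE) auto
    have "?w r \<le> (LINT \<omega>|M. 2 * Q)"
      by (intro integral_mono integrable_const_bound[where B="2*Q"]) (use u_bounds Q_nonneg in auto)
    then show "?w r \<le> 2 * Q" by (simp add: prob_space)
  qed
  have "(\<integral>\<^sup>+\<omega>. ennreal (?D \<omega>) \<partial>M) \<le> (\<integral>\<^sup>+\<omega>. (\<integral>\<^sup>+r. indicator {0..t} r * ennreal \<bar>q (X r \<omega> - x) - q (X (grid n r) \<omega> - x)\<bar> \<partial>lborel) \<partial>M)"
  proof (rule nn_integral_mono)
    fix \<omega> assume w: "\<omega> \<in> space M"
    have "ennreal (?D \<omega>) = ennreal (norm (LINT r:{0..t}|lborel. q (X r \<omega> - x) - q (X (grid n r) \<omega> - x)))"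
      unfolding occ_def by (subst set_integral_diff(2)[OF occ_integrable[OF w]]) simp
    also have "\<dots> \<le> (\<integral>\<^sup>+r. ennreal (norm (indicator {0..t} r *\<^sub>R (q (X r \<omega> - x) - q (X (grid n r) \<omega> - x)))) \<partial>lborel)"
      unfolding set_lebesgue_integral_def
      using set_integral_diff(1)[OF occ_integrable[OF w], unfolded set_integrable_def]
      by (rule integral_norm_bound_ennreal)
    also have "\<dots> = (\<integral>\<^sup>+r. indicator {0..t} r * ennreal \<bar>q (X r \<omega> - x) - q (X (grid n r) \<omega> - x)\<bar> \<partial>lborel)"
      by (intro nn_integral_cong) (auto simp: indicator_def)
    finally show "ennreal (?D \<omega>) \<le> (\<integral>\<^sup>+r. indicator {0..t} r * ennreal \<bar>q (X r \<omega> - x) - q (X (grid n r) \<omega> - x)\<bar> \<partial>lborel)" .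
  qed
  also have "\<dots> = (\<integral>\<^sup>+r. (\<integral>\<^sup>+\<omega>. indicator {0..t} r * ennreal \<bar>q (X r \<omega> - x) - q (X (grid n r) \<omega> - x)\<bar> \<partial>M) \<partial>lborel)"
    by (rule LM.Fubini') measurable
  also have "\<dots> \<le> (\<integral>\<^sup>+r. ennreal (indicator {0..t} r *\<^sub>R ?w r) \<partial>lborel)"
  proof (rule nn_integral_mono)
    fix r
    show "(\<integral>\<^sup>+\<omega>. indicator {0..t} r * ennreal \<bar>q (X r \<omega> - x) - q (X (grid n r) \<omega> - x)\<bar> \<partial>M) \<le> ennreal (indicator {0..t} r *\<^sub>R ?w r)"
    proof (cases "r \<in> {0..t}")
      case True
      then have r: "r \<ge> 0" by simp
      note gb = grid_bounds[OF n r]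
      have "(\<integral>\<^sup>+\<omega>. indicator {0..t} r * ennreal \<bar>q (X r \<omega> - x) - q (X (grid n r) \<omega> - x)\<bar> \<partial>M) \<le>
        (\<integral>\<^sup>+\<omega>. ennreal (u (X (grid n r + (r - grid n r)) \<omega> - X (grid n r) \<omega>)) \<partial>M)"
        using True q_diff[of "X r \<omega> - x" "X (grid n r) \<omega> - x" for \<omega>] by (intro nn_integral_mono) (auto intro!: ennreal_leI)
      also have "\<dots> = (\<integral>\<^sup>+y. ennreal (u y) \<partial>distr M borel (\<lambda>\<omega>. X (grid n r + (r - grid n r)) \<omega> - X (grid n r) \<omega>))"
        by (subst nn_integral_distr) auto
      also have "\<dots> = (\<integral>\<^sup>+y. ennreal (u y) \<partial>distr M borel (X (r - grid n r)))"
        using gb by (subst stationary) auto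
      also have "\<dots> = (\<integral>\<^sup>+\<omega>. ennreal (u (X (r - grid n r) \<omega>)) \<partial>M)"
        by (subst nn_integral_distr) auto
      also have "\<dots> = ennreal (?w r)"
        by (intro nn_integral_eq_integral integrable_const_bound[where B="2*Q"]) (use u_bounds in auto)
      finally show ?thesis using True by simp
    qed simp
  qed
  also have "\<dots> = ennreal (err n t)" unfolding err_def set_lebesgue_integral_def
  proof (rule nn_integral_eq_integral)
    have "set_integrable lborel {0..t} ?w"
      by (rule bounded_set_integrable[where B="2 * Q"]) (use w_bd in auto)
    then show "integrable lborel (\<lambda>r. indicator {0..t} r *\<^sub>R ?w r)" by (simp add: set_integrable_def)
  qed (use w_bd in auto)
  finally have *: "(\<integral>\<^sup>+\<omega>. ennreal (?D \<omega>) \<partial>M) \<le> ennreal (err n t)" .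
  show int: "integrable M ?D"
  proof (rule integrableI_bounded)
    show "(\<integral>\<^sup>+\<omega>. ennreal (norm (?D \<omega>)) \<partial>M) < \<infinity>" using * by (simp add: le_less_trans)
  qed auto
  have "err n t \<ge> 0" unfolding err_def set_lebesgue_integral_def using w_bd by (intro integral_nonneg_AE) auto
  then show "(LINT \<omega>|M. ?D \<omega>) \<le> err n t"
    using * int by (subst (asm) nn_integral_eq_integral) auto
qed

lemma lip_expectation_error:
  assumes g: "lip_on J C g" and gb: "\<And>v. \<bar>g v\<bar> \<le> H" and n: "n > 0" and J: "J \<subseteq> {0..}"
  shows "\<bar>(LINT \<omega>|M. g (\<lambda>t. c * occ q x X t \<omega>)) - (LINT \<omega>|M. g (\<lambda>t. c * occ q x (\<lambda>r. X (grid n r)) t \<omega>))\<bar>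
    \<le> C * (\<Sum>t\<in>J. \<bar>c\<bar> * err n t)"
proof -
  let ?a = "\<lambda>\<omega>. g (\<lambda>t. c * occ q x X t \<omega>)" and ?b = "\<lambda>\<omega>. g (\<lambda>t. c * occ q x (\<lambda>r. X (grid n r)) t \<omega>)"
  let ?D = "\<lambda>t \<omega>. \<bar>occ q x X t \<omega> - occ q x (\<lambda>r. X (grid n r)) t \<omega>\<bar>"
  have C: "C \<ge> 0" "finite J" using g by (auto simp: lip_on_def)
  have m: "?a \<in> borel_measurable M" "?b \<in> borel_measurable M" by (rule lip_on_measurable[OF g]; simp)+
  have i: "integrable M ?a" "integrable M ?b"
    by (rule integrable_const_bound[where B=H]; use gb m in auto)+
  have "\<bar>(LINT \<omega>|M. ?a \<omega>) - (LINT \<omega>|M. ?b \<omega>)\<bar> = \<bar>LINT \<omega>|M. ?a \<omega> - ?b \<omega>\<bar>"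
    using i by (simp add: Bochner_Integration.integral_diff)
  also have "\<dots> \<le> (LINT \<omega>|M. \<bar>?a \<omega> - ?b \<omega>\<bar>)" by (rule integral_abs_bound)
  also have "\<dots> \<le> (LINT \<omega>|M. C * (\<Sum>t\<in>J. \<bar>c\<bar> * ?D t \<omega>))"
  proof (rule integral_mono)
    show "integrable M (\<lambda>\<omega>. \<bar>?a \<omega> - ?b \<omega>\<bar>)" using i by (intro integrable_abs Bochner_Integration.integrable_diff)
    show "integrable M (\<lambda>\<omega>. C * (\<Sum>t\<in>J. \<bar>c\<bar> * ?D t \<omega>))"
      using J by (intro integrable_mult_right Bochner_Integration.integrable_sum discretisation_error(1)[OF n]) auto
    fix \<omega>
    show "\<bar>?a \<omega> - ?b \<omega>\<bar> \<le> C * (\<Sum>t\<in>J. \<bar>c\<bar> * ?D t \<omega>)"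
      using lip_onD[OF g, of "\<lambda>t. c * occ q x X t \<omega>" "\<lambda>t. c * occ q x (\<lambda>r. X (grid n r)) t \<omega>"]
      by (simp add: right_diff_distrib[symmetric] abs_mult)
  qed
  also have "\<dots> = C * (\<Sum>t\<in>J. \<bar>c\<bar> * (LINT \<omega>|M. ?D t \<omega>))"
    using J discretisation_error(1)[OF n]
    by (subst integral_mult_right_zero, subst Bochner_Integration.integral_sum) (auto simp: subset_iff)
  also have "\<dots> \<le> C * (\<Sum>t\<in>J. \<bar>c\<bar> * err n t)"
    using C J by (intro mult_left_mono sum_mono discretisation_error(2)[OF n]) auto
  finally show ?thesis .
qed

text \<open>The elapsed times tend to 0, and the process starts at 0 and is right-continuous
  there.\<close>

lemma err_tendsto_0: "(\<lambda>n. err n t) \<longlonglongrightarrow> 0"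
proof -
  have "(\<lambda>n. LINT r|lborel. indicator {0..t} r *\<^sub>R (LINT \<omega>|M. u (X (r - grid n r) \<omega>))) \<longlonglongrightarrow> integral\<^sup>L lborel (\<lambda>_::real. 0::real)"
  proof (rule integral_dominated_convergence[where w="\<lambda>r. 2 * Q * indicator {0..t} r"])
    show "integrable lborel (\<lambda>r. 2 * Q * indicator {0..t} r)"
      by (intro integrable_mult_right integrable_real_indicator emeasure_compact_finite compact_Icc) auto
    show "AE r in lborel. (\<lambda>n. indicator {0..t} r *\<^sub>R (LINT \<omega>|M. u (X (r - grid n r) \<omega>))) \<longlonglongrightarrow> 0"
    proof (rule AE_I2)
      fix r
      show "(\<lambda>n. indicator {0..t} r *\<^sub>R (LINT \<omega>|M. u (X (r - grid n r) \<omega>))) \<longlonglongrightarrow> 0"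
      proof (cases "r \<in> {0..t}")
        case True
        \<comment> \<open>The shift to \<open>Suc n\<close> avoids the degenerate grid with n =
          0.\<close>
        define h where "h n = r - grid (Suc n) r" for n
        have h: "0 \<le> h n" "h n \<le> 1 / real (Suc n)" for n
          using grid_bounds[of "Suc n" r] True unfolding h_def by auto
        have h0: "h \<longlonglongrightarrow> 0"
        proof (rule tendsto_sandwich[of "\<lambda>_. 0" h _ "\<lambda>n. 1 / real (Suc n)"])
          show "(\<lambda>n. 1 / real (Suc n)) \<longlonglongrightarrow> 0" by real_asymp
        qed (use h in auto)
        have "(\<lambda>n. LINT \<omega>|M. u (X (h n) \<omega>)) \<longlonglongrightarrow> (LINT \<omega>|M. 0)"
        proof (rule integral_dominated_convergence[where w="\<lambda>_. 2 * Q"])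
          have "AE \<omega> in M. cadlag (\<lambda>t. X t \<omega>)" using lp by (simp add: levy_process_def)
          then show "AE \<omega> in M. (\<lambda>n. u (X (h n) \<omega>)) \<longlonglongrightarrow> 0"
            using X_0
          proof eventually_elim
            case (elim \<omega>)
            have rc: "((\<lambda>t. X t \<omega>) \<longlongrightarrow> X 0 \<omega>) (at_right 0)" using elim by (auto simp: cadlag_def continuous_within)
            have "(\<lambda>n. X (h n) \<omega>) \<longlonglongrightarrow> 0"
            proof (rule tendstoI)
              fix e :: real assume e: "e > 0"
              then have "\<forall>\<^sub>F s in at_right 0. dist (X s \<omega>) (X 0 \<omega>) < e" using rc by (rule tendstoD[rotated])
              then obtain b where b: "b > 0" "\<And>s. 0 < s \<Longrightarrow> s < b \<Longrightarrow> dist (X s \<omega>) (X 0 \<omega>) < e"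
                unfolding eventually_at_right_field by auto
              have "\<forall>\<^sub>F n in sequentially. h n < b" using h0 b(1) by (rule order_tendstoD)
              then show "\<forall>\<^sub>F n in sequentially. dist (X (h n) \<omega>) 0 < e"
              proof eventually_elim
                case (elim n)
                \<comment> \<open>At grid points the elapsed time is exactly 0, which a limit from
                  the right does not see; there the initial value is used.\<close>
                then show ?case using b(2)[of "h n"] h(1)[of n] \<open>X 0 \<omega> = 0\<close> e by (cases "h n = 0") auto
              qed
            qed
            then have "(\<lambda>n. u (X (h n) \<omega>)) \<longlonglongrightarrow> u 0"
              using u_cont by (intro isCont_tendsto_compose[of 0 u]) (simp_all add: continuous_on_eq_continuous_at)
            then show ?case using Q_nonneg by (simp add: u_def)
          qed
        qed (use u_bounds in auto)
        then have "(\<lambda>n. LINT \<omega>|M. u (X (r - grid (Suc n) r) \<omega>)) \<longlonglongrightarrow> 0" unfolding h_def by simp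
        then have "(\<lambda>n. LINT \<omega>|M. u (X (r - grid n r) \<omega>)) \<longlonglongrightarrow> 0" by (rule LIMSEQ_imp_Suc)
        then show ?thesis using True by simp
      qed simp
    qed
    show "AE r in lborel. norm (indicator {0..t} r *\<^sub>R (LINT \<omega>|M. u (X (r - grid n r) \<omega>))) \<le> 2 * Q * indicator {0..t} r" for n
    proof (rule AE_I2)
      fix r
      have "\<bar>LINT \<omega>|M. u (X (r - grid n r) \<omega>)\<bar> \<le> (LINT \<omega>|M. 2 * Q)"
        by (rule order.trans[OF integral_abs_bound integral_mono]) (use u_bounds in \<open>auto intro!: integrable_const_bound[where B="2*Q"]\<close>)
      then show "norm (indicator {0..t} r *\<^sub>R (LINT \<omega>|M. u (X (r - grid n r) \<omega>))) \<le> 2 * Q * indicator {0..t} r"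
        by (simp add: prob_space indicator_def)
    qed
  qed auto
  then show ?thesis by (simp add: err_def set_lebesgue_integral_def)
qed

end

locale levy_limit_kernel = levy_limit M X N \<xi> + lipschitz_kernel q Q \<Lambda>
  for M :: "'a measure" and X and N :: "'b measure" and \<xi> and q Q \<Lambda>

sublocale levy_limit_kernel \<subseteq> XK: levy_path_kernel M "X R" q Q \<Lambda> for R by unfold_locales
sublocale levy_limit_kernel \<subseteq> xiK: levy_path_kernel N \<xi> q Q \<Lambda> by unfold_locales

context levy_limit_kernel begin

text \<open>This makes the discretisation uniform in R: a mesh that is fine enough for the limit
  process is fine enough for all large R.\<close>

lemma err_convergence:
  assumes n: "n > 0"
  shows "((\<lambda>R. XK.err R n t) \<longlongrightarrow> xiK.err n t) at_top"
  unfolding XK.err_def xiK.err_def set_lebesgue_integral_def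
proof (rule integral_dominated_convergence_at_top[where w="\<lambda>r. 2 * Q * indicator {0..t} r"])
  show "integrable lborel (\<lambda>r. 2 * Q * indicator {0..t} r)"
    by (intro integrable_mult_right integrable_real_indicator emeasure_compact_finite compact_Icc) auto
  show "AE r in lborel. ((\<lambda>R. indicator {0..t} r *\<^sub>R (LINT \<omega>|M. u (X R (r - grid n r) \<omega>))) \<longlongrightarrow>
      indicator {0..t} r *\<^sub>R (LINT \<omega>|N. u (\<xi> (r - grid n r) \<omega>))) at_top"
  proof (rule AE_I2)
    fix r
    show "((\<lambda>R. indicator {0..t} r *\<^sub>R (LINT \<omega>|M. u (X R (r - grid n r) \<omega>))) \<longlongrightarrow>
      indicator {0..t} r *\<^sub>R (LINT \<omega>|N. u (\<xi> (r - grid n r) \<omega>))) at_top"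
    proof (cases "r \<in> {0..t}")
      case True
      then show ?thesis using grid_bounds[OF n, of r]
        by (intro tendsto_scaleR tendsto_const marginal_convergence[where B="2*Q"] u_cont u_bounds) auto
    qed simp
  qed
  show "\<forall>\<^sub>F R in at_top. AE r in lborel. norm (indicator {0..t} r *\<^sub>R (LINT \<omega>|M. u (X R (r - grid n r) \<omega>))) \<le> 2 * Q * indicator {0..t} r"
  proof (intro always_eventually allI AE_I2)
    fix R r
    have "\<bar>LINT \<omega>|M. u (X R (r - grid n r) \<omega>)\<bar> \<le> (LINT \<omega>|M. 2 * Q)"
      by (rule order.trans[OF integral_abs_bound integral_mono]) (use u_bounds in \<open>auto intro!: X.integrable_const_bound[where B="2*Q"]\<close>)
    then show "norm (indicator {0..t} r *\<^sub>R (LINT \<omega>|M. u (X R (r - grid n r) \<omega>))) \<le> 2 * Q * indicator {0..t} r"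
      by (simp add: X.prob_space indicator_def)
  qed
qed auto

text \<open>The truncation at \<open>m\<close> makes this a function of the first \<open>m\<close> coordinates only; it is void
  when \<open>t * n \<le> m\<close> for the relevant times \<open>t\<close>.\<close>

definition walk_functional where
  "walk_functional g c x n m v = g (\<lambda>t. c * (LINT r:{0..t}|lborel. q ((\<Sum>l<min m (nat \<lfloor>r * real n\<rfloor>). v l) - x)))"
  for g :: "(real \<Rightarrow> real) \<Rightarrow> real" and c x :: real and n m :: nat and v :: "nat \<Rightarrow> real"

text \<open>The number of summands depends on r but takes countably many values, which gives joint
  measurability in r and v; integration over r preserves it.\<close>

lemma walk_functional_meas:
  assumes g: "lip_on J C g"
  shows "walk_functional g c x n m \<in> borel_measurable (PiM {..<m} (\<lambda>_. borel))"
proof -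
  have comp: "(\<lambda>z. (\<Sum>l<min m i. fst z l :: real)) \<in> borel_measurable (PiM {..<m} (\<lambda>_. borel) \<Otimes>\<^sub>M lborel)" for i
  proof (rule borel_measurable_sum[where f="\<lambda>l z. fst z l"])
    fix l assume "l \<in> {..<min m i}"
    then show "(\<lambda>z. fst z l :: real) \<in> borel_measurable (PiM {..<m} (\<lambda>_. borel) \<Otimes>\<^sub>M lborel)"
      by (intro measurable_compose[OF measurable_fst] measurable_component_singleton) auto
  qed
  have joint: "(\<lambda>z. (\<lambda>i z. (\<Sum>l<min m i. fst z l :: real)) (nat \<lfloor>snd z * real n\<rfloor>) z) \<in> borel_measurable (PiM {..<m} (\<lambda>_. borel) \<Otimes>\<^sub>M lborel)"
    by (rule measurable_compose_countable[where f="\<lambda>i z. \<Sum>l<min m i. fst z l", OF comp]) measurable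
  have "(\<lambda>z. indicator {0..t} (snd z) *\<^sub>R q ((\<Sum>l<min m (nat \<lfloor>snd z * real n\<rfloor>). fst z l) - x)) \<in> borel_measurable (PiM {..<m} (\<lambda>_. borel) \<Otimes>\<^sub>M lborel)" for t
  proof (rule borel_measurable_scaleR)
    show "(\<lambda>z. indicator {0..t} (snd z) :: real) \<in> borel_measurable (PiM {..<m} (\<lambda>_. borel) \<Otimes>\<^sub>M lborel)" by measurable
    show "(\<lambda>z. q ((\<Sum>l<min m (nat \<lfloor>snd z * real n\<rfloor>). fst z l) - x)) \<in> borel_measurable (PiM {..<m} (\<lambda>_. borel) \<Otimes>\<^sub>M lborel)"
      by (rule measurable_compose[OF borel_measurable_diff[OF joint borel_measurable_const] q_meas])
  qed
  then have [measurable]: "(\<lambda>v. LINT r|lborel. indicator {0..t} r *\<^sub>R q ((\<Sum>l<min m (nat \<lfloor>r * real n\<rfloor>). v l) - x)) \<in> borel_measurable (PiM {..<m} (\<lambda>_. borel))" for t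
    by (intro lborel.borel_measurable_lebesgue_integral) (simp add: case_prod_beta)
  show ?thesis unfolding walk_functional_def[abs_def] set_lebesgue_integral_def
    by (rule lip_on_measurable[OF g]) simp
qed

lemma walk_functional_cont:
  assumes g: "lip_on J C g" and v: "\<And>i. i < m \<Longrightarrow> (\<lambda>k. v k i) \<longlonglongrightarrow> w i"
  shows "(\<lambda>k::nat. walk_functional g c x n m (v k)) \<longlonglongrightarrow> walk_functional g c x n m w"
  unfolding walk_functional_def
proof (rule lip_on_tendsto[OF g])
  fix t
  have "(\<lambda>k. LINT r:{0..t}|lborel. q ((\<Sum>l<min m (nat \<lfloor>r * real n\<rfloor>). v k l) - x)) \<longlonglongrightarrow>
     (LINT r:{0..t}|lborel. q ((\<Sum>l<min m (nat \<lfloor>r * real n\<rfloor>). w l) - x))"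
    unfolding set_lebesgue_integral_def
  proof (rule integral_dominated_convergence[where w="\<lambda>r. Q * indicator {0..t} r"])
    have m: "(\<lambda>r. q ((\<Sum>l<min m (nat \<lfloor>r * real n\<rfloor>). y l) - x)) \<in> borel_measurable borel" for y :: "nat \<Rightarrow> real"
    proof -
      have "(\<lambda>r. (\<lambda>i r. (\<Sum>l<min m i. y l)) (nat \<lfloor>r * real n\<rfloor>) r) \<in> borel_measurable borel"
        by (rule measurable_compose_countable) measurable
      then show ?thesis by measurable
    qed
    show "(\<lambda>r. indicator {0..t} r *\<^sub>R q ((\<Sum>l<min m (nat \<lfloor>r * real n\<rfloor>). w l) - x)) \<in> borel_measurable lborel"
      using m[of w] by measurable
    show "(\<lambda>r. indicator {0..t} r *\<^sub>R q ((\<Sum>l<min m (nat \<lfloor>r * real n\<rfloor>). v k l) - x)) \<in> borel_measurable lborel" for k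
      using m[of "v k"] by measurable
    show "integrable lborel (\<lambda>r. Q * indicator {0..t} r)"
      by (intro integrable_mult_right integrable_real_indicator emeasure_compact_finite compact_Icc) auto
    have qc: "isCont q y" for y
      unfolding isCont_def
    proof (rule LIM_zero_cancel, rule Lim_null_comparison[where g="\<lambda>z. \<Lambda> * \<bar>z - y\<bar>"])
      show "\<forall>\<^sub>F z in at y. norm (q z - q y) \<le> \<Lambda> * \<bar>z - y\<bar>" using q_lip by simp
      have "((\<lambda>z. \<Lambda> * \<bar>z - y\<bar>) \<longlongrightarrow> \<Lambda> * \<bar>y - y\<bar>) (at y)" by (intro tendsto_intros)
      then show "((\<lambda>z. \<Lambda> * \<bar>z - y\<bar>) \<longlongrightarrow> 0) (at y)" by simp
    qed
    show "AE r in lborel. (\<lambda>k. indicator {0..t} r *\<^sub>R q ((\<Sum>l<min m (nat \<lfloor>r * real n\<rfloor>). v k l) - x)) \<longlonglongrightarrow>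
      indicator {0..t} r *\<^sub>R q ((\<Sum>l<min m (nat \<lfloor>r * real n\<rfloor>). w l) - x)"
      by (intro AE_I2 tendsto_scaleR tendsto_const isCont_tendsto_compose[OF qc] tendsto_diff tendsto_sum v) auto
  qed (use q_bound in \<open>auto simp: indicator_def\<close>)
  then show "(\<lambda>k. c * (LINT r:{0..t}|lborel. q ((\<Sum>l<min m (nat \<lfloor>r * real n\<rfloor>). v k l) - x))) \<longlonglongrightarrow>
     c * (LINT r:{0..t}|lborel. q ((\<Sum>l<min m (nat \<lfloor>r * real n\<rfloor>). w l) - x))"
    by (rule tendsto_mult_left)
qed

lemma walk_functional_increments:
  fixes Y :: "real \<Rightarrow> 'c \<Rightarrow> real"
  assumes g: "lip_on J C g" and n: "n > 0" and m: "\<And>t. t \<in> J \<Longrightarrow> t * real n \<le> real m" and Y0: "Y 0 \<omega> = 0"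
  shows "walk_functional g c x n m (\<lambda>i\<in>{..<m}. Y (real (Suc i) * (1 / real n)) \<omega> - Y (real i * (1 / real n)) \<omega>) =
    g (\<lambda>t. c * occ q x (\<lambda>r. Y (grid n r)) t \<omega>)"
  unfolding walk_functional_def
proof (rule lip_on_cong[OF g])
  fix t assume t: "t \<in> J"
  have "(LINT r:{0..t}|lborel. q ((\<Sum>l<min m (nat \<lfloor>r * real n\<rfloor>). (\<lambda>i\<in>{..<m}. Y (real (Suc i) * (1 / real n)) \<omega> - Y (real i * (1 / real n)) \<omega>) l) - x)) = 
    (LINT r:{0..t}|lborel. q (Y (grid n r) \<omega> - x))"
  proof (rule set_lebesgue_integral_cong)
    show "\<forall>r. r \<in> {0..t} \<longrightarrow> q ((\<Sum>l<min m (nat \<lfloor>r * real n\<rfloor>). (\<lambda>i\<in>{..<m}. Y (real (Suc i) * (1 / real n)) \<omega> - Y (real i * (1 / real n)) \<omega>) l) - x) = q (Y (grid n r) \<omega> - x)"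
    proof (intro allI impI)
      fix r assume r: "r \<in> {0..t}"
      have "r * real n \<le> t * real n" using r by (intro mult_right_mono) auto
      then have "r * real n \<le> real m" using m[OF t] by linarith
      then have "nat \<lfloor>r * real n\<rfloor> \<le> m" by linarith
      then have mn: "min m (nat \<lfloor>r * real n\<rfloor>) = nat \<lfloor>r * real n\<rfloor>" by simp
      have "(\<Sum>l<nat \<lfloor>r * real n\<rfloor>. (\<lambda>i\<in>{..<m}. Y (real (Suc i) * (1 / real n)) \<omega> - Y (real i * (1 / real n)) \<omega>) l) = 
        (\<Sum>l<nat \<lfloor>r * real n\<rfloor>. Y (real (Suc l) * (1 / real n)) \<omega> - Y (real l * (1 / real n)) \<omega>)"
        using \<open>nat \<lfloor>r * real n\<rfloor> \<le> m\<close> by (intro sum.cong) auto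
      also have "\<dots> = Y (grid n r) \<omega>"
        using sum_lessThan_telescope[of "\<lambda>l. Y (real l * (1 / real n)) \<omega>" "nat \<lfloor>r * real n\<rfloor>"] Y0 by (simp add: grid_def)
      finally show "q ((\<Sum>l<min m (nat \<lfloor>r * real n\<rfloor>). (\<lambda>i\<in>{..<m}. Y (real (Suc i) * (1 / real n)) \<omega> - Y (real i * (1 / real n)) \<omega>) l) - x) = q (Y (grid n r) \<omega> - x)"
        unfolding mn by simp
    qed
  qed auto
  then show "c * (LINT r:{0..t}|lborel. q ((\<Sum>l<min m (nat \<lfloor>r * real n\<rfloor>). (\<lambda>i\<in>{..<m}. Y (real (Suc i) * (1 / real n)) \<omega> - Y (real i * (1 / real n)) \<omega>) l) - x)) =
    c * occ q x (\<lambda>r. Y (grid n r)) t \<omega>" by (simp add: occ_def)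
qed

lemma discretised_convergence:
  assumes g: "lip_on J C g" and gb: "\<And>v. \<bar>g v\<bar> \<le> H" and n: "n > 0"
  shows "((\<lambda>R. LINT \<omega>|M. g (\<lambda>t. c * occ q x (\<lambda>r. X R (grid n r)) t \<omega>)) \<longlongrightarrow> 
    (LINT \<omega>|N. g (\<lambda>t. c * occ q x (\<lambda>r. \<xi> (grid n r)) t \<omega>))) at_top"
proof -
  have J: "finite J" using g by (simp add: lip_on_def)
  obtain b where b: "\<And>t. t \<in> J \<Longrightarrow> t \<le> b" using bdd_above_finite[OF J] unfolding bdd_above_def by blast
  obtain m where m: "b * real n < real m" "m > 0"
    using reals_Archimedean2[of "max 1 (b * real n)"] by (metis max_less_iff_conj of_nat_0_less_iff order_less_trans zero_less_one)
  have mt: "t * real n \<le> real m" if "t \<in> J" for t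
    using mult_right_mono[OF b[OF that], of "real n"] m by simp
  let ?F = "walk_functional g c x n m"
  have "((\<lambda>R. LINT \<omega>|M. ?F (\<lambda>i\<in>{..<m}. X R (real (Suc i) * (1 / real n)) \<omega> - X R (real i * (1 / real n)) \<omega>)) \<longlongrightarrow> 
    (LINT \<omega>|N. ?F (\<lambda>i\<in>{..<m}. \<xi> (real (Suc i) * (1 / real n)) \<omega> - \<xi> (real i * (1 / real n)) \<omega>))) at_top"
    by (rule increments_convergence[where B=H, OF m(2) _ walk_functional_meas[OF g]])
      (use gb in \<open>auto simp: walk_functional_def[of g] intro!: walk_functional_cont[OF g, unfolded walk_functional_def]\<close>)
  moreover have "(LINT \<omega>|M. ?F (\<lambda>i\<in>{..<m}. X R (real (Suc i) * (1 / real n)) \<omega> - X R (real i * (1 / real n)) \<omega>)) = 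
    (LINT \<omega>|M. g (\<lambda>t. c * occ q x (\<lambda>r. X R (grid n r)) t \<omega>))" for R
  proof (rule integral_cong_AE)
    show "AE \<omega> in M. ?F (\<lambda>i\<in>{..<m}. X R (real (Suc i) * (1 / real n)) \<omega> - X R (real i * (1 / real n)) \<omega>) = g (\<lambda>t. c * occ q x (\<lambda>r. X R (grid n r)) t \<omega>)"
      using X.X_0[of R] by eventually_elim (rule walk_functional_increments[OF g n mt])
    show "(\<lambda>\<omega>. g (\<lambda>t. c * occ q x (\<lambda>r. X R (grid n r)) t \<omega>)) \<in> borel_measurable M"
      by (rule lip_on_measurable[OF g]) simp
    show "(\<lambda>\<omega>. ?F (\<lambda>i\<in>{..<m}. X R (real (Suc i) * (1 / real n)) \<omega> - X R (real i * (1 / real n)) \<omega>)) \<in> borel_measurable M"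
      by (rule measurable_compose[OF _ walk_functional_meas[OF g]]) (intro measurable_restrict borel_measurable_diff X.X_meas)
  qed
  moreover have "(LINT \<omega>|N. ?F (\<lambda>i\<in>{..<m}. \<xi> (real (Suc i) * (1 / real n)) \<omega> - \<xi> (real i * (1 / real n)) \<omega>)) = 
    (LINT \<omega>|N. g (\<lambda>t. c * occ q x (\<lambda>r. \<xi> (grid n r)) t \<omega>))"
  proof (rule integral_cong_AE)
    show "AE \<omega> in N. ?F (\<lambda>i\<in>{..<m}. \<xi> (real (Suc i) * (1 / real n)) \<omega> - \<xi> (real i * (1 / real n)) \<omega>) = g (\<lambda>t. c * occ q x (\<lambda>r. \<xi> (grid n r)) t \<omega>)"
      using xi.X_0 by eventually_elim (rule walk_functional_increments[OF g n mt])
    show "(\<lambda>\<omega>. g (\<lambda>t. c * occ q x (\<lambda>r. \<xi> (grid n r)) t \<omega>)) \<in> borel_measurable N"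
      by (rule lip_on_measurable[OF g]) simp
    show "(\<lambda>\<omega>. ?F (\<lambda>i\<in>{..<m}. \<xi> (real (Suc i) * (1 / real n)) \<omega> - \<xi> (real i * (1 / real n)) \<omega>)) \<in> borel_measurable N"
      by (rule measurable_compose[OF _ walk_functional_meas[OF g]]) (intro measurable_restrict borel_measurable_diff xi.X_meas)
  qed
  ultimately show ?thesis by simp
qed

text \<open>The mesh is fixed by the error of the limit process. For that mesh the error of
  \<open>X R\<close> is eventually as small, and the discretised functionals depend on finitely many
  increments, whose convergence is known.\<close>

theorem occupation_convergence:
  assumes g: "lip_on J C g" and gb: "\<And>v. \<bar>g v\<bar> \<le> H" and J: "J \<subseteq> {0..}"
  shows "((\<lambda>R. LINT \<omega>|M. g (\<lambda>t. c * occ q x (X R) t \<omega>)) \<longlongrightarrow> (LINT \<omega>|N. g (\<lambda>t. c * occ q x \<xi> t \<omega>))) at_top"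
proof (rule tendsto_approximation)
  fix \<epsilon> :: real assume e: "\<epsilon> > 0"
  have "(\<lambda>n. C * (\<Sum>t\<in>J. \<bar>c\<bar> * xiK.err n t)) \<longlonglongrightarrow> C * (\<Sum>t\<in>J. \<bar>c\<bar> * 0)"
    by (intro tendsto_mult_left tendsto_sum xiK.err_tendsto_0)
  then have "\<forall>\<^sub>F n in sequentially. C * (\<Sum>t\<in>J. \<bar>c\<bar> * xiK.err n t) < \<epsilon> \<and> n > 0"
    using e by (intro eventually_conj eventually_gt_at_top order_tendstoD(2)[of _ 0]) auto
  then obtain n where n: "C * (\<Sum>t\<in>J. \<bar>c\<bar> * xiK.err n t) < \<epsilon>" "n > 0"
    by (auto simp: eventually_sequentially)
  let ?b = "\<lambda>R. LINT \<omega>|M. g (\<lambda>t. c * occ q x (\<lambda>r. X R (grid n r)) t \<omega>)"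
  let ?l = "LINT \<omega>|N. g (\<lambda>t. c * occ q x (\<lambda>r. \<xi> (grid n r)) t \<omega>)"
  have "((\<lambda>R. C * (\<Sum>t\<in>J. \<bar>c\<bar> * XK.err R n t)) \<longlongrightarrow> C * (\<Sum>t\<in>J. \<bar>c\<bar> * xiK.err n t)) at_top"
    by (intro tendsto_mult_left tendsto_sum err_convergence n)
  then have "\<forall>\<^sub>F R in at_top. C * (\<Sum>t\<in>J. \<bar>c\<bar> * XK.err R n t) < \<epsilon>"
    using n(1) by (rule order_tendstoD)
  then have 1: "\<forall>\<^sub>F R in at_top. \<bar>(LINT \<omega>|M. g (\<lambda>t. c * occ q x (X R) t \<omega>)) - ?b R\<bar> \<le> \<epsilon>"
  proof eventually_elim
    case (elim R)
    then show ?case using XK.lip_expectation_error[OF g gb n(2) J, of c x R] by linarith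
  qed
  have 3: "\<bar>?l - (LINT \<omega>|N. g (\<lambda>t. c * occ q x \<xi> t \<omega>))\<bar> \<le> \<epsilon>"
    using xiK.lip_expectation_error[OF g gb n(2) J, of c x] n(1) by linarith
  show "\<exists>b l'. (\<forall>\<^sub>F R in at_top. \<bar>(LINT \<omega>|M. g (\<lambda>t. c * occ q x (X R) t \<omega>)) - b R\<bar> \<le> \<epsilon>) \<and> (b \<longlongrightarrow> l') at_top \<and>
    \<bar>l' - (LINT \<omega>|N. g (\<lambda>t. c * occ q x \<xi> t \<omega>))\<bar> \<le> \<epsilon>"
    using 1 discretised_convergence[OF g gb n(2), where c=c and x=x] 3
    by (intro exI[of _ ?b] exI[of _ ?l] conjI)
qed

end

section \<open>Local times\<close>

lemma assumption_A_D:
  assumes A: "assumption_A \<beta> M \<eta> f \<psi>" and b: "1 < \<beta>" "\<beta> < 2"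
  shows "levy_process M \<eta>" "regular_exponent \<beta> f" "slowly_varying f"
    "\<And>t \<theta>. t \<ge> 0 \<Longrightarrow> char (distr M borel (\<eta> t)) \<theta> = complex_of_real (exp (- (t * tail_exponent \<beta> f \<theta>)))"
proof -
  define w where "w x = tail_density \<beta> f x / c_stable \<beta>" for x
  define \<nu> where "\<nu> = density lborel (\<lambda>x. ennreal (w x))"
  have c: "c_stable \<beta> > 0" by (rule c_stable_pos[OF b])
  have *: "levy_process M \<eta>" "has_characteristic_triple M \<eta> 0 0 \<nu>" "\<psi> = levy_exponent 0 0 \<nu>"
    "\<And>x. tail_density \<beta> f x \<ge> 0" "\<And>x. f (- x) = f x" "slowly_varying f"
    "(\<integral>\<^sup>+ z\<in>{1..}. inverse (ennreal (Re (\<psi> z))) \<partial>lborel) < \<infinity>"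
    using A unfolding assumption_A_def Let_def \<nu>_def w_def tail_density_def by auto
  have fm [measurable]: "f \<in> borel_measurable borel" using *(6) by (simp add: slowly_varying_def)
  have gm [measurable]: "tail_density \<beta> f \<in> borel_measurable borel" unfolding tail_density_def[abs_def] by measurable
  have wm [measurable]: "w \<in> borel_measurable borel" unfolding w_def[abs_def] by measurable
  have wnn: "w x \<ge> 0" for x using *(4) c by (simp add: w_def)
  have weven: "w (- x) = w x" for x using *(5) by (simp add: w_def tail_density_def)
  have "(\<integral>\<^sup>+ x. ennreal (min 1 (x\<^sup>2)) \<partial>\<nu>) < \<infinity>"
    using *(2) by (simp add: has_characteristic_triple_def levy_measure_def)
  then have "(\<integral>\<^sup>+ x. ennreal (w x) * ennreal (min 1 (x\<^sup>2)) \<partial>lborel) < \<infinity>"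
    unfolding \<nu>_def by (subst (asm) nn_integral_density) auto
  then have wint: "integrable lborel (\<lambda>x. min 1 (x\<^sup>2) * w x)"
    using wnn by (intro integrableI_bounded) (auto simp: ennreal_mult[symmetric] mult.commute)
  have psi: "\<psi> \<theta> = complex_of_real (tail_exponent \<beta> f \<theta>)" for \<theta>
    unfolding *(3) \<nu>_def levy_exponent_even[OF wm wnn weven wint] by (simp add: tail_exponent_def w_def)
  show "levy_process M \<eta>" "slowly_varying f" by fact+
  have "integrable lborel (\<lambda>x. c_stable \<beta> * (min 1 (x\<^sup>2) * w x))" using wint by simp
  also have "(\<lambda>x. c_stable \<beta> * (min 1 (x\<^sup>2) * w x)) = (\<lambda>x. min 1 (x\<^sup>2) * tail_density \<beta> f x)"
    using c by (simp add: w_def fun_eq_iff)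
  finally show "regular_exponent \<beta> f"
    using b * unfolding psi by unfold_locales auto
  show "char (distr M borel (\<eta> t)) \<theta> = complex_of_real (exp (- (t * tail_exponent \<beta> f \<theta>)))" if "t \<ge> 0" for t \<theta>
    using *(2) that psi[of \<theta>] unfolding has_characteristic_triple_def *(3) by (simp add: exp_of_real[symmetric])
qed

text \<open>Substitution and evenness reduce this to the integral over \<open>{1/R..}\<close>. It
  only gives finiteness for each single R, so that the rescaled process has densities; uniformity is
  the business of \<open>inverse_tail_exponent_uniform\<close>.\<close>

lemma (in regular_exponent) inverse_Psi_scaled_finite:
  assumes R: "R > 0" and b: "b > 0"
  shows "(\<integral>\<^sup>+\<theta>. inverse (ennreal (b * \<Psi> (\<theta> / R))) * indicator {\<theta>. \<bar>\<theta>\<bar> > 1} \<theta> \<partial>lborel) < \<infinity>"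
proof -
  let ?h = "\<lambda>z. inverse (ennreal (\<Psi> z)) * indicator {1 / R..} z"
  have eq: "(\<integral>\<^sup>+\<theta>. inverse (ennreal (b * \<Psi> (\<theta> / R))) * indicator {\<theta>. \<bar>\<theta>\<bar> > 1} \<theta> \<partial>lborel) = 
    ennreal \<bar>R\<bar> * (\<integral>\<^sup>+z. inverse (ennreal (b * \<Psi> ((0 + R * z) / R))) * indicator {\<theta>. \<bar>\<theta>\<bar> > 1} (0 + R * z) \<partial>lborel)"
    using R by (intro nn_integral_real_affine) auto
  have "(\<integral>\<^sup>+z. inverse (ennreal (b * \<Psi> ((0 + R * z) / R))) * indicator {\<theta>. \<bar>\<theta>\<bar> > 1} (0 + R * z) \<partial>lborel)
    \<le> (\<integral>\<^sup>+z. ennreal (1 / b) * (?h z + ?h (0 + (-1) * z)) \<partial>lborel)"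
  proof (rule nn_integral_mono)
    fix z
    have "inverse (ennreal (b * \<Psi> ((0 + R * z) / R))) = inverse (ennreal b * ennreal (\<Psi> z))"
      using R b Psi_nonneg[of z] by (simp add: ennreal_mult)
    also have "\<dots> = inverse (ennreal b) * inverse (ennreal (\<Psi> z))"
      using b by (intro ennreal_inverse_mult) auto
    also have "inverse (ennreal b) = ennreal (1 / b)" using b by (simp add: inverse_ennreal inverse_eq_divide)
    finally have e: "inverse (ennreal (b * \<Psi> ((0 + R * z) / R))) = ennreal (1 / b) * inverse (ennreal (\<Psi> z))" .
    have "inverse (ennreal (\<Psi> z)) * indicator {\<theta>. \<bar>\<theta>\<bar> > 1} (0 + R * z) \<le> ?h z + ?h (0 + (-1) * z)"
    proof (cases "\<bar>R * z\<bar> > 1")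
      case True
      then have "1 < \<bar>z\<bar> * R" using R by (simp add: abs_mult mult.commute)
      then have "1 / R < \<bar>z\<bar>" using R by (simp add: pos_divide_less_eq)
      then show ?thesis using True
        by (cases "z \<ge> 0") (auto simp: Psi_even abs_if intro: add_increasing add_increasing2)
    qed (simp add: indicator_def)
    then show "inverse (ennreal (b * \<Psi> ((0 + R * z) / R))) * indicator {\<theta>. \<bar>\<theta>\<bar> > 1} (0 + R * z) \<le> ennreal (1 / b) * (?h z + ?h (0 + (-1) * z))"
      unfolding e mult.assoc by (rule mult_left_mono) simp
  qed
  also have "\<dots> = ennreal (1 / b) * ((\<integral>\<^sup>+z. ?h z \<partial>lborel) + (\<integral>\<^sup>+z. ?h (0 + (-1) * z) \<partial>lborel))"
    by (subst nn_integral_cmult) (auto simp: nn_integral_add)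
  also have "(\<integral>\<^sup>+z. ?h (0 + (-1) * z) \<partial>lborel) = (\<integral>\<^sup>+z. ?h z \<partial>lborel)"
    using nn_integral_real_affine[of ?h "-1" 0] by simp
  also have "ennreal (1 / b) * ((\<integral>\<^sup>+z. ?h z \<partial>lborel) + (\<integral>\<^sup>+z. ?h z \<partial>lborel)) < \<infinity>"
    using inverse_Psi_finite[of "1 / R"] R by (simp add: ennreal_mult_less_top)
  finally show ?thesis unfolding eq by (simp add: ennreal_mult_less_top)
qed

lemma lipschitz_kernel_tent: "\<epsilon> > 0 \<Longrightarrow> lipschitz_kernel (tent \<epsilon>) (1 / \<epsilon>) (1 / \<epsilon>\<^sup>2)"
  using tent_lipschitz[of \<epsilon>] tent_nonneg[of \<epsilon>] tent_le[of \<epsilon>] by unfold_locales auto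

lemma occ_eq_local_time:
  fixes Y :: "real \<Rightarrow> 'b \<Rightarrow> real"
  assumes [measurable]: "(\<lambda>r. Y r \<omega>) \<in> borel_measurable borel" "q \<in> borel_measurable borel" "l \<in> borel_measurable borel"
    and nn: "\<And>y. l y \<ge> 0"
    and d: "distr (restrict_space lborel {0..t}) borel (\<lambda>r. Y r \<omega>) = density lborel (\<lambda>y. ennreal (l y))"
  shows "occ q x Y t \<omega> = (LINT y|lborel. l y * q (y - x))"
proof -
  have "occ q x Y t \<omega> = (LINT r|restrict_space lborel {0..t}. q (Y r \<omega> - x))"
    unfolding occ_def by (subst integral_restrict_space) (auto simp: set_lebesgue_integral_def)
  also have "\<dots> = (LINT y|distr (restrict_space lborel {0..t}) borel (\<lambda>r. Y r \<omega>). q (y - x))"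
    by (subst integral_distr) (auto intro!: measurable_restrict_space1)
  also have "\<dots> = (LINT y|lborel. l y * q (y - x))"
    unfolding d by (subst integral_density) (use nn in auto)
  finally show ?thesis .
qed

lemma tent_approximates:
  assumes l: "continuous_on UNIV l"
  shows "((\<lambda>\<epsilon>. LINT y|lborel. l y * tent \<epsilon> (y - x)) \<longlongrightarrow> l x) (at_right 0)"
proof (rule tendstoI)
  fix e :: real assume e: "e > 0"
  have lm [measurable]: "l \<in> borel_measurable borel" using l by (rule borel_measurable_continuous_onI)
  have "isCont l x" using l by (simp add: continuous_on_eq_continuous_at)
  then have "(l \<longlongrightarrow> l x) (at x)" by (simp add: isCont_def)
  then have "\<forall>\<^sub>F y in at x. dist (l y) (l x) < e / 2" using e by (intro tendstoD) auto
  then obtain d where d: "d > 0" "\<And>y. y \<noteq> x \<Longrightarrow> dist y x < d \<Longrightarrow> dist (l y) (l x) < e / 2"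
    by (auto simp: eventually_at)
  have "\<forall>\<^sub>F \<epsilon> in at_right 0. 0 < \<epsilon> \<and> \<epsilon> < d"
    using eventually_at_right_real[OF d(1)] by eventually_elim auto
  then show "\<forall>\<^sub>F \<epsilon> in at_right 0. dist (LINT y|lborel. l y * tent \<epsilon> (y - x)) (l x) < e"
  proof eventually_elim
    case (elim \<epsilon>)
    note t = tent_integral[of \<epsilon>]
    have it: "integrable lborel (\<lambda>y. tent \<epsilon> (y - x))"
      using lborel_integrable_real_affine[OF t(1), of 1 "-x"] elim by simp
    have It: "(LINT y|lborel. tent \<epsilon> (y - x)) = 1"
      using lborel_integral_real_affine[of 1 "tent \<epsilon>" "-x"] t(2) elim by simp
    have b: "\<bar>(l y - l x) * tent \<epsilon> (y - x)\<bar> \<le> e / 2 * tent \<epsilon> (y - x)" for y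
    proof (cases "\<bar>y - x\<bar> < \<epsilon>")
      case True
      then have "\<bar>l y - l x\<bar> \<le> e / 2"
        using d(2)[of y] elim e by (cases "y = x") (auto simp: dist_real_def)
      then show ?thesis using tent_nonneg[of \<epsilon> "y - x"] elim by (simp only: abs_mult abs_of_nonneg mult_right_mono)
    next
      case False
      then show ?thesis using tent_support[of \<epsilon> "y - x"] elim by simp
    qed
    have ie: "integrable lborel (\<lambda>y. e / 2 * tent \<epsilon> (y - x))" using it by simp
    have id: "integrable lborel (\<lambda>y. (l y - l x) * tent \<epsilon> (y - x))"
      by (rule Bochner_Integration.integrable_bound[OF ie]) (use order.trans[OF b abs_ge_self] in \<open>auto simp del: abs_mult times_divide_eq_left\<close>)
    have "(LINT y|lborel. l y * tent \<epsilon> (y - x)) = (LINT y|lborel. (l y - l x) * tent \<epsilon> (y - x) + l x * tent \<epsilon> (y - x))"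
      by (intro Bochner_Integration.integral_cong) (auto simp: algebra_simps)
    also have "\<dots> = (LINT y|lborel. (l y - l x) * tent \<epsilon> (y - x)) + l x"
      using id it It by (subst Bochner_Integration.integral_add) auto
    finally have "dist (LINT y|lborel. l y * tent \<epsilon> (y - x)) (l x) = \<bar>LINT y|lborel. (l y - l x) * tent \<epsilon> (y - x)\<bar>"
      by (simp add: dist_real_def)
    also have "\<dots> \<le> (LINT y|lborel. e / 2 * tent \<epsilon> (y - x))"
      by (rule order.trans[OF integral_abs_bound integral_mono]) (use id ie b in auto)
    also have "\<dots> = e / 2" using It by simp
    finally show ?case using e by simp
  qed
qed

text \<open>The occupation integral of a tent is the local time averaged against the tent, and the
  local time is continuous in space. The exceptional null set depends on t, which is harmless for
  finitely many times.\<close>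

lemma local_time_limit:
  assumes L: "jointly_continuous_local_time N \<xi> L" and xi': "levy_path N \<xi>'" and eq: "AE \<omega> in N. \<forall>t\<ge>0. \<xi>' t \<omega> = \<xi> t \<omega>"
    and t: "t \<ge> 0"
  shows "AE \<omega> in N. ((\<lambda>\<epsilon>. occ (tent \<epsilon>) x \<xi>' t \<omega>) \<longlongrightarrow> L t x \<omega>) (at_right 0)"
proof -
  interpret levy_path N \<xi>' by fact
  have "AE \<omega> in N. (\<forall>x. L t x \<omega> \<ge> 0) \<and> distr (restrict_space lborel {0..t}) borel (\<lambda>s. \<xi> s \<omega>) = density lborel (\<lambda>x. ennreal (L t x \<omega>))"
    using L t by (auto simp: jointly_continuous_local_time_def local_time_def)
  moreover have "AE \<omega> in N. continuous_on ({0..} \<times> UNIV) (\<lambda>(t, x). L t x \<omega>)"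
    using L by (simp add: jointly_continuous_local_time_def)
  ultimately show ?thesis using eq AE_space
  proof eventually_elim
    case (elim \<omega>)
    have [measurable]: "\<omega> \<in> space N" by fact
    have "continuous_on UNIV (\<lambda>x. (\<lambda>(t, x). L t x \<omega>) (t, x))"
      by (rule continuous_on_compose2[OF elim(2)]) (use t in \<open>auto intro!: continuous_intros\<close>)
    then have cont: "continuous_on UNIV (\<lambda>x. L t x \<omega>)" by simp
    have "distr (restrict_space lborel {0..t}) borel (\<lambda>s. \<xi>' s \<omega>) = distr (restrict_space lborel {0..t}) borel (\<lambda>s. \<xi> s \<omega>)"
      using elim(3) by (intro distr_cong) (auto simp: space_restrict_space)
    then have d: "distr (restrict_space lborel {0..t}) borel (\<lambda>s. \<xi>' s \<omega>) = density lborel (\<lambda>x. ennreal (L t x \<omega>))"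
      using elim(1) by simp
    have "occ (tent \<epsilon>) x \<xi>' t \<omega> = (LINT y|lborel. L t y \<omega> * tent \<epsilon> (y - x))" for \<epsilon>
      using elim(1) cont by (intro occ_eq_local_time d) (auto intro: borel_measurable_continuous_onI)
    then show ?case using tent_approximates[OF cont, of x] by simp
  qed
qed

section \<open>Convergence in law tested on Lipschitz functions\<close>

lemma space_borel_of [simp]: "space (borel_of X) = topspace X"
  unfolding borel_of_def by (rule space_measure_of) (auto dest: openin_subset)

lemma sets_borel_of: "openin X U \<Longrightarrow> U \<in> sets (borel_of X)"
  unfolding borel_of_def by (subst sets_measure_of) (auto dest: openin_subset)

lemma continuous_map_borel_of:
  assumes "continuous_map X euclideanreal h"
  shows "h \<in> borel_measurable (borel_of X)"
proof (rule borel_measurableI)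
  fix S :: "real set" assume "open S"
  then have "openin X {x \<in> topspace X. h x \<in> S}"
    using assms by (intro openin_continuous_map_preimage[of X euclideanreal]) auto
  moreover have "h -` S \<inter> space (borel_of X) = {x \<in> topspace X. h x \<in> S}" by auto
  ultimately show "h -` S \<inter> space (borel_of X) \<in> sets (borel_of X)" by (simp add: sets_borel_of)
qed

text \<open>A topology generated by an increasing sequence of pseudometrics. It treats finite
  products and the path space together, reducing both Borel measurability and convergence in law to
  functions that are Lipschitz in a single gauge.\<close>

locale gauge_space =
  fixes X :: "'c topology" and d :: "nat \<Rightarrow> 'c \<Rightarrow> 'c \<Rightarrow> real"
  assumes d_nonneg: "\<And>n w v. w \<in> topspace X \<Longrightarrow> v \<in> topspace X \<Longrightarrow> 0 \<le> d n w v"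
    and d_refl: "\<And>n w. w \<in> topspace X \<Longrightarrow> d n w w = 0"
    and d_sym: "\<And>n w v. d n w v = d n v w"
    and d_tri: "\<And>n w v z. w \<in> topspace X \<Longrightarrow> v \<in> topspace X \<Longrightarrow> z \<in> topspace X \<Longrightarrow> d n w z \<le> d n w v + d n v z"
    and d_mono: "\<And>m n w v. m \<le> n \<Longrightarrow> w \<in> topspace X \<Longrightarrow> v \<in> topspace X \<Longrightarrow> d m w v \<le> d n w v"
    and d_open: "\<And>U w. openin X U \<Longrightarrow> w \<in> U \<Longrightarrow> \<exists>n. \<exists>e>0. \<forall>v\<in>topspace X. d n w v < e \<longrightarrow> v \<in> U"
    and d_ball: "\<And>n w e. w \<in> topspace X \<Longrightarrow> openin X {v \<in> topspace X. d n w v < e}"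
begin

definition gauge_lipschitz :: "nat \<Rightarrow> real \<Rightarrow> ('c \<Rightarrow> real) \<Rightarrow> bool" where
  "gauge_lipschitz n C h \<longleftrightarrow> C \<ge> 0 \<and> (\<forall>w\<in>topspace X. \<forall>v\<in>topspace X. \<bar>h w - h v\<bar> \<le> C * d n w v)"

lemma gauge_lipschitzD:
  "gauge_lipschitz n C h \<Longrightarrow> w \<in> topspace X \<Longrightarrow> v \<in> topspace X \<Longrightarrow> \<bar>h w - h v\<bar> \<le> C * d n w v"
  by (simp add: gauge_lipschitz_def)

lemma gauge_lipschitz_continuous_map:
  assumes h: "gauge_lipschitz n C h"
  shows "continuous_map X euclideanreal h"
  unfolding continuous_map_def
proof (intro conjI allI impI)
  fix U :: "real set" assume "openin euclideanreal U"
  then have U: "open U" by simp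
  show "openin X {w \<in> topspace X. h w \<in> U}"
  proof (subst openin_subopen, intro ballI)
    fix w assume w: "w \<in> {w \<in> topspace X. h w \<in> U}"
    then obtain e where e: "e > 0" "\<And>y. \<bar>y - h w\<bar> < e \<Longrightarrow> y \<in> U"
      using U unfolding open_dist dist_real_def by auto
    have C: "C \<ge> 0" using h by (simp add: gauge_lipschitz_def)
    define \<delta> where "\<delta> = e / (C + 1)"
    have del: "\<delta> > 0" "C * \<delta> < e" using e(1) C by (auto simp: \<delta>_def field_simps)
    have "h v \<in> U" if v: "v \<in> topspace X" "d n w v < \<delta>" for v
    proof (rule e(2))
      have "\<bar>h w - h v\<bar> \<le> C * d n w v" using h w v by (simp add: gauge_lipschitz_def)
      also have "\<dots> \<le> C * \<delta>" using v C by (intro mult_left_mono) auto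
      finally show "\<bar>h v - h w\<bar> < e" using del by linarith
    qed
    then show "\<exists>T. openin X T \<and> w \<in> T \<and> T \<subseteq> {w \<in> topspace X. h w \<in> U}"
      using d_ball[of w n \<delta>] w d_refl[of w n] del by (intro exI[of _ "{v \<in> topspace X. d n w v < \<delta>}"]) auto
  qed
qed auto

text \<open>An infimum of functions with a common Lipschitz constant keeps that constant. It is
  applied to distances from a set and to the Lipschitz regularisations of a continuous
  function.\<close>

lemma INF_lipschitz:
  fixes F :: "'c \<Rightarrow> 'i \<Rightarrow> real"
  assumes ne: "I \<noteq> {}" and bd: "\<And>w i. w \<in> topspace X \<Longrightarrow> i \<in> I \<Longrightarrow> B \<le> F w i" and C: "C \<ge> 0"
    and lip: "\<And>w v i. w \<in> topspace X \<Longrightarrow> v \<in> topspace X \<Longrightarrow> i \<in> I \<Longrightarrow> F w i \<le> F v i + C * d n w v"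
  shows "gauge_lipschitz n C (\<lambda>w. INF i\<in>I. F w i)"
proof -
  have bb: "bdd_below (F w ` I)" if "w \<in> topspace X" for w
    using bd[OF that] by (auto simp: bdd_below_def)
  have le: "(INF i\<in>I. F w i) - C * d n w v \<le> (INF i\<in>I. F v i)" if "w \<in> topspace X" "v \<in> topspace X" for w v
  proof (rule cINF_greatest[OF ne])
    fix i assume i: "i \<in> I"
    have "(INF i\<in>I. F w i) \<le> F w i" using bb[OF that(1)] i by (rule cINF_lower)
    also have "\<dots> \<le> F v i + C * d n w v" using lip that i by simp
    finally show "(INF i\<in>I. F w i) - C * d n w v \<le> F v i" by simp
  qed
  show ?thesis unfolding gauge_lipschitz_def
  proof (intro conjI C ballI)
    fix w v assume wv: "w \<in> topspace X" "v \<in> topspace X"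
    have "C * d n v w = C * d n w v" by (simp only: d_sym[of n v w])
    then show "\<bar>(INF i\<in>I. F w i) - (INF i\<in>I. F v i)\<bar> \<le> C * d n w v"
      using le[OF wv] le[OF wv(2,1)] by linarith
  qed
qed

text \<open>An open set consists of the points whose truncated distance to its complement is
  positive in some gauge. These distances are Lipschitz, so the preimage of the set is a countable
  union of measurable sets.\<close>

lemma measurable_borel_ofI:
  assumes Y: "\<And>\<omega>. \<omega> \<in> space M \<Longrightarrow> Y \<omega> \<in> topspace X"
    and meas: "\<And>n C h. gauge_lipschitz n C h \<Longrightarrow> (\<lambda>\<omega>. h (Y \<omega>)) \<in> borel_measurable M"
  shows "Y \<in> M \<rightarrow>\<^sub>M borel_of X"
  unfolding borel_of_def
proof (rule measurable_measure_of)
  show "{U. openin X U} \<subseteq> Pow (topspace X)" by (auto dest: openin_subset)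
  show "Y \<in> space M \<rightarrow> topspace X" using Y by auto
  fix U assume "U \<in> {U. openin X U}"
  then have U: "openin X U" "U \<subseteq> topspace X" by (auto simp: openin_subset)
  show "Y -` U \<inter> space M \<in> sets M"
  proof (cases "topspace X - U = {}")
    case True
    then have "Y -` U \<inter> space M = space M" using Y U(2) by auto
    then show ?thesis by simp
  next
    case False
    define D where "D n w = (INF v\<in>topspace X - U. min 1 (d n w v))" for n w
    have lip: "gauge_lipschitz n 1 (D n)" for n
      unfolding D_def
    proof (rule INF_lipschitz[OF False, of 0])
      show "min 1 (d n w i) \<le> min 1 (d n v i) + 1 * d n w v" if "w \<in> topspace X" "v \<in> topspace X" "i \<in> topspace X - U" for w v i
        using d_tri[of w v i n] d_nonneg[of w v n] that by auto
    qed (use d_nonneg in auto)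
    have eq: "w \<in> U \<longleftrightarrow> (\<exists>n. D n w > 0)" if w: "w \<in> topspace X" for w
    proof
      assume "w \<in> U"
      then obtain n e where e: "e > 0" "\<And>v. v \<in> topspace X \<Longrightarrow> d n w v < e \<Longrightarrow> v \<in> U"
        using d_open[OF U(1)] by blast
      have "min 1 e \<le> D n w" unfolding D_def
      proof (rule cINF_greatest[OF False])
        fix v assume "v \<in> topspace X - U"
        then show "min 1 e \<le> min 1 (d n w v)" using e(2)[of v] by force
      qed
      then have "D n w > 0" using e(1) by (auto simp: min_def split: if_splits)
      then show "\<exists>n. D n w > 0" ..
    next
      assume "\<exists>n. D n w > 0"
      then obtain n where n: "D n w > 0" ..
      show "w \<in> U"
      proof (rule ccontr)
        assume "w \<notin> U"
        then have "D n w \<le> min 1 (d n w w)" unfolding D_def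
          using w d_nonneg by (intro cINF_lower) (auto simp: bdd_below_def intro!: exI[of _ 0])
        then show False using n d_refl[OF w] by simp
      qed
    qed
    have "Y -` U \<inter> space M = (\<Union>n. {\<omega> \<in> space M. D n (Y \<omega>) > 0})"
      using eq Y by auto
    moreover have "{\<omega> \<in> space M. D n (Y \<omega>) > 0} \<in> sets M" for n
      using meas[OF lip, of n] by measurable
    ultimately show ?thesis by auto
  qed
qed

text \<open>A bounded continuous \<open>h\<close> is the increasing limit of the Lipschitz functions
  \<open>\<lambda>w. INF v. h v + n * d n w v\<close>.\<close>

lemma lower_semicontinuity:
  fixes h :: "'c \<Rightarrow> real"
  assumes M: "prob_space M" and N: "prob_space N"
    and Y: "\<forall>\<^sub>F T in F. Y T \<in> M \<rightarrow>\<^sub>M borel_of X" and Z: "Z \<in> N \<rightarrow>\<^sub>M borel_of X"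
    and lip: "\<And>n C h H. gauge_lipschitz n C h \<Longrightarrow> (\<And>w. w \<in> topspace X \<Longrightarrow> \<bar>h w\<bar> \<le> H) \<Longrightarrow>
        ((\<lambda>T. \<integral>\<omega>. h (Y T \<omega>) \<partial>M) \<longlongrightarrow> (\<integral>\<omega>. h (Z \<omega>) \<partial>N)) F"
    and h: "continuous_map X euclideanreal h" and B: "\<And>w. w \<in> topspace X \<Longrightarrow> \<bar>h w\<bar> \<le> B" and e: "e > 0"
  shows "\<forall>\<^sub>F T in F. (\<integral>\<omega>. h (Y T \<omega>) \<partial>M) > (\<integral>\<omega>. h (Z \<omega>) \<partial>N) - e"
proof -
  interpret M: prob_space M by fact
  interpret N: prob_space N by fact
  have hm [measurable]: "h \<in> borel_measurable (borel_of X)" by (rule continuous_map_borel_of[OF h])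
  obtain z where "z \<in> space N" using N.not_empty by auto
  then have ne: "topspace X \<noteq> {}" using measurable_space[OF Z] by force
  define k where "k n w = (INF v\<in>topspace X. h v + real n * d n w v)" for n w
  have bdd: "bdd_below ((\<lambda>v. h v + real n * d n w v) ` topspace X)" if "w \<in> topspace X" for n w
  proof -
    have "- B \<le> h v + real n * d n w v" if "v \<in> topspace X" for v
    proof -
      have "- B \<le> h v" using B[OF that] by (simp add: abs_le_iff)
      moreover have "0 \<le> real n * d n w v" using d_nonneg[of w v n] that \<open>w \<in> topspace X\<close> by simp
      ultimately show ?thesis by linarith
    qed
    then show ?thesis by (auto simp: bdd_below_def)
  qed
  have klip: "gauge_lipschitz n (real n) (k n)" for n
    unfolding k_def
  proof (rule INF_lipschitz[OF ne, of "-B"])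
    fix w i assume wi: "w \<in> topspace X" "i \<in> topspace X"
    have "- B \<le> h i" using B[OF wi(2)] by (simp add: abs_le_iff)
    moreover have "0 \<le> real n * d n w i" using d_nonneg[of w i n] wi by simp
    ultimately show "- B \<le> h i + real n * d n w i" by linarith
  next
    fix w v i assume "w \<in> topspace X" "v \<in> topspace X" "i \<in> topspace X"
    then have "real n * d n w i \<le> real n * (d n w v + d n v i)" by (intro mult_left_mono d_tri) auto
    then show "h i + real n * d n w i \<le> h i + real n * d n v i + real n * d n w v" by (simp add: distrib_left)
  qed simp
  have klow: "- B \<le> k n w" if w: "w \<in> topspace X" for n w
    unfolding k_def
  proof (rule cINF_greatest[OF ne])
    fix i assume i: "i \<in> topspace X"
    have "- B \<le> h i" using B[OF i] by (simp add: abs_le_iff)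
    moreover have "0 \<le> real n * d n w i" using d_nonneg[of w i n] w i by simp
    ultimately show "- B \<le> h i + real n * d n w i" by linarith
  qed
  have kle: "k n w \<le> h w" if w: "w \<in> topspace X" for n w
    unfolding k_def using cINF_lower[OF bdd[OF w] w, of n] d_refl[OF w] by simp
  have kb: "\<bar>k n w\<bar> \<le> B" if "w \<in> topspace X" for n w
    using klow[OF that, of n] kle[OF that, of n] B[OF that] by (simp add: abs_le_iff)
  have klim: "(\<lambda>n. k n w) \<longlonglongrightarrow> h w" if w: "w \<in> topspace X" for w
  proof (rule tendstoI)
    fix \<epsilon> :: real assume eps: "\<epsilon> > 0"
    have "openin X {v \<in> topspace X. h v \<in> {h w - \<epsilon> / 2<..}}"
      using h by (intro openin_continuous_map_preimage[of X euclideanreal]) auto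
    then obtain m \<delta> where m: "\<delta> > 0" "\<And>v. v \<in> topspace X \<Longrightarrow> d m w v < \<delta> \<Longrightarrow> h v > h w - \<epsilon> / 2"
      using d_open[of "{v \<in> topspace X. h v \<in> {h w - \<epsilon> / 2<..}}" w] w eps by auto
    \<comment> \<open>Outside the gauge ball of radius \<delta> the penalty is at least
      \<open>2 * B\<close>, more than any variation of \<open>h\<close> could compensate; inside the
      ball continuity takes over.\<close>
    obtain n0 :: nat where n0: "2 * B / \<delta> \<le> real n0" using real_arch_simple by blast
    show "\<forall>\<^sub>F n in sequentially. dist (k n w) (h w) < \<epsilon>"
      using eventually_ge_at_top[of "max m n0"]
    proof eventually_elim
      case (elim n)
      have "h w - \<epsilon> / 2 \<le> k n w" unfolding k_def
      proof (rule cINF_greatest[OF ne])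
        fix v assume v: "v \<in> topspace X"
        show "h w - \<epsilon> / 2 \<le> h v + real n * d n w v"
        proof (cases "d m w v < \<delta>")
          case True
          have "0 \<le> real n * d n w v" using d_nonneg[OF w v, of n] by simp
          then show ?thesis using m(2)[OF v True] by linarith
        next
          case False
          have "2 * B \<le> real n0 * \<delta>" using n0 m(1) by (simp add: pos_divide_le_eq)
          also have "\<dots> \<le> real n * d n w v"
            using False elim m(1) d_mono[of m n w v] w v by (intro mult_mono) auto
          finally show ?thesis using B[OF w] B[OF v] eps by (simp add: abs_le_iff)
        qed
      qed
      then show ?case using kle[OF w, of n] eps by (simp add: dist_real_def)
    qed
  qed
  note [measurable] = continuous_map_borel_of[OF gauge_lipschitz_continuous_map[OF klip]] Z
  have Zin: "Z \<omega> \<in> topspace X" if "\<omega> \<in> space N" for \<omega> using measurable_space[OF Z that] by simp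
  have "(\<lambda>n. \<integral>\<omega>. k n (Z \<omega>) \<partial>N) \<longlonglongrightarrow> (\<integral>\<omega>. h (Z \<omega>) \<partial>N)"
    by (rule integral_dominated_convergence[where w="\<lambda>_. B"]) (use kb klim Zin in auto)
  then have "\<forall>\<^sub>F n in sequentially. (\<integral>\<omega>. k n (Z \<omega>) \<partial>N) > (\<integral>\<omega>. h (Z \<omega>) \<partial>N) - e"
    using e by (intro order_tendstoD(1)) auto
  then obtain n where n: "(\<integral>\<omega>. k n (Z \<omega>) \<partial>N) > (\<integral>\<omega>. h (Z \<omega>) \<partial>N) - e"
    by (auto simp: eventually_sequentially)
  have "\<forall>\<^sub>F T in F. (\<integral>\<omega>. k n (Y T \<omega>) \<partial>M) > (\<integral>\<omega>. h (Z \<omega>) \<partial>N) - e"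
    using lip[OF klip, of n B] kb n by (intro order_tendstoD(1)) auto
  with Y show ?thesis
  proof eventually_elim
    case (elim T)
    note [measurable] = elim(1)
    have Yin: "Y T \<omega> \<in> topspace X" if "\<omega> \<in> space M" for \<omega> using measurable_space[OF elim(1) that] by simp
    have "(\<integral>\<omega>. k n (Y T \<omega>) \<partial>M) \<le> (\<integral>\<omega>. h (Y T \<omega>) \<partial>M)"
      by (intro integral_mono M.integrable_const_bound[where B=B]) (use kb B kle Yin in auto)
    then show ?case using elim(2) by linarith
  qed
qed

text \<open>The lower bound of \<open>lower_semicontinuity\<close>, applied to \<open>h\<close> and
  to \<open>- h\<close>, encloses the integrals from both sides.\<close>

lemma conv_in_law_lipschitzI:
  assumes M: "prob_space M" and N: "prob_space N"
    and Y: "\<forall>\<^sub>F T in at_top. Y' T \<in> M \<rightarrow>\<^sub>M borel_of X \<and> (AE \<omega> in M. Y' T \<omega> = Y T \<omega>)"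
    and Z: "Z' \<in> N \<rightarrow>\<^sub>M borel_of X" "AE \<omega> in N. Z' \<omega> = Z \<omega>"
    and lip: "\<And>n C h H. gauge_lipschitz n C h \<Longrightarrow> (\<And>w. w \<in> topspace X \<Longrightarrow> \<bar>h w\<bar> \<le> H) \<Longrightarrow>
        ((\<lambda>T. \<integral>\<omega>. h (Y' T \<omega>) \<partial>M) \<longlongrightarrow> (\<integral>\<omega>. h (Z' \<omega>) \<partial>N)) at_top"
  shows "conv_in_law X M Y N Z"
  unfolding conv_in_law_def
proof (intro exI[of _ Y'] exI[of _ Z'] conjI Y Z allI impI)
  fix h assume "continuous_map X euclideanreal h \<and> bounded (h ` topspace X)"
  then have h: "continuous_map X euclideanreal h" and "bounded (h ` topspace X)" by auto
  then obtain B where B: "\<And>w. w \<in> topspace X \<Longrightarrow> \<bar>h w\<bar> \<le> B" by (auto simp: bounded_iff)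
  have Y'm: "\<forall>\<^sub>F T in at_top. Y' T \<in> M \<rightarrow>\<^sub>M borel_of X" using Y by eventually_elim auto
  have h': "continuous_map X euclideanreal (\<lambda>w. - h w)" using h by (rule continuous_map_minus)
  show "((\<lambda>T. \<integral>\<omega>. h (Y' T \<omega>) \<partial>M) \<longlongrightarrow> (\<integral>\<omega>. h (Z' \<omega>) \<partial>N)) at_top"
  proof (rule tendstoI)
    fix e :: real assume e: "e > 0"
    have "\<forall>\<^sub>F T in at_top. (\<integral>\<omega>. h (Y' T \<omega>) \<partial>M) > (\<integral>\<omega>. h (Z' \<omega>) \<partial>N) - e"
      by (rule lower_semicontinuity[OF M N Y'm Z(1) lip h B e])
    moreover have "\<forall>\<^sub>F T in at_top. (\<integral>\<omega>. - h (Y' T \<omega>) \<partial>M) > (\<integral>\<omega>. - h (Z' \<omega>) \<partial>N) - e"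
      by (rule lower_semicontinuity[OF M N Y'm Z(1) lip h' _ e]) (use B in auto)
    ultimately show "\<forall>\<^sub>F T in at_top. dist (\<integral>\<omega>. h (Y' T \<omega>) \<partial>M) (\<integral>\<omega>. h (Z' \<omega>) \<partial>N) < e"
      by eventually_elim (simp add: dist_real_def abs_less_iff)
  qed
qed

end

section \<open>Finite-dimensional laws\<close>

lemma gauge_space_product:
  fixes J :: "real set"
  assumes J: "finite J"
  shows "gauge_space (product_topology (\<lambda>_. euclideanreal) J) (\<lambda>_ w v. \<Sum>j\<in>J. \<bar>w j - v j\<bar>)"
proof
  let ?X = "product_topology (\<lambda>_::real. euclideanreal) J"
  show "0 \<le> (\<Sum>j\<in>J. \<bar>w j - v j\<bar>)" for w v :: "real \<Rightarrow> real" by (intro sum_nonneg) auto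
  show "(\<Sum>j\<in>J. \<bar>w j - w j\<bar>) = 0" for w :: "real \<Rightarrow> real" by simp
  show "(\<Sum>j\<in>J. \<bar>w j - v j\<bar>) = (\<Sum>j\<in>J. \<bar>v j - w j\<bar>)" for w v :: "real \<Rightarrow> real"
    by (simp add: abs_minus_commute)
  show "(\<Sum>j\<in>J. \<bar>w j - z j\<bar>) \<le> (\<Sum>j\<in>J. \<bar>w j - v j\<bar>) + (\<Sum>j\<in>J. \<bar>v j - z j\<bar>)" for w v z :: "real \<Rightarrow> real"
    unfolding sum.distrib[symmetric] by (intro sum_mono) auto
  show "(\<Sum>j\<in>J. \<bar>w j - v j\<bar>) \<le> (\<Sum>j\<in>J. \<bar>w j - v j\<bar>)" for w v :: "real \<Rightarrow> real" by simp
  show "openin ?X {v \<in> topspace ?X. (\<Sum>j\<in>J. \<bar>w j - v j\<bar>) < e}" for w :: "real \<Rightarrow> real" and e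
  proof -
    have "continuous_map ?X euclideanreal (\<lambda>v. \<Sum>j\<in>J. \<bar>w j - v j\<bar>)"
    proof (intro continuous_map_sum J continuous_map_real_abs continuous_map_diff)
      fix j assume "j \<in> J"
      then show "continuous_map ?X euclideanreal (\<lambda>v. v j)" by (rule continuous_map_product_projection)
      show "continuous_map ?X euclideanreal (\<lambda>v. w j)" by simp
    qed
    then have "openin ?X {v \<in> topspace ?X. (\<Sum>j\<in>J. \<bar>w j - v j\<bar>) \<in> {..<e}}"
      by (rule openin_continuous_map_preimage) auto
    then show ?thesis by simp
  qed
  fix U w assume U: "openin ?X U" and w: "w \<in> U"
  have "\<forall>x\<in>U. \<exists>V. finite {i \<in> J. V i \<noteq> topspace euclideanreal} \<and> (\<forall>i\<in>J. openin euclideanreal (V i)) \<and> x \<in> Pi\<^sub>E J V \<and> Pi\<^sub>E J V \<subseteq> U"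
    using U by (simp only: openin_product_topology_alt)
  from bspec[OF this w] obtain V where "\<forall>i\<in>J. openin euclideanreal (V i)" and V': "w \<in> Pi\<^sub>E J V" "Pi\<^sub>E J V \<subseteq> U"
    by (elim exE conjE)
  then have V: "\<And>j. j \<in> J \<Longrightarrow> open (V j)" "w \<in> Pi\<^sub>E J V" "Pi\<^sub>E J V \<subseteq> U" by simp_all
  have "\<forall>j\<in>J. \<exists>e>0. \<forall>y. \<bar>y - w j\<bar> < e \<longrightarrow> y \<in> V j"
  proof
    fix j assume j: "j \<in> J"
    then have "w j \<in> V j" using V(2) by auto
    then show "\<exists>e>0. \<forall>y. \<bar>y - w j\<bar> < e \<longrightarrow> y \<in> V j"
      using V(1)[OF j] unfolding open_dist dist_real_def by (rule bspec[rotated])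
  qed
  then obtain e where "\<forall>j\<in>J. e j > 0 \<and> (\<forall>y. \<bar>y - w j\<bar> < e j \<longrightarrow> y \<in> V j)" by (rule bchoice[THEN exE])
  then have e: "\<And>j. j \<in> J \<Longrightarrow> e j > 0" "\<And>j y. j \<in> J \<Longrightarrow> \<bar>y - w j\<bar> < e j \<Longrightarrow> y \<in> V j" by auto
  \<comment> \<open>The smallest of the radii belonging to the coordinates of \<open>J\<close>; the
    inserted 1 provides a radius when \<open>J\<close> is empty.\<close>
  define \<delta> where "\<delta> = Min (insert 1 (e ` J))"
  have d: "\<delta> > 0" "\<And>j. j \<in> J \<Longrightarrow> \<delta> \<le> e j" using J e(1) by (auto simp: \<delta>_def)
  have "v \<in> U" if v: "v \<in> topspace ?X" "(\<Sum>j\<in>J. \<bar>w j - v j\<bar>) < \<delta>" for v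
  proof -
    have "v j \<in> V j" if j: "j \<in> J" for j
    proof (rule e(2)[OF j])
      have "\<bar>w j - v j\<bar> \<le> (\<Sum>j\<in>J. \<bar>w j - v j\<bar>)" using J j by (intro member_le_sum) auto
      then show "\<bar>v j - w j\<bar> < e j" using v(2) d(2)[OF j] by linarith
    qed
    moreover have "v \<in> extensional J" using v(1) by (auto simp: topspace_product_topology PiE_iff)
    ultimately have "v \<in> Pi\<^sub>E J V" by (auto simp: PiE_iff)
    then show ?thesis using V(3) by auto
  qed
  then show "\<exists>n::nat. \<exists>e>0. \<forall>v\<in>topspace ?X. (\<Sum>j\<in>J. \<bar>w j - v j\<bar>) < e \<longrightarrow> v \<in> U"
    using d(1) by (intro exI[of _ 0] exI[of _ \<delta>] conjI ballI impI)
qed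

text \<open>Composed with restriction to \<open>J\<close>, a Lipschitz function on the finite
  product becomes a test function in the sense of \<open>lip_on\<close>.\<close>

lemma fdd_convI:
  fixes Y Y' :: "real \<Rightarrow> real \<Rightarrow> 'a \<Rightarrow> real" and Z Z' :: "real \<Rightarrow> 'b \<Rightarrow> real"
  assumes M: "prob_space M" and N: "prob_space N"
    and Y'm: "\<And>T t. Y' T t \<in> borel_measurable M" and Z'm: "\<And>t. Z' t \<in> borel_measurable N"
    and Y: "\<forall>\<^sub>F T in at_top. AE \<omega> in M. \<forall>t\<ge>0. Y' T t \<omega> = Y T t \<omega>"
    and Z: "AE \<omega> in N. \<forall>t\<ge>0. Z' t \<omega> = Z t \<omega>"
    and conv: "\<And>J C g H. lip_on J C g \<Longrightarrow> J \<subseteq> {0..} \<Longrightarrow> (\<And>v. \<bar>g v\<bar> \<le> H) \<Longrightarrow> 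
        ((\<lambda>T. \<integral>\<omega>. g (\<lambda>t. Y' T t \<omega>) \<partial>M) \<longlongrightarrow> (\<integral>\<omega>. g (\<lambda>t. Z' t \<omega>) \<partial>N)) at_top"
  shows "fdd_conv M Y N Z"
  unfolding fdd_conv_def
proof (intro allI impI)
  fix J :: "real set" assume "finite J \<and> J \<subseteq> {0..}"
  then have J: "finite J" "J \<subseteq> {0..}" by auto
  let ?X = "product_topology (\<lambda>_::real. euclideanreal) J"
  interpret gauge_space ?X "\<lambda>_ w v. \<Sum>j\<in>J. \<bar>w j - v j\<bar>" by (rule gauge_space_product[OF J(1)])
  have res: "restrict v J \<in> topspace ?X" for v :: "real \<Rightarrow> real" by (simp add: topspace_product_topology)
  have lip: "lip_on J C (\<lambda>v. h (restrict v J))" if "gauge_lipschitz n C h" for n C h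
    unfolding lip_on_def
  proof (intro conjI J allI)
    show "C \<ge> 0" using that by (simp add: gauge_lipschitz_def)
    fix v w :: "real \<Rightarrow> real"
    have "\<bar>h (restrict v J) - h (restrict w J)\<bar> \<le> C * (\<Sum>j\<in>J. \<bar>restrict v J j - restrict w J j\<bar>)"
      by (rule gauge_lipschitzD[OF that res res])
    also have "(\<Sum>j\<in>J. \<bar>restrict v J j - restrict w J j\<bar>) = (\<Sum>j\<in>J. \<bar>v j - w j\<bar>)" by (intro sum.cong) auto
    finally show "\<bar>h (restrict v J) - h (restrict w J)\<bar> \<le> C * (\<Sum>j\<in>J. \<bar>v j - w j\<bar>)" .
  qed
  show "conv_in_law ?X M (\<lambda>T \<omega>. \<lambda>t\<in>J. Y T t \<omega>) N (\<lambda>\<omega>. \<lambda>t\<in>J. Z t \<omega>)"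
  proof (rule conv_in_law_lipschitzI[OF M N, where Y'="\<lambda>T \<omega>. \<lambda>t\<in>J. Y' T t \<omega>" and Z'="\<lambda>\<omega>. \<lambda>t\<in>J. Z' t \<omega>"])
    have "(\<lambda>\<omega>. \<lambda>t\<in>J. Y' T t \<omega>) \<in> M \<rightarrow>\<^sub>M borel_of ?X" for T
      by (rule measurable_borel_ofI[OF res]) (rule lip_on_measurable[OF lip Y'm])
    moreover have "\<forall>\<^sub>F T in at_top. AE \<omega> in M. (\<lambda>t\<in>J. Y' T t \<omega>) = (\<lambda>t\<in>J. Y T t \<omega>)"
      using Y
    proof eventually_elim
      case (elim T)
      then show ?case by eventually_elim (use J(2) in \<open>auto intro!: restrict_ext\<close>)
    qed
    ultimately show "\<forall>\<^sub>F T in at_top. (\<lambda>\<omega>. \<lambda>t\<in>J. Y' T t \<omega>) \<in> M \<rightarrow>\<^sub>M borel_of ?X \<and> (AE \<omega> in M. (\<lambda>t\<in>J. Y' T t \<omega>) = (\<lambda>t\<in>J. Y T t \<omega>))"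
      by (simp add: eventually_conj_iff)
    show "(\<lambda>\<omega>. \<lambda>t\<in>J. Z' t \<omega>) \<in> N \<rightarrow>\<^sub>M borel_of ?X"
      by (rule measurable_borel_ofI[OF res]) (rule lip_on_measurable[OF lip Z'm])
    show "AE \<omega> in N. (\<lambda>t\<in>J. Z' t \<omega>) = (\<lambda>t\<in>J. Z t \<omega>)"
      using Z by eventually_elim (use J(2) in \<open>auto intro!: restrict_ext\<close>)
    show "((\<lambda>T. \<integral>\<omega>. h (\<lambda>t\<in>J. Y' T t \<omega>) \<partial>M) \<longlongrightarrow> (\<integral>\<omega>. h (\<lambda>t\<in>J. Z' t \<omega>) \<partial>N)) at_top"
      if "gauge_lipschitz n C h" "\<And>w. w \<in> topspace ?X \<Longrightarrow> \<bar>h w\<bar> \<le> H" for n C h H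
      by (rule conv[OF lip[OF that(1)] J(2) that(2)[OF res]])
  qed
qed

section \<open>The space of continuous paths: interpolation, oscillation, convergence in law\<close>

definition sup_dist :: "nat \<Rightarrow> (real \<Rightarrow> real) \<Rightarrow> (real \<Rightarrow> real) \<Rightarrow> real" where
  "sup_dist n w v = (SUP t\<in>{0..real n}. \<bar>w t - v t\<bar>)"

lemma sup_dist_bdd:
  assumes "w \<in> C_halfline" "v \<in> C_halfline"
  shows "bdd_above ((\<lambda>t. \<bar>w t - v t\<bar>) ` {0..real n})"
proof -
  have "continuous_on {0..real n} (\<lambda>t. \<bar>w t - v t\<bar>)"
    using assms unfolding C_halfline_def by (auto intro!: continuous_intros elim: continuous_on_subset)
  then have "compact ((\<lambda>t. \<bar>w t - v t\<bar>) ` {0..real n})" by (rule compact_continuous_image) simp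
  then show ?thesis by (intro bounded_imp_bdd_above compact_imp_bounded)
qed

lemma sup_dist_upper:
  "w \<in> C_halfline \<Longrightarrow> v \<in> C_halfline \<Longrightarrow> t \<in> {0..real n} \<Longrightarrow> \<bar>w t - v t\<bar> \<le> sup_dist n w v"
  unfolding sup_dist_def by (rule cSUP_upper[OF _ sup_dist_bdd])

lemma sup_dist_least:
  "(\<And>t. t \<in> {0..real n} \<Longrightarrow> \<bar>w t - v t\<bar> \<le> B) \<Longrightarrow> sup_dist n w v \<le> B"
  unfolding sup_dist_def by (rule cSUP_least) auto

lemma sup_dist_nonneg: "w \<in> C_halfline \<Longrightarrow> v \<in> C_halfline \<Longrightarrow> 0 \<le> sup_dist n w v"
  using sup_dist_upper[of w v 0 n] by auto

lemma sup_dist_sym: "sup_dist n w v = sup_dist n v w"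
  unfolding sup_dist_def by (simp add: abs_minus_commute)

lemma sup_dist_triangle:
  assumes "w \<in> C_halfline" "v \<in> C_halfline" "z \<in> C_halfline"
  shows "sup_dist n w z \<le> sup_dist n w v + sup_dist n v z"
proof (rule sup_dist_least)
  fix t assume "t \<in> {0..real n}"
  then show "\<bar>w t - z t\<bar> \<le> sup_dist n w v + sup_dist n v z"
    using sup_dist_upper[OF assms(1,2), of t n] sup_dist_upper[OF assms(2,3), of t n] by linarith
qed

interpretation C_gauge: gauge_space C_halfline_topology sup_dist
proof (unfold_locales, unfold topspace_C_halfline_topology openin_C_halfline_topology)
  fix n :: nat and w v z :: "real \<Rightarrow> real"
  show "w \<in> C_halfline \<Longrightarrow> v \<in> C_halfline \<Longrightarrow> 0 \<le> sup_dist n w v" by (rule sup_dist_nonneg)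
  show "sup_dist n w w = 0" unfolding sup_dist_def by simp
  show "sup_dist n w v = sup_dist n v w" by (rule sup_dist_sym)
  show "w \<in> C_halfline \<Longrightarrow> v \<in> C_halfline \<Longrightarrow> z \<in> C_halfline \<Longrightarrow> sup_dist n w z \<le> sup_dist n w v + sup_dist n v z"
    by (rule sup_dist_triangle)
next
  fix m n :: nat and w v :: "real \<Rightarrow> real" assume *: "m \<le> n" "w \<in> C_halfline" "v \<in> C_halfline"
  show "sup_dist m w v \<le> sup_dist n w v"
    by (rule sup_dist_least, rule sup_dist_upper) (use * in auto)
next
  fix U w assume U: "C_halfline_open U" and w: "w \<in> U"
  then obtain K e where K: "K \<ge> 0" "e > 0" "\<forall>v\<in>C_halfline. (\<forall>t\<in>{0..K}. \<bar>v t - w t\<bar> < e) \<longrightarrow> v \<in> U"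
    unfolding C_halfline_open_def by blast
  have wC: "w \<in> C_halfline" using U w unfolding C_halfline_open_def by auto
  obtain n :: nat where n: "K \<le> real n" using real_arch_simple by blast
  have "v \<in> U" if v: "v \<in> C_halfline" "sup_dist n w v < e" for v
  proof (rule K(3)[rule_format, OF v(1)])
    fix t assume "t \<in> {0..K}"
    then have "\<bar>w t - v t\<bar> \<le> sup_dist n w v" using n by (intro sup_dist_upper wC v) auto
    then show "\<bar>v t - w t\<bar> < e" using v(2) by linarith
  qed
  then show "\<exists>n. \<exists>e>0. \<forall>v\<in>C_halfline. sup_dist n w v < e \<longrightarrow> v \<in> U"
    using K(2) by (intro exI[of _ n] exI[of _ e] conjI ballI impI)
next
  fix n :: nat and w :: "real \<Rightarrow> real" and e assume w: "w \<in> C_halfline"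
  show "C_halfline_open {v \<in> C_halfline. sup_dist n w v < e}"
    unfolding C_halfline_open_def
  proof (intro conjI ballI)
    fix v assume "v \<in> {v \<in> C_halfline. sup_dist n w v < e}"
    then have v: "v \<in> C_halfline" "sup_dist n w v < e" by auto
    define r where "r = (e - sup_dist n w v) / 2"
    have r: "r > 0" "sup_dist n w v + r < e" using v by (auto simp: r_def field_simps)
    have main: "\<forall>z\<in>C_halfline. (\<forall>t\<in>{0..real n}. \<bar>z t - v t\<bar> < r) \<longrightarrow> z \<in> {v \<in> C_halfline. sup_dist n w v < e}"
    proof (intro ballI impI)
      fix z assume z: "z \<in> C_halfline" "\<forall>t\<in>{0..real n}. \<bar>z t - v t\<bar> < r"
      have "sup_dist n v z \<le> r"
      proof (rule sup_dist_least)
        fix t assume "t \<in> {0..real n}"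
        then have "\<bar>z t - v t\<bar> < r" using z(2) by blast
        then show "\<bar>v t - z t\<bar> \<le> r" by linarith
      qed
      then have "sup_dist n w z < e" using sup_dist_triangle[OF w v(1) z(1), of n] r(2) by linarith
      then show "z \<in> {v \<in> C_halfline. sup_dist n w v < e}" using z(1) by simp
    qed
    show "\<exists>K\<ge>0. \<exists>e'>0. \<forall>z\<in>C_halfline. (\<forall>t\<in>{0..K}. \<bar>z t - v t\<bar> < e') \<longrightarrow> z \<in> {v \<in> C_halfline. sup_dist n w v < e}"
      by (rule exI[of _ "real n"], rule conjI, simp, rule exI[of _ r], rule conjI, rule r(1), rule main)
  qed auto
qed

text \<open>The piecewise linear interpolation at the points \<open>i / m\<close> up to time n,
  constant afterwards. Written as a sum of increments times ramps, it is visibly linear in finitely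
  many values of \<open>w\<close>.\<close>

definition interp :: "nat \<Rightarrow> nat \<Rightarrow> (real \<Rightarrow> real) \<Rightarrow> real \<Rightarrow> real" where
  "interp n m w = (\<lambda>t\<in>{0..}. w 0 + (\<Sum>i<n * m. (w (real (Suc i) / real m) - w (real i / real m)) * max 0 (min 1 (real m * t - real i))))"

definition gridset :: "nat \<Rightarrow> nat \<Rightarrow> real set" where
  "gridset n m = (\<lambda>i. real i / real m) ` {..n * m}"

lemma gridset_props: "finite (gridset n m)" "gridset n m \<subseteq> {0..}"
  "i \<le> n * m \<Longrightarrow> real i / real m \<in> gridset n m" "0 \<in> gridset n m"
  unfolding gridset_def by (auto intro: image_eqI[of _ _ 0])

lemma interp_in_C: "interp n m w \<in> C_halfline"
  unfolding C_halfline_def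
proof (rule CollectI, intro conjI)
  have "continuous_on {0..} (\<lambda>t. w 0 + (\<Sum>i<n * m. (w (real (Suc i) / real m) - w (real i / real m)) * max 0 (min 1 (real m * t - real i))))"
    by (intro continuous_intros)
  then show "continuous_on {0..} (interp n m w)" unfolding interp_def by (rule continuous_on_eq) auto
qed (simp add: interp_def)

lemma interp_restrict: "interp n m (restrict w {0..}) = interp n m w"
  unfolding interp_def by (intro restrict_ext) (simp add: divide_nonneg_nonneg)

text \<open>Within a cell both the path and the chord stay within \<delta> of the value at the left
  end.\<close>

lemma interp_error:
  assumes m: "m > 0" and del: "\<delta> \<ge> 0"
    and osc: "\<And>i t. i < n * m \<Longrightarrow> real i / real m \<le> t \<Longrightarrow> t \<le> real (Suc i) / real m \<Longrightarrow> \<bar>w t - w (real i / real m)\<bar> \<le> \<delta>"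
    and t: "t \<in> {0..real n}"
  shows "\<bar>interp n m w t - w t\<bar> \<le> 2 * \<delta>"
proof -
  let ?D = "\<lambda>i. w (real (Suc i) / real m) - w (real i / real m)"
  have tel: "w 0 + (\<Sum>i<k. ?D i) = w (real k / real m)" for k
    using sum_lessThan_telescope[of "\<lambda>i. w (real i / real m)" k] by simp
  have it: "interp n m w t = w 0 + (\<Sum>i<n * m. ?D i * max 0 (min 1 (real m * t - real i)))"
    using t by (simp add: interp_def)
  show ?thesis
  proof (cases "t = real n")
    \<comment> \<open>At the right end the floor of \<open>m * t\<close> is \<open>n * m\<close>, an
      index outside the sum. There all ramps have reached 1 and the sum telescopes.\<close>
    case True
    have "(\<Sum>i<n * m. ?D i * max 0 (min 1 (real m * t - real i))) = (\<Sum>i<n * m. ?D i)"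
    proof (intro sum.cong refl)
      fix i assume "i \<in> {..<n * m}"
      then have "real (Suc i) \<le> real (n * m)" by (intro of_nat_mono) auto
      then have "real m * t - real i \<ge> 1" using True by (simp add: mult.commute)
      then show "?D i * max 0 (min 1 (real m * t - real i)) = ?D i" by simp
    qed
    then have "interp n m w t = w t" unfolding it using tel[of "n * m"] True m by simp
    then show ?thesis using del by simp
  next
    case False
    define k where "k = nat \<lfloor>real m * t\<rfloor>"
    have k: "real k \<le> real m * t" "real m * t < real k + 1"
      using t by (auto simp: k_def)
    have "real m * t < real m * real n" using False t m by simp
    then have kn: "k < n * m" using k(1) by (metis mult.commute of_nat_less_iff of_nat_mult order_le_less_trans)
    have "(\<Sum>i<n * m. ?D i * max 0 (min 1 (real m * t - real i))) = (\<Sum>i<Suc k. ?D i * max 0 (min 1 (real m * t - real i)))"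
    proof (rule sum.mono_neutral_right)
      show "\<forall>i\<in>{..<n * m} - {..<Suc k}. ?D i * max 0 (min 1 (real m * t - real i)) = 0"
      proof
        fix i assume "i \<in> {..<n * m} - {..<Suc k}"
        then have "real (Suc k) \<le> real i" by (intro of_nat_mono) auto
        then show "?D i * max 0 (min 1 (real m * t - real i)) = 0" using k by simp
      qed
    qed (use kn in auto)
    also have "\<dots> = (\<Sum>i<k. ?D i * max 0 (min 1 (real m * t - real i))) + ?D k * max 0 (min 1 (real m * t - real k))"
      by simp
    also have "(\<Sum>i<k. ?D i * max 0 (min 1 (real m * t - real i))) = (\<Sum>i<k. ?D i)"
    proof (intro sum.cong refl)
      fix i assume "i \<in> {..<k}"
      then have "real (Suc i) \<le> real k" by (intro of_nat_mono) auto
      then show "?D i * max 0 (min 1 (real m * t - real i)) = ?D i" using k by simp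
    qed
    also have "max 0 (min 1 (real m * t - real k)) = real m * t - real k" using k by simp
    finally have e: "interp n m w t = w (real k / real m) + ?D k * (real m * t - real k)"
      unfolding it using tel[of k] by simp
    have kt: "real k / real m \<le> t" "t \<le> real (Suc k) / real m"
      using k m by (simp_all add: pos_divide_le_eq pos_le_divide_eq mult.commute less_imp_le)
    have 1: "\<bar>w t - w (real k / real m)\<bar> \<le> \<delta>" by (rule osc[OF kn kt])
    have 2: "\<bar>?D k\<bar> \<le> \<delta>" by (rule osc[OF kn]) (use m in \<open>auto simp: divide_right_mono\<close>)
    have "\<bar>?D k * (real m * t - real k)\<bar> \<le> \<delta> * 1" unfolding abs_mult
      using 2 k del by (intro mult_mono) auto
    then show ?thesis unfolding e using 1 by linarith
  qed
qed

text \<open>Interpolation turns a Lipschitz functional on path space into a finite-dimensional test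
  function. In the constant, 1 stands for the initial value and 2 for the two end points of each of
  the \<open>n * m\<close> increments.\<close>

lemma interp_lip:
  assumes h: "C_gauge.gauge_lipschitz n C h"
  shows "lip_on (gridset n m) (C * (1 + real (n * m) * 2)) (\<lambda>w. h (interp n m w))"
  unfolding lip_on_def
proof (intro conjI allI gridset_props)
  have C: "C \<ge> 0" using h by (simp add: C_gauge.gauge_lipschitz_def)
  then show "0 \<le> C * (1 + real (n * m) * 2)" by simp
  fix v w :: "real \<Rightarrow> real"
  define S where "S = (\<Sum>j\<in>gridset n m. \<bar>v j - w j\<bar>)"
  have S: "\<bar>v j - w j\<bar> \<le> S" if "j \<in> gridset n m" for j
    unfolding S_def using gridset_props(1) that by (intro member_le_sum) auto
  have "sup_dist n (interp n m v) (interp n m w) \<le> (1 + real (n * m) * 2) * S"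
  proof (rule sup_dist_least)
    fix t assume t: "t \<in> {0..real n}"
    let ?c = "\<lambda>i. max 0 (min 1 (real m * t - real i))"
    have eq: "interp n m v t - interp n m w t = (v 0 - w 0) + 
      (\<Sum>i<n * m. ((v (real (Suc i) / real m) - w (real (Suc i) / real m)) - (v (real i / real m) - w (real i / real m))) * ?c i)"
    proof -
      have "interp n m v t - interp n m w t = (v 0 - w 0) + 
        ((\<Sum>i<n * m. (v (real (Suc i) / real m) - v (real i / real m)) * ?c i) - (\<Sum>i<n * m. (w (real (Suc i) / real m) - w (real i / real m)) * ?c i))"
        using t by (simp add: interp_def)
      also have "\<dots> = (v 0 - w 0) + 
        (\<Sum>i<n * m. (v (real (Suc i) / real m) - v (real i / real m)) * ?c i - (w (real (Suc i) / real m) - w (real i / real m)) * ?c i)"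
        by (simp only: sum_subtractf)
      also have "\<dots> = (v 0 - w 0) + 
        (\<Sum>i<n * m. ((v (real (Suc i) / real m) - w (real (Suc i) / real m)) - (v (real i / real m) - w (real i / real m))) * ?c i)"
        unfolding left_diff_distrib[symmetric] by (intro arg_cong2[where f="(+)"] arg_cong2[where f="(*)"] refl sum.cong) simp_all
      finally show ?thesis .
    qed
    have "\<bar>interp n m v t - interp n m w t\<bar> \<le> \<bar>v 0 - w 0\<bar> + 
      (\<Sum>i<n * m. \<bar>((v (real (Suc i) / real m) - w (real (Suc i) / real m)) - (v (real i / real m) - w (real i / real m))) * ?c i\<bar>)"
      unfolding eq by (rule order.trans[OF abs_triangle_ineq add_left_mono[OF sum_abs]])
    also have "\<dots> \<le> S + (\<Sum>i<n * m. 2 * S)"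
    proof (intro add_mono sum_mono S gridset_props)
      fix i assume i: "i \<in> {..<n * m}"
      have a: "\<bar>v (real (Suc i) / real m) - w (real (Suc i) / real m)\<bar> \<le> S" "\<bar>v (real i / real m) - w (real i / real m)\<bar> \<le> S"
        by (intro S gridset_props; use i in auto)+
      have "\<bar>((v (real (Suc i) / real m) - w (real (Suc i) / real m)) - (v (real i / real m) - w (real i / real m))) * ?c i\<bar> \<le> (2 * S) * 1"
        unfolding abs_mult
      proof (rule mult_mono)
        show "\<bar>(v (real (Suc i) / real m) - w (real (Suc i) / real m)) - (v (real i / real m) - w (real i / real m))\<bar> \<le> 2 * S"
          using abs_triangle_ineq4[of "v (real (Suc i) / real m) - w (real (Suc i) / real m)" "v (real i / real m) - w (real i / real m)"] a
          by linarith
        show "0 \<le> 2 * S" using order.trans[OF abs_ge_zero a(1)] by simp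
      qed simp_all
      then show "\<bar>((v (real (Suc i) / real m) - w (real (Suc i) / real m)) - (v (real i / real m) - w (real i / real m))) * ?c i\<bar> \<le> 2 * S" by simp
    qed
    also have "\<dots> = (1 + real (n * m) * 2) * S" by (simp add: algebra_simps)
    finally show "\<bar>interp n m v t - interp n m w t\<bar> \<le> (1 + real (n * m) * 2) * S" .
  qed
  then have "C * sup_dist n (interp n m v) (interp n m w) \<le> C * ((1 + real (n * m) * 2) * S)"
    using C by (rule mult_left_mono)
  moreover have "\<bar>h (interp n m v) - h (interp n m w)\<bar> \<le> C * sup_dist n (interp n m v) (interp n m w)"
    by (rule C_gauge.gauge_lipschitzD[OF h]) (simp_all add: topspace_C_halfline_topology interp_in_C)
  ultimately show "\<bar>h (interp n m v) - h (interp n m w)\<bar> \<le> C * (1 + real (n * m) * 2) * (\<Sum>j\<in>gridset n m. \<bar>v j - w j\<bar>)"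
    unfolding S_def[symmetric] by (simp only: mult.assoc)
qed

lemma uniform_oscillation:
  assumes w: "continuous_on {0..} w" and e: "e > (0::real)"
  shows "\<forall>\<^sub>F m in sequentially. m > 0 \<and> (\<forall>i t. i < n * m \<longrightarrow> real i / real m \<le> t \<longrightarrow> t \<le> real (Suc i) / real m \<longrightarrow> \<bar>w t - w (real i / real m)\<bar> < (e::real))"
proof -
  have "uniformly_continuous_on {0..real n} w"
    by (intro compact_uniformly_continuous continuous_on_subset[OF w]) auto
  then obtain d where d: "d > 0" "\<And>s t. s \<in> {0..real n} \<Longrightarrow> t \<in> {0..real n} \<Longrightarrow> dist t s < d \<Longrightarrow> dist (w t) (w s) < e"
    using e unfolding uniformly_continuous_on_def by metis
  have "\<forall>\<^sub>F m in sequentially. 1 / real m < d" using d(1) by real_asymp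
  then show ?thesis using eventually_gt_at_top[of 0]
  proof eventually_elim
    case (elim m)
    show ?case
    proof (intro conjI allI impI elim)
      fix i t assume i: "i < n * m" "real i / real m \<le> t" "t \<le> real (Suc i) / real m"
      have "real (Suc i) \<le> real (n * m)" using i(1) by (intro of_nat_mono) auto
      then have sn: "real (Suc i) / real m \<le> real n" using elim by (simp add: pos_divide_le_eq)
      have s0: "0 \<le> real i / real m" by simp
      have "real (Suc i) / real m = real i / real m + 1 / real m" by (simp add: add_divide_distrib)
      then have "dist t (real i / real m) < d" using i elim unfolding dist_real_def by linarith
      then show "\<bar>w t - w (real i / real m)\<bar> < e"
        using d(2)[of "real i / real m" t] i sn s0 unfolding dist_real_def by auto
    qed
  qed
qed

lemma interp_tendsto:
  assumes w: "w \<in> C_halfline"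
  shows "(\<lambda>m. sup_dist n (interp n m w) w) \<longlonglongrightarrow> 0"
proof (rule tendstoI)
  fix e :: real assume e: "e > 0"
  have wc: "continuous_on {0..} w" using w by (simp add: C_halfline_def)
  have "e / 4 > 0" using e by simp
  from uniform_oscillation[OF wc this, of n]
  show "\<forall>\<^sub>F m in sequentially. dist (sup_dist n (interp n m w) w) 0 < e"
  proof eventually_elim
    case (elim m)
    have "sup_dist n (interp n m w) w \<le> 2 * (e / 4)"
      by (rule sup_dist_least, rule interp_error) (use elim e in \<open>auto intro: less_imp_le\<close>)
    then show ?case using sup_dist_nonneg[OF interp_in_C w, of n n m w] e by simp
  qed
qed

lemma interp_gauge_tendsto:
  assumes h: "C_gauge.gauge_lipschitz n C h" and w: "w \<in> C_halfline"
  shows "(\<lambda>m. h (interp n m w)) \<longlonglongrightarrow> h w"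
proof -
  have "(\<lambda>m. C * sup_dist n (interp n m w) w) \<longlonglongrightarrow> 0"
    by (intro tendsto_mult_right_zero interp_tendsto w)
  moreover have "norm (h (interp n m w) - h w) \<le> C * sup_dist n (interp n m w) w" for m
    unfolding real_norm_def
    by (rule C_gauge.gauge_lipschitzD[OF h]) (simp_all add: topspace_C_halfline_topology interp_in_C w)
  ultimately have "(\<lambda>m. h (interp n m w) - h w) \<longlonglongrightarrow> 0"
    by (rule Lim_null_comparison[OF always_eventually[OF allI], rotated])
  then show ?thesis by (rule LIM_zero_cancel)
qed

text \<open>A Lipschitz functional of the path is the limit of its values at the interpolated paths,
  which depend on finitely many coordinates.\<close>

lemma C_process_measurable:
  assumes Y: "\<And>t. Y t \<in> borel_measurable M" and cont: "\<And>\<omega>. \<omega> \<in> space M \<Longrightarrow> continuous_on {0..} (\<lambda>t. Y t \<omega>)"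
  shows "(\<lambda>\<omega>. \<lambda>t\<in>{0..}. Y t \<omega>) \<in> M \<rightarrow>\<^sub>M borel_of C_halfline_topology"
proof (rule C_gauge.measurable_borel_ofI)
  have inC: "(\<lambda>t\<in>{0..}. Y t \<omega>) \<in> C_halfline" if "\<omega> \<in> space M" for \<omega>
    using cont[OF that] unfolding C_halfline_def by (auto cong: continuous_on_cong_simp)
  then show "(\<lambda>t\<in>{0..}. Y t \<omega>) \<in> topspace C_halfline_topology" if "\<omega> \<in> space M" for \<omega>
    using that by (simp add: topspace_C_halfline_topology)
  fix n C h assume h: "C_gauge.gauge_lipschitz n C h"
  show "(\<lambda>\<omega>. h (\<lambda>t\<in>{0..}. Y t \<omega>)) \<in> borel_measurable M"
  proof (rule borel_measurable_LIMSEQ_real)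
    show "(\<lambda>\<omega>. h (interp n m (\<lambda>t. Y t \<omega>))) \<in> borel_measurable M" for m
      by (rule lip_on_measurable[OF interp_lip[OF h]]) (rule Y)
    show "(\<lambda>m. h (interp n m (\<lambda>t. Y t \<omega>))) \<longlonglongrightarrow> h (\<lambda>t\<in>{0..}. Y t \<omega>)" if "\<omega> \<in> space M" for \<omega>
      using interp_gauge_tendsto[OF h inC[OF that]] by (simp add: interp_restrict)
  qed
qed

text \<open>For a nondecreasing path the largest increment over a cell is its largest oscillation
  within a cell, so grid values suffice. The cap \<open>B\<close> makes this a bounded test
  function; the inserted 0 gives the maximum a value when there are no cells.\<close>

definition grid_osc :: "real \<Rightarrow> nat \<Rightarrow> nat \<Rightarrow> (real \<Rightarrow> real) \<Rightarrow> real" where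
  "grid_osc B n m v = min B (Max (insert 0 ((\<lambda>i. \<bar>v (real (Suc i) / real m) - v (real i / real m)\<bar>) ` {..<n * m})))"

lemma Max_le_Max_add:
  fixes a b :: "nat \<Rightarrow> real"
  assumes "\<And>i. i < k \<Longrightarrow> a i \<le> b i + S" "S \<ge> 0"
  shows "Max (insert 0 (a ` {..<k})) \<le> Max (insert 0 (b ` {..<k})) + S"
proof (rule Max.boundedI)
  fix y assume "y \<in> insert 0 (a ` {..<k})"
  then consider "y = 0" | i where "i < k" "y = a i" by auto
  then show "y \<le> Max (insert 0 (b ` {..<k})) + S"
  proof cases
    case 1
    have "0 \<le> Max (insert 0 (b ` {..<k}))" by (rule Max_ge) auto
    then show ?thesis using 1 assms(2) by simp
  next
    case 2
    have "b i \<le> Max (insert 0 (b ` {..<k}))" using 2 by (intro Max_ge) auto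
    then show ?thesis using 2(2) assms(1)[OF 2(1)] by linarith
  qed
qed auto

lemma grid_osc_lip: "lip_on (gridset n m) 2 (grid_osc B n m)"
  unfolding lip_on_def
proof (intro conjI allI gridset_props)
  fix v w :: "real \<Rightarrow> real"
  define S where "S = (\<Sum>j\<in>gridset n m. \<bar>v j - w j\<bar>)"
  have S0: "S \<ge> 0" unfolding S_def by (intro sum_nonneg) auto
  have S: "\<bar>v j - w j\<bar> \<le> S" if "j \<in> gridset n m" for j
    unfolding S_def using gridset_props(1) that by (intro member_le_sum) auto
  have a: "\<bar>v (real (Suc i) / real m) - w (real (Suc i) / real m)\<bar> \<le> S" "\<bar>v (real i / real m) - w (real i / real m)\<bar> \<le> S" if "i < n * m" for i
    by (rule S, rule gridset_props, use that in simp)+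
  let ?a = "\<lambda>v i. \<bar>v (real (Suc i) / real m) - v (real i / real m)\<bar>"
  have 1: "?a v i \<le> ?a w i + 2 * S" "?a w i \<le> ?a v i + 2 * S" if "i < n * m" for i
    using a[OF that] by linarith+
  have "Max (insert 0 (?a v ` {..<n * m})) \<le> Max (insert 0 (?a w ` {..<n * m})) + 2 * S"
    "Max (insert 0 (?a w ` {..<n * m})) \<le> Max (insert 0 (?a v ` {..<n * m})) + 2 * S"
    by (rule Max_le_Max_add; use 1 S0 in simp)+
  then show "\<bar>grid_osc B n m v - grid_osc B n m w\<bar> \<le> 2 * (\<Sum>j\<in>gridset n m. \<bar>v j - w j\<bar>)"
    unfolding grid_osc_def S_def[symmetric] by linarith
qed simp

lemma grid_osc_bounds: "B \<ge> 0 \<Longrightarrow> 0 \<le> grid_osc B n m v" "grid_osc B n m v \<le> B"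
proof -
  have "0 \<le> Max (insert 0 ((\<lambda>i. \<bar>v (real (Suc i) / real m) - v (real i / real m)\<bar>) ` {..<n * m}))"
    by (rule Max_ge) auto
  then show "B \<ge> 0 \<Longrightarrow> 0 \<le> grid_osc B n m v" by (simp add: grid_osc_def)
qed (simp add: grid_osc_def)

lemma grid_osc_tendsto:
  assumes v: "continuous_on {0..} v" and B: "B \<ge> 0"
  shows "(\<lambda>m. grid_osc B n m v) \<longlonglongrightarrow> 0"
proof (rule tendstoI)
  fix e :: real assume e: "e > 0"
  from uniform_oscillation[OF v e, of n]
  show "\<forall>\<^sub>F m in sequentially. dist (grid_osc B n m v) 0 < e"
  proof eventually_elim
    case (elim m)
    have "Max (insert 0 ((\<lambda>i. \<bar>v (real (Suc i) / real m) - v (real i / real m)\<bar>) ` {..<n * m})) < e"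
    proof (subst Max_less_iff)
      show "\<forall>a\<in>insert 0 ((\<lambda>i. \<bar>v (real (Suc i) / real m) - v (real i / real m)\<bar>) ` {..<n * m}). a < e"
        using elim e by (auto simp: divide_right_mono)
    qed auto
    then have "grid_osc B n m v < e" unfolding grid_osc_def by (rule min.strict_coboundedI2)
    then show ?case using grid_osc_bounds(1)[OF B, of n m v] unfolding dist_real_def by linarith
  qed
qed

text \<open>Inside a cell \<open>w\<close> moves at most as much as \<open>v\<close>, which is
  nondecreasing, hence at most by the increment of \<open>v\<close> over the cell. The summand
  \<open>2 * C\<close> is the Lipschitz estimate; the summand 1 covers the case where the cap
  \<open>2 * H\<close> is active, in which the trivial bound of the difference by
  \<open>2 * H\<close> applies.\<close>

lemma interp_gauge_error:
  assumes h: "C_gauge.gauge_lipschitz n C h" and hb: "\<And>w. w \<in> C_halfline \<Longrightarrow> \<bar>h w\<bar> \<le> H"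
    and w: "w \<in> C_halfline" and m: "m > 0"
    and dom: "\<And>s t. 0 \<le> s \<Longrightarrow> s \<le> t \<Longrightarrow> \<bar>w t - w s\<bar> \<le> v t - v s"
  shows "\<bar>h (interp n m w) - h w\<bar> \<le> (2 * C + 1) * grid_osc (2 * H) n m v"
proof -
  have C: "C \<ge> 0" using h by (simp add: C_gauge.gauge_lipschitz_def)
  have H: "H \<ge> 0" using hb[OF w] by linarith
  define \<delta> where "\<delta> = Max (insert 0 ((\<lambda>i. \<bar>v (real (Suc i) / real m) - v (real i / real m)\<bar>) ` {..<n * m}))"
  have d0: "\<delta> \<ge> 0" unfolding \<delta>_def by (rule Max_ge) auto
  have di: "\<bar>v (real (Suc i) / real m) - v (real i / real m)\<bar> \<le> \<delta>" if "i < n * m" for i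
    unfolding \<delta>_def using that by (intro Max_ge) auto
  have "sup_dist n (interp n m w) w \<le> 2 * \<delta>"
  proof (rule sup_dist_least, rule interp_error[OF m d0])
    fix i t assume i: "i < n * m" "real i / real m \<le> t" "t \<le> real (Suc i) / real m"
    have i0: "0 \<le> real i / real m" by simp
    have "\<bar>w t - w (real i / real m)\<bar> \<le> v t - v (real i / real m)" using dom[OF i0 i(2)] .
    moreover have "0 \<le> v (real (Suc i) / real m) - v t"
      by (rule order.trans[OF abs_ge_zero dom[OF order.trans[OF i0 i(2)] i(3)]])
    ultimately show "\<bar>w t - w (real i / real m)\<bar> \<le> \<delta>" using di[OF i(1)] by linarith
  qed
  then have "C * sup_dist n (interp n m w) w \<le> C * (2 * \<delta>)" using C by (rule mult_left_mono)
  moreover have "\<bar>h (interp n m w) - h w\<bar> \<le> C * sup_dist n (interp n m w) w"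
    by (rule C_gauge.gauge_lipschitzD[OF h]) (simp_all add: topspace_C_halfline_topology interp_in_C w)
  ultimately have 1: "\<bar>h (interp n m w) - h w\<bar> \<le> 2 * C * \<delta>" by simp
  have 2: "\<bar>h (interp n m w) - h w\<bar> \<le> 2 * H"
    using hb[OF w] hb[OF interp_in_C[of n m w]] by linarith
  show ?thesis
  proof (cases "\<delta> \<le> 2 * H")
    case True
    then have "grid_osc (2 * H) n m v = \<delta>" unfolding grid_osc_def \<delta>_def[symmetric] by simp
    then show ?thesis using 1 d0 by (simp add: distrib_right)
  next
    case False
    then have g: "grid_osc (2 * H) n m v = 2 * H" unfolding grid_osc_def \<delta>_def[symmetric] by simp
    have "0 \<le> 2 * C * (2 * H)" using C H by simp
    then show ?thesis using 2 unfolding g by (simp add: distrib_right)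
  qed
qed

text \<open>Domination takes the place of a separate tightness argument: the error of interpolating
  \<open>Y'\<close> is controlled by the grid oscillation of \<open>V\<close>, a finite-dimensional
  quantity whose expectation converges to that for \<open>U\<close>, and this is small on a fine
  grid because \<open>U\<close> is continuous.\<close>

lemma weak_conv_CI:
  fixes Y Y' V :: "real \<Rightarrow> real \<Rightarrow> 'a \<Rightarrow> real" and Z Z' U :: "real \<Rightarrow> 'b \<Rightarrow> real"
  assumes M: "prob_space M" and N: "prob_space N"
    and Y'm: "\<And>T t. Y' T t \<in> borel_measurable M" and Z'm: "\<And>t. Z' t \<in> borel_measurable N"
    and Vm: "\<And>T t. V T t \<in> borel_measurable M" and Um: "\<And>t. U t \<in> borel_measurable N"
    and Y'c: "\<And>T \<omega>. \<omega> \<in> space M \<Longrightarrow> continuous_on {0..} (\<lambda>t. Y' T t \<omega>)"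
    and Z'c: "\<And>\<omega>. \<omega> \<in> space N \<Longrightarrow> continuous_on {0..} (\<lambda>t. Z' t \<omega>)"
    and Uc: "\<And>\<omega>. \<omega> \<in> space N \<Longrightarrow> continuous_on {0..} (\<lambda>t. U t \<omega>)"
    and Y: "\<forall>\<^sub>F T in at_top. AE \<omega> in M. \<forall>t\<ge>0. Y' T t \<omega> = Y T t \<omega>"
    and Z: "AE \<omega> in N. \<forall>t\<ge>0. Z' t \<omega> = Z t \<omega>"
    and dom: "\<forall>\<^sub>F T in at_top. AE \<omega> in M. \<forall>s t. 0 \<le> s \<longrightarrow> s \<le> t \<longrightarrow> \<bar>Y' T t \<omega> - Y' T s \<omega>\<bar> \<le> V T t \<omega> - V T s \<omega>"
    and convY: "\<And>J C g H. lip_on J C g \<Longrightarrow> J \<subseteq> {0..} \<Longrightarrow> (\<And>v. \<bar>g v\<bar> \<le> H) \<Longrightarrow> 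
        ((\<lambda>T. \<integral>\<omega>. g (\<lambda>t. Y' T t \<omega>) \<partial>M) \<longlongrightarrow> (\<integral>\<omega>. g (\<lambda>t. Z' t \<omega>) \<partial>N)) at_top"
    and convV: "\<And>J C g H. lip_on J C g \<Longrightarrow> J \<subseteq> {0..} \<Longrightarrow> (\<And>v. \<bar>g v\<bar> \<le> H) \<Longrightarrow> 
        ((\<lambda>T. \<integral>\<omega>. g (\<lambda>t. V T t \<omega>) \<partial>M) \<longlongrightarrow> (\<integral>\<omega>. g (\<lambda>t. U t \<omega>) \<partial>N)) at_top"
  shows "weak_conv_C M Y N Z"
  unfolding weak_conv_C_def
proof (rule C_gauge.conv_in_law_lipschitzI[OF M N, where Y'="\<lambda>T \<omega>. \<lambda>t\<in>{0..}. Y' T t \<omega>" and Z'="\<lambda>\<omega>. \<lambda>t\<in>{0..}. Z' t \<omega>"])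
  interpret M: prob_space M by fact
  interpret N: prob_space N by fact
  have Y'in: "(\<lambda>\<omega>. \<lambda>t\<in>{0..}. Y' T t \<omega>) \<in> M \<rightarrow>\<^sub>M borel_of C_halfline_topology" for T
    by (rule C_process_measurable[OF Y'm Y'c])
  moreover have "\<forall>\<^sub>F T in at_top. AE \<omega> in M. (\<lambda>t\<in>{0..}. Y' T t \<omega>) = (\<lambda>t\<in>{0..}. Y T t \<omega>)"
    using Y
  proof eventually_elim
    case (elim T)
    then show ?case by eventually_elim (auto intro!: restrict_ext)
  qed
  ultimately show "\<forall>\<^sub>F T in at_top. (\<lambda>\<omega>. \<lambda>t\<in>{0..}. Y' T t \<omega>) \<in> M \<rightarrow>\<^sub>M borel_of C_halfline_topology \<and>
      (AE \<omega> in M. (\<lambda>t\<in>{0..}. Y' T t \<omega>) = (\<lambda>t\<in>{0..}. Y T t \<omega>))" by simp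
  show Z'in: "(\<lambda>\<omega>. \<lambda>t\<in>{0..}. Z' t \<omega>) \<in> N \<rightarrow>\<^sub>M borel_of C_halfline_topology"
    by (rule C_process_measurable[OF Z'm Z'c])
  show "AE \<omega> in N. (\<lambda>t\<in>{0..}. Z' t \<omega>) = (\<lambda>t\<in>{0..}. Z t \<omega>)"
    using Z by eventually_elim (auto intro!: restrict_ext)
  fix n C H and h :: "(real \<Rightarrow> real) \<Rightarrow> real"
  assume h: "C_gauge.gauge_lipschitz n C h" and "\<And>w. w \<in> topspace C_halfline_topology \<Longrightarrow> \<bar>h w\<bar> \<le> H"
  then have hb: "\<And>w. w \<in> C_halfline \<Longrightarrow> \<bar>h w\<bar> \<le> H" by (simp add: topspace_C_halfline_topology)
  have H: "H \<ge> 0" using hb[OF interp_in_C] by (meson abs_ge_zero order.trans)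
  have C: "C \<ge> 0" using h by (simp add: C_gauge.gauge_lipschitz_def)
  have hm: "h \<in> borel_measurable (borel_of C_halfline_topology)"
    by (rule continuous_map_borel_of[OF C_gauge.gauge_lipschitz_continuous_map[OF h]])
  have YC: "(\<lambda>t\<in>{0..}. Y' T t \<omega>) \<in> C_halfline" if "\<omega> \<in> space M" for T \<omega>
    using measurable_space[OF Y'in that] by (simp add: topspace_C_halfline_topology)
  have ZC: "(\<lambda>t\<in>{0..}. Z' t \<omega>) \<in> C_halfline" if "\<omega> \<in> space N" for \<omega>
    using measurable_space[OF Z'in that] by (simp add: topspace_C_halfline_topology)
  have lipi: "lip_on (gridset n m) (C * (1 + real (n * m) * 2)) (\<lambda>w. h (interp n m w))" for m
    by (rule interp_lip[OF h])
  have hib: "\<bar>h (interp n m w)\<bar> \<le> H" for m w by (rule hb[OF interp_in_C])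
  let ?D = "2 * C + 1"
  show "((\<lambda>T. \<integral>\<omega>. h (\<lambda>t\<in>{0..}. Y' T t \<omega>) \<partial>M) \<longlongrightarrow> (\<integral>\<omega>. h (\<lambda>t\<in>{0..}. Z' t \<omega>) \<partial>N)) at_top"
  proof (rule tendsto_approximation)
    fix \<epsilon> :: real assume e: "\<epsilon> > 0"
    have "(\<lambda>m. \<integral>\<omega>. h (interp n m (\<lambda>t. Z' t \<omega>)) \<partial>N) \<longlonglongrightarrow> (\<integral>\<omega>. h (\<lambda>t\<in>{0..}. Z' t \<omega>) \<partial>N)"
    proof (rule integral_dominated_convergence[where w="\<lambda>_. H"])
      show "(\<lambda>\<omega>. h (\<lambda>t\<in>{0..}. Z' t \<omega>)) \<in> borel_measurable N" by (rule measurable_compose[OF Z'in hm])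
      show "(\<lambda>\<omega>. h (interp n m (\<lambda>t. Z' t \<omega>))) \<in> borel_measurable N" for m
        by (rule lip_on_measurable[OF lipi Z'm])
      show "AE \<omega> in N. (\<lambda>m. h (interp n m (\<lambda>t. Z' t \<omega>))) \<longlonglongrightarrow> h (\<lambda>t\<in>{0..}. Z' t \<omega>)"
      proof (rule AE_I2)
        fix \<omega> assume "\<omega> \<in> space N"
        from interp_gauge_tendsto[OF h ZC[OF this]]
        show "(\<lambda>m. h (interp n m (\<lambda>t. Z' t \<omega>))) \<longlonglongrightarrow> h (\<lambda>t\<in>{0..}. Z' t \<omega>)" by (simp only: interp_restrict)
      qed
    qed (use hib in auto)
    then have ev1: "\<forall>\<^sub>F m in sequentially. dist (\<integral>\<omega>. h (interp n m (\<lambda>t. Z' t \<omega>)) \<partial>N) (\<integral>\<omega>. h (\<lambda>t\<in>{0..}. Z' t \<omega>) \<partial>N) < \<epsilon>"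
      using e by (rule tendstoD)
    have "(\<lambda>m. \<integral>\<omega>. grid_osc (2 * H) n m (\<lambda>t. U t \<omega>) \<partial>N) \<longlonglongrightarrow> (\<integral>\<omega>. 0 \<partial>N)"
    proof (rule integral_dominated_convergence[where w="\<lambda>_. 2 * H"])
      show "(\<lambda>\<omega>. grid_osc (2 * H) n m (\<lambda>t. U t \<omega>)) \<in> borel_measurable N" for m
        by (rule lip_on_measurable[OF grid_osc_lip Um])
      show "AE \<omega> in N. (\<lambda>m. grid_osc (2 * H) n m (\<lambda>t. U t \<omega>)) \<longlonglongrightarrow> 0"
        by (rule AE_I2, rule grid_osc_tendsto[OF Uc]) (use H in auto)
    qed (use grid_osc_bounds H in auto)
    then have "(\<lambda>m. ?D * (\<integral>\<omega>. grid_osc (2 * H) n m (\<lambda>t. U t \<omega>) \<partial>N)) \<longlonglongrightarrow> 0"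
      by (intro tendsto_mult_right_zero) simp
    then have ev2: "\<forall>\<^sub>F m in sequentially. ?D * (\<integral>\<omega>. grid_osc (2 * H) n m (\<lambda>t. U t \<omega>) \<partial>N) < \<epsilon>"
      using e by (rule order_tendstoD)
    \<comment> \<open>The mesh is fixed by the limit processes \<open>Z'\<close> and
      \<open>U\<close> alone; T is taken large afterwards.\<close>
    obtain m where m: "dist (\<integral>\<omega>. h (interp n m (\<lambda>t. Z' t \<omega>)) \<partial>N) (\<integral>\<omega>. h (\<lambda>t\<in>{0..}. Z' t \<omega>) \<partial>N) < \<epsilon>"
      "?D * (\<integral>\<omega>. grid_osc (2 * H) n m (\<lambda>t. U t \<omega>) \<partial>N) < \<epsilon>" "m > 0"
      using eventually_happens'[OF _ eventually_conj[OF ev1 eventually_conj[OF ev2 eventually_gt_at_top[of 0]]]] by auto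
    have osc_lim: "((\<lambda>T. \<integral>\<omega>. grid_osc (2 * H) n m (\<lambda>t. V T t \<omega>) \<partial>M) \<longlongrightarrow> (\<integral>\<omega>. grid_osc (2 * H) n m (\<lambda>t. U t \<omega>) \<partial>N)) at_top"
      by (rule convV[OF grid_osc_lip gridset_props(2), of _ _ _ "2 * H"]) (use grid_osc_bounds H in \<open>auto simp: abs_le_iff intro: order.trans[of _ 0]\<close>)
    have "\<forall>\<^sub>F T in at_top. ?D * (\<integral>\<omega>. grid_osc (2 * H) n m (\<lambda>t. V T t \<omega>) \<partial>M) < \<epsilon>"
      by (rule order_tendstoD(2)[OF tendsto_mult_left[OF osc_lim] m(2)])
    with dom have ev: "\<forall>\<^sub>F T in at_top. \<bar>(\<integral>\<omega>. h (\<lambda>t\<in>{0..}. Y' T t \<omega>) \<partial>M) - (\<integral>\<omega>. h (interp n m (\<lambda>t. Y' T t \<omega>)) \<partial>M)\<bar> \<le> \<epsilon>"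
    proof eventually_elim
      case (elim T)
      let ?a = "\<lambda>\<omega>. h (\<lambda>t\<in>{0..}. Y' T t \<omega>)" and ?b = "\<lambda>\<omega>. h (interp n m (\<lambda>t. Y' T t \<omega>))" and ?o = "\<lambda>\<omega>. grid_osc (2 * H) n m (\<lambda>t. V T t \<omega>)"
      have am: "?a \<in> borel_measurable M" by (rule measurable_compose[OF Y'in hm])
      have bm: "?b \<in> borel_measurable M" by (rule lip_on_measurable[OF lipi Y'm])
      have om: "?o \<in> borel_measurable M" by (rule lip_on_measurable[OF grid_osc_lip Vm])
      have ia: "integrable M ?a" by (rule M.integrable_const_bound[where B=H]) (use am hb YC in auto)
      have ib: "integrable M ?b" by (rule M.integrable_const_bound[where B=H]) (use bm hib in auto)
      have io: "integrable M ?o" by (rule M.integrable_const_bound[where B="2 * H"]) (use om grid_osc_bounds H in auto)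
      have "\<bar>(\<integral>\<omega>. ?a \<omega> \<partial>M) - (\<integral>\<omega>. ?b \<omega> \<partial>M)\<bar> = \<bar>\<integral>\<omega>. ?a \<omega> - ?b \<omega> \<partial>M\<bar>"
        by (simp only: Bochner_Integration.integral_diff[OF ia ib])
      also have "\<dots> \<le> (\<integral>\<omega>. \<bar>?a \<omega> - ?b \<omega>\<bar> \<partial>M)" by (rule integral_abs_bound)
      also have "\<dots> \<le> (\<integral>\<omega>. ?D * ?o \<omega> \<partial>M)"
      proof (rule integral_mono_AE)
        show "integrable M (\<lambda>\<omega>. \<bar>?a \<omega> - ?b \<omega>\<bar>)" by (intro integrable_abs Bochner_Integration.integrable_diff ia ib)
        show "integrable M (\<lambda>\<omega>. ?D * ?o \<omega>)" by (intro integrable_mult_right io)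
        show "AE \<omega> in M. \<bar>?a \<omega> - ?b \<omega>\<bar> \<le> ?D * ?o \<omega>"
          using elim(1) AE_space
        proof eventually_elim
          case (elim \<omega>)
          have "\<bar>h (interp n m (\<lambda>t\<in>{0..}. Y' T t \<omega>)) - h (\<lambda>t\<in>{0..}. Y' T t \<omega>)\<bar> \<le> ?D * ?o \<omega>"
            by (rule interp_gauge_error[OF h hb YC[OF elim(2)] m(3)]) (use elim(1) in auto)
          then show ?case by (simp only: interp_restrict abs_minus_commute)
        qed
      qed
      also have "\<dots> = ?D * (\<integral>\<omega>. ?o \<omega> \<partial>M)" by simp
      finally show ?case using elim(2) by linarith
    qed
    have conv: "((\<lambda>T. \<integral>\<omega>. h (interp n m (\<lambda>t. Y' T t \<omega>)) \<partial>M) \<longlongrightarrow> (\<integral>\<omega>. h (interp n m (\<lambda>t. Z' t \<omega>)) \<partial>N)) at_top"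
      by (rule convY[OF lipi gridset_props(2) hib])
    show "\<exists>b l'. (\<forall>\<^sub>F T in at_top. \<bar>(\<integral>\<omega>. h (\<lambda>t\<in>{0..}. Y' T t \<omega>) \<partial>M) - b T\<bar> \<le> \<epsilon>) \<and> (b \<longlongrightarrow> l') at_top \<and>
      \<bar>l' - (\<integral>\<omega>. h (\<lambda>t\<in>{0..}. Z' t \<omega>) \<partial>N)\<bar> \<le> \<epsilon>"
      using ev conv m(1)[unfolded dist_real_def]
      by (intro exI[of _ "\<lambda>T. \<integral>\<omega>. h (interp n m (\<lambda>t. Y' T t \<omega>)) \<partial>M"] exI[of _ "\<integral>\<omega>. h (interp n m (\<lambda>t. Z' t \<omega>)) \<partial>N"] conjI less_imp_le)
  qed
qed

section \<open>Convergence of the scaled functionals\<close>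

text \<open>The process \<open>\<eta>\<close> in the natural time scale \<open>R\<^sup>\<beta> / f R\<close> and space scale \<open>R = T\<^bsup>1/\<beta>\<^esup>\<close>;
  the value \<open>1\<close> of the time scale is a dummy where \<open>f R\<close> is not positive.\<close>

definition time_scale :: "real \<Rightarrow> (real \<Rightarrow> real) \<Rightarrow> real \<Rightarrow> real" where
  "time_scale \<beta> f R = (if R > 0 \<and> f R > 0 then R powr \<beta> / f R else 1)"

lemma time_scale_pos: "time_scale \<beta> f R > 0"
  by (simp add: time_scale_def)

text \<open>\<open>l\<close> plays the role of the local time at the level \<open>x\<close>. It is
  tied to the stable process as the limit of tent occupation integrals, at each fixed time off a
  null set.\<close>

locale local_time_setting = regular_exponent \<beta> f + eta: levy_path M \<eta> + xi: levy_path N \<xi>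
  for \<beta> :: real and f and M :: "'a measure" and \<eta> and N :: "'b measure" and \<xi> +
  fixes l :: "real \<Rightarrow> 'b \<Rightarrow> real" and x :: real
  assumes char_eta: "\<And>t \<theta>. t \<ge> 0 \<Longrightarrow> char (distr M borel (\<eta> t)) \<theta> = complex_of_real (exp (- (t * tail_exponent \<beta> f \<theta>)))"
    and char_xi: "\<And>t \<theta>. t \<ge> 0 \<Longrightarrow> char (distr N borel (\<xi> t)) \<theta> = complex_of_real (exp (- (t * \<bar>\<theta>\<bar> powr \<beta>)))"
    and l_meas [measurable]: "\<And>t. l t \<in> borel_measurable N"
    and l_limit: "\<And>t. t \<ge> 0 \<Longrightarrow> AE \<omega> in N. ((\<lambda>\<epsilon>. occ (tent \<epsilon>) x \<xi> t \<omega>) \<longlongrightarrow> l t \<omega>) (at_right 0)"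
begin

definition X :: "real \<Rightarrow> real \<Rightarrow> 'a \<Rightarrow> real" where
  "X R t \<omega> = \<eta> (time_scale \<beta> f R * t) \<omega> / R"

lemma X_path: "levy_path M (X R)"
  unfolding X_def[abs_def] by (rule eta.scale[OF time_scale_pos])

lemma char_X:
  assumes "t \<ge> 0"
  shows "char (distr M borel (X R t)) \<theta> = complex_of_real (exp (- (t * (time_scale \<beta> f R * tail_exponent \<beta> f (\<theta> / R)))))"
proof -
  have "char (distr M borel (X R t)) \<theta> = char (distr M borel (\<eta> (time_scale \<beta> f R * t))) (\<theta> / R)"
    unfolding char_def X_def by (simp add: integral_distr)
  also have "\<dots> = complex_of_real (exp (- (time_scale \<beta> f R * t * tail_exponent \<beta> f (\<theta> / R))))"
    using assms time_scale_pos[of \<beta> f R] by (intro char_eta) simp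
  finally show ?thesis by (simp add: mult_ac)
qed

lemma eventually_regular: "\<forall>\<^sub>F R in at_top. R > 0 \<and> f R > 0"
  using sv eventually_gt_at_top[of 0] by (auto simp: slowly_varying_def eventually_conj_iff)

lemma X_path_char: "\<forall>\<^sub>F R in at_top. levy_path_char M (X R) (\<lambda>\<theta>. R powr \<beta> / f R * tail_exponent \<beta> f (\<theta> / R))"
  using eventually_regular
proof eventually_elim
  case (elim R)
  have ts: "time_scale \<beta> f R = R powr \<beta> / f R" using elim by (simp add: time_scale_def)
  show ?case
  proof (intro levy_path_char.intro X_path levy_path_char_axioms.intro)
    show "0 \<le> R powr \<beta> / f R * tail_exponent \<beta> f (\<theta> / R)" for \<theta>
      using elim Psi_nonneg by (intro mult_nonneg_nonneg) auto
    show "char (distr M borel (X R t)) \<theta> = complex_of_real (exp (- (t * (R powr \<beta> / f R * tail_exponent \<beta> f (\<theta> / R)))))" if "t \<ge> 0" for t \<theta>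
      using char_X[OF that] by (simp add: ts)
    show "(\<integral>\<^sup>+\<theta>. inverse (ennreal (R powr \<beta> / f R * tail_exponent \<beta> f (\<theta> / R))) * indicator {\<theta>. \<bar>\<theta>\<bar> > 1} \<theta> \<partial>lborel) < \<infinity>"
      using elim by (intro inverse_Psi_scaled_finite) auto
  qed measurable
qed

sublocale levy_limit M X N \<xi>
proof (intro levy_limit.intro X_path xi.levy_path_axioms)
  fix h \<theta> :: real assume h: "h \<ge> 0"
  have "((\<lambda>R. complex_of_real (exp (- (h * (R powr \<beta> / f R * tail_exponent \<beta> f (\<theta> / R)))))) \<longlongrightarrow> complex_of_real (exp (- (h * \<bar>\<theta>\<bar> powr \<beta>)))) at_top"
    by (intro tendsto_intros tail_exponent_scaling)
  moreover have "\<forall>\<^sub>F R in at_top. complex_of_real (exp (- (h * (R powr \<beta> / f R * tail_exponent \<beta> f (\<theta> / R))))) = char (distr M borel (X R h)) \<theta>"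
    using eventually_regular by eventually_elim (simp add: char_X[OF h] time_scale_def)
  ultimately show "((\<lambda>R. char (distr M borel (X R h)) \<theta>) \<longlongrightarrow> char (distr N borel (\<xi> h)) \<theta>) at_top"
    unfolding char_xi[OF h] by (simp add: tendsto_cong)
qed

definition scaled_occ :: "(real \<Rightarrow> real) \<Rightarrow> real \<Rightarrow> real \<Rightarrow> 'a \<Rightarrow> real" where
  "scaled_occ \<phi> R t \<omega> = (LINT r:{0..t}|lborel. R * \<phi> (R * (X R r \<omega> - x)))"

lemma scaled_occ_meas:
  assumes [measurable]: "\<phi> \<in> borel_measurable borel"
  shows "scaled_occ \<phi> R t \<in> borel_measurable M"
  unfolding scaled_occ_def[abs_def] set_lebesgue_integral_def by measurable

text \<open>The tent must be narrow enough for the comparison with the scaled kernel, at all times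
  of \<open>J\<close>, and narrow enough for the stable process to be close to its local time. The
  first condition is a threshold \<open>d\<close> independent of R, so both can be met before R
  tends to infinity.\<close>

theorem lipschitz_fdd_convergence:
  assumes phi: "integrable lborel \<phi>" and F: "lip_on J C F" and gb: "\<And>v. \<bar>F v\<bar> \<le> H" and J: "J \<subseteq> {0..}"
  shows "((\<lambda>R. LINT \<omega>|M. F (\<lambda>t. scaled_occ \<phi> R t \<omega>)) \<longlongrightarrow> (LINT \<omega>|N. F (\<lambda>t. (LINT y|lborel. \<phi> y) * l t \<omega>))) at_top"
proof (rule tendsto_approximation)
  have [measurable]: "\<phi> \<in> borel_measurable borel" using phi by auto
  define c where "c = (LINT y|lborel. \<phi> y)"
  have CJ: "finite J" "C \<ge> 0" using F by (auto simp: lip_on_def)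
  fix \<epsilon> :: real assume e: "\<epsilon> > 0"
  \<comment> \<open>The tolerance for a single time, such that the Lipschitz bound over
    \<open>J\<close> adds up to at most \<epsilon>; the added 1 keeps the denominator
    positive.\<close>
  define \<eta>' where "\<eta>' = \<epsilon> / (C * card J + 1)"
  have cj: "C * card J + 1 > 0" using CJ by (simp add: add_nonneg_pos)
  have eta': "\<eta>' > 0" "C * (card J * \<eta>') \<le> \<epsilon>"
  proof -
    show "\<eta>' > 0" using e cj by (simp add: \<eta>'_def)
    then have "C * (card J * \<eta>') \<le> (C * card J + 1) * \<eta>'" by (simp add: algebra_simps)
    then show "C * (card J * \<eta>') \<le> \<epsilon>" using cj by (simp add: \<eta>'_def)
  qed
  let ?E = "\<lambda>\<delta> R t \<omega>. \<bar>scaled_occ \<phi> R t \<omega> - c * occ (tent \<delta>) x (X R) t \<omega>\<bar>"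
  define good where "good t d \<longleftrightarrow> d > 0 \<and> (\<forall>\<delta>. 0 < \<delta> \<longrightarrow> \<delta> \<le> d \<longrightarrow> (\<forall>\<^sub>F R in at_top. (\<integral>\<^sup>+\<omega>. ennreal (?E \<delta> R t \<omega>) \<partial>M) \<le> ennreal \<eta>'))" for t d
  have "\<forall>t\<in>J. \<exists>d. good t d"
  proof
    fix t assume "t \<in> J"
    then have "t \<ge> 0" using J by auto
    from occupation_approximation[OF X_path_char phi this eta'(1), of x]
    show "\<exists>d. good t d" unfolding good_def scaled_occ_def occ_def c_def .
  qed
  then obtain D where "\<forall>t\<in>J. good t (D t)" by (rule bchoice[THEN exE])
  then have D: "\<And>t. t \<in> J \<Longrightarrow> D t > 0" 
    "\<And>t \<delta>. t \<in> J \<Longrightarrow> 0 < \<delta> \<Longrightarrow> \<delta> \<le> D t \<Longrightarrow> (\<forall>\<^sub>F R in at_top. (\<integral>\<^sup>+\<omega>. ennreal (?E \<delta> R t \<omega>) \<partial>M) \<le> ennreal \<eta>')"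
    unfolding good_def by blast+
  define d where "d = Min (insert 1 (D ` J))"
  have d: "d > 0" "\<And>t. t \<in> J \<Longrightarrow> d \<le> D t" using CJ D(1) by (auto simp: d_def)
  \<comment> \<open>A sequence of widths, all below the common threshold, since dominated
    convergence is applied along sequences.\<close>
  define del where "del k = d / real (Suc k)" for k
  have del: "del k > 0" "del k \<le> d" for k using d(1) by (auto simp: del_def divide_le_eq mult_le_cancel_left1)
  have del0: "filterlim del (at_right 0) sequentially"
  proof -
    have "(\<lambda>k. d * (1 / real (Suc k))) \<longlonglongrightarrow> 0" by (intro tendsto_mult_right_zero) real_asymp
    then have "del \<longlonglongrightarrow> 0" by (simp add: del_def[abs_def])
    then show ?thesis unfolding filterlim_at using del(1) by (auto intro!: always_eventually simp: less_imp_neq[symmetric])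
  qed
  have gm: "(\<lambda>\<omega>. F (\<lambda>t. c * occ (tent (del k)) x \<xi> t \<omega>)) \<in> borel_measurable N" for k
    by (rule lip_on_measurable[OF F]) (simp add: occ_def set_lebesgue_integral_def)
  have "(\<lambda>k. LINT \<omega>|N. F (\<lambda>t. c * occ (tent (del k)) x \<xi> t \<omega>)) \<longlonglongrightarrow> (LINT \<omega>|N. F (\<lambda>t. c * l t \<omega>))"
  proof (rule integral_dominated_convergence[where w="\<lambda>_. H"])
    show "(\<lambda>\<omega>. F (\<lambda>t. c * l t \<omega>)) \<in> borel_measurable N" by (rule lip_on_measurable[OF F]) simp
    have "AE \<omega> in N. \<forall>t\<in>J. ((\<lambda>\<epsilon>. occ (tent \<epsilon>) x \<xi> t \<omega>) \<longlongrightarrow> l t \<omega>) (at_right 0)"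
      using CJ J l_limit by (subst AE_finite_all) auto
    then show "AE \<omega> in N. (\<lambda>k. F (\<lambda>t. c * occ (tent (del k)) x \<xi> t \<omega>)) \<longlonglongrightarrow> F (\<lambda>t. c * l t \<omega>)"
    proof eventually_elim
      case (elim \<omega>)
      then show ?case
        by (intro lip_on_tendsto[OF F] tendsto_mult_left filterlim_compose[OF _ del0]) (rule bspec)
    qed
  qed (use gm gb in auto)
  then have "\<forall>\<^sub>F k in sequentially. dist (LINT \<omega>|N. F (\<lambda>t. c * occ (tent (del k)) x \<xi> t \<omega>)) (LINT \<omega>|N. F (\<lambda>t. c * l t \<omega>)) < \<epsilon>"
    using e by (rule tendstoD)
  then obtain k where k: "dist (LINT \<omega>|N. F (\<lambda>t. c * occ (tent (del k)) x \<xi> t \<omega>)) (LINT \<omega>|N. F (\<lambda>t. c * l t \<omega>)) < \<epsilon>"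
    by (auto simp: eventually_sequentially)
  define \<delta> where "\<delta> = del k"
  have delta: "\<delta> > 0" "\<delta> \<le> d" using del unfolding \<delta>_def by auto
  interpret lipschitz_kernel "tent \<delta>" "1 / \<delta>" "1 / \<delta>\<^sup>2" by (rule lipschitz_kernel_tent[OF delta(1)])
  interpret levy_limit_kernel M X N \<xi> "tent \<delta>" "1 / \<delta>" "1 / \<delta>\<^sup>2" ..
  have conv: "((\<lambda>R. LINT \<omega>|M. F (\<lambda>t. c * occ (tent \<delta>) x (X R) t \<omega>)) \<longlongrightarrow> (LINT \<omega>|N. F (\<lambda>t. c * occ (tent \<delta>) x \<xi> t \<omega>))) at_top"
    by (rule occupation_convergence[OF F gb J])
  have "\<forall>\<^sub>F R in at_top. \<forall>t\<in>J. (\<integral>\<^sup>+\<omega>. ennreal (?E \<delta> R t \<omega>) \<partial>M) \<le> ennreal \<eta>'"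
    by (intro eventually_ball_finite ballI CJ(1) D(2) delta(1) order.trans[OF delta(2) d(2)])
  then have "\<forall>\<^sub>F R in at_top. \<bar>(LINT \<omega>|M. F (\<lambda>t. scaled_occ \<phi> R t \<omega>)) - (LINT \<omega>|M. F (\<lambda>t. c * occ (tent \<delta>) x (X R) t \<omega>))\<bar> \<le> \<epsilon>"
  proof eventually_elim
    case (elim R)
    have [measurable]: "scaled_occ \<phi> R t \<in> borel_measurable M" for t by (rule scaled_occ_meas) simp
    have iE: "integrable M (?E \<delta> R t)" "(LINT \<omega>|M. ?E \<delta> R t \<omega>) \<le> \<eta>'" if "t \<in> J" for t
    proof -
      show i: "integrable M (?E \<delta> R t)"
        using le_less_trans[OF elim[rule_format, OF that] ennreal_less_top] by (intro integrableI_bounded) auto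
      show "(LINT \<omega>|M. ?E \<delta> R t \<omega>) \<le> \<eta>'"
        using elim[rule_format, OF that] i eta'(1) by (subst (asm) nn_integral_eq_integral) auto
    qed
    let ?a = "\<lambda>\<omega>. F (\<lambda>t. scaled_occ \<phi> R t \<omega>)" and ?b = "\<lambda>\<omega>. F (\<lambda>t. c * occ (tent \<delta>) x (X R) t \<omega>)"
    have m: "?a \<in> borel_measurable M" "?b \<in> borel_measurable M" by (rule lip_on_measurable[OF F]; simp)+
    have i: "integrable M ?a" "integrable M ?b"
      by (rule eta.integrable_const_bound[where B=H]; use gb m in auto)+
    have "\<bar>(LINT \<omega>|M. ?a \<omega>) - (LINT \<omega>|M. ?b \<omega>)\<bar> = \<bar>LINT \<omega>|M. ?a \<omega> - ?b \<omega>\<bar>"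
      using i by (simp add: Bochner_Integration.integral_diff)
    also have "\<dots> \<le> (LINT \<omega>|M. \<bar>?a \<omega> - ?b \<omega>\<bar>)" by (rule integral_abs_bound)
    also have "\<dots> \<le> (LINT \<omega>|M. C * (\<Sum>t\<in>J. ?E \<delta> R t \<omega>))"
      by (intro integral_mono integrable_abs integrable_mult_right Bochner_Integration.integrable_diff Bochner_Integration.integrable_sum i iE(1) lip_onD[OF F])
    also have "\<dots> = C * (\<Sum>t\<in>J. (LINT \<omega>|M. ?E \<delta> R t \<omega>))"
      using iE(1) by (subst integral_mult_right_zero, subst Bochner_Integration.integral_sum) auto
    also have "\<dots> \<le> C * (\<Sum>t\<in>J. \<eta>')"
      using CJ iE(2) by (intro mult_left_mono sum_mono) auto
    also have "\<dots> \<le> \<epsilon>" using eta'(2) by simp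
    finally show ?case .
  qed
  then show "\<exists>b l'. (\<forall>\<^sub>F R in at_top. \<bar>(LINT \<omega>|M. F (\<lambda>t. scaled_occ \<phi> R t \<omega>)) - b R\<bar> \<le> \<epsilon>) \<and> (b \<longlongrightarrow> l') at_top \<and>
    \<bar>l' - (LINT \<omega>|N. F (\<lambda>t. (LINT y|lborel. \<phi> y) * l t \<omega>))\<bar> \<le> \<epsilon>"
    using conv k unfolding c_def[symmetric] \<delta>_def[symmetric] dist_real_def
    by (intro exI[of _ "\<lambda>R. LINT \<omega>|M. F (\<lambda>t. c * occ (tent \<delta>) x (X R) t \<omega>)"] exI[of _ "LINT \<omega>|N. F (\<lambda>t. c * occ (tent \<delta>) x \<xi> t \<omega>)"] conjI less_imp_le)
qed

text \<open>One null set serves all times: integrability is obtained at the countably many integer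
  horizons and inherited by shorter intervals.\<close>

lemma AE_scaled_occ_integrable:
  assumes phi: "integrable lborel \<phi>"
  shows "\<forall>\<^sub>F R in at_top. AE \<omega> in M. \<forall>t. set_integrable lborel {0..t} (\<lambda>r. R * \<phi> (R * (X R r \<omega> - x)))"
  using X_path_char eventually_gt_at_top[of 0]
proof eventually_elim
  case (elim R)
  interpret levy_path_char M "X R" "\<lambda>\<theta>. R powr \<beta> / f R * tail_exponent \<beta> f (\<theta> / R)" by (rule elim(1))
  have i: "integrable lborel (\<lambda>y. R * \<phi> (R * y))"
    using lborel_integrable_real_affine[OF phi, of R 0] elim by simp
  then have [measurable]: "(\<lambda>y. R * \<phi> (R * y)) \<in> borel_measurable borel" by auto
  have "AE \<omega> in M. \<forall>n::nat. integrable lborel (\<lambda>r. K (real n) x (\<lambda>y. R * \<phi> (R * y)) r \<omega>)"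
    unfolding AE_all_countable by (intro allI AE_integrable_K i) simp
  then show ?case using AE_space
  proof eventually_elim
    case (elim \<omega>)
    show ?case
    proof
      fix t
      obtain n :: nat where n: "t \<le> real n" using real_arch_simple by blast
      have "set_integrable lborel {0..real n} (\<lambda>r. R * \<phi> (R * (X R r \<omega> - x)))"
        using elim by (subst set_integral_K(2)) auto
      then show "set_integrable lborel {0..t} (\<lambda>r. R * \<phi> (R * (X R r \<omega> - x)))"
        by (rule set_integrable_subset) (use n in auto)
    qed
  qed
qed

end

section \<open>Path integrals as functions of time\<close>

lemma continuous_on_indefinite_set_integral:
  fixes h :: "real \<Rightarrow> real"
  assumes h: "\<And>t. set_integrable lborel {0..t} h"
  shows "continuous_on {0..} (\<lambda>t. LINT r:{0..t}|lborel. h r)"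
  unfolding continuous_on_eq_continuous_within continuous_within tendsto_at_iff_sequentially
proof (intro ballI allI impI)
  fix t0 and s :: "nat \<Rightarrow> real" assume t0: "t0 \<in> {0..}" and s: "\<forall>i. s i \<in> {0..} - {t0}" "s \<longlonglongrightarrow> t0"
  have "Bseq s" by (rule convergent_imp_Bseq[OF convergentI[OF s(2)]])
  then obtain b where b: "b > 0" "\<And>n. norm (s n) \<le> b" by (rule BseqE) blast
  have sb: "s n \<le> b" for n using b(2)[of n] by simp
  have t0b: "t0 \<le> b" by (rule LIMSEQ_le_const2[OF s(2)]) (use sb in auto)
  have m: "(\<lambda>r. indicator {0..t} r *\<^sub>R h r) \<in> borel_measurable lborel" for t
    using h[of t] unfolding set_integrable_def by (rule borel_measurable_integrable)
  have "(\<lambda>n. LINT r|lborel. indicator {0..s n} r *\<^sub>R h r) \<longlonglongrightarrow> (LINT r|lborel. indicator {0..t0} r *\<^sub>R h r)"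
  proof (rule integral_dominated_convergence[where w="\<lambda>r. norm (indicator {0..b} r *\<^sub>R h r)"])
    show "integrable lborel (\<lambda>r. norm (indicator {0..b} r *\<^sub>R h r))"
      using h[of b] unfolding set_integrable_def by (rule integrable_norm)
    show "AE r in lborel. (\<lambda>n. indicator {0..s n} r *\<^sub>R h r) \<longlonglongrightarrow> indicator {0..t0} r *\<^sub>R h r"
      using AE_lborel_singleton[of t0]
    proof eventually_elim
      case (elim r)
      have "\<forall>\<^sub>F n in sequentially. (r \<le> s n) = (r \<le> t0)"
      proof (cases "r < t0")
        case True
        from order_tendstoD(1)[OF s(2) this] show ?thesis by eventually_elim (use True in auto)
      next
        case False
        then have "t0 < r" using elim by simp
        from order_tendstoD(2)[OF s(2) this] show ?thesis by eventually_elim (use \<open>t0 < r\<close> in auto)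
      qed
      then have "\<forall>\<^sub>F n in sequentially. indicator {0..s n} r *\<^sub>R h r = indicator {0..t0} r *\<^sub>R h r"
        by eventually_elim (simp add: indicator_def)
      then show ?case by (rule tendsto_eventually)
    qed
    show "AE r in lborel. norm (indicator {0..s n} r *\<^sub>R h r) \<le> norm (indicator {0..b} r *\<^sub>R h r)" for n
      using sb[of n] by (intro AE_I2) (auto simp: indicator_def)
  qed (use m in auto)
  then show "((\<lambda>t. LINT r:{0..t}|lborel. h r) \<circ> s) \<longlonglongrightarrow> (LINT r:{0..t0}|lborel. h r)"
    by (simp add: set_lebesgue_integral_def comp_def)
qed

lemma set_integral_Icc_scale:
  fixes k :: "real \<Rightarrow> real"
  assumes "a > 0"
  shows "(LINT s:{0..a * t}|lborel. k s) = a * (LINT r:{0..t}|lborel. k (a * r))"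
proof -
  have "(LINT s|lborel. indicator {0..a * t} s *\<^sub>R k s) = \<bar>a\<bar> *\<^sub>R (LINT r|lborel. indicator {0..a * t} (0 + a * r) *\<^sub>R k (0 + a * r))"
    using assms by (intro lborel_integral_real_affine) simp
  also have "(LINT r|lborel. indicator {0..a * t} (0 + a * r) *\<^sub>R k (0 + a * r)) = (LINT r|lborel. indicator {0..t} r *\<^sub>R k (a * r))"
    using assms by (intro Bochner_Integration.integral_cong) (auto simp: indicator_def zero_le_mult_iff)
  finally show ?thesis using assms by (simp add: set_lebesgue_integral_def)
qed

text \<open>Supplies the domination by the functional of the absolute value that replaces
  tightness.\<close>

lemma set_integral_increment_le:
  fixes h :: "real \<Rightarrow> real"
  assumes h: "\<And>t. set_integrable lborel {0..t} h" and st: "0 \<le> s" "s \<le> t"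
  shows "\<bar>(LINT r:{0..t}|lborel. h r) - (LINT r:{0..s}|lborel. h r)\<bar> \<le> (LINT r:{0..t}|lborel. \<bar>h r\<bar>) - (LINT r:{0..s}|lborel. \<bar>h r\<bar>)"
proof -
  have sub: "set_integrable lborel {s<..t} h" by (rule set_integrable_subset[OF h[of t]]) (use st in auto)
  have U: "{0..t} = {0..s} \<union> {s<..t}" using st by auto
  have h': "set_integrable lborel {0..s} (\<lambda>r. \<bar>h r\<bar>)" "set_integrable lborel {s<..t} (\<lambda>r. \<bar>h r\<bar>)"
    using h[of s] sub by (auto intro: set_integrable_abs)
  have "(LINT r:{0..t}|lborel. h r) = (LINT r:{0..s}|lborel. h r) + (LINT r:{s<..t}|lborel. h r)"
    unfolding U by (rule set_integral_Un) (use h sub in auto)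
  moreover have "(LINT r:{0..t}|lborel. \<bar>h r\<bar>) = (LINT r:{0..s}|lborel. \<bar>h r\<bar>) + (LINT r:{s<..t}|lborel. \<bar>h r\<bar>)"
    unfolding U by (rule set_integral_Un) (use h' in auto)
  moreover have "\<bar>LINT r:{s<..t}|lborel. h r\<bar> \<le> (LINT r:{s<..t}|lborel. \<bar>h r\<bar>)"
    using integral_abs_bound[of lborel "\<lambda>r. indicator {s<..t} r *\<^sub>R h r"]
    by (simp add: set_lebesgue_integral_def abs_mult)
  ultimately show ?thesis by simp
qed

context local_time_setting begin

text \<open>Stated with nonnegative integrals at integer horizons, so that it is a countable
  intersection of measurable events.\<close>

definition locally_finite :: "(real \<Rightarrow> real) \<Rightarrow> real \<Rightarrow> 'a \<Rightarrow> bool" where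
  "locally_finite \<phi> R \<omega> \<longleftrightarrow> (\<forall>n::nat. (\<integral>\<^sup>+r. ennreal (norm (indicator {0..real n} r *\<^sub>R (R * \<phi> (R * (X R r \<omega> - x))))) \<partial>lborel) < \<infinity>)"

text \<open>The version of the functional that serves as random element in
  \<open>conv_in_law\<close>. Paths with a divergent integral are set to 0, so every path is
  continuous.\<close>

definition regular_occ :: "(real \<Rightarrow> real) \<Rightarrow> real \<Rightarrow> real \<Rightarrow> 'a \<Rightarrow> real" where
  "regular_occ \<phi> R t \<omega> = (if locally_finite \<phi> R \<omega> then scaled_occ \<phi> R t \<omega> else 0)"

lemma locally_finite_integrable:
  assumes [measurable]: "\<phi> \<in> borel_measurable borel" "\<omega> \<in> space M" and lf: "locally_finite \<phi> R \<omega>"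
  shows "set_integrable lborel {0..t} (\<lambda>r. R * \<phi> (R * (X R r \<omega> - x)))"
proof -
  obtain n :: nat where n: "t \<le> real n" using real_arch_simple by blast
  have "set_integrable lborel {0..real n} (\<lambda>r. R * \<phi> (R * (X R r \<omega> - x)))"
    unfolding set_integrable_def using lf by (intro integrableI_bounded) (auto simp: locally_finite_def)
  then show ?thesis by (rule set_integrable_subset) (use n in auto)
qed

lemma AE_locally_finite:
  assumes phi: "integrable lborel \<phi>"
  shows "\<forall>\<^sub>F R in at_top. AE \<omega> in M. locally_finite \<phi> R \<omega>"
  using AE_scaled_occ_integrable[OF phi]
proof eventually_elim
  case (elim R)
  then show ?case
  proof eventually_elim
    case (elim \<omega>)
    then show ?case unfolding locally_finite_def set_integrable_def integrable_iff_bounded by blast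
  qed
qed

lemma regular_occ_meas:
  assumes [measurable]: "\<phi> \<in> borel_measurable borel"
  shows "regular_occ \<phi> R t \<in> borel_measurable M"
proof -
  have [measurable]: "scaled_occ \<phi> R t \<in> borel_measurable M" by (rule scaled_occ_meas) simp
  have [measurable]: "Measurable.pred M (locally_finite \<phi> R)"
    unfolding locally_finite_def by measurable
  show ?thesis unfolding regular_occ_def[abs_def] by measurable
qed

lemma regular_occ_continuous:
  assumes "\<phi> \<in> borel_measurable borel" "\<omega> \<in> space M"
  shows "continuous_on {0..} (\<lambda>t. regular_occ \<phi> R t \<omega>)"
proof (cases "locally_finite \<phi> R \<omega>")
  case True
  have "continuous_on {0..} (\<lambda>t. LINT r:{0..t}|lborel. R * \<phi> (R * (X R r \<omega> - x)))"
    by (intro continuous_on_indefinite_set_integral locally_finite_integrable assms True)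
  then show ?thesis using True by (simp add: regular_occ_def scaled_occ_def)
qed (simp add: regular_occ_def)

lemma regular_occ_convergence:
  assumes phi: "integrable lborel \<phi>" and F: "lip_on J C F" and J: "J \<subseteq> {0..}" and Fb: "\<And>v. \<bar>F v\<bar> \<le> H"
  shows "((\<lambda>R. LINT \<omega>|M. F (\<lambda>t. regular_occ \<phi> R t \<omega>)) \<longlongrightarrow> (LINT \<omega>|N. F (\<lambda>t. (LINT y|lborel. \<phi> y) * l t \<omega>))) at_top"
proof -
  have pm: "\<phi> \<in> borel_measurable borel" using phi by auto
  have "\<forall>\<^sub>F R in at_top. (LINT \<omega>|M. F (\<lambda>t. scaled_occ \<phi> R t \<omega>)) = (LINT \<omega>|M. F (\<lambda>t. regular_occ \<phi> R t \<omega>))"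
    using AE_locally_finite[OF phi]
  proof eventually_elim
    case (elim R)
    show ?case
    proof (rule integral_cong_AE)
      show "(\<lambda>\<omega>. F (\<lambda>t. scaled_occ \<phi> R t \<omega>)) \<in> borel_measurable M" by (rule lip_on_measurable[OF F scaled_occ_meas[OF pm]])
      show "(\<lambda>\<omega>. F (\<lambda>t. regular_occ \<phi> R t \<omega>)) \<in> borel_measurable M" by (rule lip_on_measurable[OF F regular_occ_meas[OF pm]])
      show "AE \<omega> in M. F (\<lambda>t. scaled_occ \<phi> R t \<omega>) = F (\<lambda>t. regular_occ \<phi> R t \<omega>)"
        using elim by eventually_elim (simp add: regular_occ_def)
    qed
  qed
  from tendsto_cong[OF this] show ?thesis using lipschitz_fdd_convergence[OF phi F Fb J] by simp
qed

text \<open>With T equal to the \<beta>-th power of R, the upper limit of integration is a = T / f R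
  times t, and substituting s = a r gives a factor that combines with the norming to exactly
  R.\<close>

lemma scaled_functional_eq:
  assumes T: "T > 0" and f: "f (T powr (1 / \<beta>)) > 0" and eq: "\<forall>t\<ge>0. \<eta> t \<omega> = \<eta>0 t \<omega>"
  shows "scaled_functional \<beta> f \<phi> \<eta>0 x T t \<omega> = scaled_occ \<phi> (T powr (1 / \<beta>)) t \<omega>"
proof -
  define R where "R = T powr (1 / \<beta>)"
  have R: "R > 0" using T by (simp add: R_def)
  have Rb: "R powr \<beta> = T" using T beta by (simp add: R_def powr_powr)
  define a where "a = T / f R"
  have a: "a > 0" using T f by (simp add: a_def R_def)
  have ts: "time_scale \<beta> f R = a" using R f by (simp add: time_scale_def R_def[symmetric] Rb a_def)
  have "(LINT s:{0..a * t}|lborel. \<phi> (\<eta>0 s \<omega> - R * x)) = (LINT s:{0..a * t}|lborel. \<phi> (\<eta> s \<omega> - R * x))"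
    by (rule set_lebesgue_integral_cong) (use eq in auto)
  also have "\<dots> = a * (LINT r:{0..t}|lborel. \<phi> (\<eta> (a * r) \<omega> - R * x))"
    by (rule set_integral_Icc_scale[OF a])
  finally have 1: "(LINT s:{0..a * t}|lborel. \<phi> (\<eta>0 s \<omega> - R * x)) = a * (LINT r:{0..t}|lborel. \<phi> (\<eta> (a * r) \<omega> - R * x))" .
  have 2: "scaled_occ \<phi> R t \<omega> = R * (LINT r:{0..t}|lborel. \<phi> (\<eta> (a * r) \<omega> - R * x))"
    unfolding scaled_occ_def X_def ts using R by (simp add: right_diff_distrib)
  have 3: "1 / norming \<beta> f T * a = R"
  proof -
    have "T powr (1 - 1 / \<beta>) = T / R" using T by (simp add: R_def powr_diff)
    then show ?thesis using T f R unfolding norming_def a_def R_def[symmetric] by (simp add: field_simps)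
  qed
  have "scaled_functional \<beta> f \<phi> \<eta>0 x T t \<omega> = 1 / norming \<beta> f T * (LINT s:{0..a * t}|lborel. \<phi> (\<eta>0 s \<omega> - R * x))"
    unfolding scaled_functional_def R_def[symmetric] a_def[symmetric] ..
  also have "\<dots> = (1 / norming \<beta> f T * a) * (LINT r:{0..t}|lborel. \<phi> (\<eta> (a * r) \<omega> - R * x))"
    unfolding 1 by (simp only: mult.assoc)
  also have "\<dots> = scaled_occ \<phi> R t \<omega>" unfolding 2 3 ..
  finally show ?thesis unfolding R_def .
qed

lemma space_scale_at_top: "filterlim (\<lambda>T. T powr (1 / \<beta>)) at_top at_top"
  using beta by (intro real_powr_at_top) auto

lemma eventually_space_scale: "eventually Q at_top \<Longrightarrow> \<forall>\<^sub>F T in at_top. Q (T powr (1 / \<beta>))"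
  using space_scale_at_top by (simp add: filterlim_iff)

theorem functional_convergence:
  assumes phi: "integrable lborel \<phi>" and eq: "AE \<omega> in M. \<forall>t\<ge>0. \<eta> t \<omega> = \<eta>0 t \<omega>"
    and L: "AE \<omega> in N. \<forall>t\<ge>0. l t \<omega> = L t \<omega>" and lc: "\<And>\<omega>. \<omega> \<in> space N \<Longrightarrow> continuous_on {0..} (\<lambda>t. l t \<omega>)"
  shows "fdd_conv M (scaled_functional \<beta> f \<phi> \<eta>0 x) N (\<lambda>t \<omega>. L t \<omega> * (LINT y|lborel. \<phi> y))"
    "weak_conv_C M (scaled_functional \<beta> f \<phi> \<eta>0 x) N (\<lambda>t \<omega>. L t \<omega> * (LINT y|lborel. \<phi> y))"
proof -
  let ?R = "\<lambda>T. T powr (1 / \<beta>)" and ?c = "LINT y|lborel. \<phi> y" and ?c' = "LINT y|lborel. \<bar>\<phi> y\<bar>"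
  have pm: "\<phi> \<in> borel_measurable borel" using phi by auto
  have phi': "integrable lborel (\<lambda>y. \<bar>\<phi> y\<bar>)" using phi by (rule integrable_abs)
  have pm': "(\<lambda>y. \<bar>\<phi> y\<bar>) \<in> borel_measurable borel" using phi' by auto
  have Y: "\<forall>\<^sub>F T in at_top. AE \<omega> in M. \<forall>t\<ge>0. regular_occ \<phi> (?R T) t \<omega> = scaled_functional \<beta> f \<phi> \<eta>0 x T t \<omega>"
    using eventually_space_scale[OF AE_locally_finite[OF phi]] eventually_space_scale[OF eventually_regular] eventually_gt_at_top[of 0]
  proof eventually_elim
    case (elim T)
    show ?case using elim(1) eq
    proof eventually_elim
      case (elim \<omega>)
      then show ?case using scaled_functional_eq[of T \<omega> \<eta>0 \<phi>] \<open>0 < T\<close> \<open>0 < ?R T \<and> 0 < f (?R T)\<close> by (simp add: regular_occ_def)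
    qed
  qed
  have Z: "AE \<omega> in N. \<forall>t\<ge>0. ?c * l t \<omega> = L t \<omega> * ?c"
    using L by eventually_elim (simp add: mult.commute)
  have conv: "((\<lambda>T. LINT \<omega>|M. F (\<lambda>t. regular_occ \<phi> (?R T) t \<omega>)) \<longlongrightarrow> (LINT \<omega>|N. F (\<lambda>t. ?c * l t \<omega>))) at_top"
    if "lip_on J C F" "J \<subseteq> {0..}" "\<And>v. \<bar>F v\<bar> \<le> H" for J C F H
    by (rule filterlim_compose[OF regular_occ_convergence[OF phi that] space_scale_at_top])
  have convV: "((\<lambda>T. LINT \<omega>|M. F (\<lambda>t. scaled_occ (\<lambda>y. \<bar>\<phi> y\<bar>) (?R T) t \<omega>)) \<longlongrightarrow> (LINT \<omega>|N. F (\<lambda>t. ?c' * l t \<omega>))) at_top"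
    if "lip_on J C F" "J \<subseteq> {0..}" "\<And>v. \<bar>F v\<bar> \<le> H" for J C F H
    by (rule filterlim_compose[OF lipschitz_fdd_convergence[OF phi' that(1,3,2)] space_scale_at_top])
  have cl: "(\<lambda>\<omega>. b * l t \<omega>) \<in> borel_measurable N" for b t by simp
  show "fdd_conv M (scaled_functional \<beta> f \<phi> \<eta>0 x) N (\<lambda>t \<omega>. L t \<omega> * ?c)"
    by (rule fdd_convI[where Y'="\<lambda>T. regular_occ \<phi> (?R T)" and Z'="\<lambda>t \<omega>. ?c * l t \<omega>",
          OF eta.prob_space_axioms xi.prob_space_axioms regular_occ_meas[OF pm] cl Y Z conv])
  \<comment> \<open>On locally finite paths both functionals are convergent integrals, so their
    increments can be compared.\<close>
  have dom: "\<forall>\<^sub>F T in at_top. AE \<omega> in M. \<forall>s t. 0 \<le> s \<longrightarrow> s \<le> t \<longrightarrow> \<bar>regular_occ \<phi> (?R T) t \<omega> - regular_occ \<phi> (?R T) s \<omega>\<bar> \<le>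
      scaled_occ (\<lambda>y. \<bar>\<phi> y\<bar>) (?R T) t \<omega> - scaled_occ (\<lambda>y. \<bar>\<phi> y\<bar>) (?R T) s \<omega>"
    using eventually_space_scale[OF AE_locally_finite[OF phi]] eventually_space_scale[OF eventually_regular]
  proof eventually_elim
    case (elim T)
    then have R0: "?R T > 0" by simp
    show ?case using elim(1) AE_space
    proof eventually_elim
      case (elim \<omega>)
      show ?case
      proof (intro allI impI)
        fix s t :: real assume st: "0 \<le> s" "s \<le> t"
        have "\<bar>?R T * \<phi> y\<bar> = ?R T * \<bar>\<phi> y\<bar>" for y using R0 by (simp add: abs_mult)
        then show "\<bar>regular_occ \<phi> (?R T) t \<omega> - regular_occ \<phi> (?R T) s \<omega>\<bar> \<le>
            scaled_occ (\<lambda>y. \<bar>\<phi> y\<bar>) (?R T) t \<omega> - scaled_occ (\<lambda>y. \<bar>\<phi> y\<bar>) (?R T) s \<omega>"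
          using set_integral_increment_le[OF locally_finite_integrable[OF pm elim(2,1)] st] elim(1)
          by (simp only: regular_occ_def scaled_occ_def if_True)
      qed
    qed
  qed
  have lc': "continuous_on {0..} (\<lambda>t. b * l t \<omega>)" if "\<omega> \<in> space N" for b \<omega>
    by (intro continuous_intros lc that)
  show "weak_conv_C M (scaled_functional \<beta> f \<phi> \<eta>0 x) N (\<lambda>t \<omega>. L t \<omega> * ?c)"
    by (rule weak_conv_CI[where Y'="\<lambda>T. regular_occ \<phi> (?R T)" and Z'="\<lambda>t \<omega>. ?c * l t \<omega>"
          and V="\<lambda>T. scaled_occ (\<lambda>y. \<bar>\<phi> y\<bar>) (?R T)" and U="\<lambda>t \<omega>. ?c' * l t \<omega>",
          OF eta.prob_space_axioms xi.prob_space_axioms regular_occ_meas[OF pm] cl scaled_occ_meas[OF pm'] cl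
            regular_occ_continuous[OF pm] lc' lc' Y Z dom conv convV])
qed

end

theorem proposition2p3:
  fixes \<beta> x :: real
    and M :: "'a measure" and \<eta> :: "real \<Rightarrow> 'a \<Rightarrow> real"
    and N :: "'b measure" and \<xi> :: "real \<Rightarrow> 'b \<Rightarrow> real" and L :: "real \<Rightarrow> real \<Rightarrow> 'b \<Rightarrow> real"
    and f \<phi> :: "real \<Rightarrow> real" and \<psi> :: "real \<Rightarrow> complex"
  assumes "1 < \<beta>" and "\<beta> < 2"
    and "assumption_A \<beta> M \<eta> f \<psi>"
    and "stable_process \<beta> N \<xi>"
    and "jointly_continuous_local_time N \<xi> L"
    and "integrable lborel \<phi>"
    and "(LINT y|lborel. \<phi> y) \<noteq> 0"
  shows "fdd_conv M (scaled_functional \<beta> f \<phi> \<eta> x) N (\<lambda>t \<omega>. L t x \<omega> * (LINT y|lborel. \<phi> y)) \<and>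
    ((\<exists>\<kappa>. 0 < \<kappa> \<and> \<kappa> < 1 \<and>
        (\<integral>\<^sup>+ w\<in>{1..}. inverse (ennreal (Re (\<psi> w) powr \<kappa>)) \<partial>lborel) < \<infinity>) \<longrightarrow>
      weak_conv_C M (scaled_functional \<beta> f \<phi> \<eta> x) N (\<lambda>t \<omega>. L t x \<omega> * (LINT y|lborel. \<phi> y)))"
proof -
  note A = assumption_A_D[OF assms(3,1,2)]
  \<comment> \<open>The processes are replaced by jointly measurable versions. These agree with the
    originals at all nonnegative times simultaneously, almost surely, so neither marginal laws nor
    path integrals change beyond a null set.\<close>
  obtain \<eta>' where eta': "levy_path M \<eta>'" "AE \<omega> in M. \<forall>t\<ge>0. \<eta>' t \<omega> = \<eta> t \<omega>"
    using levy_process_regularize[OF A(1)] by blast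
  have xi: "levy_process N \<xi>" using assms(4) by (simp add: stable_process_def)
  obtain \<xi>' where xi': "levy_path N \<xi>'" "AE \<omega> in N. \<forall>t\<ge>0. \<xi>' t \<omega> = \<xi> t \<omega>"
    using levy_process_regularize[OF xi] by blast
  interpret e: levy_path M \<eta>' by (rule eta')
  interpret x: levy_path N \<xi>' by (rule xi')
  have L: "\<And>t. t \<ge> 0 \<Longrightarrow> L t x \<in> borel_measurable N" "AE \<omega> in N. continuous_on ({0..} \<times> UNIV) (\<lambda>(t, x). L t x \<omega>)"
    using assms(5) by (auto simp: jointly_continuous_local_time_def local_time_def)
  from L(2) obtain B where B: "{\<omega> \<in> space N. \<not> continuous_on ({0..} \<times> UNIV) (\<lambda>(t, x). L t x \<omega>)} \<subseteq> B" "emeasure N B = 0" "B \<in> sets N"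
    by (rule AE_E)
  have AEB: "AE \<omega> in N. \<omega> \<notin> B" using B by (intro AE_not_in) (auto simp: null_sets_def)
  \<comment> \<open>The local time at the level x, set to 0 at negative times and on a measurable
    null set containing the discontinuous paths. Every path of \<open>l\<close> is then continuous
    on \<open>{0..}\<close>, and every \<open>l t\<close> is measurable, at negative t as
    well.\<close>
  define l where "l t \<omega> = (if t \<ge> 0 \<and> \<omega> \<notin> B then L t x \<omega> else 0)" for t \<omega>
  have lm: "l t \<in> borel_measurable N" for t
  proof (cases "t \<ge> 0")
    case True
    have [measurable]: "L t x \<in> borel_measurable N" "B \<in> sets N" using L(1)[OF True] B by auto
    show ?thesis unfolding l_def[abs_def] using True by simp
  qed (simp add: l_def[abs_def])
  have lL: "AE \<omega> in N. \<forall>t\<ge>0. l t \<omega> = L t x \<omega>" using AEB by eventually_elim (simp add: l_def)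
  have lc: "continuous_on {0..} (\<lambda>t. l t \<omega>)" if "\<omega> \<in> space N" for \<omega>
  proof (cases "\<omega> \<in> B")
    case False
    then have c: "continuous_on ({0..} \<times> UNIV) (\<lambda>(t, x). L t x \<omega>)" using B(1) that by auto
    have "continuous_on {0..} (\<lambda>t. (\<lambda>(t, x). L t x \<omega>) (t, x))"
      by (rule continuous_on_compose2[OF c]) (auto intro!: continuous_intros)
    then have "continuous_on {0..} (\<lambda>t. L t x \<omega>)" by simp
    then show ?thesis by (rule continuous_on_eq) (use False in \<open>simp add: l_def\<close>)
  qed (simp add: l_def)
  have char_eta: "char (distr M borel (\<eta>' t)) \<theta> = complex_of_real (exp (- (t * tail_exponent \<beta> f \<theta>)))" if "t \<ge> 0" for t \<theta>
  proof -
    have "\<eta> t \<in> borel_measurable M" using A(1) that by (simp add: levy_process_def)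
    moreover have "AE \<omega> in M. \<eta>' t \<omega> = \<eta> t \<omega>" using eta'(2) by eventually_elim (use that in auto)
    ultimately have "distr M borel (\<eta>' t) = distr M borel (\<eta> t)" by (intro distr_cong_AE) auto
    then show ?thesis using A(4)[OF that] by simp
  qed
  have char_xi: "char (distr N borel (\<xi>' t)) \<theta> = complex_of_real (exp (- (t * \<bar>\<theta>\<bar> powr \<beta>)))" if "t \<ge> 0" for t \<theta>
  proof -
    have "\<xi> t \<in> borel_measurable N" using xi that by (simp add: levy_process_def)
    moreover have "AE \<omega> in N. \<xi>' t \<omega> = \<xi> t \<omega>" using xi'(2) by eventually_elim (use that in auto)
    ultimately have "distr N borel (\<xi>' t) = distr N borel (\<xi> t)" by (intro distr_cong_AE) auto
    then show ?thesis using assms(4) that by (simp add: stable_process_def)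
  qed
  have l_lim: "AE \<omega> in N. ((\<lambda>\<epsilon>. occ (tent \<epsilon>) x \<xi>' t \<omega>) \<longlongrightarrow> l t \<omega>) (at_right 0)" if "t \<ge> 0" for t
    using local_time_limit[OF assms(5) xi' that, of x] lL by eventually_elim (use that in auto)
  interpret S: local_time_setting \<beta> f M \<eta>' N \<xi>' l x
    by (intro local_time_setting.intro local_time_setting_axioms.intro A(2) eta'(1) xi'(1) char_eta char_xi lm l_lim)
  show ?thesis using S.functional_convergence[OF assms(6) eta'(2) lL lc] by blast
qed

end
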